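(* Let $f\in L^2(I;V^* )$, $u_0\in H_\sigma$, and let $(u,p)\in\mathcal{W}(I)\times L^2(I;L^2_0(\Omega))$ be the solution of the unsteady Stokes equations $$\partial_tu(t)+(-\Delta)u(t)+\nabla p(t)=f(t)\text{ in }V^*,\qquad\operatorname{div}u(t)=0\text{ a.e. in }\Omega,\qquad\text{for a.e. }t\in I,\qquad u(0)=u_0\text{ in }H .$$ Then, for every $v\in\mathcal{W}(I)$ with $v(0)=u_0$ in $H$ and $v\in L^2(I;V_\sigma)$, $$\begin{aligned}&\tfrac12\|\nabla(v-u)\|_Q^2+\tfrac12\|\partial_t(v-u)|_{L^2(I;V_\sigma)}\|_{L^2(I;V_\sigma^* )}^2+\tfrac12\|(v-u)(T)\|_H^2\\&\qquad=\inf\bigl\{\tfrac12\|\operatorname{dev}y-\nabla v\|_Q^2\;\bigm|\;y\in L^2(I;Y^* ),\ L^*y=f-\partial_tv\text{ in }L^2(I;V^* )\bigr\}\\&\qquad=\tfrac12\|(\partial_tv+(-\Delta)v-f)|_{L^2(I;V_\sigma)}\|_{L^2(I;V_\sigma^* )}^2 .\end{aligned}$$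
   Context: $\Omega\subseteq\mathbb{R}^d$ is a bounded Lipschitz domain; $I=(0,T)$, $0<T<\infty$; $Q=I\times\Omega$. $V=W^{1,2}_0(\Omega;\mathbb{R}^d)$ (full Dirichlet boundary) with norm $\|\nabla\cdot\|_{L^2(\Omega)}$, $H=L^2(\Omega;\mathbb{R}^d)$, $Y=Y^*=L^2(\Omega;\mathbb{R}^{d\times d})$. $V_\sigma=\{v\in V\mid\operatorname{div}v=0\text{ a.e. in }\Omega\}$ with norm $\|\nabla\cdot\|_{L^2(\Omega)}$, $V_\sigma^*$ with the dual norm, and $H_\sigma$ the closure of $V_\sigma$ in $H$. $L^2_0(\Omega)=\{q\in L^2(\Omega)\mid\int_\Omega q\,dx=0\}$. $V\hookrightarrow H\cong H^*\hookrightarrow V^*$ is the usual evolution triple and $\mathcal{W}(I)=\{v\in L^2(I;V)\mid\partial_tv\in L^2(I;V^* )\}\hookrightarrow C^0(\overline I;H)$. $L=\nabla\colon V\to Y$, $\langle L^*y,v\rangle_V=\int_\Omega y:\nabla v\,dx$; $\langle(-\Delta)v,w\rangle_V=\int_\Omega\nabla v:\nabla w\,dx$; $\nabla\colon L^2_0(\Omega)\to V^*$, $\langle\nabla q,v\rangle_V=-\int_\Omega q\operatorname{div}v\,dx$. $\operatorname{dev}A=A-\frac1d\operatorname{tr}(A)\mathrm{I}_d$. Operators act pointwise in time; $g|_{L^2(I;V_\sigma)}$ is the restriction of the functional $g\in L^2(I;V^* )$ to $L^2(I;V_\sigma)$. $\|\cdot\|_Q$ is the $L^2(Q)$-norm.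 *)

theory Defs
  imports "HOL-Analysis.Analysis" "HOL-Library.Function_Algebras"
begin

text \<open>
  Elements of Lebesgue, Sobolev and Bochner spaces are represented by functions; the spaces are
  sets of representatives carrying a seminorm, and equality in a space is equality almost
  everywhere. Vector fields are added and subtracted pointwise (\<^theory>\<open>HOL-Library.Function_Algebras\<close>).
\<close>

section \<open>Lipschitz domains\<close>

text \<open>Near every boundary point, and up to a rotation taking the last coordinate axis to \<open>n\<close>,
  the set is the strict epigraph of a Lipschitz function on the hyperplane orthogonal to \<open>n\<close>.\<close>

definition lipschitz_boundary :: "'a::euclidean_space set \<Rightarrow> bool" where
  "lipschitz_boundary \<Omega> \<longleftrightarrow>
     (\<forall>x0\<in>frontier \<Omega>. \<exists>r>0. \<exists>n \<gamma> C. norm n = 1 \<and> C-lipschitz_on {z. z \<bullet> n = 0} (\<gamma> :: 'a \<Rightarrow> real) \<and>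
        \<Omega> \<inter> ball x0 r = {x \<in> ball x0 r. x \<bullet> n > \<gamma> (x - (x \<bullet> n) *\<^sub>R n)})"

definition bounded_lipschitz_domain :: "'a::euclidean_space set \<Rightarrow> bool" where
  "bounded_lipschitz_domain \<Omega> \<longleftrightarrow>
     open \<Omega> \<and> connected \<Omega> \<and> \<Omega> \<noteq> {} \<and> bounded \<Omega> \<and> lipschitz_boundary \<Omega>"

section \<open>Lebesgue and Bochner spaces\<close>

definition L2 :: "'a measure \<Rightarrow> ('a \<Rightarrow> 'b::euclidean_space) set" where
  "L2 M = {g \<in> borel_measurable M. integrable M (\<lambda>x. (norm (g x))\<^sup>2)}"

definition L2_norm :: "'a measure \<Rightarrow> ('a \<Rightarrow> 'b::euclidean_space) \<Rightarrow> real" where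
  "L2_norm M g = sqrt (\<integral>x. (norm (g x))\<^sup>2 \<partial>M)"

text \<open>\<open>S\<close> is the target space and \<open>N\<close> its (semi)norm. Simple functions with values in the
  quotient of \<open>S\<close> by the kernel of \<open>N\<close> lift to simple functions with values in \<open>S\<close>.\<close>

definition bochner_measurable ::
    "'t measure \<Rightarrow> 'v::minus set \<Rightarrow> ('v \<Rightarrow> real) \<Rightarrow> ('t \<Rightarrow> 'v) \<Rightarrow> bool" where
  "bochner_measurable M S N g \<longleftrightarrow>
     (\<exists>s. (\<forall>n. simple_function M (s n) \<and> s n ` space M \<subseteq> S) \<and>
          (AE t in M. g t \<in> S \<and> (\<lambda>n::nat. N (g t - s n t)) \<longlonglongrightarrow> 0))"

definition bochner_L2 ::
    "'t measure \<Rightarrow> 'v::minus set \<Rightarrow> ('v \<Rightarrow> real) \<Rightarrow> ('t \<Rightarrow> 'v) set" where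
  "bochner_L2 M S N = {g. bochner_measurable M S N g \<and> integrable M (\<lambda>t. (N (g t))\<^sup>2)}"

definition bochner_L2_norm :: "'t measure \<Rightarrow> ('v \<Rightarrow> real) \<Rightarrow> ('t \<Rightarrow> 'v) \<Rightarrow> real" where
  "bochner_L2_norm M N g = sqrt (\<integral>t. (N (g t))\<^sup>2 \<partial>M)"

text \<open>Topological dual of a space \<open>S\<close> of functions with seminorm \<open>N\<close>. Only the values of a
  functional on \<open>S\<close> matter.\<close>

definition dual_space ::
    "('a \<Rightarrow> 'b::real_vector) set \<Rightarrow> (('a \<Rightarrow> 'b) \<Rightarrow> real) \<Rightarrow> (('a \<Rightarrow> 'b) \<Rightarrow> real) set" where
  "dual_space S N = {F. (\<forall>v\<in>S. \<forall>w\<in>S. F (v + w) = F v + F w) \<and>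
                        (\<forall>c. \<forall>v\<in>S. F (\<lambda>x. c *\<^sub>R v x) = c * F v) \<and>
                        (\<exists>C. \<forall>v\<in>S. \<bar>F v\<bar> \<le> C * N v)}"

definition dual_norm :: "'v set \<Rightarrow> ('v \<Rightarrow> real) \<Rightarrow> ('v \<Rightarrow> real) \<Rightarrow> real" where
  "dual_norm S N F = (SUP v\<in>{v \<in> S. N v \<le> 1}. \<bar>F v\<bar>)"

section \<open>Test functions, weak gradients, Sobolev spaces\<close>

primrec C_k :: "nat \<Rightarrow> ('a::euclidean_space \<Rightarrow> 'b::real_normed_vector) \<Rightarrow> bool" where
  "C_k 0 \<phi> \<longleftrightarrow> continuous_on UNIV \<phi>"
| "C_k (Suc k) \<phi> \<longleftrightarrow> (\<forall>x. \<phi> differentiable (at x)) \<and>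
     (\<forall>b\<in>Basis. C_k k (\<lambda>x. frechet_derivative \<phi> (at x) b))"

definition test_functions ::
    "'a::euclidean_space set \<Rightarrow> ('a \<Rightarrow> 'b::real_normed_vector) set" where
  "test_functions \<Omega> = {\<phi>. (\<forall>k. C_k k \<phi>) \<and> (\<exists>K. compact K \<and> K \<subseteq> \<Omega> \<and> (\<forall>x. x \<notin> K \<longrightarrow> \<phi> x = 0))}"

text \<open>\<open>G x $ i $ j\<close> is the \<open>j\<close>-th weak partial derivative of the \<open>i\<close>-th component of \<open>v\<close>.\<close>

definition is_weak_gradient ::
    "(real^'d) set \<Rightarrow> (real^'d \<Rightarrow> real^'d) \<Rightarrow> (real^'d \<Rightarrow> real^'d^'d) \<Rightarrow> bool" where
  "is_weak_gradient \<Omega> v G \<longleftrightarrow>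
     (\<forall>\<phi>\<in>test_functions \<Omega>. \<forall>i j.
        (\<integral>x. v x $ i * frechet_derivative \<phi> (at x) (axis j 1) \<partial>lebesgue_on \<Omega>) =
        - (\<integral>x. G x $ i $ j * \<phi> x \<partial>lebesgue_on \<Omega>))"

definition W12 :: "(real^'d) set \<Rightarrow> (real^'d \<Rightarrow> real^'d) set" where
  "W12 \<Omega> = {v \<in> L2 (lebesgue_on \<Omega>). \<exists>G \<in> L2 (lebesgue_on \<Omega>). is_weak_gradient \<Omega> v G}"

definition grad :: "(real^'d) set \<Rightarrow> (real^'d \<Rightarrow> real^'d) \<Rightarrow> real^'d \<Rightarrow> real^'d^'d" where
  "grad \<Omega> v = (SOME G. G \<in> L2 (lebesgue_on \<Omega>) \<and> is_weak_gradient \<Omega> v G)"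

definition W12_norm :: "(real^'d) set \<Rightarrow> (real^'d \<Rightarrow> real^'d) \<Rightarrow> real" where
  "W12_norm \<Omega> v = sqrt ((L2_norm (lebesgue_on \<Omega>) v)\<^sup>2 + (L2_norm (lebesgue_on \<Omega>) (grad \<Omega> v))\<^sup>2)"

definition W12_0 :: "(real^'d) set \<Rightarrow> (real^'d \<Rightarrow> real^'d) set" where
  "W12_0 \<Omega> = {v \<in> W12 \<Omega>. \<forall>\<epsilon>>0. \<exists>\<phi>\<in>test_functions \<Omega>. W12_norm \<Omega> (v - \<phi>) < \<epsilon>}"

section \<open>Function spaces and operators of the Stokes problem\<close>

abbreviation V_space :: "(real^'d) set \<Rightarrow> (real^'d \<Rightarrow> real^'d) set" where
  "V_space \<Omega> \<equiv> W12_0 \<Omega>"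

definition V_norm :: "(real^'d) set \<Rightarrow> (real^'d \<Rightarrow> real^'d) \<Rightarrow> real" where
  "V_norm \<Omega> v = L2_norm (lebesgue_on \<Omega>) (grad \<Omega> v)"

abbreviation H_space :: "(real^'d) set \<Rightarrow> (real^'d \<Rightarrow> real^'d) set" where
  "H_space \<Omega> \<equiv> L2 (lebesgue_on \<Omega>)"

abbreviation H_norm :: "(real^'d) set \<Rightarrow> (real^'d \<Rightarrow> real^'d) \<Rightarrow> real" where
  "H_norm \<Omega> \<equiv> L2_norm (lebesgue_on \<Omega>)"

abbreviation Y_space :: "(real^'d) set \<Rightarrow> (real^'d \<Rightarrow> real^'d^'d) set" where
  "Y_space \<Omega> \<equiv> L2 (lebesgue_on \<Omega>)"

abbreviation Y_norm :: "(real^'d) set \<Rightarrow> (real^'d \<Rightarrow> real^'d^'d) \<Rightarrow> real" where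
  "Y_norm \<Omega> \<equiv> L2_norm (lebesgue_on \<Omega>)"

definition divergence :: "(real^'d) set \<Rightarrow> (real^'d \<Rightarrow> real^'d) \<Rightarrow> real^'d \<Rightarrow> real" where
  "divergence \<Omega> v x = trace (grad \<Omega> v x)"

definition div_free :: "(real^'d) set \<Rightarrow> (real^'d \<Rightarrow> real^'d) \<Rightarrow> bool" where
  "div_free \<Omega> v \<longleftrightarrow> (AE x in lebesgue_on \<Omega>. divergence \<Omega> v x = 0)"

definition V_sigma :: "(real^'d) set \<Rightarrow> (real^'d \<Rightarrow> real^'d) set" where
  "V_sigma \<Omega> = {v \<in> V_space \<Omega>. div_free \<Omega> v}"

definition H_sigma :: "(real^'d) set \<Rightarrow> (real^'d \<Rightarrow> real^'d) set" where
  "H_sigma \<Omega> = {h \<in> H_space \<Omega>. \<forall>\<epsilon>>0. \<exists>v\<in>V_sigma \<Omega>. H_norm \<Omega> (h - v) < \<epsilon>}"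

definition L2_0 :: "(real^'d) set \<Rightarrow> (real^'d \<Rightarrow> real) set" where
  "L2_0 \<Omega> = {q \<in> L2 (lebesgue_on \<Omega>). (\<integral>x. q x \<partial>lebesgue_on \<Omega>) = 0}"

abbreviation V_dual :: "(real^'d) set \<Rightarrow> ((real^'d \<Rightarrow> real^'d) \<Rightarrow> real) set" where
  "V_dual \<Omega> \<equiv> dual_space (V_space \<Omega>) (V_norm \<Omega>)"

abbreviation V_dual_norm :: "(real^'d) set \<Rightarrow> ((real^'d \<Rightarrow> real^'d) \<Rightarrow> real) \<Rightarrow> real" where
  "V_dual_norm \<Omega> \<equiv> dual_norm (V_space \<Omega>) (V_norm \<Omega>)"

abbreviation V_sigma_dual_norm :: "(real^'d) set \<Rightarrow> ((real^'d \<Rightarrow> real^'d) \<Rightarrow> real) \<Rightarrow> real" where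
  "V_sigma_dual_norm \<Omega> \<equiv> dual_norm (V_sigma \<Omega>) (V_norm \<Omega>)"

definition eq_in_V_dual ::
    "(real^'d) set \<Rightarrow> ((real^'d \<Rightarrow> real^'d) \<Rightarrow> real) \<Rightarrow> ((real^'d \<Rightarrow> real^'d) \<Rightarrow> real) \<Rightarrow> bool" where
  "eq_in_V_dual \<Omega> F G \<longleftrightarrow> (\<forall>w\<in>V_space \<Omega>. F w = G w)"

text \<open>The inner product of \<^typ>\<open>real^'d^'d\<close> is the Frobenius product.\<close>

definition L_adj :: "(real^'d) set \<Rightarrow> (real^'d \<Rightarrow> real^'d^'d) \<Rightarrow> (real^'d \<Rightarrow> real^'d) \<Rightarrow> real" where
  "L_adj \<Omega> y w = (\<integral>x. y x \<bullet> grad \<Omega> w x \<partial>lebesgue_on \<Omega>)"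

definition neg_laplace ::
    "(real^'d) set \<Rightarrow> (real^'d \<Rightarrow> real^'d) \<Rightarrow> (real^'d \<Rightarrow> real^'d) \<Rightarrow> real" where
  "neg_laplace \<Omega> v w = (\<integral>x. grad \<Omega> v x \<bullet> grad \<Omega> w x \<partial>lebesgue_on \<Omega>)"

definition grad_pressure ::
    "(real^'d) set \<Rightarrow> (real^'d \<Rightarrow> real) \<Rightarrow> (real^'d \<Rightarrow> real^'d) \<Rightarrow> real" where
  "grad_pressure \<Omega> q w = - (\<integral>x. q x * divergence \<Omega> w x \<partial>lebesgue_on \<Omega>)"

definition dev :: "real^'d^'d \<Rightarrow> real^'d^'d" where
  "dev A = A - (trace A / real CARD('d)) *\<^sub>R mat 1"

section \<open>Time-dependent functions\<close>

abbreviation time_interval :: "real \<Rightarrow> real measure" where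
  "time_interval T \<equiv> lebesgue_on {0<..<T}"

text \<open>The \<open>L\<^sup>2(Q)\<close>-norm under the isometry between \<open>L\<^sup>2(Q)\<close> and \<open>L\<^sup>2(I; L\<^sup>2(\<Omega>))\<close>. A Bochner
  measurable \<open>g\<close> need not be jointly measurable on \<open>Q\<close>, because for each \<open>t\<close> an arbitrary
  representative \<open>g t\<close> is allowed; the iterated integral does not depend on that choice.\<close>

definition Q_norm :: "(real^'d) set \<Rightarrow> real \<Rightarrow> (real \<Rightarrow> real^'d \<Rightarrow> real^'d^'d) \<Rightarrow> real" where
  "Q_norm \<Omega> T g = bochner_L2_norm (time_interval T) (Y_norm \<Omega>) g"

text \<open>Distributional derivative in time, where \<open>u t \<in> V\<close> is identified with the functional
  \<open>(u t, \<cdot>)\<^sub>H\<close> in the dual of \<open>V\<close>. The identity between integrals in the dual of \<open>V\<close> is written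
  tested with \<open>w \<in> V\<close>.\<close>

definition has_time_deriv ::
    "(real^'d) set \<Rightarrow> real \<Rightarrow> (real \<Rightarrow> real^'d \<Rightarrow> real^'d) \<Rightarrow>
      (real \<Rightarrow> (real^'d \<Rightarrow> real^'d) \<Rightarrow> real) \<Rightarrow> bool" where
  "has_time_deriv \<Omega> T u g \<longleftrightarrow>
     (\<forall>\<phi>\<in>test_functions {0<..<T}. \<forall>w\<in>V_space \<Omega>.
        (\<integral>t. deriv \<phi> t * (\<integral>x. u t x \<bullet> w x \<partial>lebesgue_on \<Omega>) \<partial>time_interval T) =
        - (\<integral>t. \<phi> t * g t w \<partial>time_interval T))"

abbreviation L2_V_dual :: "(real^'d) set \<Rightarrow> real \<Rightarrow> (real \<Rightarrow> (real^'d \<Rightarrow> real^'d) \<Rightarrow> real) set" where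
  "L2_V_dual \<Omega> T \<equiv> bochner_L2 (time_interval T) (V_dual \<Omega>) (V_dual_norm \<Omega>)"

definition time_deriv ::
    "(real^'d) set \<Rightarrow> real \<Rightarrow> (real \<Rightarrow> real^'d \<Rightarrow> real^'d) \<Rightarrow>
      real \<Rightarrow> (real^'d \<Rightarrow> real^'d) \<Rightarrow> real" where
  "time_deriv \<Omega> T u = (SOME g. g \<in> L2_V_dual \<Omega> T \<and> has_time_deriv \<Omega> T u g)"

definition W_I :: "(real^'d) set \<Rightarrow> real \<Rightarrow> (real \<Rightarrow> real^'d \<Rightarrow> real^'d) set" where
  "W_I \<Omega> T = {u \<in> bochner_L2 (time_interval T) (V_space \<Omega>) (V_norm \<Omega>).
                \<exists>g \<in> L2_V_dual \<Omega> T. has_time_deriv \<Omega> T u g}"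

text \<open>Values \<open>u(t)\<close>, \<open>0 \<le> t \<le> T\<close>, of \<open>u \<in> W(I)\<close> are those of its representative in
  \<open>C([0,T]; H)\<close>.\<close>

definition is_continuous_rep ::
    "(real^'d) set \<Rightarrow> real \<Rightarrow> (real \<Rightarrow> real^'d \<Rightarrow> real^'d) \<Rightarrow>
      (real \<Rightarrow> real^'d \<Rightarrow> real^'d) \<Rightarrow> bool" where
  "is_continuous_rep \<Omega> T u U \<longleftrightarrow>
     (\<forall>t\<in>{0..T}. U t \<in> H_space \<Omega> \<and>
        ((\<lambda>s. H_norm \<Omega> (U s - U t)) \<longlongrightarrow> 0) (at t within {0..T})) \<and>
     (AE t in time_interval T. AE x in lebesgue_on \<Omega>. U t x = u t x)"

definition time_value ::
    "(real^'d) set \<Rightarrow> real \<Rightarrow> (real \<Rightarrow> real^'d \<Rightarrow> real^'d) \<Rightarrow> real \<Rightarrow> real^'d \<Rightarrow> real^'d" where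
  "time_value \<Omega> T u = (SOME U. is_continuous_rep \<Omega> T u U)"

text \<open>The restriction to \<open>L\<^sup>2(I; V\<^sub>\<sigma>)\<close> of the functional given by \<open>g\<close> is represented by restricting
  every \<open>g t\<close> to \<open>V\<^sub>\<sigma>\<close>.\<close>

definition restrict_V_sigma ::
    "(real^'d) set \<Rightarrow> (real \<Rightarrow> (real^'d \<Rightarrow> real^'d) \<Rightarrow> real) \<Rightarrow>
      real \<Rightarrow> (real^'d \<Rightarrow> real^'d) \<Rightarrow> real" where
  "restrict_V_sigma \<Omega> g t = restrict (g t) (V_sigma \<Omega>)"

abbreviation L2_V_sigma_dual_norm ::
    "(real^'d) set \<Rightarrow> real \<Rightarrow> (real \<Rightarrow> (real^'d \<Rightarrow> real^'d) \<Rightarrow> real) \<Rightarrow> real" where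
  "L2_V_sigma_dual_norm \<Omega> T \<equiv> bochner_L2_norm (time_interval T) (V_sigma_dual_norm \<Omega>)"

definition stokes_solution ::
    "(real^'d) set \<Rightarrow> real \<Rightarrow> (real \<Rightarrow> (real^'d \<Rightarrow> real^'d) \<Rightarrow> real) \<Rightarrow> (real^'d \<Rightarrow> real^'d) \<Rightarrow>
      (real \<Rightarrow> real^'d \<Rightarrow> real^'d) \<Rightarrow> (real \<Rightarrow> real^'d \<Rightarrow> real) \<Rightarrow> bool" where
  "stokes_solution \<Omega> T f u0 u p \<longleftrightarrow>
     u \<in> W_I \<Omega> T \<and>
     p \<in> bochner_L2 (time_interval T) (L2_0 \<Omega>) (L2_norm (lebesgue_on \<Omega>)) \<and>
     (AE t in time_interval T.
        eq_in_V_dual \<Omega> (time_deriv \<Omega> T u t + neg_laplace \<Omega> (u t) + grad_pressure \<Omega> (p t)) (f t) \<and>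
        div_free \<Omega> (u t)) \<and>
     (AE x in lebesgue_on \<Omega>. time_value \<Omega> T u 0 x = u0 x)"

end

theory Submission
  imports Defs
begin

text \<open>
  By the Riesz theorem for \<open>V\<close>, functionals in \<open>L\<^sup>2(I; V\<^sup>*)\<close> become functions in \<open>L\<^sup>2(I; V)\<close>, and
  restricting to \<open>V\<^sub>\<sigma>\<close> becomes the orthogonal projection \<open>P\<close> onto \<open>V\<^sub>\<sigma>\<close>. Put \<open>e = v - u\<close> and let
  \<open>g\<close> represent \<open>\<partial>\<^sub>te\<close>. On \<open>V\<^sub>\<sigma>\<close> the pressure disappears and \<open>\<partial>\<^sub>tv - \<Delta>v - f\<close> is represented by
  \<open>P g + e\<close>; its squared norm is \<open>\<parallel>P g\<parallel>\<^sup>2 + 2 \<langle>\<partial>\<^sub>te, e\<rangle> + \<parallel>\<nabla>e\<parallel>\<^sup>2\<close>, and the middle term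
  integrates to \<open>\<parallel>e(T)\<parallel>\<^sup>2\<close> because \<open>e(0) = 0\<close>.

  For the infimum, testing \<open>L\<^sup>*y = f - \<partial>\<^sub>tv\<close> with \<open>w \<in> V\<^sub>\<sigma>\<close>, whose gradient is trace-free, gives
  the lower bound. Conversely, the trace-free fields orthogonal to \<open>dev (ker L\<^sup>*)\<close> are exactly the
  gradients of functions in \<open>V\<^sub>\<sigma>\<close>; so the lower bound is approximated by admissible \<open>y\<close>, chosen
  measurably in time through simple functions. Closedness of the range of \<open>div\<close> is not needed since
  the infimum need not be attained.

  The energy identity for \<open>\<W>(I)\<close> uses \<open>\<parallel>e(r + h)\<parallel>\<^sup>2 - \<parallel>e(r)\<parallel>\<^sup>2 \<ge> 2 (e(r + h) - e(r), e(r))\<close> for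
  both signs of \<open>h\<close>, which determines the distributional derivative of \<open>\<parallel>e\<parallel>\<^sup>2\<close>.
\<close>

text \<open>Spaces consist of representatives, so \<open>ip x x = 0\<close> does not force
  \<open>x = 0\<close>. Everything is therefore done for positive semidefinite forms on subspaces:
  Riesz representatives, projections and limits are determined up to seminorm zero, which is all
  that the norms in the theorem see. The cross term in the expansion is exact because
  \<open>e(t)\<close> lies in \<open>V\<^sub>\<sigma>\<close> itself, so that
  \<open>(P g, e) = (g, e)\<close> in \<open>V\<close>. The obstacle in the energy identity is that
  \<open>\<partial>\<^sub>te\<close> exists only in the dual of \<open>V\<close>, so
  \<open>\<parallel>e\<parallel>\<^sup>2\<close> has no product rule. The quoted inequality turns
  difference quotients into averages of \<open>(g(s), e(r))\<close> over \<open>s\<close> near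
  \<open>r\<close>, but \<open>g\<close>, being only square integrable in time, is not continuous.
  An integrable modulus replaces continuity:
  \<open>\<parallel>g(s) - g(r)\<parallel>\<^sup>2 \<le> b(s) + b(r)\<close> for almost all
  \<open>s\<close>, \<open>r\<close> with \<open>\<bar>s - r\<bar> < d\<close>, the integral of
  \<open>b\<close> being as small as desired. The term \<open>b(s)\<close> depends on the averaged
  variable; its average is a difference quotient of the primitive of \<open>b\<close> and is moved
  to the other side.\<close>

instantiation "fun" :: (type, real_vector) real_vector
begin

text \<open>Together with the pointwise addition of functions this makes \<open>subspace\<close> and
  \<open>linear\<close> available for sets of functions. \<open>dual_space\<close> writes scalar
  multiples out as \<open>\<lambda>x. c *\<^sub>R v x\<close>; unfolding this definition is the
  translation.\<close>

definition scaleR_fun_def: "scaleR c f = (\<lambda>x. c *\<^sub>R f x)"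

instance
  by standard (auto simp: scaleR_fun_def plus_fun_def algebra_simps fun_eq_iff)

end

section \<open>Semi-inner product spaces\<close>

definition snorm :: "('v \<Rightarrow> 'v \<Rightarrow> real) \<Rightarrow> 'v \<Rightarrow> real" where
  "snorm ip x = sqrt (ip x x)"

text \<open>The laws are demanded on \<open>S\<close> only: outside an L2 space the integral of a
  product may take its default value, and bilinearity fails. No norm is attached to the type, since
  \<open>ip\<close> is merely semidefinite and several forms live on the same type of
  functions.\<close>

locale semi_inner =
  fixes S :: "'v::real_vector set" and ip :: "'v \<Rightarrow> 'v \<Rightarrow> real"
  assumes subspace_S: "subspace S"
    and ip_add_left: "x \<in> S \<Longrightarrow> y \<in> S \<Longrightarrow> z \<in> S \<Longrightarrow> ip (x + y) z = ip x z + ip y z"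
    and ip_scale_left: "x \<in> S \<Longrightarrow> z \<in> S \<Longrightarrow> ip (c *\<^sub>R x) z = c * ip x z"
    and ip_commute: "x \<in> S \<Longrightarrow> y \<in> S \<Longrightarrow> ip x y = ip y x"
    and ip_nonneg: "x \<in> S \<Longrightarrow> 0 \<le> ip x x"
begin

abbreviation "sn \<equiv> snorm ip"

lemma S_zero [simp]: "0 \<in> S" using subspace_S by (rule subspace_0)
lemma S_add [simp]: "x \<in> S \<Longrightarrow> y \<in> S \<Longrightarrow> x + y \<in> S" using subspace_S by (rule subspace_add)
lemma S_diff [simp]: "x \<in> S \<Longrightarrow> y \<in> S \<Longrightarrow> x - y \<in> S" using subspace_S by (rule subspace_diff)
lemma S_scale [simp]: "x \<in> S \<Longrightarrow> c *\<^sub>R x \<in> S" using subspace_S by (rule subspace_scale)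

lemma ip_diff_left:
  assumes "x \<in> S" "y \<in> S" "z \<in> S" shows "ip (x - y) z = ip x z - ip y z"
proof -
  have "ip x z = ip (x - y) z + ip y z"
    using ip_add_left[of "x - y" y z] assms by simp
  then show ?thesis by simp
qed

lemma ip_zero_left [simp]: "z \<in> S \<Longrightarrow> ip 0 z = 0"
  using ip_scale_left[of 0 z 0] by simp

lemma ip_zero_right [simp]: "z \<in> S \<Longrightarrow> ip z 0 = 0"
  using ip_commute[of z 0] by simp

lemma ip_add_right: "x \<in> S \<Longrightarrow> y \<in> S \<Longrightarrow> z \<in> S \<Longrightarrow> ip z (x + y) = ip z x + ip z y"
  using ip_add_left ip_commute S_add by metis

lemma ip_diff_right: "x \<in> S \<Longrightarrow> y \<in> S \<Longrightarrow> z \<in> S \<Longrightarrow> ip z (x - y) = ip z x - ip z y"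
  using ip_diff_left ip_commute S_diff by metis

lemma ip_scale_right: "x \<in> S \<Longrightarrow> z \<in> S \<Longrightarrow> ip z (c *\<^sub>R x) = c * ip z x"
  using ip_scale_left ip_commute S_scale by metis

lemmas ip_simps = ip_add_left ip_add_right ip_diff_left ip_diff_right ip_scale_left ip_scale_right

lemma sn_nonneg: "x \<in> S \<Longrightarrow> 0 \<le> sn x"
  by (simp add: snorm_def ip_nonneg)

lemma sn_sq: "x \<in> S \<Longrightarrow> (sn x)\<^sup>2 = ip x x"
  by (simp add: snorm_def ip_nonneg)

lemma sn_zero [simp]: "sn 0 = 0"
  by (simp add: snorm_def)

lemma sn_scale: "x \<in> S \<Longrightarrow> sn (c *\<^sub>R x) = \<bar>c\<bar> * sn x"
  by (simp add: snorm_def ip_simps real_sqrt_mult flip: power2_eq_square mult.assoc)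

lemma sn_minus_commute: "x \<in> S \<Longrightarrow> y \<in> S \<Longrightarrow> sn (x - y) = sn (y - x)"
  using sn_scale[of "y - x" "-1"] by simp

text \<open>Cauchy-Schwarz from the nonnegativity of \<open>ip\<close> on all combinations of
  \<open>x\<close> and \<open>y\<close>. Two parameters are kept because \<open>y\<close> cannot be
  normalised when its seminorm vanishes.\<close>

lemma ip_le_sn: assumes x: "x \<in> S" and y: "y \<in> S" shows "\<bar>ip x y\<bar> \<le> sn x * sn y"
proof -
  let ?a = "ip x x" and ?b = "ip x y" and ?c = "ip y y"
  have q: "0 \<le> s\<^sup>2 * ?a + 2 * (s * t) * ?b + t\<^sup>2 * ?c" for s t
    using ip_nonneg[of "s *\<^sub>R x + t *\<^sub>R y"] x y
    by (simp add: ip_simps ip_commute[of y x] algebra_simps power2_eq_square)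
  have ac: "0 \<le> ?a" "0 \<le> ?c" using x y by (auto intro: ip_nonneg)
  have "?b\<^sup>2 \<le> ?a * ?c"
  proof (cases "?c = 0")
    case True
    \<comment> \<open>With \<open>?c = 0\<close> the form is affine in \<open>t\<close>; for
      \<open>?b\<close> nonzero the value of \<open>t\<close> below would make it
      \<open>-1\<close>.\<close>
    have "?b = 0"
    proof (rule ccontr)
      assume "?b \<noteq> 0"
      then have "2 * (- (?a + 1) / (2 * ?b)) * ?b = - (?a + 1)" by simp
      then show False using q[of 1 "- (?a + 1) / (2 * ?b)"] True by simp
    qed
    then show ?thesis using ac by simp
  next
    case False
    then have "0 < ?c" using ac by simp
    \<comment> \<open>The minimising combination is proportional to \<open>?c x - ?b y\<close>,
      written without division.\<close>
    moreover have "0 \<le> ?c * (?c * ?a - ?b\<^sup>2)"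
      using q[of ?c "- ?b"] by (simp add: algebra_simps power2_eq_square)
    ultimately show ?thesis
      by (simp add: zero_le_mult_iff mult.commute)
  qed
  then have "sqrt (?b\<^sup>2) \<le> sqrt (?a * ?c)" by (rule real_sqrt_le_mono)
  then show ?thesis by (simp add: snorm_def real_sqrt_mult)
qed

lemma ip_le_ab: "x \<in> S \<Longrightarrow> y \<in> S \<Longrightarrow> \<bar>ip x y\<bar> \<le> ((sn x)\<^sup>2 + (sn y)\<^sup>2) / 2"
  using ip_le_sn[of x y] sum_squares_bound[of "sn x" "sn y"] by (simp add: field_simps)

lemma sn_triangle: assumes "x \<in> S" "y \<in> S" shows "sn (x + y) \<le> sn x + sn y"
proof (rule power2_le_imp_le)
  have "(sn (x + y))\<^sup>2 = (sn x)\<^sup>2 + 2 * ip x y + (sn y)\<^sup>2"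
    using assms by (simp add: sn_sq ip_simps ip_commute[of y x])
  also have "\<dots> \<le> (sn x + sn y)\<^sup>2"
    using ip_le_sn[OF assms] by (simp add: power2_sum)
  finally show "(sn (x + y))\<^sup>2 \<le> (sn x + sn y)\<^sup>2" .
  show "0 \<le> sn x + sn y" using assms by (simp add: sn_nonneg)
qed

lemma sn_diff_triangle:
  assumes "x \<in> S" "y \<in> S" "z \<in> S" shows "sn (x - z) \<le> sn (x - y) + sn (y - z)"
  using sn_triangle[of "x - y" "y - z"] assms by simp

lemma sn_diff_le: "x \<in> S \<Longrightarrow> y \<in> S \<Longrightarrow> sn (x - y) \<le> sn x + sn y"
  using sn_diff_triangle[of x 0 y] sn_minus_commute[of y 0] by (simp add: sn_minus_commute)

lemma abs_sn_diff_le: assumes "x \<in> S" "y \<in> S" shows "\<bar>sn x - sn y\<bar> \<le> sn (x - y)"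
  using sn_triangle[of "x - y" y] sn_triangle[of "y - x" x] sn_minus_commute[of x y] assms by simp

lemma sn_add_sq_le: assumes "x \<in> S" "y \<in> S" shows "(sn (x + y))\<^sup>2 \<le> 2 * (sn x)\<^sup>2 + 2 * (sn y)\<^sup>2"
proof -
  have "(sn (x + y))\<^sup>2 \<le> (sn x + sn y)\<^sup>2"
    using sn_triangle[OF assms] sn_nonneg assms by (intro power_mono) auto
  also have "\<dots> \<le> 2 * (sn x)\<^sup>2 + 2 * (sn y)\<^sup>2"
    using sum_squares_bound[of "sn x" "sn y"] by (simp add: power2_sum)
  finally show ?thesis .
qed

text \<open>Substitute for definiteness: null vectors drop out of every inner product.\<close>

lemma sn_zero_imp_ip_zero: "x \<in> S \<Longrightarrow> y \<in> S \<Longrightarrow> sn x = 0 \<Longrightarrow> ip x y = 0"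
  using ip_le_sn[of x y] by simp

lemma tendsto_sn:
  assumes "\<And>n. X n \<in> S" "x \<in> S" "((\<lambda>n. sn (X n - x)) \<longlongrightarrow> 0) F"
  shows "((\<lambda>n. sn (X n)) \<longlongrightarrow> sn x) F"
proof -
  have "((\<lambda>n. sn (X n) - sn x) \<longlongrightarrow> 0) F"
    by (rule Lim_null_comparison[OF _ assms(3)]) (use abs_sn_diff_le assms(1,2) in auto)
  then show ?thesis by (simp add: LIM_zero_iff)
qed

lemma tendsto_ip:
  assumes "\<And>n. X n \<in> S" "x \<in> S" "((\<lambda>n. sn (X n - x)) \<longlongrightarrow> 0) F"
    and "\<And>n. Y n \<in> S" "y \<in> S" "((\<lambda>n. sn (Y n - y)) \<longlongrightarrow> 0) F"
  shows "((\<lambda>n. ip (X n) (Y n)) \<longlongrightarrow> ip x y) F"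
proof -
  have "((\<lambda>n. ip (X n) (Y n) - ip x y) \<longlongrightarrow> 0) F"
  proof (rule Lim_null_comparison)
    have "((\<lambda>n. sn (X n - x) * sn (Y n) + sn x * sn (Y n - y)) \<longlongrightarrow> 0 * sn y + sn x * 0) F"
      using assms by (intro tendsto_intros tendsto_sn) auto
    then show "((\<lambda>n. sn (X n - x) * sn (Y n) + sn x * sn (Y n - y)) \<longlongrightarrow> 0) F" by simp
    have "norm (ip (X n) (Y n) - ip x y) \<le> sn (X n - x) * sn (Y n) + sn x * sn (Y n - y)" for n
    proof -
      have "ip (X n) (Y n) - ip x y = ip (X n - x) (Y n) + ip x (Y n - y)"
        using assms(1,2,4,5) by (simp add: ip_simps)
      then show ?thesis
        using ip_le_sn[of "X n - x" "Y n"] ip_le_sn[of x "Y n - y"] assms(1,2,4,5) by simp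
    qed
    then show "\<forall>\<^sub>F n in F. norm (ip (X n) (Y n) - ip x y) \<le> sn (X n - x) * sn (Y n) + sn x * sn (Y n - y)"
      by simp
  qed
  then show ?thesis by (simp add: LIM_zero_iff)
qed

lemma tendsto_ip_left:
  assumes "\<And>n. X n \<in> S" "x \<in> S" "((\<lambda>n. sn (X n - x)) \<longlongrightarrow> 0) F" "y \<in> S"
  shows "((\<lambda>n. ip (X n) y) \<longlongrightarrow> ip x y) F"
  by (rule tendsto_ip[OF assms(1-3), where Y = "\<lambda>_. y"]) (use assms in auto)

lemma semi_inner_subspace: "subspace D \<Longrightarrow> D \<subseteq> S \<Longrightarrow> semi_inner D ip"
  by unfold_locales (auto simp: subset_eq ip_simps ip_nonneg ip_commute)

text \<open>The supremum is attained at \<open>r\<close> divided by its seminorm; if that is zero,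
  Cauchy-Schwarz makes the functional vanish and \<open>0\<close> attains the supremum.\<close>

lemma dual_norm_eq_sn:
  assumes r: "r \<in> S" and F: "\<And>w. w \<in> S \<Longrightarrow> F w = ip r w"
  shows "dual_norm S sn F = sn r"
  unfolding dual_norm_def
proof (rule cSup_eq_maximum)
  have "\<exists>v\<in>S. sn v \<le> 1 \<and> \<bar>ip r v\<bar> = sn r"
  proof (cases "sn r = 0")
    case True
    then show ?thesis using r by (intro bexI[of _ 0]) auto
  next
    case False
    then have p: "0 < sn r" using sn_nonneg[OF r] by simp
    have "ip r ((1 / sn r) *\<^sub>R r) = sn r"
      using r p by (simp add: ip_simps power2_eq_square field_simps flip: sn_sq)
    then show ?thesis using r p by (intro bexI[of _ "(1 / sn r) *\<^sub>R r"]) (auto simp: sn_scale)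
  qed
  then show "sn r \<in> (\<lambda>v. \<bar>F v\<bar>) ` {v \<in> S. sn v \<le> 1}"
    using F by (fastforce simp: image_iff)
next
  fix y assume "y \<in> (\<lambda>v. \<bar>F v\<bar>) ` {v \<in> S. sn v \<le> 1}"
  then obtain v where v: "v \<in> S" "sn v \<le> 1" "y = \<bar>ip r v\<bar>" using F by auto
  have "y \<le> sn r * sn v" using v r ip_le_sn by simp
  also have "\<dots> \<le> sn r" using v sn_nonneg[OF r] by (simp add: mult_left_le)
  finally show "y \<le> sn r" .
qed

end

text \<open>Completeness is spelled out with Cauchy sequences, because no metric is attached to the
  type; limits need not be unique.\<close>

locale semi_hilbert = semi_inner +
  assumes complete: "\<forall>n::nat. X n \<in> S \<Longrightarrow>
      \<forall>e>0. \<exists>N. \<forall>m\<ge>N. \<forall>n\<ge>N. snorm ip (X m - X n) < e \<Longrightarrow>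
      \<exists>x\<in>S. (\<lambda>n. snorm ip (X n - x)) \<longlonglongrightarrow> 0"
begin

text \<open>The representative minimises \<open>ip w w - 2 F w\<close>.\<close>

lemma riesz:
  assumes add: "\<And>v w. v \<in> S \<Longrightarrow> w \<in> S \<Longrightarrow> F (v + w) = F v + F w"
    and scale: "\<And>c v. v \<in> S \<Longrightarrow> F (c *\<^sub>R v) = c * F v"
    and bound: "\<And>v. v \<in> S \<Longrightarrow> \<bar>F v\<bar> \<le> C * sn v"
  shows "\<exists>r\<in>S. \<forall>w\<in>S. F w = ip r w"
proof -
  define J where "J w = ip w w - 2 * F w" for w
  define I where "I = Inf (J ` S)"
  have "- C\<^sup>2 \<le> J w" if "w \<in> S" for w
  proof -
    have "0 \<le> (sn w - C)\<^sup>2" by simp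
    also have "\<dots> = ip w w - 2 * (C * sn w) + C\<^sup>2" using that by (simp add: power2_diff sn_sq)
    also have "\<dots> \<le> J w + C\<^sup>2" using bound[OF that] by (simp add: J_def)
    finally show ?thesis by simp
  qed
  then have bdd: "bdd_below (J ` S)" by (auto simp: bdd_below_def)
  have I_le: "I \<le> J w" if "w \<in> S" for w
    unfolding I_def using bdd that by (intro cInf_lower) auto
  have "\<exists>w\<in>S. J w < I + 1 / real (Suc n)" for n
  proof -
    have "Inf (J ` S) < I + 1 / real (Suc n)" by (simp add: I_def)
    then show ?thesis using cInf_lessD[of "J ` S"] S_zero by blast
  qed
  then obtain X where X: "\<And>n. X n \<in> S" "\<And>n. J (X n) < I + 1 / real (Suc n)" by metis
  \<comment> \<open>Parallelogram law: the linear part of \<open>J\<close> cancels against its value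
    at the midpoint, where \<open>J\<close> is at least \<open>I\<close>. Near-minimisers are thus
    close to each other.\<close>
  have par: "(sn (v - w))\<^sup>2 \<le> 2 * (J v - I) + 2 * (J w - I)" if "v \<in> S" "w \<in> S" for v w
  proof -
    have "4 * J ((1/2) *\<^sub>R (v + w)) = ip (v + w) (v + w) - 4 * (F v + F w)"
      using that by (simp add: J_def ip_simps scale add field_simps)
    moreover have "I \<le> J ((1/2) *\<^sub>R (v + w))" using that by (intro I_le) simp
    moreover have "(sn (v - w))\<^sup>2 = 2 * ip v v + 2 * ip w w - ip (v + w) (v + w)"
      using that by (simp add: sn_sq ip_simps ip_commute[of w v])
    ultimately show ?thesis by (simp add: J_def)
  qed
  have "\<exists>N. \<forall>m\<ge>N. \<forall>n\<ge>N. sn (X m - X n) < e" if "0 < e" for e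
  proof -
    \<comment> \<open>A quarter, because the parallelogram estimate adds twice the excess of each of
      two points.\<close>
    have "0 < e\<^sup>2 / 4" using that by simp
    from reals_Archimedean[OF this] obtain N where N: "1 / real (Suc N) < e\<^sup>2 / 4"
      unfolding inverse_eq_divide by blast
    have "sn (X m - X n) < e" if "m \<ge> N" "n \<ge> N" for m n
    proof -
      have *: "J (X k) - I < e\<^sup>2 / 4" if "k \<ge> N" for k
      proof -
        have "J (X k) < I + 1 / real (Suc k)" by (rule X(2))
        also have "\<dots> \<le> I + 1 / real (Suc N)" using that by (simp add: frac_le)
        also have "\<dots> < I + e\<^sup>2 / 4" using N by simp
        finally show ?thesis by simp
      qed
      have "(sn (X m - X n))\<^sup>2 < e\<^sup>2"
        using par[OF X(1) X(1), of m n] mult_strict_left_mono[OF *[OF \<open>m \<ge> N\<close>], of 2]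
          mult_strict_left_mono[OF *[OF \<open>n \<ge> N\<close>], of 2] by simp
      then show ?thesis using \<open>0 < e\<close> by (simp add: power_less_imp_less_base)
    qed
    then show ?thesis by blast
  qed
  then obtain r where r: "r \<in> S" "(\<lambda>n. sn (X n - r)) \<longlonglongrightarrow> 0"
    using complete[of X] X(1) by auto
  have "(\<lambda>n. F (X n) - F r) \<longlonglongrightarrow> 0"
  proof (rule Lim_null_comparison)
    have "F (X n) - F r = F (X n - r)" for n
      using add[of "X n - r" r] X(1) r(1) by simp
    then show "\<forall>\<^sub>F n in sequentially. norm (F (X n) - F r) \<le> C * sn (X n - r)"
      using bound X(1) r(1) by simp
    show "(\<lambda>n. C * sn (X n - r)) \<longlonglongrightarrow> 0" using tendsto_mult_right_zero[OF r(2)] by simp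
  qed
  then have "(\<lambda>n. F (X n)) \<longlonglongrightarrow> F r" by (simp add: LIM_zero_iff)
  then have "(\<lambda>n. J (X n)) \<longlonglongrightarrow> J r"
    unfolding J_def using X(1) r by (intro tendsto_intros tendsto_ip) auto
  moreover have "(\<lambda>n. I + 1 / real (Suc n)) \<longlonglongrightarrow> I + 0"
    by (intro tendsto_intros LIMSEQ_Suc[OF lim_1_over_n])
  ultimately have "J r \<le> I"
    using X(2) by (intro LIMSEQ_le[of "\<lambda>n. J (X n)" _ "\<lambda>n. I + 1 / real (Suc n)"]) (auto intro: less_imp_le)
  have "F w = ip r w" if w: "w \<in> S" for w
  proof -
    define a where "a = ip r w - F w"
    define b where "b = ip w w"
    have b: "0 \<le> b" using w by (simp add: b_def ip_nonneg)
    \<comment> \<open>First variation at the minimiser in the direction \<open>w\<close>.\<close>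
    have ge: "0 \<le> 2 * t * a + t\<^sup>2 * b" for t
    proof -
      have "J (r + t *\<^sub>R w) = J r + 2 * t * a + t\<^sup>2 * b"
        using r(1) w by (simp add: J_def ip_simps add scale a_def b_def ip_commute[of w r]
            algebra_simps power2_eq_square)
      moreover have "I \<le> J (r + t *\<^sub>R w)" using r(1) w by (intro I_le) simp
      ultimately show ?thesis using \<open>J r \<le> I\<close> by simp
    qed
    have "a = 0"
    proof (rule ccontr)
      assume "a \<noteq> 0"
      \<comment> \<open>A step against the slope. The \<open>+ 1\<close> covers null directions,
        where \<open>b = 0\<close>; the variation at \<open>- s\<close> is
        \<open>- (s\<^sup>2 * (b + 2))\<close>, which is negative.\<close>
      define s where "s = a / (b + 1)"
      have a: "a = s * (b + 1)" "s \<noteq> 0" using b \<open>a \<noteq> 0\<close> by (auto simp: s_def)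
      have "2 * (- s) * a + (- s)\<^sup>2 * b = - (s\<^sup>2 * (b + 2))"
        by (simp add: a(1) algebra_simps power2_eq_square)
      moreover have "0 < s\<^sup>2 * (b + 2)" using a(2) b by simp
      ultimately show False using ge[of "- s"] by linarith
    qed
    then show ?thesis by (simp add: a_def)
  qed
  then show ?thesis using r(1) by blast
qed

end

text \<open>Orthogonal projection, characterised by testing with \<open>D\<close>. It is unique only
  up to seminorm zero, hence the choice; as a function it need be neither linear nor the identity on
  \<open>D\<close>.\<close>

definition proj :: "'v set \<Rightarrow> ('v \<Rightarrow> 'v \<Rightarrow> real) \<Rightarrow> 'v::real_vector \<Rightarrow> 'v" where
  "proj D ip x = (SOME p. p \<in> D \<and> (\<forall>m\<in>D. ip p m = ip x m))"

locale semi_hilbert_sub = semi_inner S ip + D: semi_hilbert D ip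
  for S D :: "'v::real_vector set" and ip +
  assumes D_sub: "D \<subseteq> S"
begin

text \<open>Riesz representation, in the complete space \<open>D\<close>, of the functional
  \<open>ip x\<close>.\<close>

lemma proj: assumes x: "x \<in> S"
  shows proj_mem: "proj D ip x \<in> D" and ip_proj: "m \<in> D \<Longrightarrow> ip (proj D ip x) m = ip x m"
proof -
  have "\<exists>p\<in>D. \<forall>m\<in>D. ip x m = ip p m"
    by (rule D.riesz[where C = "sn x"]) (use x D_sub in \<open>auto simp: subset_eq ip_simps ip_le_sn\<close>)
  then have "\<exists>p. p \<in> D \<and> (\<forall>m\<in>D. ip p m = ip x m)" by metis
  then have "proj D ip x \<in> D \<and> (\<forall>m\<in>D. ip (proj D ip x) m = ip x m)"
    unfolding proj_def by (rule someI_ex)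
  then show "proj D ip x \<in> D" "m \<in> D \<Longrightarrow> ip (proj D ip x) m = ip x m" by auto
qed

lemma proj_mem_S: "x \<in> S \<Longrightarrow> proj D ip x \<in> S"
  using proj_mem D_sub by auto

text \<open>Stated for a difference of projections rather than for the projection of a difference,
  since the chosen representatives need not add up. Testing the difference with itself gives the
  contraction.\<close>

lemma sn_proj_diff_le: assumes x: "x \<in> S" and y: "y \<in> S"
  shows "sn (proj D ip x - proj D ip y) \<le> sn (x - y)"
proof -
  let ?p = "proj D ip x - proj D ip y"
  have p: "?p \<in> D" "?p \<in> S" using x y proj_mem proj_mem_S by auto
  have "(sn ?p)\<^sup>2 = ip (x - y) ?p"
    using x y p D_sub proj_mem_S by (simp add: sn_sq ip_diff_left ip_proj)
  also have "\<dots> \<le> sn (x - y) * sn ?p" using ip_le_sn[of "x - y" ?p] x y p by simp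
  finally have "sn ?p * sn ?p \<le> sn (x - y) * sn ?p" by (simp add: power2_eq_square)
  then show ?thesis using sn_nonneg[OF p(2)] sn_nonneg[of "x - y"] x y
    by (cases "sn ?p = 0") (auto simp: mult_le_cancel_right)
qed

lemma sn_diff_proj_of_mem: assumes "x \<in> D" shows "sn (x - proj D ip x) = 0"
proof -
  have x: "x \<in> S" using assms D_sub by auto
  then have p: "x - proj D ip x \<in> D" "x - proj D ip x \<in> S"
    using assms proj_mem proj_mem_S by auto
  have "(sn (x - proj D ip x))\<^sup>2 = 0"
    using p x proj_mem_S[OF x] ip_proj[OF x p(1)] by (simp add: sn_sq ip_diff_left)
  then show ?thesis by simp
qed

end

section \<open>Closures\<close>

definition sclosure :: "'v set \<Rightarrow> ('v \<Rightarrow> 'v \<Rightarrow> real) \<Rightarrow> 'v set \<Rightarrow> 'v::real_vector set" where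
  "sclosure S ip D = {x \<in> S. \<forall>e>0. \<exists>d\<in>D. snorm ip (x - d) < e}"

context semi_hilbert
begin

lemma sclosure_approx:
  assumes "x \<in> sclosure S ip D" "D \<subseteq> S"
  obtains d where "\<And>n. d n \<in> D" "(\<lambda>n. sn (d n - x)) \<longlonglongrightarrow> 0"
proof -
  have x: "x \<in> S" using assms by (simp add: sclosure_def)
  have "\<exists>d\<in>D. sn (x - d) < 1 / real (Suc n)" for n
    using assms by (auto simp: sclosure_def)
  then obtain d where d: "\<And>n. d n \<in> D" "\<And>n. sn (x - d n) < 1 / real (Suc n)" by metis
  have "(\<lambda>n. sn (d n - x)) \<longlonglongrightarrow> 0"
  proof (rule Lim_null_comparison[OF _ LIMSEQ_Suc[OF lim_1_over_n]])
    have "norm (sn (d n - x)) \<le> 1 / real (Suc n)" for n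
      using d[of n] x assms(2) sn_minus_commute[of x "d n"] sn_nonneg[of "d n - x"]
      by (auto simp: subset_eq)
    then show "\<forall>\<^sub>F n in sequentially. norm (sn (d n - x)) \<le> 1 / real (Suc n)" by simp
  qed
  then show ?thesis using d(1) that by blast
qed

lemma semi_hilbert_sclosure:
  assumes D: "subspace D" "D \<subseteq> S"
  shows "semi_hilbert (sclosure S ip D) ip"
proof -
  let ?C = "sclosure S ip D"
  have CS: "?C \<subseteq> S" by (auto simp: sclosure_def)
  have DS: "d \<in> S" if "d \<in> D" for d using D(2) that by auto
  have "subspace ?C"
  proof (rule subspaceI)
    show "0 \<in> ?C" using subspace_0[OF D(1)] by (auto simp: sclosure_def intro!: bexI[of _ 0])
  next
    fix x y assume xy: "x \<in> ?C" "y \<in> ?C"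
    have "\<exists>d\<in>D. sn (x + y - d) < e" if "0 < e" for e
    proof -
      obtain d1 d2 where d: "d1 \<in> D" "d2 \<in> D" "sn (x - d1) < e/2" "sn (y - d2) < e/2"
        using xy \<open>0 < e\<close> unfolding sclosure_def by (auto dest!: spec[of _ "e/2"])
      have eq: "x + y - (d1 + d2) = (x - d1) + (y - d2)" by simp
      have "sn (x + y - (d1 + d2)) \<le> sn (x - d1) + sn (y - d2)"
        unfolding eq by (rule sn_triangle) (use xy CS d DS in \<open>auto simp: subset_eq\<close>)
      then show ?thesis using d subspace_add[OF D(1)] by (intro bexI[of _ "d1 + d2"]) auto
    qed
    then show "x + y \<in> ?C" using xy by (auto simp: sclosure_def)
  next
    fix c x assume x: "x \<in> ?C"
    have "\<exists>d\<in>D. sn (c *\<^sub>R x - d) < e" if "0 < e" for e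
    proof -
      \<comment> \<open>Dividing by \<open>\<bar>c\<bar> + 1\<close> instead of
        \<open>\<bar>c\<bar>\<close> spares a separate case for \<open>c = 0\<close>.\<close>
      have "0 < e / (\<bar>c\<bar> + 1)" using that by simp
      then obtain d where d: "d \<in> D" "sn (x - d) < e / (\<bar>c\<bar> + 1)"
        using x unfolding sclosure_def by auto
      have xd: "x - d \<in> S" using x CS d DS by auto
      have "sn (c *\<^sub>R x - c *\<^sub>R d) = \<bar>c\<bar> * sn (x - d)"
        using sn_scale[OF xd, of c] by (simp add: scaleR_diff_right)
      also have "\<dots> \<le> (\<bar>c\<bar> + 1) * sn (x - d)" using sn_nonneg[OF xd] by (simp add: algebra_simps)
      also have "\<dots> < e" using d(2) by (simp add: field_simps)
      finally show ?thesis using d subspace_scale[OF D(1)] by blast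
    qed
    then show "c *\<^sub>R x \<in> ?C" using x by (auto simp: sclosure_def)
  qed
  then interpret C: semi_inner ?C ip by (rule semi_inner_subspace[OF _ CS])
  show ?thesis
  proof
    fix X :: "nat \<Rightarrow> _" assume X: "\<forall>n. X n \<in> ?C"
      and C: "\<forall>e>0. \<exists>N. \<forall>m\<ge>N. \<forall>n\<ge>N. sn (X m - X n) < e"
    have "\<forall>n. X n \<in> S" using X CS by auto
    from complete[OF this C] obtain x where x: "x \<in> S" "(\<lambda>n. sn (X n - x)) \<longlonglongrightarrow> 0"
      by auto
    have "\<exists>d\<in>D. sn (x - d) < e" if "0 < e" for e
    proof -
      have "\<forall>\<^sub>F n in sequentially. sn (X n - x) < e/2"
        using order_tendstoD(2)[OF x(2), of "e/2"] \<open>0 < e\<close> by simp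
      then obtain n where n: "sn (X n - x) < e/2" by (meson eventually_happens' sequentially_bot)
      obtain d where d: "d \<in> D" "sn (X n - d) < e/2"
        using X[rule_format, of n] \<open>0 < e\<close> unfolding sclosure_def by (auto dest!: spec[of _ "e/2"])
      have "sn (x - d) \<le> sn (x - X n) + sn (X n - d)"
        using x(1) X[rule_format, of n] CS d(1) DS by (intro sn_diff_triangle) auto
      then have "sn (x - d) < e" using n d(2) sn_minus_commute[of x "X n"] x(1) X[rule_format, of n] CS by auto
      then show ?thesis using d(1) by blast
    qed
    then show "\<exists>x\<in>?C. (\<lambda>n. sn (X n - x)) \<longlonglongrightarrow> 0" using x by (auto simp: sclosure_def)
  qed
qed

lemma subset_sclosure: "D \<subseteq> S \<Longrightarrow> D \<subseteq> sclosure S ip D"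
  by (auto simp: sclosure_def intro!: bexI)

end

lemma riesz_dual_space:
  fixes S :: "('a \<Rightarrow> 'b::real_vector) set"
  assumes "semi_hilbert S ip" and F: "F \<in> dual_space S (snorm ip)"
  shows "\<exists>r\<in>S. \<forall>w\<in>S. F w = ip r w"
proof -
  interpret semi_hilbert S ip by fact
  obtain C where "\<forall>v\<in>S. \<bar>F v\<bar> \<le> C * snorm ip v" using F by (auto simp: dual_space_def)
  then show ?thesis
    using F by (intro riesz[where C = C]) (simp_all add: dual_space_def scaleR_fun_def)
qed

section \<open>Bochner square-integrable functions\<close>

text \<open>Preimages under \<open>g\<close> and under the pointwise \<open>lim\<close> differ by a
  null set, which completeness makes measurable. Bochner measurability gives approximation almost
  everywhere and leaves the values on a null set arbitrary, so the measurability of inner products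
  and seminorms rests on this.\<close>

lemma (in complete_measure) borel_measurable_AE_LIMSEQ:
  fixes f :: "nat \<Rightarrow> 'a \<Rightarrow> real"
  assumes "\<And>i. f i \<in> borel_measurable M" "AE x in M. (\<lambda>i. f i x) \<longlonglongrightarrow> g x"
  shows "g \<in> borel_measurable M"
proof (rule measurableI)
  fix B :: "real set" assume B: "B \<in> sets borel"
  let ?h = "\<lambda>x. lim (\<lambda>i. f i x)"
  have h: "?h \<in> borel_measurable M" using assms(1) by (rule borel_measurable_lim_metric)
  have ae: "AE x in M. x \<in> ?h -` B \<inter> space M \<longleftrightarrow> x \<in> g -` B \<inter> space M"
    using assms(2) by eventually_elim (simp add: limI)
  show "g -` B \<inter> space M \<in> sets M"
    by (rule in_sets_AE[OF ae]) (use measurable_sets[OF h B] in auto)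
qed simp

text \<open>The map is applied to the approximating simple functions. Only the Lipschitz bound
  enters, so the lemma covers maps built by choice, such as the Riesz representative and the
  projection.\<close>

lemma bochner_measurable_lipschitz:
  assumes "bochner_measurable M S N g"
    and A: "\<And>x. x \<in> S \<Longrightarrow> A x \<in> S'"
    and lip: "\<And>x y. x \<in> S \<Longrightarrow> y \<in> S \<Longrightarrow> 0 \<le> N' (A x - A y) \<and> N' (A x - A y) \<le> C * N (x - y)"
  shows "bochner_measurable M S' N' (\<lambda>t. A (g t))"
proof -
  obtain s where s: "\<And>n. simple_function M (s n)" "\<And>n. s n ` space M \<subseteq> S"
    "AE t in M. g t \<in> S \<and> (\<lambda>n::nat. N (g t - s n t)) \<longlonglongrightarrow> 0"
    using assms(1) unfolding bochner_measurable_def by auto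
  have "simple_function M (\<lambda>t. A (s n t)) \<and> (\<lambda>t. A (s n t)) ` space M \<subseteq> S'" for n
    using simple_function_compose1[OF s(1)] s(2)[of n] A by auto
  moreover have "AE t in M. A (g t) \<in> S' \<and> (\<lambda>n. N' (A (g t) - A (s n t))) \<longlonglongrightarrow> 0"
    using s(3) AE_space
  proof eventually_elim
    case (elim t)
    have "(\<lambda>n. N' (A (g t) - A (s n t))) \<longlonglongrightarrow> 0"
    proof (rule Lim_null_comparison)
      show "(\<lambda>n. C * N (g t - s n t)) \<longlonglongrightarrow> 0" using elim tendsto_mult_right_zero by blast
      have "norm (N' (A (g t) - A (s n t))) \<le> C * N (g t - s n t)" for n
        using lip[of "g t" "s n t"] elim s(2)[of n] by (auto simp: image_subset_iff)
      then show "\<forall>\<^sub>F n in sequentially. norm (N' (A (g t) - A (s n t))) \<le> C * N (g t - s n t)"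
        by simp
    qed
    then show ?case using elim A by auto
  qed
  ultimately show ?thesis
    unfolding bochner_measurable_def by (intro exI[of _ "\<lambda>n t. A (s n t)"]) auto
qed

locale bochner_space = semi_inner S ip + complete_measure M
  for S :: "'v::real_vector set" and ip and M :: "'t measure"
begin

abbreviation "BM \<equiv> bochner_measurable M S sn"
abbreviation "BL \<equiv> bochner_L2 M S sn"

lemma BM_obtain:
  assumes "BM g"
  obtains s where "\<And>n. simple_function M (s n)" "\<And>n t. t \<in> space M \<Longrightarrow> s n t \<in> S"
    "AE t in M. g t \<in> S" "AE t in M. (\<lambda>n::nat. sn (s n t - g t)) \<longlonglongrightarrow> 0"
proof -
  obtain s where s: "\<And>n. simple_function M (s n)" "\<And>n. s n ` space M \<subseteq> S"
    "AE t in M. g t \<in> S \<and> (\<lambda>n::nat. sn (g t - s n t)) \<longlonglongrightarrow> 0"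
    using assms unfolding bochner_measurable_def by auto
  have mem: "s n t \<in> S" if "t \<in> space M" for n t using s(2)[of n] that by auto
  have "AE t in M. (\<lambda>n. sn (s n t - g t)) \<longlonglongrightarrow> 0"
    using s(3) AE_space
  proof eventually_elim
    case (elim t)
    then have "(\<lambda>n. sn (g t - s n t)) = (\<lambda>n. sn (s n t - g t))"
      using sn_minus_commute mem by auto
    then show ?case using elim by simp
  qed
  moreover have "AE t in M. g t \<in> S" using s(3) by auto
  ultimately show ?thesis using s(1) mem that by blast
qed

lemma BMI:
  assumes "\<And>n. simple_function M (s n)" "\<And>n t. t \<in> space M \<Longrightarrow> s n t \<in> S"
    "AE t in M. g t \<in> S" "AE t in M. (\<lambda>n::nat. sn (s n t - g t)) \<longlonglongrightarrow> 0"
  shows "BM g"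
proof -
  have "AE t in M. g t \<in> S \<and> (\<lambda>n. sn (g t - s n t)) \<longlonglongrightarrow> 0"
    using assms(3,4) AE_space
  proof eventually_elim
    case (elim t)
    then have "(\<lambda>n. sn (g t - s n t)) = (\<lambda>n. sn (s n t - g t))"
      using sn_minus_commute assms(2) by auto
    then show ?case using elim by simp
  qed
  then show ?thesis unfolding bochner_measurable_def using assms(1,2) by (intro exI[of _ s]) auto
qed

lemma BM_AE_mem: "BM g \<Longrightarrow> AE t in M. g t \<in> S"
  by (erule BM_obtain)

lemma BL_BM: "g \<in> BL \<Longrightarrow> BM g" by (simp add: bochner_L2_def)
lemma BL_AE_mem: "g \<in> BL \<Longrightarrow> AE t in M. g t \<in> S" by (simp add: bochner_L2_def BM_AE_mem)
lemma BL_integrable: "g \<in> BL \<Longrightarrow> integrable M (\<lambda>t. (sn (g t))\<^sup>2)" by (simp add: bochner_L2_def)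

text \<open>Inner products of simple functions are simple; continuity of \<open>ip\<close> along the
  approximations gives the limit almost everywhere.\<close>

lemma BM_ip_measurable:
  assumes "BM g" "BM h" shows "(\<lambda>t. ip (g t) (h t)) \<in> borel_measurable M"
proof -
  obtain s where s: "\<And>n. simple_function M (s n)" "\<And>n t. t \<in> space M \<Longrightarrow> s n t \<in> S"
    "AE t in M. g t \<in> S" "AE t in M. (\<lambda>n::nat. sn (s n t - g t)) \<longlonglongrightarrow> 0"
    by (rule BM_obtain[OF assms(1)]) (rule that)
  obtain s' where s': "\<And>n. simple_function M (s' n)" "\<And>n t. t \<in> space M \<Longrightarrow> s' n t \<in> S"
    "AE t in M. h t \<in> S" "AE t in M. (\<lambda>n::nat. sn (s' n t - h t)) \<longlonglongrightarrow> 0"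
    by (rule BM_obtain[OF assms(2)]) (rule that)
  show ?thesis
  proof (rule borel_measurable_AE_LIMSEQ)
    show "(\<lambda>t. ip (s i t) (s' i t)) \<in> borel_measurable M" for i
      by (intro borel_measurable_simple_function simple_function_compose2[where h = ip] s s')
    show "AE t in M. (\<lambda>i. ip (s i t) (s' i t)) \<longlonglongrightarrow> ip (g t) (h t)"
      using s(3,4) s'(3,4) AE_space
      by eventually_elim (use s(2) s'(2) in \<open>auto intro!: tendsto_ip\<close>)
  qed
qed

lemma BM_sn_measurable: "BM g \<Longrightarrow> (\<lambda>t. sn (g t)) \<in> borel_measurable M"
  unfolding snorm_def[of _ "g _"]
  by (rule measurable_compose[OF BM_ip_measurable borel_measurable_sqrt])

lemma BM_simple: "simple_function M s \<Longrightarrow> (\<And>t. t \<in> space M \<Longrightarrow> s t \<in> S) \<Longrightarrow> BM s"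
  by (rule BMI[of "\<lambda>_. s"]) auto

lemma BM_add: assumes "BM g" "BM h" shows "BM (g + h)"
proof -
  obtain s where s: "\<And>n. simple_function M (s n)" "\<And>n t. t \<in> space M \<Longrightarrow> s n t \<in> S"
    "AE t in M. g t \<in> S" "AE t in M. (\<lambda>n::nat. sn (s n t - g t)) \<longlonglongrightarrow> 0"
    by (rule BM_obtain[OF assms(1)]) (rule that)
  obtain s' where s': "\<And>n. simple_function M (s' n)" "\<And>n t. t \<in> space M \<Longrightarrow> s' n t \<in> S"
    "AE t in M. h t \<in> S" "AE t in M. (\<lambda>n::nat. sn (s' n t - h t)) \<longlonglongrightarrow> 0"
    by (rule BM_obtain[OF assms(2)]) (rule that)
  show ?thesis
  proof (rule BMI[of "\<lambda>n t. s n t + s' n t"])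
    show "simple_function M (\<lambda>t. s n t + s' n t)" for n
      by (intro simple_function_add s s')
    show "AE t in M. (\<lambda>n. sn (s n t + s' n t - (g + h) t)) \<longlonglongrightarrow> 0"
      using s(3,4) s'(3,4) AE_space
    proof eventually_elim
      case (elim t)
      have eq: "s n t + s' n t - (g + h) t = (s n t - g t) + (s' n t - h t)" for n by simp
      show ?case
      proof (rule Lim_null_comparison)
        show "(\<lambda>n. sn (s n t - g t) + sn (s' n t - h t)) \<longlonglongrightarrow> 0"
          using elim tendsto_add_zero by blast
        have "norm (sn (s n t + s' n t - (g + h) t)) \<le> sn (s n t - g t) + sn (s' n t - h t)" for n
        proof -
          have "s n t - g t \<in> S" "s' n t - h t \<in> S" using elim s(2)[of t n] s'(2)[of t n] by auto
          then show ?thesis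
            unfolding eq using sn_triangle sn_nonneg[of "s n t - g t + (s' n t - h t)"] by simp
        qed
        then show "\<forall>\<^sub>F n in sequentially. norm (sn (s n t + s' n t - (g + h) t))
            \<le> sn (s n t - g t) + sn (s' n t - h t)" by simp
      qed
    qed
  qed (use s s' in \<open>auto\<close>)
qed

lemma BM_scale: assumes "BM g" shows "BM (c *\<^sub>R g)"
proof -
  have "BM (\<lambda>t. c *\<^sub>R g t)"
  proof (rule bochner_measurable_lipschitz[OF assms, where C = "\<bar>c\<bar>"])
    fix x y assume "x \<in> S" "y \<in> S"
    then show "0 \<le> sn (c *\<^sub>R x - c *\<^sub>R y) \<and> sn (c *\<^sub>R x - c *\<^sub>R y) \<le> \<bar>c\<bar> * sn (x - y)"
      using sn_scale[of "x - y" c] sn_nonneg[of "x - y"] by (simp add: scaleR_diff_right)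
  qed auto
  then show ?thesis by (simp add: scaleR_fun_def)
qed

lemma BM_diff: assumes "BM g" "BM h" shows "BM (g - h)"
proof -
  have eq: "g - h = g + (-1) *\<^sub>R h" by simp
  show ?thesis unfolding eq by (intro BM_add BM_scale assms)
qed

lemma BL_add: assumes "g \<in> BL" "h \<in> BL" shows "g + h \<in> BL"
proof -
  have "integrable M (\<lambda>t. (sn ((g + h) t))\<^sup>2)"
  proof (rule Bochner_Integration.integrable_bound)
    show "integrable M (\<lambda>t. 2 * (sn (g t))\<^sup>2 + 2 * (sn (h t))\<^sup>2)"
      using assms by (auto simp: BL_integrable)
    show "(\<lambda>t. (sn ((g + h) t))\<^sup>2) \<in> borel_measurable M"
      using BM_sn_measurable[OF BM_add[OF assms[THEN BL_BM]]] by (rule borel_measurable_power)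
    show "AE t in M. norm ((sn ((g + h) t))\<^sup>2) \<le> norm (2 * (sn (g t))\<^sup>2 + 2 * (sn (h t))\<^sup>2)"
      using BL_AE_mem[OF assms(1)] BL_AE_mem[OF assms(2)]
      by eventually_elim (use sn_add_sq_le in auto)
  qed
  then show ?thesis using BM_add[OF assms[THEN BL_BM]] by (simp add: bochner_L2_def)
qed

lemma BL_scale: assumes "g \<in> BL" shows "c *\<^sub>R g \<in> BL"
proof -
  have "integrable M (\<lambda>t. c\<^sup>2 * (sn (g t))\<^sup>2)" using assms by (simp add: BL_integrable)
  then have "integrable M (\<lambda>t. (sn ((c *\<^sub>R g) t))\<^sup>2)"
  proof (rule integrable_cong_AE_imp)
    show "(\<lambda>t. (sn ((c *\<^sub>R g) t))\<^sup>2) \<in> borel_measurable M"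
      using BM_sn_measurable[OF BM_scale[OF assms[THEN BL_BM]]] by (rule borel_measurable_power)
    show "AE t in M. c\<^sup>2 * (sn (g t))\<^sup>2 = (sn ((c *\<^sub>R g) t))\<^sup>2"
      using BL_AE_mem[OF assms]
      by eventually_elim (simp add: scaleR_fun_def sn_scale power_mult_distrib)
  qed
  then show ?thesis using BM_scale[OF assms[THEN BL_BM]] by (simp add: bochner_L2_def)
qed

lemma BL_diff: assumes "g \<in> BL" "h \<in> BL" shows "g - h \<in> BL"
proof -
  have eq: "g - h = g + (-1) *\<^sub>R h" by simp
  show ?thesis unfolding eq by (intro BL_add BL_scale assms)
qed

lemma BL_ip_integrable:
  assumes "g \<in> BL" "h \<in> BL" shows "integrable M (\<lambda>t. ip (g t) (h t))"
proof (rule Bochner_Integration.integrable_bound)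
  show "integrable M (\<lambda>t. ((sn (g t))\<^sup>2 + (sn (h t))\<^sup>2) / 2)"
    using assms by (auto simp: BL_integrable)
  show "(\<lambda>t. ip (g t) (h t)) \<in> borel_measurable M" by (intro BM_ip_measurable BL_BM assms)
  show "AE t in M. norm (ip (g t) (h t)) \<le> norm (((sn (g t))\<^sup>2 + (sn (h t))\<^sup>2) / 2)"
    using BL_AE_mem[OF assms(1)] BL_AE_mem[OF assms(2)]
    by eventually_elim (use ip_le_ab in auto)
qed

lemma subspace_BL: "subspace BL"
proof (rule subspaceI)
  have "BM (\<lambda>_. 0)" by (rule BM_simple) simp_all
  then show "0 \<in> BL" by (simp add: bochner_L2_def zero_fun_def)
qed (auto simp: BL_add BL_scale)

text \<open>Inner product of the Bochner space. Its triangle inequality is Minkowski's inequality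
  for the L2 norm in time, which adds up the errors in the approximation of the infimum.\<close>

definition bip :: "('t \<Rightarrow> 'v) \<Rightarrow> ('t \<Rightarrow> 'v) \<Rightarrow> real" where
  "bip g h = (\<integral>t. ip (g t) (h t) \<partial>M)"

lemma semi_inner_BL: "semi_inner BL bip"
proof
  fix x y z assume xyz: "x \<in> BL" "y \<in> BL" "z \<in> BL"
  have "bip (x + y) z = (\<integral>t. ip (x t) (z t) + ip (y t) (z t) \<partial>M)"
    unfolding bip_def
  proof (rule integral_cong_AE)
    show "AE t in M. ip ((x + y) t) (z t) = ip (x t) (z t) + ip (y t) (z t)"
      using xyz[THEN BL_AE_mem] by eventually_elim (simp add: ip_simps)
    show "(\<lambda>t. ip ((x + y) t) (z t)) \<in> borel_measurable M"
      using xyz by (intro BM_ip_measurable BM_add BL_BM)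
    show "(\<lambda>t. ip (x t) (z t) + ip (y t) (z t)) \<in> borel_measurable M"
      using xyz by (intro borel_measurable_add BM_ip_measurable BL_BM)
  qed
  then show "bip (x + y) z = bip x z + bip y z"
    using BL_ip_integrable xyz by (simp add: bip_def)
next
  fix x z c assume xz: "x \<in> BL" "z \<in> BL"
  have "bip (c *\<^sub>R x) z = (\<integral>t. c * ip (x t) (z t) \<partial>M)"
    unfolding bip_def
  proof (rule integral_cong_AE)
    show "AE t in M. ip ((c *\<^sub>R x) t) (z t) = c * ip (x t) (z t)"
      using xz[THEN BL_AE_mem] by eventually_elim (simp add: ip_simps scaleR_fun_def)
    show "(\<lambda>t. ip ((c *\<^sub>R x) t) (z t)) \<in> borel_measurable M"
      using xz by (intro BM_ip_measurable BM_scale BL_BM)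
    show "(\<lambda>t. c * ip (x t) (z t)) \<in> borel_measurable M"
      using BM_ip_measurable[OF xz[THEN BL_BM]] by simp
  qed
  then show "bip (c *\<^sub>R x) z = c * bip x z" by (simp add: bip_def)
next
  fix x y assume xy: "x \<in> BL" "y \<in> BL"
  show "bip x y = bip y x"
    unfolding bip_def
  proof (rule integral_cong_AE)
    show "AE t in M. ip (x t) (y t) = ip (y t) (x t)"
      using xy[THEN BL_AE_mem] by eventually_elim (simp add: ip_commute)
  qed (use xy in \<open>auto intro: BM_ip_measurable BL_BM\<close>)
next
  fix x assume x: "x \<in> BL"
  show "0 \<le> bip x x" unfolding bip_def
    by (rule integral_nonneg_AE) (use BL_AE_mem[OF x] in eventually_elim, simp add: ip_nonneg)
qed (rule subspace_BL)

lemma bip_self: assumes "g \<in> BL" shows "bip g g = (\<integral>t. (sn (g t))\<^sup>2 \<partial>M)"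
  unfolding bip_def
proof (rule integral_cong_AE)
  show "AE t in M. ip (g t) (g t) = (sn (g t))\<^sup>2"
    using BL_AE_mem[OF assms] by eventually_elim (simp add: sn_sq)
  show "(\<lambda>t. (sn (g t))\<^sup>2) \<in> borel_measurable M"
    using BM_sn_measurable[OF BL_BM[OF assms]] by (rule borel_measurable_power)
qed (use assms in \<open>auto intro: BM_ip_measurable BL_BM\<close>)

lemma bochner_L2_norm_sq: "(bochner_L2_norm M N g)\<^sup>2 = (\<integral>t. (N (g t))\<^sup>2 \<partial>M)"
  by (simp add: bochner_L2_norm_def)

text \<open>Bochner measurability yields pointwise approximation; truncation supplies the dominating
  function that upgrades it to convergence of the squared integrals.\<close>

lemma BL_approx:
  assumes g: "g \<in> BL" and e: "0 < e"
  obtains s where "simple_function M s" "\<And>t. t \<in> space M \<Longrightarrow> s t \<in> S" "s \<in> BL"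
    "(\<integral>t. (sn (g t - s t))\<^sup>2 \<partial>M) < e"
proof -
  obtain s where s: "\<And>n. simple_function M (s n)" "\<And>n t. t \<in> space M \<Longrightarrow> s n t \<in> S"
    "AE t in M. g t \<in> S" "AE t in M. (\<lambda>n::nat. sn (s n t - g t)) \<longlonglongrightarrow> 0"
    by (rule BM_obtain[OF BL_BM[OF g]]) (rule that)
  have [measurable]: "(\<lambda>t. sn (g t)) \<in> borel_measurable M" using BM_sn_measurable BL_BM[OF g] .
  have [measurable]: "(\<lambda>t. sn (s n t)) \<in> borel_measurable M" for n
    by (rule BM_sn_measurable[OF BM_simple]) (use s in auto)
  \<comment> \<open>Where \<open>s n t\<close> is more than twice as large as \<open>g t\<close>,
    the reverse triangle inequality makes its error at least that of the value \<open>0\<close>.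
    Truncation thus never increases the error, which stays below \<open>3 * sn (g t)\<close>; hence
    the factor 9 in the dominating function.\<close>
  define s' where "s' n t = (if sn (s n t) \<le> 2 * sn (g t) then s n t else 0)" for n t
  have s': "simple_function M (s' n)" "\<And>t. t \<in> space M \<Longrightarrow> s' n t \<in> S" for n
  proof -
    have "{t \<in> space M. sn (s n t) \<le> 2 * sn (g t)} \<in> sets M" by measurable
    then show "simple_function M (s' n)"
      unfolding s'_def using s(1) by (intro simple_function_If) auto
  qed (use s in \<open>auto simp: s'_def\<close>)
  have bd: "AE t in M. sn (g t - s' n t) \<le> sn (s n t - g t) \<and> 0 \<le> sn (g t - s' n t)
      \<and> sn (g t - s' n t) \<le> 3 * sn (g t)" for n
    using s(3) AE_space
  proof eventually_elim
    case (elim t)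
    have st: "s n t \<in> S" using elim s(2) by auto
    have *: "sn (g t - s n t) = sn (s n t - g t)" using st elim sn_minus_commute by auto
    then show ?case
      using elim st sn_nonneg[of "g t - s' n t"] s'(2)[of t n] sn_diff_le[of "g t" "s n t"]
        abs_sn_diff_le[of "s n t" "g t"] sn_nonneg[of "g t"] by (auto simp: s'_def)
  qed
  have bd': "AE t in M. \<forall>n. sn (g t - s' n t) \<le> sn (s n t - g t) \<and> 0 \<le> sn (g t - s' n t)"
    unfolding AE_all_countable
  proof
    fix n show "AE t in M. sn (g t - s' n t) \<le> sn (s n t - g t) \<and> 0 \<le> sn (g t - s' n t)"
      using bd[of n] by eventually_elim simp
  qed
  have BMs: "BM (\<lambda>t. g t - s' n t)" for n
    using BM_diff[OF BL_BM[OF g] BM_simple[OF s'(1)], of n] s'(2) by (simp add: fun_diff_def)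
  have "(\<lambda>n. \<integral>t. (sn (g t - s' n t))\<^sup>2 \<partial>M) \<longlonglongrightarrow> (\<integral>t. 0 \<partial>M)"
  proof (rule integral_dominated_convergence[where w = "\<lambda>t. 9 * (sn (g t))\<^sup>2"])
    show "(\<lambda>t. (sn (g t - s' n t))\<^sup>2) \<in> borel_measurable M" for n
      using BM_sn_measurable[OF BMs] by (rule borel_measurable_power)
    show "integrable M (\<lambda>t. 9 * (sn (g t))\<^sup>2)" using BL_integrable[OF g] by simp
    show "AE t in M. (\<lambda>n. (sn (g t - s' n t))\<^sup>2) \<longlonglongrightarrow> 0"
      using s(4) bd'
    proof eventually_elim
      case (elim t)
      have "(\<lambda>n. sn (g t - s' n t)) \<longlonglongrightarrow> 0"
        by (rule Lim_null_comparison[OF _ elim(1)]) (use elim(2) in auto)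
      from tendsto_power[OF this, of 2] show ?case by simp
    qed
    show "AE t in M. norm ((sn (g t - s' n t))\<^sup>2) \<le> 9 * (sn (g t))\<^sup>2" for n
      using bd[of n]
    proof eventually_elim
      case (elim t)
      have "(sn (g t - s' n t))\<^sup>2 \<le> (3 * sn (g t))\<^sup>2" using elim by (intro power_mono) auto
      then show ?case by simp
    qed
  qed simp
  then have "\<forall>\<^sub>F n in sequentially. (\<integral>t. (sn (g t - s' n t))\<^sup>2 \<partial>M) < e"
    using e by (simp add: order_tendstoD)
  then obtain n where n: "(\<integral>t. (sn (g t - s' n t))\<^sup>2 \<partial>M) < e"
    by (meson eventually_happens' sequentially_bot)
  have "integrable M (\<lambda>t. (sn (s' n t))\<^sup>2)"
  proof (rule Bochner_Integration.integrable_bound[where f = "\<lambda>t. 4 * (sn (g t))\<^sup>2"])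
    show "integrable M (\<lambda>t. 4 * (sn (g t))\<^sup>2)" using BL_integrable[OF g] by simp
    show "(\<lambda>t. (sn (s' n t))\<^sup>2) \<in> borel_measurable M"
      by (intro borel_measurable_power BM_sn_measurable BM_simple s')
    show "AE t in M. norm ((sn (s' n t))\<^sup>2) \<le> norm (4 * (sn (g t))\<^sup>2)"
      using s(3) AE_space
    proof eventually_elim
      case (elim t)
      have "sn (s' n t) \<le> 2 * sn (g t)" using elim sn_nonneg[of "g t"] by (auto simp: s'_def)
      then have "(sn (s' n t))\<^sup>2 \<le> (2 * sn (g t))\<^sup>2"
        using sn_nonneg[OF s'(2)] elim by (intro power_mono) auto
      then show ?case by simp
    qed
  qed
  then have "s' n \<in> BL" using BM_simple[OF s'(1)[of n]] s'(2) by (simp add: bochner_L2_def)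
  then show ?thesis using that[of "s' n"] s' n by blast
qed

end

lemma bochner_L2_lipschitz:
  assumes "bochner_space S ip M" "bochner_space S' ip' M"
    and g: "g \<in> bochner_L2 M S (snorm ip)"
    and A: "\<And>x. x \<in> S \<Longrightarrow> A x \<in> S'" "\<And>x. x \<in> S \<Longrightarrow> snorm ip' (A x) \<le> C * snorm ip x"
    and lip: "\<And>x y. x \<in> S \<Longrightarrow> y \<in> S \<Longrightarrow> snorm ip' (A x - A y) \<le> C * snorm ip (x - y)"
  shows "(\<lambda>t. A (g t)) \<in> bochner_L2 M S' (snorm ip')"
proof -
  interpret X: bochner_space S ip M by fact
  interpret Y: bochner_space S' ip' M by fact
  have BM: "Y.BM (\<lambda>t. A (g t))"
    by (rule bochner_measurable_lipschitz[OF X.BL_BM[OF g] A(1), where C = C])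
      (use A lip in \<open>auto intro!: Y.sn_nonneg\<close>)
  have "integrable M (\<lambda>t. (snorm ip' (A (g t)))\<^sup>2)"
  proof (rule Bochner_Integration.integrable_bound)
    show "integrable M (\<lambda>t. C\<^sup>2 * (snorm ip (g t))\<^sup>2)" using X.BL_integrable[OF g] by simp
    show "(\<lambda>t. (snorm ip' (A (g t)))\<^sup>2) \<in> borel_measurable M"
      using Y.BM_sn_measurable[OF BM] by (rule borel_measurable_power)
    show "AE t in M. norm ((snorm ip' (A (g t)))\<^sup>2) \<le> norm (C\<^sup>2 * (snorm ip (g t))\<^sup>2)"
      using X.BL_AE_mem[OF g]
    proof eventually_elim
      case (elim t)
      have "(snorm ip' (A (g t)))\<^sup>2 \<le> (C * snorm ip (g t))\<^sup>2"
        using A elim Y.sn_nonneg by (intro power_mono) auto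
      then show ?case by (simp add: power_mult_distrib)
    qed
  qed
  then show ?thesis using BM by (simp add: bochner_L2_def)
qed

section \<open>Completeness of \<open>L\<^sup>2\<close>\<close>

definition L2_ip :: "'a measure \<Rightarrow> ('a \<Rightarrow> 'b::euclidean_space) \<Rightarrow> ('a \<Rightarrow> 'b) \<Rightarrow> real" where
  "L2_ip M f g = (\<integral>x. f x \<bullet> g x \<partial>M)"

lemma L2_norm_eq_snorm: "L2_norm M = snorm (L2_ip M)"
  by (simp add: fun_eq_iff L2_norm_def snorm_def L2_ip_def power2_norm_eq_inner)

lemma L2_D:
  assumes "f \<in> L2 M"
  shows L2_measurable: "f \<in> borel_measurable M"
    and L2_integrable: "integrable M (\<lambda>x. (norm (f x))\<^sup>2)"
  using assms by (auto simp: L2_def)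

lemma L2_inner_integrable:
  assumes "f \<in> L2 M" "g \<in> L2 M" shows "integrable M (\<lambda>x. f x \<bullet> g x)"
proof (rule Bochner_Integration.integrable_bound)
  show "integrable M (\<lambda>x. ((norm (f x))\<^sup>2 + (norm (g x))\<^sup>2) / 2)"
    using assms[THEN L2_integrable] by auto
  show "(\<lambda>x. f x \<bullet> g x) \<in> borel_measurable M"
    using assms[THEN L2_measurable] by measurable
  have "\<bar>f x \<bullet> g x\<bar> \<le> ((norm (f x))\<^sup>2 + (norm (g x))\<^sup>2) / 2" for x
    using Cauchy_Schwarz_ineq2[of "f x" "g x"] sum_squares_bound[of "norm (f x)" "norm (g x)"] by (simp add: field_simps)
  then show "AE x in M. norm (f x \<bullet> g x) \<le> norm (((norm (f x))\<^sup>2 + (norm (g x))\<^sup>2) / 2)"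
    by simp
qed

lemma norm_add_sq_le: "(norm (a + b))\<^sup>2 \<le> 2 * (norm a)\<^sup>2 + 2 * (norm (b::'b::real_normed_vector))\<^sup>2"
proof -
  have "(norm (a + b))\<^sup>2 \<le> (norm a + norm b)\<^sup>2" by (intro power_mono norm_triangle_ineq) simp
  then show ?thesis using sum_squares_bound[of "norm a" "norm b"] by (simp add: power2_sum)
qed

lemma subspace_L2: "subspace (L2 M)"
proof (rule subspaceI)
  show "0 \<in> L2 M" by (simp add: L2_def zero_fun_def)
next
  fix f g :: "'a \<Rightarrow> 'b" assume fg: "f \<in> L2 M" "g \<in> L2 M"
  note [measurable] = fg[THEN L2_measurable]
  have "integrable M (\<lambda>x. (norm (f x + g x))\<^sup>2)"
  proof (rule Bochner_Integration.integrable_bound)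
    show "integrable M (\<lambda>x. 2 * (norm (f x))\<^sup>2 + 2 * (norm (g x))\<^sup>2)"
      using fg[THEN L2_integrable] by auto
    show "AE x in M. norm ((norm (f x + g x))\<^sup>2) \<le> norm (2 * (norm (f x))\<^sup>2 + 2 * (norm (g x))\<^sup>2)"
      using norm_add_sq_le by auto
  qed measurable
  then show "f + g \<in> L2 M" by (simp add: L2_def plus_fun_def)
next
  fix c :: real and f :: "'a \<Rightarrow> 'b" assume "f \<in> L2 M"
  note L2_D[OF this, measurable]
  then show "c *\<^sub>R f \<in> L2 M" by (simp add: L2_def scaleR_fun_def power_mult_distrib)
qed

lemma semi_inner_L2: "semi_inner (L2 M) (L2_ip M)"
proof
  fix x y z :: "'a \<Rightarrow> 'b" assume "x \<in> L2 M" "y \<in> L2 M" "z \<in> L2 M"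
  then show "L2_ip M (x + y) z = L2_ip M x z + L2_ip M y z"
    by (simp add: L2_ip_def inner_add_left L2_inner_integrable)
next
  fix x y :: "'a \<Rightarrow> 'b" show "L2_ip M x y = L2_ip M y x"
    by (simp add: L2_ip_def inner_commute)
qed (simp_all add: subspace_L2 L2_ip_def scaleR_fun_def)

text \<open>Squared increments weighted by \<open>2^k\<close> have integrals at most
  \<open>(1/2)^k\<close>, so their sum is finite almost everywhere. By the inequality of arithmetic
  and geometric means an increment is at most \<open>(1/2)^k\<close> plus its weighted square, and
  the series of increments converges absolutely.\<close>

lemma L2_Cauchy_subseq_AE:
  fixes X :: "nat \<Rightarrow> 'a \<Rightarrow> 'b::euclidean_space"
  assumes X: "\<And>n. X n \<in> L2 M"
    and small: "\<And>k. (\<integral>x. (norm (X (Suc k) x - X k x))\<^sup>2 \<partial>M) \<le> (1/4)^k"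
  shows "AE x in M. convergent (\<lambda>k. X k x)"
proof -
  interpret semi_inner "L2 M" "L2_ip M" by (rule semi_inner_L2)
  note [measurable] = X[THEN L2_measurable]
  define a where "a k x = 2^k * (norm (X (Suc k) x - X k x))\<^sup>2" for k x
  have [measurable]: "a k \<in> borel_measurable M" for k unfolding a_def by measurable
  have i: "integrable M (a k)" for k
    using L2_integrable[OF S_diff[OF X X], of "Suc k" k] by (simp add: a_def[abs_def])
  have "(\<integral>\<^sup>+x. (\<Sum>k. ennreal (a k x)) \<partial>M) = (\<Sum>k. \<integral>\<^sup>+x. ennreal (a k x) \<partial>M)"
    by (intro nn_integral_suminf) measurable
  also have "\<dots> \<le> (\<Sum>k. ennreal ((1/2)^k))"
  proof (intro suminf_le summableI)
    fix k
    have "(\<integral>\<^sup>+x. ennreal (a k x) \<partial>M) = ennreal (\<integral>x. a k x \<partial>M)"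
      by (intro nn_integral_eq_integral i) (simp add: a_def)
    also have "(\<integral>x. a k x \<partial>M) \<le> 2^k * (1/4)^k"
      unfolding a_def using small[of k] by simp
    also have "2^k * (1/4)^k = (1/2::real)^k" by (simp flip: power_mult_distrib)
    finally show "(\<integral>\<^sup>+x. ennreal (a k x) \<partial>M) \<le> ennreal ((1/2)^k)" by (simp add: ennreal_leI)
  qed
  also have "\<dots> = ennreal (\<Sum>k. (1/2)^k)" by (intro suminf_ennreal2) auto
  also have "\<dots> < \<infinity>" by simp
  finally have "AE x in M. (\<Sum>k. ennreal (a k x)) \<noteq> \<infinity>"
    by (intro nn_integral_noteq_infinite) auto
  then show ?thesis
  proof eventually_elim
    case (elim x)
    then have sa: "summable (\<lambda>k. a k x)"
      by (intro summable_suminf_not_top) (auto simp: a_def)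
    have "norm (X (Suc k) x - X k x) \<le> (1/2)^k + a k x" for k
    proof -
      let ?d = "norm (X (Suc k) x - X k x)"
      have "0 \<le> (1 / 2^k) * (2^k * ?d - 1)\<^sup>2" by simp
      also have "\<dots> = a k x - 2 * ?d + (1/2)^k"
        by (simp add: a_def power2_eq_square field_simps power_one_over)
      finally show ?thesis by (simp add: a_def) (smt (verit) zero_le_power norm_ge_zero)
    qed
    note d = this
    have "summable (\<lambda>k. (1/2)^k + a k x)" by (intro summable_add sa summable_geometric) simp
    then have "summable (\<lambda>k. X (Suc k) x - X k x)"
      by (rule summable_comparison_test'[where N = 0]) (rule d)
    then obtain l where "(\<lambda>n. \<Sum>k<n. X (Suc k) x - X k x) \<longlonglongrightarrow> l"
      unfolding summable_def sums_def by blast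
    then have "(\<lambda>n. X n x - X 0 x) \<longlonglongrightarrow> l" unfolding sum_lessThan_telescope[of "\<lambda>k. X k x"] .
    from tendsto_add[OF this tendsto_const[of "X 0 x"]] show ?case
      unfolding diff_add_cancel by (rule convergentI)
  qed
qed

text \<open>Riesz-Fischer: a fast subsequence converges almost everywhere, and Fatou's lemma along
  it bounds the distance of the limit to every late member of the whole sequence.\<close>

lemma semi_hilbert_L2: "semi_hilbert (L2 M) (L2_ip M :: ('a \<Rightarrow> 'b::euclidean_space) \<Rightarrow> _)"
proof -
  interpret semi_inner "L2 M" "L2_ip M :: ('a \<Rightarrow> 'b) \<Rightarrow> _" by (rule semi_inner_L2)
  show ?thesis
  proof
    fix X :: "nat \<Rightarrow> 'a \<Rightarrow> 'b"
    assume "\<forall>n. X n \<in> L2 M" and C: "\<forall>e>0. \<exists>N. \<forall>m\<ge>N. \<forall>n\<ge>N. sn (X m - X n) < e"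
    then have X: "X n \<in> L2 M" for n by simp
    note [measurable] = X[THEN L2_measurable]
    have "\<forall>k. \<exists>N. \<forall>m\<ge>N. \<forall>n\<ge>N. sn (X m - X n) < (1/2)^k" using C by simp
    then obtain N where N: "\<And>k m n. m \<ge> N k \<Longrightarrow> n \<ge> N k \<Longrightarrow> sn (X m - X n) < (1/2)^k" by metis
    \<comment> \<open>Partial sums make the indices monotone while staying above
      \<open>N k\<close>.\<close>
    define r where "r k = (\<Sum>j\<le>k. N j)" for k
    have r: "N k \<le> r k" "r k \<le> r (Suc k)" for k
      using member_le_sum[of k "{..k}" N] by (auto simp: r_def)
    have sq: "(\<integral>x. (norm (X m x - X n x))\<^sup>2 \<partial>M) = (sn (X m - X n))\<^sup>2" for m n
      using X by (simp add: sn_sq) (simp add: L2_ip_def power2_norm_eq_inner)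
    have "AE x in M. convergent (\<lambda>k. X (r k) x)"
    proof (rule L2_Cauchy_subseq_AE)
      fix k
      have "sn (X (r (Suc k)) - X (r k)) \<le> (1/2)^k"
        using N[of k "r (Suc k)" "r k"] r[of k] by simp
      then have "(sn (X (r (Suc k)) - X (r k)))\<^sup>2 \<le> ((1/2)^k)\<^sup>2"
        using X by (intro power_mono sn_nonneg) auto
      also have "((1/2)^k)\<^sup>2 = (1/4::real)^k"
        by (simp add: power2_eq_square flip: power_mult_distrib)
      finally show "(\<integral>x. (norm (X (r (Suc k)) x - X (r k) x))\<^sup>2 \<partial>M) \<le> (1/4)^k"
        by (simp add: sq)
    qed (rule X)
    define f where "f x = lim (\<lambda>k. X (r k) x)" for x
    have [measurable]: "f \<in> borel_measurable M" unfolding f_def by measurable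
    have f: "AE x in M. (\<lambda>k. X (r k) x) \<longlonglongrightarrow> f x"
      using \<open>AE x in M. convergent _\<close> by eventually_elim (simp add: f_def convergent_LIMSEQ_iff)
    have est: "f - X n \<in> L2 M \<and> (sn (X n - f))\<^sup>2 \<le> ((1/2)^k)\<^sup>2" if "n \<ge> N k" for n k
    proof -
      have "(\<integral>\<^sup>+x. ennreal ((norm (f x - X n x))\<^sup>2) \<partial>M)
          = (\<integral>\<^sup>+x. liminf (\<lambda>j. ennreal ((norm (X (r j) x - X n x))\<^sup>2)) \<partial>M)"
      proof (rule nn_integral_cong_AE, use f in eventually_elim)
        case (elim x)
        then have "(\<lambda>j. ennreal ((norm (X (r j) x - X n x))\<^sup>2)) \<longlonglongrightarrow> ennreal ((norm (f x - X n x))\<^sup>2)"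
          by (intro tendsto_intros)
        then show ?case by (rule lim_imp_Liminf[OF trivial_limit_sequentially, symmetric])
      qed
      also have "\<dots> \<le> liminf (\<lambda>j. \<integral>\<^sup>+x. ennreal ((norm (X (r j) x - X n x))\<^sup>2) \<partial>M)"
        by (rule nn_integral_liminf) measurable
      also have "\<dots> \<le> ennreal (((1/2)^k)\<^sup>2)"
      proof (rule order_trans[OF Liminf_le_Limsup Limsup_bounded])
        have "(\<integral>\<^sup>+x. ennreal ((norm (X (r j) x - X n x))\<^sup>2) \<partial>M) \<le> ennreal (((1/2)^k)\<^sup>2)"
          if "j \<ge> k" for j
        proof -
          have "N k \<le> r j" using r(1)[of k] lift_Suc_mono_le[of r k j] r(2) that by (meson le_trans)
          then have "(sn (X (r j) - X n))\<^sup>2 \<le> ((1/2)^k)\<^sup>2"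
            using X N[of k "r j" n] \<open>n \<ge> N k\<close> by (intro power_mono sn_nonneg) (auto intro: less_imp_le)
          moreover have "integrable M (\<lambda>x. (norm (X (r j) x - X n x))\<^sup>2)"
            using L2_integrable[OF S_diff[OF X X], of "r j" n] by simp
          ultimately show ?thesis
            by (subst nn_integral_eq_integral) (auto simp: sq intro: ennreal_leI)
        qed
        then show "\<forall>\<^sub>F j in sequentially.
            (\<integral>\<^sup>+x. ennreal ((norm (X (r j) x - X n x))\<^sup>2) \<partial>M) \<le> ennreal (((1/2)^k)\<^sup>2)"
          by (rule eventually_sequentiallyI)
      qed simp
      finally have le: "(\<integral>\<^sup>+x. ennreal ((norm (f x - X n x))\<^sup>2) \<partial>M) \<le> ennreal (((1/2)^k)\<^sup>2)" .
      also have "\<dots> < \<infinity>" by simp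
      finally have int: "integrable M (\<lambda>x. (norm (f x - X n x))\<^sup>2)"
        by (intro integrableI_bounded) auto
      then have mem: "f - X n \<in> L2 M" by (simp add: L2_def fun_diff_def)
      have "(\<integral>x. (norm (f x - X n x))\<^sup>2 \<partial>M) \<le> ((1/2)^k)\<^sup>2"
        using le int by (subst (asm) nn_integral_eq_integral) (auto simp: ennreal_le_iff)
      moreover have "(sn (X n - f))\<^sup>2 = (\<integral>x. (norm (f x - X n x))\<^sup>2 \<partial>M)"
        by (simp add: snorm_def L2_ip_def power2_norm_eq_inner)
          (simp add: norm_minus_commute flip: power2_norm_eq_inner)
      ultimately show ?thesis using mem by simp
    qed
    have f_mem: "f \<in> L2 M"
      using S_add[OF conjunct1[OF est[OF order_refl]] X, of 0 "N 0"] by (simp only: diff_add_cancel)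
    have "(\<lambda>n. sn (X n - f)) \<longlonglongrightarrow> 0"
    proof (rule LIMSEQ_I)
      fix e :: real assume "0 < e"
      then obtain k where k: "(1/2::real)^k < e" using real_arch_pow_inv[of e "1/2"] by auto
      have "norm (sn (X n - f) - 0) < e" if "n \<ge> N k" for n
      proof -
        have "sn (X n - f) \<le> (1/2)^k"
          using est[OF that] by (intro power2_le_imp_le[of "sn (X n - f)"]) auto
        then show ?thesis using k sn_nonneg[of "X n - f"] X f_mem by simp
      qed
      then show "\<exists>no. \<forall>n\<ge>no. norm (sn (X n - f) - 0) < e" by blast
    qed
    then show "\<exists>x\<in>L2 M. (\<lambda>n. sn (X n - x)) \<longlonglongrightarrow> 0" using f_mem by blast
  qed
qed

section \<open>Smooth bump functions\<close>

text \<open>The extension by zero of \<open>p (1/x) * exp (-1/x)\<close>. A polynomial parameter is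
  carried along because this class, unlike the single function with \<open>p = 1\<close>, is closed
  under differentiation.\<close>

definition flat_exp :: "real poly \<Rightarrow> real \<Rightarrow> real" where
  "flat_exp p x = (if x \<le> 0 then 0 else poly p (1 / x) * exp (- 1 / x))"

lemma tendsto_poly_times_exp_minus: "((\<lambda>y::real. poly p y * exp (- y)) \<longlongrightarrow> 0) at_top"
proof -
  have "((\<lambda>y::real. \<Sum>i\<le>degree p. coeff p i * (y ^ i / exp y)) \<longlongrightarrow> (\<Sum>i\<le>degree p. coeff p i * 0)) at_top"
    by (intro tendsto_intros tendsto_power_div_exp_0)
  moreover have "(\<lambda>y::real. poly p y * exp (- y)) = (\<lambda>y. \<Sum>i\<le>degree p. coeff p i * (y ^ i / exp y))"
    by (simp add: fun_eq_iff poly_altdef sum_distrib_right exp_minus divide_inverse mult.assoc)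
  ultimately show ?thesis by simp
qed

lemma flat_exp_tendsto_0: "(flat_exp p \<longlongrightarrow> 0) (at_right 0)"
proof -
  have "((\<lambda>x::real. poly p (inverse x) * exp (- inverse x)) \<longlongrightarrow> 0) (at_right 0)"
    by (rule filterlim_compose[OF tendsto_poly_times_exp_minus filterlim_inverse_at_top_right])
  then show ?thesis
    by (rule Lim_transform_eventually)
      (auto simp: eventually_at_right_field flat_exp_def divide_inverse intro!: exI[of _ 1])
qed

text \<open>In the variable \<open>y = 1/x\<close>, differentiation maps \<open>p(y) exp(-y)\<close>
  to \<open>y\<^sup>2 (p - p')(y) exp(-y)\<close>, whence the polynomial. At 0 the right-hand
  quotient \<open>flat_exp p h / h\<close> is again of this form, with \<open>p\<close> multiplied
  by \<open>y\<close>, and tends to 0.\<close>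

lemma flat_exp_has_derivative:
  "(flat_exp p has_real_derivative flat_exp ([:0, 0, 1:] * (p - pderiv p)) x) (at x)"
proof -
  consider "x < 0" | "x > 0" | "x = 0" by linarith
  then show ?thesis
  proof cases
    case 1
    have "((\<lambda>_. 0) has_real_derivative 0) (at x)" by simp
    then have "(flat_exp p has_real_derivative 0) (at x)"
      by (rule has_field_derivative_transform_within_open[where S = "{..<0}"])
        (use 1 in \<open>auto simp: flat_exp_def\<close>)
    then show ?thesis using 1 by (simp add: flat_exp_def)
  next
    case 2
    have "((\<lambda>x. poly p (1 / x) * exp (- 1 / x)) has_real_derivative
        (poly (pderiv p) (1 / x) * (- 1 / x\<^sup>2)) * exp (- 1 / x)
        + poly p (1 / x) * (exp (- 1 / x) * (1 / x\<^sup>2))) (at x)"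
      using 2 by (auto intro!: derivative_eq_intros DERIV_chain2[OF poly_DERIV]
          simp: power2_eq_square)
    then have "(flat_exp p has_real_derivative
        (poly (pderiv p) (1 / x) * (- 1 / x\<^sup>2)) * exp (- 1 / x)
        + poly p (1 / x) * (exp (- 1 / x) * (1 / x\<^sup>2))) (at x)"
      by (rule has_field_derivative_transform_within_open[where S = "{0<..}"])
        (use 2 in \<open>auto simp: flat_exp_def\<close>)
    moreover have "(poly (pderiv p) (1 / x) * (- 1 / x\<^sup>2)) * exp (- 1 / x)
        + poly p (1 / x) * (exp (- 1 / x) * (1 / x\<^sup>2)) = flat_exp ([:0, 0, 1:] * (p - pderiv p)) x"
      using 2 by (simp add: flat_exp_def power2_eq_square field_simps)
    ultimately show ?thesis by simp
  next
    case 3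
    have "((\<lambda>h. flat_exp p h / h) \<longlongrightarrow> 0) (at 0)"
      unfolding filterlim_at_split
    proof
      have "\<forall>\<^sub>F h in at_left 0. 0 = flat_exp p h / h"
        by (auto simp: eventually_at_left_field flat_exp_def intro!: exI[of _ "-1"])
      then show "((\<lambda>h. flat_exp p h / h) \<longlongrightarrow> 0) (at_left 0)"
        by (rule Lim_transform_eventually[OF tendsto_const])
      have "\<forall>\<^sub>F h in at_right 0. flat_exp (pCons 0 p) h = flat_exp p h / h"
        by (auto simp: eventually_at_right_field flat_exp_def intro!: exI[of _ 1])
      then show "((\<lambda>h. flat_exp p h / h) \<longlongrightarrow> 0) (at_right 0)"
        by (rule Lim_transform_eventually[OF flat_exp_tendsto_0])
    qed
    then show ?thesis
      using 3 by (simp add: DERIV_def flat_exp_def)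
  qed
qed

text \<open>Instead of computing iterated derivatives of a bump, a class is used that contains the
  bumps and is closed under directional derivatives; membership in \<open>C_k\<close> for every
  \<open>k\<close> is then one induction.\<close>

inductive smooth_expr :: "('a::euclidean_space \<Rightarrow> real) \<Rightarrow> bool" where
  const: "smooth_expr (\<lambda>_. c)"
| coord: "smooth_expr (\<lambda>x. x \<bullet> b)"
| add: "smooth_expr f \<Longrightarrow> smooth_expr g \<Longrightarrow> smooth_expr (\<lambda>x. f x + g x)"
| mult: "smooth_expr f \<Longrightarrow> smooth_expr g \<Longrightarrow> smooth_expr (\<lambda>x. f x * g x)"
| flat: "smooth_expr f \<Longrightarrow> smooth_expr (\<lambda>x. flat_exp p (f x))"

lemma smooth_expr_derivative:
  assumes "smooth_expr f"
  shows "\<exists>f'. (\<forall>x. (f has_derivative f' x) (at x)) \<and> (\<forall>b. smooth_expr (\<lambda>x. f' x b))"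
  using assms
proof induction
  case (const c)
  show ?case by (rule exI[of _ "\<lambda>_ _. 0"]) (auto intro: smooth_expr.intros)
next
  case (coord b)
  show ?case
    by (rule exI[of _ "\<lambda>_ h. h \<bullet> b"]) (auto intro!: smooth_expr.intros derivative_eq_intros)
next
  case (add f g)
  then obtain f' g' where "\<And>x. (f has_derivative f' x) (at x)" "\<And>b. smooth_expr (\<lambda>x. f' x b)"
    "\<And>x. (g has_derivative g' x) (at x)" "\<And>b. smooth_expr (\<lambda>x. g' x b)" by metis
  then show ?case
    by (intro exI[of _ "\<lambda>x h. f' x h + g' x h"]) (auto intro: smooth_expr.intros has_derivative_add)
next
  case (mult f g)
  then obtain f' g' where "\<And>x. (f has_derivative f' x) (at x)" "\<And>b. smooth_expr (\<lambda>x. f' x b)"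
    "\<And>x. (g has_derivative g' x) (at x)" "\<And>b. smooth_expr (\<lambda>x. g' x b)" by metis
  note d = this
  have "smooth_expr (\<lambda>x. f x * g' x b + f' x b * g x)" for b
    by (rule smooth_expr.add) (rule smooth_expr.mult mult.hyps d)+
  then show ?case
    using has_derivative_mult[OF d(1) d(3)]
    by (intro exI[of _ "\<lambda>x h. f x * g' x h + f' x h * g x"]) simp
next
  case (flat f p)
  then obtain f' where f': "\<And>x. (f has_derivative f' x) (at x)" "\<And>b. smooth_expr (\<lambda>x. f' x b)"
    by blast
  let ?q = "[:0, 0, 1:] * (p - pderiv p)"
  have "((\<lambda>x. flat_exp p (f x)) has_derivative (\<lambda>h. flat_exp ?q (f x) * f' x h)) (at x)" for x
    by (rule has_derivative_compose[OF f'(1)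
        flat_exp_has_derivative[unfolded has_field_derivative_def]])
  moreover have "smooth_expr (\<lambda>x. flat_exp ?q (f x) * f' x b)" for b
    by (rule smooth_expr.mult[OF smooth_expr.flat[OF flat.hyps] f'(2)])
  ultimately show ?case
    by (intro exI[of _ "\<lambda>x h. flat_exp ?q (f x) * f' x h"] conjI allI)
qed

lemma smooth_expr_C_k: "smooth_expr f \<Longrightarrow> C_k k f"
proof (induction k arbitrary: f)
  case 0
  then show ?case
    using smooth_expr_derivative[OF 0] has_derivative_continuous
    by (fastforce simp: continuous_on_eq_continuous_within)
next
  case (Suc k)
  obtain f' where f': "\<And>x. (f has_derivative f' x) (at x)" "\<And>b. smooth_expr (\<lambda>x. f' x b)"
    using smooth_expr_derivative[OF Suc.prems] by metis
  have "frechet_derivative f (at x) = f' x" for x using f'(1) frechet_derivative_at by metis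
  then show ?case using f' Suc.IH by (auto simp: differentiable_def)
qed

lemma smooth_expr_sum: "finite A \<Longrightarrow> (\<And>i. i \<in> A \<Longrightarrow> smooth_expr (f i)) \<Longrightarrow> smooth_expr (\<lambda>x. \<Sum>i\<in>A. f i x)"
  by (induction A rule: finite_induct) (auto intro: smooth_expr.intros)

lemma smooth_expr_prod: "finite A \<Longrightarrow> (\<And>i. i \<in> A \<Longrightarrow> smooth_expr (f i)) \<Longrightarrow> smooth_expr (\<lambda>x. \<Prod>i\<in>A. f i x)"
  by (induction A rule: finite_induct) (auto intro: smooth_expr.intros)

text \<open>The factor \<open>n\<close> steepens the profile: inside the ball the values tend to 1
  as \<open>n\<close> grows, while the function stays smooth and vanishes outside.\<close>

definition bump :: "'a::euclidean_space \<Rightarrow> real \<Rightarrow> real \<Rightarrow> 'a \<Rightarrow> real" where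
  "bump a r n x = flat_exp 1 (n * (r\<^sup>2 - (norm (x - a))\<^sup>2))"

lemma smooth_expr_bump: "smooth_expr (bump a r n)"
proof -
  have "bump a r n = (\<lambda>x. flat_exp 1 (n * (r\<^sup>2 + (- 1) * (\<Sum>b\<in>Basis. (x \<bullet> b + - (a \<bullet> b)) * (x \<bullet> b + - (a \<bullet> b))))))"
  proof
    fix x
    have "(norm (x - a))\<^sup>2 = (\<Sum>b\<in>Basis. ((x - a) \<bullet> b) * ((x - a) \<bullet> b))"
      unfolding power2_norm_eq_inner by (rule euclidean_inner)
    then show "bump a r n x = flat_exp 1 (n * (r\<^sup>2 + (- 1) * (\<Sum>b\<in>Basis. (x \<bullet> b + - (a \<bullet> b)) * (x \<bullet> b + - (a \<bullet> b)))))"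
      by (simp add: bump_def inner_diff_left)
  qed
  then show ?thesis by (simp only:) (intro smooth_expr.intros smooth_expr_sum finite_Basis)
qed

lemma bump_bounds: "0 \<le> bump a r n x" "bump a r n x \<le> 1"
  by (auto simp: bump_def flat_exp_def)

lemma bump_eq_0: "0 \<le> n \<Longrightarrow> 0 \<le> r \<Longrightarrow> x \<notin> ball a r \<Longrightarrow> bump a r n x = 0"
proof -
  assume "0 \<le> n" "0 \<le> r" "x \<notin> ball a r"
  then have "r\<^sup>2 \<le> (norm (x - a))\<^sup>2" by (intro power_mono) (auto simp: dist_norm norm_minus_commute)
  then show ?thesis using \<open>0 \<le> n\<close> by (simp add: bump_def flat_exp_def mult_nonneg_nonpos)
qed

lemma bump_pos: "0 < n \<Longrightarrow> x \<in> ball a r \<Longrightarrow> 0 < bump a r n x"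
  by (simp add: bump_def flat_exp_def dist_norm norm_minus_commute not_le power_strict_mono)

lemma bump_tendsto_1: assumes "x \<in> ball a r" shows "(\<lambda>n. bump a r (real n) x) \<longlonglongrightarrow> 1"
proof -
  define c where "c = r\<^sup>2 - (norm (x - a))\<^sup>2"
  have "0 < c" using assms by (simp add: c_def dist_norm norm_minus_commute power_strict_mono)
  have "(\<lambda>n. exp (- (1 / c) * (1 / real n))) \<longlonglongrightarrow> exp (- (1 / c) * 0)"
    by (intro tendsto_intros lim_1_over_n)
  then have "(\<lambda>n. exp (- (1 / c) * (1 / real n))) \<longlonglongrightarrow> 1" by simp
  moreover have "\<forall>\<^sub>F n in sequentially. exp (- (1 / c) * (1 / real n)) = bump a r (real n) x"
    using eventually_gt_at_top[of 0]
    by eventually_elim (use \<open>0 < c\<close> in \<open>simp add: bump_def flat_exp_def not_le field_simps flip: c_def\<close>)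
  ultimately show ?thesis by (rule Lim_transform_eventually)
qed

section \<open>The fundamental lemma of the calculus of variations\<close>

lemma test_functions_smooth_expr:
  "smooth_expr f \<Longrightarrow> compact K \<Longrightarrow> K \<subseteq> \<Omega> \<Longrightarrow> (\<And>x. x \<notin> K \<Longrightarrow> f x = 0) \<Longrightarrow> f \<in> test_functions \<Omega>"
  unfolding test_functions_def using smooth_expr_C_k by blast

text \<open>A countable family of balls exhausts \<open>U\<close>; stage \<open>n\<close> uses the
  first \<open>n\<close> of them with steepness \<open>n\<close>. The support lies in finitely many
  closed balls contained in \<open>U\<close> and is compact.\<close>

lemma open_test_approx:
  fixes U :: "'a::euclidean_space set"
  assumes "open U"
  obtains \<psi> where "\<And>n::nat. \<psi> n \<in> test_functions U" "\<And>n. smooth_expr (\<psi> n)"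
    "\<And>n x. 0 \<le> \<psi> n x \<and> \<psi> n x \<le> 1" "\<And>n x. x \<notin> U \<Longrightarrow> \<psi> n x = 0"
    "\<And>x. x \<in> U \<Longrightarrow> (\<lambda>n. \<psi> n x) \<longlonglongrightarrow> 1"
proof (cases "U = {}")
  case True
  have "(\<lambda>_. 0::real) \<in> test_functions U"
    by (rule test_functions_smooth_expr[OF smooth_expr.const, where K = "{}"]) auto
  then show ?thesis using True by (intro that[of "\<lambda>_ _. 0"]) (auto intro: smooth_expr.const)
next
  case False
  let ?F = "{ball a r | a r. 0 < r \<and> cball a r \<subseteq> U}"
  obtain F' where F': "F' \<subseteq> ?F" "countable F'" "\<Union>F' = \<Union>?F"
    using Lindelof[of ?F] by auto
  have "\<Union>?F = U"
  proof
    show "\<Union>?F \<subseteq> U" using ball_subset_cball by blast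
    show "U \<subseteq> \<Union>?F"
    proof
      fix x assume "x \<in> U"
      then obtain r where "0 < r" "cball x r \<subseteq> U" using \<open>open U\<close> open_contains_cball by blast
      then show "x \<in> \<Union>?F" by (intro UnionI[of "ball x r"]) auto
    qed
  qed
  then have UF: "\<Union>F' = U" using F' by simp
  then have "F' \<noteq> {}" using False by auto
  then have rng: "range (from_nat_into F') = F'" using F'(2) by (rule range_from_nat_into)
  then have "\<forall>k. \<exists>a r. from_nat_into F' k = ball a r \<and> 0 < r \<and> cball a r \<subseteq> U"
    using F'(1) by blast
  then obtain a r where ar: "\<And>k. from_nat_into F' k = ball (a k) (r k)" "\<And>k. 0 < r k"
    "\<And>k. cball (a k) (r k) \<subseteq> U" by metis
  \<comment> \<open>A smooth substitute for the maximum of the bumps: it stays between 0 and 1 and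
    dominates each of them. It is written with sums and products only, to match the rules of
    \<open>smooth_expr\<close>.\<close>
  define \<psi> where "\<psi> n x = 1 + (- 1) * (\<Prod>k<n. 1 + (- 1) * bump (a k) (r k) (real n) x)" for n :: nat and x
  have P: "0 \<le> (\<Prod>k<n. 1 + (- 1) * bump (a k) (r k) (real n) x)"
    "(\<Prod>k<n. 1 + (- 1) * bump (a k) (r k) (real n) x) \<le> 1" for n x
    using bump_bounds by (auto intro!: prod_nonneg prod_le_1)
  have sm: "smooth_expr (\<psi> n)" for n
    unfolding \<psi>_def by (intro smooth_expr.intros smooth_expr_prod smooth_expr_bump finite_lessThan)
  have zero: "\<psi> n x = 0" if "x \<notin> (\<Union>k<n. cball (a k) (r k))" for n x
  proof -
    have "bump (a k) (r k) (real n) x = 0" if "k < n" for k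
    proof (rule bump_eq_0)
      have "x \<notin> cball (a k) (r k)" using that \<open>x \<notin> _\<close> by blast
      then show "x \<notin> ball (a k) (r k)" by auto
    qed (use ar(2)[of k] in auto)
    then show ?thesis by (simp add: \<psi>_def)
  qed
  show ?thesis
  proof
    show "\<psi> n \<in> test_functions U" for n
    proof (rule test_functions_smooth_expr[OF sm])
      show "compact (\<Union>k<n. cball (a k) (r k))" by (intro compact_UN) auto
      show "(\<Union>k<n. cball (a k) (r k)) \<subseteq> U" using ar(3) by blast
    qed (rule zero)
    show "smooth_expr (\<psi> n)" for n by (rule sm)
    show "0 \<le> \<psi> n x \<and> \<psi> n x \<le> 1" for n x using P[of n x] by (auto simp: \<psi>_def)
    show "\<psi> n x = 0" if "x \<notin> U" for n x using zero ar(3) that by blast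
    fix x assume "x \<in> U"
    then obtain k where k: "x \<in> ball (a k) (r k)" using UF rng ar(1) by (metis UnionE rangeE)
    have "\<forall>\<^sub>F n in sequentially. bump (a k) (r k) (real n) x \<le> \<psi> n x"
      using eventually_gt_at_top[of k]
    proof eventually_elim
      case (elim n)
      let ?b = "\<lambda>k. bump (a k) (r k) (real n) x"
      have "(\<Prod>k<n. 1 + (- 1) * ?b k) = (1 - ?b k) * (\<Prod>k\<in>{..<n} - {k}. 1 + (- 1) * ?b k)"
        using elim by (subst prod.remove[of _ k]) auto
      also have "\<dots> \<le> (1 - ?b k) * 1"
        using bump_bounds by (intro mult_left_mono prod_le_1) auto
      finally show ?case by (simp add: \<psi>_def)
    qed
    then show "(\<lambda>n. \<psi> n x) \<longlonglongrightarrow> 1"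
      by (rule tendsto_sandwich[OF _ _ bump_tendsto_1[OF k] tendsto_const])
        (use P in \<open>auto simp: \<psi>_def\<close>)
  qed
qed

text \<open>Integrals of \<open>h\<close> vanish over open subsets by approximation of indicators,
  over measurable subsets by outer regularity, and in particular over the sets where
  \<open>h\<close> is positive or negative.\<close>

lemma fundamental_lemma:
  fixes h :: "'a::euclidean_space \<Rightarrow> real"
  assumes \<Omega>: "open \<Omega>" and h: "integrable (lebesgue_on \<Omega>) h"
    and test: "\<And>\<phi>. \<phi> \<in> test_functions \<Omega> \<Longrightarrow> smooth_expr \<phi> \<Longrightarrow> (\<integral>x. h x * \<phi> x \<partial>lebesgue_on \<Omega>) = 0"
  shows "AE x in lebesgue_on \<Omega>. h x = 0"
proof -
  let ?M = "lebesgue_on \<Omega>"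
  have \<Omega>s: "\<Omega> \<in> sets lebesgue" using \<Omega> by (simp add: borel_open)
  note [measurable] = borel_measurable_integrable[OF h]
  have op: "(\<integral>x. h x * indicator U x \<partial>?M) = 0" if U: "open U" "U \<subseteq> \<Omega>" for U
  proof -
    obtain \<psi> where \<psi>: "\<And>n::nat. \<psi> n \<in> test_functions U" "\<And>n. smooth_expr (\<psi> n)"
      "\<And>n x. 0 \<le> \<psi> n x \<and> \<psi> n x \<le> 1" "\<And>n x. x \<notin> U \<Longrightarrow> \<psi> n x = 0"
      "\<And>x. x \<in> U \<Longrightarrow> (\<lambda>n. \<psi> n x) \<longlonglongrightarrow> 1"
      using open_test_approx[OF U(1)] by metis
    have [measurable]: "\<psi> n \<in> borel_measurable ?M" for n
      using smooth_expr_C_k[OF \<psi>(2), of 0 n]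
      by (intro measurable_restrict_space1 measurable_completion) (simp add: borel_measurable_continuous_onI)
    have [measurable]: "U \<in> sets ?M" using U \<Omega> by (auto simp: sets_restrict_space borel_open)
    have "\<psi> n \<in> test_functions \<Omega>" for n using \<psi>(1)[of n] U(2) by (auto simp: test_functions_def)
    then have z: "(\<integral>x. h x * \<psi> n x \<partial>?M) = 0" for n using test \<psi>(2) by blast
    have "(\<lambda>n. \<integral>x. h x * \<psi> n x \<partial>?M) \<longlonglongrightarrow> (\<integral>x. h x * indicator U x \<partial>?M)"
    proof (rule integral_dominated_convergence[where w = "\<lambda>x. norm (h x)"])
      show "(\<lambda>x. h x * indicator U x) \<in> borel_measurable ?M" by measurable
      show "(\<lambda>x. h x * \<psi> n x) \<in> borel_measurable ?M" for n by measurable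
      show "AE x in ?M. (\<lambda>n. h x * \<psi> n x) \<longlonglongrightarrow> h x * indicator U x"
      proof (rule AE_I2)
        fix x show "(\<lambda>n. h x * \<psi> n x) \<longlonglongrightarrow> h x * indicator U x"
          using tendsto_mult_left[OF \<psi>(5), of x "h x"] \<psi>(4)[of x] by (cases "x \<in> U") auto
      qed
      have "norm (h x * \<psi> n x) \<le> norm (h x)" for n x
        using \<psi>(3)[of n x] by (simp add: abs_mult mult_left_le)
      then show "AE x in ?M. norm (h x * \<psi> n x) \<le> norm (h x)" for n by simp
    qed (use h in simp)
    then show ?thesis using z by (simp add: LIMSEQ_const_iff)
  qed
  have set0: "(\<integral>x. h x * indicator A x \<partial>?M) = 0" if A: "A \<in> sets ?M" for A
  proof -
    have Al: "A \<in> sets lebesgue" "A \<subseteq> \<Omega>"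
      using A \<Omega>s by (auto simp: sets_restrict_space_iff sets_restrict_space)
    have "\<exists>T. open T \<and> A \<subseteq> T \<and> T - A \<in> sets lebesgue \<and> emeasure lebesgue (T - A) < ennreal (1 / Suc n)" for n
      using sets_lebesgue_outer_open[OF Al(1), of "1 / Suc n"] by (metis fmeasurableD of_nat_0_less_iff zero_less_Suc zero_less_divide_1_iff)
    then obtain T where T: "\<And>n. open (T n)" "\<And>n. A \<subseteq> T n" "\<And>n. T n - A \<in> sets lebesgue"
      "\<And>n. emeasure lebesgue (T n - A) < ennreal (1 / Suc n)" by metis
    \<comment> \<open>Finite intersections keep \<open>U n\<close> open and decreasing. Their limit
      is \<open>A\<close> up to the null set \<open>Z\<close>, where pointwise convergence may
      fail.\<close>
    define U where "U n = \<Omega> \<inter> (\<Inter>k\<le>n. T k)" for n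
    have U: "open (U n)" "U n \<subseteq> \<Omega>" "A \<subseteq> U n" for n
      using T \<Omega> Al(2) by (auto simp: U_def intro!: open_INT open_Int)
    have [measurable]: "U n \<in> sets ?M" for n
      using U(1,2)[of n] \<Omega>s by (simp add: sets_restrict_space_iff borel_open)
    define Z where "Z = (\<Inter>n. T n - A)"
    have "Z \<in> null_sets lebesgue"
    proof (rule null_setsI)
      have Zs: "Z \<in> sets lebesgue" unfolding Z_def by (rule sets.countable_INT) (use T(3) in auto)
      show "emeasure lebesgue Z = 0"
      proof (rule ccontr)
        assume "emeasure lebesgue Z \<noteq> 0"
        moreover have le: "emeasure lebesgue Z \<le> ennreal (1 / Suc n)" for n
        proof -
          have "emeasure lebesgue Z \<le> emeasure lebesgue (T n - A)"
            using T(3) by (intro emeasure_mono) (auto simp: Z_def)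
          then show ?thesis using T(4)[of n] by simp
        qed
        moreover obtain e where e: "emeasure lebesgue Z = ennreal e" "0 \<le> e"
          using le[of 0] by (cases "emeasure lebesgue Z") (auto simp: top_unique)
        ultimately have "0 < e" "\<And>n. e \<le> 1 / Suc n" by (auto simp: ennreal_le_iff)
        then show False using reals_Archimedean[of e] by (auto simp: inverse_eq_divide not_le[symmetric])
      qed
      show "Z \<in> sets lebesgue" by (rule Zs)
    qed
    then have "AE x in lebesgue. x \<notin> Z" by (rule AE_not_in)
    then have "AE x in lebesgue. x \<in> \<Omega> \<longrightarrow> x \<notin> Z" by eventually_elim simp
    then have nZ: "AE x in ?M. x \<notin> Z" using \<Omega>s by (simp add: AE_restrict_space_iff)
    have "(\<lambda>n. \<integral>x. h x * indicator (U n) x \<partial>?M) \<longlonglongrightarrow> (\<integral>x. h x * indicator A x \<partial>?M)"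
    proof (rule integral_dominated_convergence[where w = "\<lambda>x. norm (h x)"])
      show "AE x in ?M. (\<lambda>n. h x * indicator (U n) x) \<longlonglongrightarrow> h x * indicator A x"
        using nZ AE_space
      proof eventually_elim
        case (elim x)
        then have "x \<in> \<Omega>" using \<Omega>s by (simp add: space_restrict_space)
        show ?case
        proof (cases "x \<in> A")
          case True
          then show ?thesis using U(3) by (auto simp: indicator_def subset_eq)
        next
          case False
          then obtain k where "x \<notin> T k" using elim by (auto simp: Z_def)
          then have "\<forall>\<^sub>F n in sequentially. h x * indicator A x = h x * indicator (U n) x"
            using False by (intro eventually_sequentiallyI[of k]) (auto simp: U_def indicator_def)
          then show ?thesis by (rule Lim_transform_eventually[OF tendsto_const])
        qed
      qed
      show "AE x in ?M. norm (h x * indicator (U n) x) \<le> norm (h x)" for n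
        by (auto simp: indicator_def)
      show "(\<lambda>x. h x * indicator A x) \<in> borel_measurable ?M" using A by measurable
    qed (use h in \<open>auto\<close>)
    then show ?thesis using op U by (simp add: LIMSEQ_const_iff)
  qed
  \<comment> \<open>The set \<open>A\<close> is taken to be the one where \<open>c * h\<close> is
    positive; \<open>c = 1\<close> and \<open>c = -1\<close> together give
    \<open>h = 0\<close>.\<close>
  have half: "AE x in ?M. c * h x \<le> 0" for c :: real
  proof -
    let ?A = "{x \<in> space ?M. 0 < c * h x}"
    have A[measurable]: "?A \<in> sets ?M" by measurable
    have i: "integrable ?M (\<lambda>x. c * (h x * indicator ?A x))"
      using integrable_mult_indicator[OF A h] by (simp add: mult.commute)
    have "(\<integral>x. c * (h x * indicator ?A x) \<partial>?M) = 0" using set0[OF A] by simp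
    then have "AE x in ?M. c * (h x * indicator ?A x) = 0"
      by (subst (asm) integral_nonneg_eq_0_iff_AE[OF i]) (auto simp: indicator_def)
    then show ?thesis using AE_space by eventually_elim (auto simp: indicator_def split: if_splits)
  qed
  show ?thesis using half[of 1] half[of "-1"] by eventually_elim simp
qed

section \<open>Integration by parts for compactly supported functions\<close>

lemma integrable_compact_support:
  fixes g :: "'a::euclidean_space \<Rightarrow> 'b::{banach, second_countable_topology}"
  assumes "continuous_on UNIV g" "compact K" "\<And>x. x \<notin> K \<Longrightarrow> g x = 0"
  shows "integrable lborel g"
proof -
  have "integrable lborel (\<lambda>x. indicator K x *\<^sub>R g x)"
    using assms by (intro borel_integrable_compact) (auto intro: continuous_on_subset)
  moreover have "(\<lambda>x. indicator K x *\<^sub>R g x) = g" using assms(3) by (auto simp: indicator_def)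
  ultimately show ?thesis by simp
qed

text \<open>The difference quotient along \<open>b\<close> has integral zero by translation
  invariance, and the mean value theorem bounds it, so the limit passes under the integral. With a
  product for \<open>F\<close> this becomes the integration by parts behind weak gradients and the
  Poincare inequality.\<close>

lemma integral_partial_derivative_zero:
  fixes F :: "'a::euclidean_space \<Rightarrow> real"
  assumes der: "\<And>x. (F has_derivative F' x) (at x)"
    and cont: "continuous_on UNIV (\<lambda>x. F' x b)"
    and K: "compact K" "\<And>x. x \<notin> K \<Longrightarrow> F x = 0"
  shows "integrable lborel (\<lambda>x. F' x b)" "(\<integral>x. F' x b \<partial>lborel) = 0"
proof -
  have contF: "continuous_on UNIV F"
    using der has_derivative_continuous by (fastforce simp: continuous_on_eq_continuous_within)
  have zero: "F' x b = 0" if "x \<notin> K" for x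
  proof -
    have "((\<lambda>_. 0) has_derivative F' x) (at x)"
      by (rule has_derivative_transform_within_open[OF der, where s = "- K"])
        (use that K compact_imp_closed in auto)
    then have "F' x = (\<lambda>_. 0)" using has_derivative_unique has_derivative_const by blast
    then show ?thesis by simp
  qed
  show int: "integrable lborel (\<lambda>x. F' x b)"
    by (rule integrable_compact_support[OF cont K(1) zero])
  have intF: "integrable lborel F" by (rule integrable_compact_support[OF contF K])
  obtain R where R: "K \<subseteq> cball 0 R" using compact_imp_bounded[OF K(1)] unfolding bounded_iff
    by (meson mem_cball_0 subsetI)
  have "bounded ((\<lambda>x. F' x b) ` K)"
    using K(1) cont by (intro compact_imp_bounded compact_continuous_image) (auto intro: continuous_on_subset)
  then obtain C where C: "\<And>x. x \<in> K \<Longrightarrow> \<bar>F' x b\<bar> \<le> C" "0 < C"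
    unfolding bounded_pos by auto
  have C': "\<bar>F' x b\<bar> \<le> C" for x using C zero[of x] by (cases "x \<in> K") auto
  define h where "h n = 1 / real (Suc n)" for n
  have h: "0 < h n" "h n \<le> 1" for n by (auto simp: h_def)
  have line: "((\<lambda>t. F (x + t *\<^sub>R b)) has_real_derivative F' (x + t *\<^sub>R b) b) (at t)" for x t
  proof -
    have "((\<lambda>t. F (x + t *\<^sub>R b)) has_derivative (\<lambda>s. F' (x + t *\<^sub>R b) (s *\<^sub>R b))) (at t)"
      by (rule has_derivative_compose[OF _ der]) (auto intro!: derivative_eq_intros)
    moreover have "F' y (s *\<^sub>R b) = F' y b * s" for y s
      using linear_scale[OF has_derivative_linear[OF der]] by (simp add: mult.commute)
    ultimately show ?thesis by (simp add: has_field_derivative_def)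
  qed
  define G where "G n x = (F (x + h n *\<^sub>R b) - F x) / h n" for n x
  \<comment> \<open>The increments \<open>h n\<close> are at most 1, so the quotients vanish outside
    the ball enlarged by \<open>norm b\<close>; this fixes the dominating function.\<close>
  have "(\<lambda>n. \<integral>x. G n x \<partial>lborel) \<longlonglongrightarrow> (\<integral>x. F' x b \<partial>lborel)"
  proof (rule integral_dominated_convergence[where w = "\<lambda>x. C * indicator (cball 0 (R + norm b)) x"])
    show "(\<lambda>x. F' x b) \<in> borel_measurable lborel" using int by simp
    have [measurable]: "F \<in> borel_measurable borel" using contF by (rule borel_measurable_continuous_onI)
    show "G n \<in> borel_measurable lborel" for n unfolding G_def by measurable
    show "integrable lborel (\<lambda>x. C * indicator (cball 0 (R + norm b)) x)"
      by (intro integrable_mult_right integrable_real_indicator) (use emeasure_bounded_finite[OF bounded_cball, of 0 "R + norm b"] in auto)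
    show "AE x in lborel. (\<lambda>n. G n x) \<longlonglongrightarrow> F' x b"
    proof (rule AE_I2)
      fix x
      have "(\<lambda>s. (F (x + (0 + s) *\<^sub>R b) - F (x + 0 *\<^sub>R b)) / s) \<midarrow>0\<rightarrow> F' (x + 0 *\<^sub>R b) b"
        using line[of x 0] unfolding DERIV_def .
      then have l: "(\<lambda>s. (F (x + s *\<^sub>R b) - F x) / s) \<midarrow>0\<rightarrow> F' x b" by simp
      have "filterlim h (at 0) sequentially"
        unfolding filterlim_at h_def by (intro conjI LIMSEQ_Suc[OF lim_1_over_n]) auto
      from filterlim_compose[OF l this] show "(\<lambda>n. G n x) \<longlonglongrightarrow> F' x b" by (simp add: G_def)
    qed
    show "AE x in lborel. norm (G n x) \<le> C * indicator (cball 0 (R + norm b)) x" for n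
    proof (rule AE_I2)
      fix x
      obtain z where z: "0 < z" "z < h n"
        "F (x + h n *\<^sub>R b) - F (x + 0 *\<^sub>R b) = (h n - 0) * F' (x + z *\<^sub>R b) b"
        using MVT2[OF h(1)[of n] line[of x]] by blast
      then have G: "G n x = F' (x + z *\<^sub>R b) b" using h(1)[of n] by (simp add: G_def)
      show "norm (G n x) \<le> C * indicator (cball 0 (R + norm b)) x"
      proof (cases "x \<in> cball 0 (R + norm b)")
        case True
        then show ?thesis using C' G by simp
      next
        case False
        have "norm (z *\<^sub>R b) \<le> norm b" using z h(2)[of n] by (simp add: mult_left_le_one_le)
        then have "R < norm (x + z *\<^sub>R b)"
          using False norm_triangle_ineq4[of "x + z *\<^sub>R b" "z *\<^sub>R b"] by simp
        then have "x + z *\<^sub>R b \<notin> K" using R by (auto simp: subset_eq)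
        then show ?thesis using zero G False by simp
      qed
    qed
  qed
  moreover have "(\<integral>x. G n x \<partial>lborel) = 0" for n
  proof -
    let ?c = "h n *\<^sub>R b"
    have [measurable]: "F \<in> borel_measurable borel" using contF by (rule borel_measurable_continuous_onI)
    have i: "integrable (distr lborel borel ((+) ?c)) F" using intF by (simp add: lborel_distr_plus)
    then have i': "integrable lborel (\<lambda>x. F (?c + x))" by (subst (asm) integrable_distr_eq) auto
    have "(\<integral>x. F x \<partial>distr lborel borel ((+) ?c)) = (\<integral>x. F (?c + x) \<partial>lborel)"
      by (rule integral_distr) auto
    then have eq: "(\<integral>x. F (?c + x) \<partial>lborel) = (\<integral>x. F x \<partial>lborel)" by (simp add: lborel_distr_plus)
    have "(\<integral>x. G n x \<partial>lborel) = (\<integral>x. F (?c + x) - F x \<partial>lborel) / h n"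
      unfolding G_def by (simp add: add.commute)
    then show ?thesis using i' intF eq by simp
  qed
  ultimately show "(\<integral>x. F' x b \<partial>lborel) = 0" by (simp add: LIMSEQ_const_iff)
qed

lemma compact_support_lebesgue_on:
  fixes g :: "'a::euclidean_space \<Rightarrow> 'b::{banach, second_countable_topology}"
  assumes g: "continuous_on UNIV g" "compact K" "\<And>x. x \<notin> K \<Longrightarrow> g x = 0"
    and \<Omega>: "K \<subseteq> \<Omega>" "\<Omega> \<in> sets lebesgue"
  shows "integrable (lebesgue_on \<Omega>) g" "(\<integral>x. g x \<partial>lebesgue_on \<Omega>) = (\<integral>x. g x \<partial>lborel)"
proof -
  have [measurable]: "g \<in> borel_measurable borel" using g(1) by (rule borel_measurable_continuous_onI)
  have eq: "(\<lambda>x. indicator \<Omega> x *\<^sub>R g x) = g" using g(3) \<Omega>(1) by (fastforce simp: indicator_def)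
  show "integrable (lebesgue_on \<Omega>) g"
    using \<Omega>(2) integrable_compact_support[OF g]
    by (subst integrable_restrict_space) (auto simp: eq integrable_completion)
  show "(\<integral>x. g x \<partial>lebesgue_on \<Omega>) = (\<integral>x. g x \<partial>lborel)"
    using \<Omega>(2) by (subst integral_restrict_space) (auto simp: eq integral_completion)
qed

section \<open>Test functions\<close>

lemma C_k_add: "C_k k f \<Longrightarrow> C_k k g \<Longrightarrow> C_k k (\<lambda>x. f x + g x)"
proof (induction k arbitrary: f g)
  case (Suc k)
  have "frechet_derivative (\<lambda>x. f x + g x) (at x)
      = (\<lambda>h. frechet_derivative f (at x) h + frechet_derivative g (at x) h)" for x
    using Suc.prems
    by (intro frechet_derivative_at[symmetric] has_derivative_add frechet_derivative_works[THEN iffD1]) auto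
  then show ?case using Suc by auto
qed (auto intro: continuous_intros)

lemma C_k_scaleR: "C_k k f \<Longrightarrow> C_k k (\<lambda>x. c *\<^sub>R f x)"
proof (induction k arbitrary: f)
  case (Suc k)
  have "frechet_derivative (\<lambda>x. c *\<^sub>R f x) (at x) = (\<lambda>h. c *\<^sub>R frechet_derivative f (at x) h)" for x
    using Suc.prems
    by (intro frechet_derivative_at[symmetric] has_derivative_scaleR_right frechet_derivative_works[THEN iffD1]) auto
  then show ?case using Suc by auto
qed (auto intro: continuous_intros)

lemma subspace_test_functions: "subspace (test_functions \<Omega>)"
proof (rule subspaceI)
  have "C_k k (\<lambda>_. 0)" for k by (induction k) auto
  then show "0 \<in> test_functions \<Omega>" by (auto simp: test_functions_def zero_fun_def intro!: exI[of _ "{}"])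
next
  fix f g :: "'a \<Rightarrow> 'b" assume f: "f \<in> test_functions \<Omega>" and g: "g \<in> test_functions \<Omega>"
  obtain K where K: "compact K" "K \<subseteq> \<Omega>" "\<And>x. x \<notin> K \<Longrightarrow> f x = 0" using f by (auto simp: test_functions_def)
  obtain L where L: "compact L" "L \<subseteq> \<Omega>" "\<And>x. x \<notin> L \<Longrightarrow> g x = 0" using g by (auto simp: test_functions_def)
  have "compact (K \<union> L) \<and> K \<union> L \<subseteq> \<Omega> \<and> (\<forall>x. x \<notin> K \<union> L \<longrightarrow> f x + g x = 0)" using K L by auto
  moreover have "C_k k (\<lambda>x. f x + g x)" for k using f g by (intro C_k_add) (auto simp: test_functions_def)
  ultimately show "f + g \<in> test_functions \<Omega>" unfolding test_functions_def plus_fun_def by blast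
next
  fix c and f :: "'a \<Rightarrow> 'b" assume "f \<in> test_functions \<Omega>"
  then show "c *\<^sub>R f \<in> test_functions \<Omega>"
    by (auto simp: test_functions_def scaleR_fun_def C_k_scaleR)
qed

lemma test_functionsE:
  assumes "\<phi> \<in> test_functions \<Omega>"
  obtains K where "compact K" "K \<subseteq> \<Omega>" "\<And>x. x \<notin> K \<Longrightarrow> \<phi> x = 0"
    "\<And>x b. x \<notin> K \<Longrightarrow> frechet_derivative \<phi> (at x) b = 0"
proof -
  obtain K where K: "compact K" "K \<subseteq> \<Omega>" "\<And>x. x \<notin> K \<Longrightarrow> \<phi> x = 0" using assms by (auto simp: test_functions_def)
  have "frechet_derivative \<phi> (at x) b = 0" if "x \<notin> K" for x b
  proof -
    have "((\<lambda>_. 0) has_derivative (\<lambda>_. 0)) (at x)" by simp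
    then have "(\<phi> has_derivative (\<lambda>_. 0)) (at x)"
      by (rule has_derivative_transform_within_open[where s = "- K"])
        (use that K compact_imp_closed in auto)
    then show ?thesis using frechet_derivative_at by metis
  qed
  then show ?thesis using K that by blast
qed

lemma test_functions_derivative:
  assumes "\<phi> \<in> test_functions \<Omega>"
  shows "(\<phi> has_derivative frechet_derivative \<phi> (at x)) (at x)"
    and "continuous_on UNIV \<phi>"
    and "b \<in> Basis \<Longrightarrow> continuous_on UNIV (\<lambda>x. frechet_derivative \<phi> (at x) b)"
proof -
  have "C_k (Suc 0) \<phi>" "C_k 0 \<phi>" using assms by (auto simp: test_functions_def simp del: C_k.simps)
  then show "(\<phi> has_derivative frechet_derivative \<phi> (at x)) (at x)" "continuous_on UNIV \<phi>"
    "b \<in> Basis \<Longrightarrow> continuous_on UNIV (\<lambda>x. frechet_derivative \<phi> (at x) b)"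
    by (auto simp flip: frechet_derivative_works)
qed

lemma axis_Basis: "axis j (1::real) \<in> Basis"
  by (simp add: axis_in_Basis_iff)

lemma L2_compact_support:
  fixes g :: "'a::euclidean_space \<Rightarrow> 'b::euclidean_space"
  assumes g: "continuous_on UNIV g" "compact K" "\<And>x. x \<notin> K \<Longrightarrow> g x = 0" "K \<subseteq> \<Omega>" "\<Omega> \<in> sets lebesgue"
  shows "g \<in> L2 (lebesgue_on \<Omega>)"
proof -
  have "integrable (lebesgue_on \<Omega>) (\<lambda>x. (norm (g x))\<^sup>2)"
    by (rule compact_support_lebesgue_on(1)[OF _ g(2) _ g(4,5)])
      (use g in \<open>auto intro!: continuous_intros\<close>)
  moreover have "g \<in> borel_measurable (lebesgue_on \<Omega>)"
    using compact_support_lebesgue_on(1)[OF g] by simp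
  ultimately show ?thesis by (simp add: L2_def)
qed

lemma L2_test_function:
  "\<phi> \<in> test_functions \<Omega> \<Longrightarrow> \<Omega> \<in> sets lebesgue \<Longrightarrow> \<phi> \<in> L2 (lebesgue_on \<Omega>)"
  using L2_compact_support test_functions_derivative(2) by (metis test_functionsE)

lemma L2_test_function_deriv:
  "\<phi> \<in> test_functions \<Omega> \<Longrightarrow> \<Omega> \<in> sets lebesgue \<Longrightarrow> b \<in> Basis \<Longrightarrow>
    (\<lambda>x. frechet_derivative \<phi> (at x) b) \<in> L2 (lebesgue_on \<Omega>)"
  using L2_compact_support[where g = "\<lambda>x. frechet_derivative \<phi> (at x) b"] test_functions_derivative(3)
  by (metis test_functionsE)

text \<open>Classical gradient in the index convention of weak gradients. \<open>grad\<close> is a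
  chosen representative and agrees with it only almost everywhere.\<close>

definition cgrad :: "(real^'d \<Rightarrow> real^'d) \<Rightarrow> real^'d \<Rightarrow> real^'d^'d" where
  "cgrad \<phi> x = (\<chi> i j. frechet_derivative \<phi> (at x) (axis j 1) $ i)"

lemma cgrad_L2:
  assumes "\<phi> \<in> test_functions \<Omega>" "\<Omega> \<in> sets lebesgue" shows "cgrad \<phi> \<in> L2 (lebesgue_on \<Omega>)"
proof -
  obtain K where K: "compact K" "K \<subseteq> \<Omega>" "\<And>x. x \<notin> K \<Longrightarrow> \<phi> x = 0"
    "\<And>x b. x \<notin> K \<Longrightarrow> frechet_derivative \<phi> (at x) b = 0" using test_functionsE[OF assms(1)] by metis
  show ?thesis
  proof (rule L2_compact_support[OF _ K(1) _ K(2) assms(2)])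
    show "continuous_on UNIV (cgrad \<phi>)"
      unfolding cgrad_def[abs_def]
      by (intro continuous_on_vec_lambda continuous_intros test_functions_derivative(3)[OF assms(1)] axis_Basis)
    show "cgrad \<phi> x = 0" if "x \<notin> K" for x using K(4)[OF that] by (simp add: cgrad_def vec_eq_iff)
  qed
qed

lemma has_derivative_component:
  assumes "\<phi> \<in> test_functions \<Omega>"
  shows "((\<lambda>x. \<phi> x $ i) has_derivative (\<lambda>h. frechet_derivative \<phi> (at x) h $ i)) (at x)"
  using bounded_linear.has_derivative[OF bounded_linear_vec_nth test_functions_derivative(1)[OF assms]] .

lemma is_weak_gradient_cgrad:
  assumes \<phi>: "\<phi> \<in> test_functions \<Omega>" and \<Omega>: "\<Omega> \<in> sets lebesgue"
  shows "is_weak_gradient \<Omega> \<phi> (cgrad \<phi>)"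
  unfolding is_weak_gradient_def
proof (intro ballI allI)
  fix \<psi> :: "real^'a \<Rightarrow> real" and i j assume \<psi>: "\<psi> \<in> test_functions \<Omega>"
  obtain K where K: "compact K" "K \<subseteq> \<Omega>" "\<And>x. x \<notin> K \<Longrightarrow> \<phi> x = 0" using test_functionsE[OF \<phi>] by metis
  let ?e = "axis j 1 :: real^'a"
  let ?a = "\<lambda>x. \<phi> x $ i * frechet_derivative \<psi> (at x) ?e"
  let ?b = "\<lambda>x. cgrad \<phi> x $ i $ j * \<psi> x"
  note c = test_functions_derivative[OF \<phi>] test_functions_derivative[OF \<psi>]
  have ca: "continuous_on UNIV ?a"
    by (intro continuous_intros c(2) c(6) axis_Basis)
  have cb: "continuous_on UNIV ?b"
    unfolding cgrad_def by (simp, intro continuous_intros c(3) c(5) axis_Basis)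
  have za: "?a x = 0" if "x \<notin> K" for x using K(3)[OF that] by simp
  obtain L where L: "compact L" "L \<subseteq> \<Omega>" "\<And>x. x \<notin> L \<Longrightarrow> \<psi> x = 0" using test_functionsE[OF \<psi>] by metis
  have zb: "?b x = 0" if "x \<notin> L" for x using L(3)[OF that] by simp
  have "(\<integral>x. \<phi> x $ i * frechet_derivative \<psi> (at x) ?e + frechet_derivative \<phi> (at x) ?e $ i * \<psi> x \<partial>lborel) = 0"
  proof (rule integral_partial_derivative_zero(2)[OF _ _ K(1)])
    show "((\<lambda>x. \<phi> x $ i * \<psi> x) has_derivative (\<lambda>h. \<phi> x $ i * frechet_derivative \<psi> (at x) h
        + frechet_derivative \<phi> (at x) h $ i * \<psi> x)) (at x)" for x
      by (rule has_derivative_mult[OF has_derivative_component[OF \<phi>] c(4)])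
    show "continuous_on UNIV (\<lambda>x. \<phi> x $ i * frechet_derivative \<psi> (at x) ?e
        + frechet_derivative \<phi> (at x) ?e $ i * \<psi> x)"
      by (intro continuous_intros c(2,3,5,6) axis_Basis)
    show "\<phi> x $ i * \<psi> x = 0" if "x \<notin> K" for x using K(3)[OF that] by simp
  qed
  then have "(\<integral>x. ?a x + ?b x \<partial>lborel) = 0" by (simp add: cgrad_def)
  then have "(\<integral>x. ?a x \<partial>lborel) + (\<integral>x. ?b x \<partial>lborel) = 0"
    using integrable_compact_support[OF ca K(1) za] integrable_compact_support[OF cb L(1) zb] by simp
  then show "(\<integral>x. ?a x \<partial>lebesgue_on \<Omega>) = - (\<integral>x. ?b x \<partial>lebesgue_on \<Omega>)"
    using compact_support_lebesgue_on(2)[OF ca K(1) za K(2) \<Omega>]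
      compact_support_lebesgue_on(2)[OF cb L(1) zb L(2) \<Omega>] by linarith
qed

lemma norm_sq_vec: "(norm (w :: real^'n))\<^sup>2 = (\<Sum>i\<in>UNIV. (w $ i)\<^sup>2)"
  by (simp add: power2_norm_eq_inner inner_vec_def flip: power2_eq_square)

text \<open>The derivative of \<open>x $ j * (\<phi> x $ i)\<^sup>2\<close> in direction
  \<open>j\<close> has integral zero, which expresses the integral of
  \<open>(\<phi> x $ i)\<^sup>2\<close> through a product of \<open>\<phi>\<close> and its
  derivative; half of the square is then absorbed. The constant comes from
  \<open>\<bar>x $ j\<bar> \<le> \<bar>R\<bar>\<close> on the support.\<close>

lemma poincare_test_functions:
  assumes \<phi>: "\<phi> \<in> test_functions (\<Omega> :: (real^'d) set)" and \<Omega>: "\<Omega> \<in> sets lebesgue" "\<Omega> \<subseteq> ball 0 R"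
  shows "(\<integral>x. (norm (\<phi> x))\<^sup>2 \<partial>lebesgue_on \<Omega>) \<le> 4 * R\<^sup>2 * (\<integral>x. (norm (cgrad \<phi> x))\<^sup>2 \<partial>lebesgue_on \<Omega>)"
proof -
  obtain K where K: "compact K" "K \<subseteq> \<Omega>" "\<And>x. x \<notin> K \<Longrightarrow> \<phi> x = 0"
    "\<And>x b. x \<notin> K \<Longrightarrow> frechet_derivative \<phi> (at x) b = 0" using test_functionsE[OF \<phi>] by metis
  \<comment> \<open>Any direction will do, and one exists because index types are nonempty.\<close>
  obtain j :: 'd where True by simp
  let ?e = "axis j 1 :: real^'d"
  let ?D = "\<lambda>i x. frechet_derivative \<phi> (at x) ?e $ i"
  note c = test_functions_derivative[OF \<phi>]
  have cD: "continuous_on UNIV (?D i)" for i by (intro continuous_intros c(3) axis_Basis)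
  have cphi: "continuous_on UNIV (\<lambda>x. \<phi> x $ i)" for i by (intro continuous_intros c(2))
  have comp: "(\<integral>x. (\<phi> x $ i)\<^sup>2 \<partial>lborel) \<le> 4 * R\<^sup>2 * (\<integral>x. (?D i x)\<^sup>2 \<partial>lborel)" for i
  proof -
    have ip: "integrable lborel (\<lambda>x. (\<phi> x $ i)\<^sup>2)"
      by (rule integrable_compact_support[OF _ K(1)]) (auto intro!: continuous_intros cphi simp: K(3))
    have iD: "integrable lborel (\<lambda>x. (?D i x)\<^sup>2)"
      by (rule integrable_compact_support[OF _ K(1)]) (auto intro!: continuous_intros cD simp: K(4))
    have ix: "integrable lborel (\<lambda>x. x $ j * (2 * \<phi> x $ i * ?D i x))"
      by (rule integrable_compact_support[OF _ K(1)]) (auto intro!: continuous_intros cphi cD simp: K(3,4))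
    have "(\<integral>x. x $ j * (2 * \<phi> x $ i * ?D i x) + ?e $ j * (\<phi> x $ i)\<^sup>2 \<partial>lborel) = 0"
    proof (rule integral_partial_derivative_zero(2)[OF _ _ K(1)])
      show "((\<lambda>x. x $ j * (\<phi> x $ i)\<^sup>2) has_derivative (\<lambda>h. x $ j * (2 * \<phi> x $ i
          * frechet_derivative \<phi> (at x) h $ i) + h $ j * (\<phi> x $ i)\<^sup>2)) (at x)" for x
        by (rule has_derivative_eq_rhs[OF has_derivative_mult[OF bounded_linear_imp_has_derivative[OF bounded_linear_vec_nth]
              has_derivative_power[OF has_derivative_component[OF \<phi>]]]])
          (simp add: fun_eq_iff)
      show "continuous_on UNIV (\<lambda>x. x $ j * (2 * \<phi> x $ i * ?D i x) + ?e $ j * (\<phi> x $ i)\<^sup>2)"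
        by (intro continuous_intros cphi cD)
      show "x $ j * (\<phi> x $ i)\<^sup>2 = 0" if "x \<notin> K" for x using K(3)[OF that] by simp
    qed
    then have "(\<integral>x. (\<phi> x $ i)\<^sup>2 \<partial>lborel) = (\<integral>x. - (x $ j * (2 * \<phi> x $ i * ?D i x)) \<partial>lborel)"
      using ip ix by (simp add: axis_def)
    also have "\<dots> \<le> (\<integral>x. (1/2) * (\<phi> x $ i)\<^sup>2 + 2 * R\<^sup>2 * (?D i x)\<^sup>2 \<partial>lborel)"
    proof (rule integral_mono)
      fix x
      show "- (x $ j * (2 * \<phi> x $ i * ?D i x)) \<le> (1/2) * (\<phi> x $ i)\<^sup>2 + 2 * R\<^sup>2 * (?D i x)\<^sup>2"
      proof (cases "x \<in> K")
        case True
        then have "norm x < R" using K(2) \<Omega>(2) by auto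
        then have "\<bar>x $ j\<bar> \<le> \<bar>R\<bar>" using component_le_norm_cart[of x j] by linarith
        then have "(x $ j)\<^sup>2 \<le> R\<^sup>2" by (simp add: abs_le_square_iff)
        then have "(x $ j)\<^sup>2 * (?D i x)\<^sup>2 \<le> R\<^sup>2 * (?D i x)\<^sup>2" by (intro mult_right_mono) auto
        \<comment> \<open>Expanding this square is Young's inequality with weights
          \<open>1/2\<close> and \<open>2\<close>; the share \<open>1/2\<close> can be absorbed on
          the left.\<close>
        moreover have "0 \<le> (\<phi> x $ i + 2 * (x $ j * ?D i x))\<^sup>2" by simp
        ultimately show ?thesis by (simp add: power2_eq_square algebra_simps)
      qed (simp add: K(3))
    qed (use ip iD ix in auto)
    also have "\<dots> = (1/2) * (\<integral>x. (\<phi> x $ i)\<^sup>2 \<partial>lborel) + 2 * R\<^sup>2 * (\<integral>x. (?D i x)\<^sup>2 \<partial>lborel)"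
      using ip iD by simp
    finally show ?thesis by simp
  qed
  have eq: "(\<integral>x. g x \<partial>lebesgue_on \<Omega>) = (\<integral>x. g x \<partial>lborel)" "integrable lborel g"
    if "continuous_on UNIV g" "\<And>x. x \<notin> K \<Longrightarrow> g x = 0" for g :: "real^'d \<Rightarrow> real"
    using compact_support_lebesgue_on[OF that(1) K(1) that(2) K(2) \<Omega>(1)]
      integrable_compact_support[OF that(1) K(1) that(2)] by auto
  have ip: "integrable lborel (\<lambda>x. (\<phi> x $ i)\<^sup>2)" and iD: "integrable lborel (\<lambda>x. (?D i x)\<^sup>2)" for i
    by (rule eq(2), auto intro!: continuous_intros cphi cD simp: K(3,4))+
  have ccg: "continuous_on UNIV (\<lambda>x. (norm (cgrad \<phi> x))\<^sup>2)"
    unfolding cgrad_def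
    by (intro continuous_intros continuous_on_vec_lambda c(3) axis_Basis)
  have "(\<integral>x. (norm (\<phi> x))\<^sup>2 \<partial>lebesgue_on \<Omega>) = (\<integral>x. (\<Sum>i\<in>UNIV. (\<phi> x $ i)\<^sup>2) \<partial>lborel)"
    by (subst eq(1)) (auto intro!: continuous_intros c(2) simp: K(3) norm_sq_vec)
  also have "\<dots> = (\<Sum>i\<in>UNIV. \<integral>x. (\<phi> x $ i)\<^sup>2 \<partial>lborel)" using ip by simp
  also have "\<dots> \<le> (\<Sum>i\<in>UNIV. 4 * R\<^sup>2 * (\<integral>x. (?D i x)\<^sup>2 \<partial>lborel))" by (intro sum_mono comp)
  also have "\<dots> = 4 * R\<^sup>2 * (\<integral>x. (\<Sum>i\<in>UNIV. (?D i x)\<^sup>2) \<partial>lborel)" using iD by (simp add: sum_distrib_left)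
  also have "\<dots> \<le> 4 * R\<^sup>2 * (\<integral>x. (norm (cgrad \<phi> x))\<^sup>2 \<partial>lborel)"
  proof (intro mult_left_mono integral_mono)
    show "integrable lborel (\<lambda>x. (norm (cgrad \<phi> x))\<^sup>2)"
      by (rule eq(2)[OF ccg]) (simp add: cgrad_def K(4) vec_eq_iff)
    fix x
    have "(\<Sum>i\<in>UNIV. (?D i x)\<^sup>2) \<le> (\<Sum>i\<in>UNIV. \<Sum>j\<in>UNIV. (cgrad \<phi> x $ i $ j)\<^sup>2)"
    proof (rule sum_mono)
      fix i
      have "(?D i x)\<^sup>2 = (cgrad \<phi> x $ i $ j)\<^sup>2" by (simp add: cgrad_def)
      also have "\<dots> \<le> (\<Sum>j\<in>UNIV. (cgrad \<phi> x $ i $ j)\<^sup>2)" by (rule member_le_sum) auto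
      finally show "(?D i x)\<^sup>2 \<le> (\<Sum>j\<in>UNIV. (cgrad \<phi> x $ i $ j)\<^sup>2)" .
    qed
    then show "(\<Sum>i\<in>UNIV. (?D i x)\<^sup>2) \<le> (norm (cgrad \<phi> x))\<^sup>2"
      by (simp add: power2_norm_eq_inner inner_vec_def flip: power2_eq_square)
  qed (use iD in auto)
  also have "(\<integral>x. (norm (cgrad \<phi> x))\<^sup>2 \<partial>lborel) = (\<integral>x. (norm (cgrad \<phi> x))\<^sup>2 \<partial>lebesgue_on \<Omega>)"
    by (rule eq(1)[OF ccg, symmetric]) (simp add: cgrad_def K(4) vec_eq_iff)
  finally show ?thesis .
qed

section \<open>The spaces \<open>V\<close> and \<open>V\<^sub>\<sigma>\<close>\<close>

definition V_ip :: "(real^'d) set \<Rightarrow> (real^'d \<Rightarrow> real^'d) \<Rightarrow> (real^'d \<Rightarrow> real^'d) \<Rightarrow> real" where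
  "V_ip \<Omega> v w = L2_ip (lebesgue_on \<Omega>) (grad \<Omega> v) (grad \<Omega> w)"

definition W_ip :: "(real^'d) set \<Rightarrow> (real^'d \<Rightarrow> real^'d) \<Rightarrow> (real^'d \<Rightarrow> real^'d) \<Rightarrow> real" where
  "W_ip \<Omega> v w = L2_ip (lebesgue_on \<Omega>) v w + V_ip \<Omega> v w"

lemma V_norm_eq_snorm: "V_norm \<Omega> = snorm (V_ip \<Omega>)"
  by (simp add: fun_eq_iff V_norm_def L2_norm_eq_snorm snorm_def V_ip_def)

lemma L2_bounded_linear:
  fixes L :: "'b::euclidean_space \<Rightarrow> 'c::euclidean_space"
  assumes L: "bounded_linear L" and f: "f \<in> L2 M"
  shows "(\<lambda>x. L (f x)) \<in> L2 M"
proof -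
  obtain K where K: "\<And>x. norm (L x) \<le> norm x * K" using bounded_linear.bounded[OF L] by blast
  have [measurable]: "(\<lambda>x. L (f x)) \<in> borel_measurable M"
    by (rule measurable_compose[OF L2_measurable[OF f]])
      (intro borel_measurable_continuous_onI linear_continuous_on L)
  have "integrable M (\<lambda>x. (norm (L (f x)))\<^sup>2)"
  proof (rule Bochner_Integration.integrable_bound)
    show "integrable M (\<lambda>x. K\<^sup>2 * (norm (f x))\<^sup>2)" using L2_integrable[OF f] by simp
    have "(norm (L (f x)))\<^sup>2 \<le> K\<^sup>2 * (norm (f x))\<^sup>2" for x
      using power_mono[OF K[of "f x"], of 2] by (simp add: power_mult_distrib mult.commute)
    then show "AE x in M. norm ((norm (L (f x)))\<^sup>2) \<le> norm (K\<^sup>2 * (norm (f x))\<^sup>2)" by simp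
  qed measurable
  then show ?thesis by (simp add: L2_def)
qed

locale bounded_open =
  fixes \<Omega> :: "(real^'d) set"
  assumes open_\<Omega>: "open \<Omega>" and bounded_\<Omega>: "bounded \<Omega>"
begin

abbreviation "M \<equiv> lebesgue_on \<Omega>"

sublocale H: semi_hilbert "L2 M" "L2_ip M :: (real^'d \<Rightarrow> real^'d) \<Rightarrow> _" by (rule semi_hilbert_L2)
sublocale Y: semi_hilbert "L2 M" "L2_ip M :: (real^'d \<Rightarrow> real^'d^'d) \<Rightarrow> _" by (rule semi_hilbert_L2)

lemma \<Omega>_sets [simp]: "\<Omega> \<in> sets lebesgue" using open_\<Omega> by (simp add: borel_open)

lemma finite_measure_M: "finite_measure M"
proof
  have "emeasure lebesgue \<Omega> < \<infinity>" 
    using emeasure_bounded_finite[OF bounded_\<Omega>] by (simp add: borel_open open_\<Omega>)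
  then show "emeasure M (space M) \<noteq> \<infinity>" by (simp add: space_restrict_space emeasure_restrict_space)
qed

lemma L2_imp_integrable:
  fixes f :: "real^'d \<Rightarrow> 'b::euclidean_space"
  assumes "f \<in> L2 M" shows "integrable M f"
proof (rule Bochner_Integration.integrable_bound)
  interpret finite_measure M by (rule finite_measure_M)
  show "integrable M (\<lambda>x. 1 + (norm (f x))\<^sup>2)" using L2_integrable[OF assms] by simp
  show "f \<in> borel_measurable M" using assms by (rule L2_measurable)
  have "norm (f x) \<le> 1 + (norm (f x))\<^sup>2" for x
  proof -
    have "2 * norm (f x) \<le> 1 + (norm (f x))\<^sup>2" using sum_squares_bound[of 1 "norm (f x)"] by simp
    then show ?thesis using norm_ge_zero[of "f x"] by linarith
  qed
  then show "AE x in M. norm (f x) \<le> norm (1 + (norm (f x))\<^sup>2)" by simp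
qed

lemma L2_component: "f \<in> L2 M \<Longrightarrow> (\<lambda>x. f x $ i) \<in> L2 M" for f :: "real^'d \<Rightarrow> ('b::euclidean_space)^'d"
  by (rule L2_bounded_linear[OF bounded_linear_vec_nth])

lemma L2_mult_integrable: "f \<in> L2 M \<Longrightarrow> g \<in> L2 M \<Longrightarrow> integrable M (\<lambda>x. f x * g x :: real)"
  using L2_inner_integrable[of f M g] by simp

lemma is_weak_gradient_lincomb:
  assumes v: "v \<in> L2 M" "G \<in> L2 M" "is_weak_gradient \<Omega> v G"
    and w: "w \<in> L2 M" "K \<in> L2 M" "is_weak_gradient \<Omega> w K"
  shows "is_weak_gradient \<Omega> (c *\<^sub>R v + w) (c *\<^sub>R G + K)"
  unfolding is_weak_gradient_def
proof (intro ballI allI)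
  fix \<phi> :: "real^'d \<Rightarrow> real" and i j assume \<phi>: "\<phi> \<in> test_functions \<Omega>"
  let ?D = "\<lambda>x. frechet_derivative \<phi> (at x) (axis j 1)"
  have D: "?D \<in> L2 M" by (rule L2_test_function_deriv[OF \<phi> _ axis_Basis]) simp
  have p: "\<phi> \<in> L2 M" by (rule L2_test_function[OF \<phi>]) simp
  note c = L2_component
  have "(\<integral>x. (c *\<^sub>R v + w) x $ i * ?D x \<partial>M) = c * (\<integral>x. v x $ i * ?D x \<partial>M) + (\<integral>x. w x $ i * ?D x \<partial>M)"
    using L2_mult_integrable[OF c[OF v(1), of i] D] L2_mult_integrable[OF c[OF w(1), of i] D]
    by (simp add: scaleR_fun_def algebra_simps)
  moreover have "(\<integral>x. (c *\<^sub>R G + K) x $ i $ j * \<phi> x \<partial>M)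
      = c * (\<integral>x. G x $ i $ j * \<phi> x \<partial>M) + (\<integral>x. K x $ i $ j * \<phi> x \<partial>M)"
    using L2_mult_integrable[OF c[OF c[OF v(2)]] p, of i j] L2_mult_integrable[OF c[OF c[OF w(2)]] p, of i j]
    by (simp add: scaleR_fun_def algebra_simps)
  ultimately show "(\<integral>x. (c *\<^sub>R v + w) x $ i * ?D x \<partial>M) = - (\<integral>x. (c *\<^sub>R G + K) x $ i $ j * \<phi> x \<partial>M)"
    using v(3) w(3) \<phi> by (simp add: is_weak_gradient_def)
qed

text \<open>The fundamental lemma, applied to each entry. It makes the choice in \<open>grad\<close>
  harmless.\<close>

lemma weak_gradient_AE_unique:
  assumes v: "G \<in> L2 M" "is_weak_gradient \<Omega> v G" and w: "K \<in> L2 M" "is_weak_gradient \<Omega> v K"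
  shows "AE x in M. G x = K x"
proof -
  have "AE x in M. G x $ i $ j - K x $ i $ j = 0" for i j
  proof (rule fundamental_lemma[OF open_\<Omega>])
    have i: "(\<lambda>x. G x $ i $ j) \<in> L2 M" "(\<lambda>x. K x $ i $ j) \<in> L2 M"
      using L2_component[OF L2_component[OF v(1)]] L2_component[OF L2_component[OF w(1)]] by auto
    then show "integrable M (\<lambda>x. G x $ i $ j - K x $ i $ j)" by (auto intro: L2_imp_integrable)
    fix \<phi> :: "real^'d \<Rightarrow> real" assume \<phi>: "\<phi> \<in> test_functions \<Omega>"
    have p: "\<phi> \<in> L2 M" by (rule L2_test_function[OF \<phi>]) simp
    have "- (\<integral>x. G x $ i $ j * \<phi> x \<partial>M) = - (\<integral>x. K x $ i $ j * \<phi> x \<partial>M)"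
      using v(2) w(2) \<phi> by (simp add: is_weak_gradient_def)
    then show "(\<integral>x. (G x $ i $ j - K x $ i $ j) * \<phi> x \<partial>M) = 0"
      using L2_mult_integrable[OF i(1) p] L2_mult_integrable[OF i(2) p] by (simp add: left_diff_distrib)
  qed
  then have "AE x in M. \<forall>i j. G x $ i $ j - K x $ i $ j = 0"
    by (simp add: AE_all_countable)
  then show ?thesis by eventually_elim (simp add: vec_eq_iff)
qed

lemma W12_D:
  assumes "v \<in> W12 \<Omega>"
  shows "v \<in> L2 M" "grad \<Omega> v \<in> L2 M" "is_weak_gradient \<Omega> v (grad \<Omega> v)"
proof -
  have "\<exists>G. G \<in> L2 M \<and> is_weak_gradient \<Omega> v G" using assms by (auto simp: W12_def)
  then have "grad \<Omega> v \<in> L2 M \<and> is_weak_gradient \<Omega> v (grad \<Omega> v)" unfolding grad_def by (rule someI_ex)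
  then show "grad \<Omega> v \<in> L2 M" "is_weak_gradient \<Omega> v (grad \<Omega> v)" by auto
  show "v \<in> L2 M" using assms by (simp add: W12_def)
qed

lemma grad_AE_eq:
  assumes "v \<in> L2 M" "G \<in> L2 M" "is_weak_gradient \<Omega> v G"
  shows "v \<in> W12 \<Omega>" "AE x in M. grad \<Omega> v x = G x"
proof -
  show "v \<in> W12 \<Omega>" using assms by (auto simp: W12_def)
  from W12_D[OF this] show "AE x in M. grad \<Omega> v x = G x"
    using weak_gradient_AE_unique assms by blast
qed

lemma W12_lincomb:
  assumes "v \<in> W12 \<Omega>" "w \<in> W12 \<Omega>"
  shows "c *\<^sub>R v + w \<in> W12 \<Omega>" "AE x in M. grad \<Omega> (c *\<^sub>R v + w) x = c *\<^sub>R grad \<Omega> v x + grad \<Omega> w x"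
proof -
  note d = W12_D[OF assms(1)] W12_D[OF assms(2)]
  have *: "c *\<^sub>R v + w \<in> L2 M" "c *\<^sub>R grad \<Omega> v + grad \<Omega> w \<in> L2 M" using d by auto
  show "c *\<^sub>R v + w \<in> W12 \<Omega>" "AE x in M. grad \<Omega> (c *\<^sub>R v + w) x = c *\<^sub>R grad \<Omega> v x + grad \<Omega> w x"
    using grad_AE_eq[OF * is_weak_gradient_lincomb[OF d]] by (auto simp: scaleR_fun_def)
qed

lemma zero_W12: "0 \<in> W12 \<Omega>" "AE x in M. grad \<Omega> 0 x = 0"
proof -
  have "is_weak_gradient \<Omega> 0 0" by (simp add: is_weak_gradient_def)
  then show "0 \<in> W12 \<Omega>" "AE x in M. grad \<Omega> 0 x = 0"
    using grad_AE_eq[of 0 0] by auto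
qed

lemma subspace_W12: "subspace (W12 \<Omega>)"
proof (rule subspaceI)
  fix c :: real and x y assume x: "x \<in> W12 \<Omega>"
  show "c *\<^sub>R x \<in> W12 \<Omega>" using W12_lincomb(1)[OF x zero_W12(1), of c] by simp
  assume "y \<in> W12 \<Omega>"
  then show "x + y \<in> W12 \<Omega>" using W12_lincomb(1)[OF x, of y 1] by simp
qed (rule zero_W12)

lemma grad_add: "v \<in> W12 \<Omega> \<Longrightarrow> w \<in> W12 \<Omega> \<Longrightarrow> AE x in M. grad \<Omega> (v + w) x = grad \<Omega> v x + grad \<Omega> w x"
  using W12_lincomb(2)[of v w 1] by simp

lemma grad_scale: "v \<in> W12 \<Omega> \<Longrightarrow> AE x in M. grad \<Omega> (c *\<^sub>R v) x = c *\<^sub>R grad \<Omega> v x"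
  using W12_lincomb(2)[OF _ zero_W12(1), of v c] zero_W12(2) by auto

lemma grad_diff: "v \<in> W12 \<Omega> \<Longrightarrow> w \<in> W12 \<Omega> \<Longrightarrow> AE x in M. grad \<Omega> (v - w) x = grad \<Omega> v x - grad \<Omega> w x"
  using W12_lincomb(2)[of w v "-1"] by simp

lemma L2_ip_cong_AE:
  assumes "f \<in> L2 M" "f' \<in> L2 M" "AE x in M. f x = f' x" "g \<in> L2 M"
  shows "L2_ip M f g = L2_ip M f' g"
  unfolding L2_ip_def
proof (rule integral_cong_AE)
  note [measurable] = assms(1,2,4)[THEN L2_measurable]
  show "(\<lambda>x. f x \<bullet> g x) \<in> borel_measurable M" "(\<lambda>x. f' x \<bullet> g x) \<in> borel_measurable M"
    by measurable
qed (use assms(3) in eventually_elim, simp)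

lemma semi_inner_W12_V_ip: "semi_inner (W12 \<Omega>) (V_ip \<Omega>)"
proof
  fix x y z assume xyz: "x \<in> W12 \<Omega>" "y \<in> W12 \<Omega>" "z \<in> W12 \<Omega>"
  note d = xyz[THEN W12_D(2)]
  have "V_ip \<Omega> (x + y) z = L2_ip M (grad \<Omega> x + grad \<Omega> y) (grad \<Omega> z)"
    unfolding V_ip_def
    by (rule L2_ip_cong_AE) (use d grad_add[OF xyz(1,2)] subspace_add[OF subspace_W12 xyz(1,2)] W12_D in auto)
  then show "V_ip \<Omega> (x + y) z = V_ip \<Omega> x z + V_ip \<Omega> y z" using d by (simp add: Y.ip_simps V_ip_def)
next
  fix x z and c :: real assume xz: "x \<in> W12 \<Omega>" "z \<in> W12 \<Omega>"
  note d = xz[THEN W12_D(2)]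
  have "V_ip \<Omega> (c *\<^sub>R x) z = L2_ip M (c *\<^sub>R grad \<Omega> x) (grad \<Omega> z)"
    unfolding V_ip_def
  proof (rule L2_ip_cong_AE)
    show "AE x' in M. grad \<Omega> (c *\<^sub>R x) x' = (c *\<^sub>R grad \<Omega> x) x'"
      using grad_scale[OF xz(1)] by (simp add: scaleR_fun_def)
  qed (use d subspace_scale[OF subspace_W12 xz(1)] W12_D in auto)
  then show "V_ip \<Omega> (c *\<^sub>R x) z = c * V_ip \<Omega> x z" using d by (simp add: Y.ip_simps V_ip_def)
qed (auto simp: subspace_W12 V_ip_def W12_D Y.ip_nonneg Y.ip_commute)

sublocale W: semi_inner "W12 \<Omega>" "W_ip \<Omega>"
proof -
  interpret A: semi_inner "W12 \<Omega>" "V_ip \<Omega>" by (rule semi_inner_W12_V_ip)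
  show "semi_inner (W12 \<Omega>) (W_ip \<Omega>)"
  proof
    fix x assume "x \<in> W12 \<Omega>"
    then show "0 \<le> W_ip \<Omega> x x" using A.ip_nonneg[of x] H.ip_nonneg[of x] W12_D(1)[of x] by (simp add: W_ip_def)
  next
    fix x y assume "x \<in> W12 \<Omega>" "y \<in> W12 \<Omega>"
    then show "W_ip \<Omega> x y = W_ip \<Omega> y x"
      using A.ip_commute[of x y] H.ip_commute[of x y] W12_D(1) by (simp add: W_ip_def)
  qed (simp_all add: subspace_W12 W_ip_def W12_D H.ip_simps A.ip_simps algebra_simps)
qed

lemma W12_norm_eq: "v \<in> W12 \<Omega> \<Longrightarrow> W12_norm \<Omega> v = snorm (W_ip \<Omega>) v"
  using W12_D[of v] by (simp add: W12_norm_def snorm_def[of "W_ip \<Omega>"] L2_norm_eq_snorm H.sn_sq Y.sn_sq W_ip_def V_ip_def)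

lemma W12_norm_sq: "v \<in> W12 \<Omega> \<Longrightarrow> (snorm (W_ip \<Omega>) v)\<^sup>2 = (snorm (L2_ip M) v)\<^sup>2 + (snorm (V_ip \<Omega>) v)\<^sup>2"
  using W12_D[of v] semi_inner.sn_sq[OF semi_inner_W12_V_ip, of v] by (simp add: W.sn_sq H.sn_sq W_ip_def)

lemma test_function_W12:
  assumes "\<phi> \<in> test_functions \<Omega>"
  shows "\<phi> \<in> W12 \<Omega>" "AE x in M. grad \<Omega> \<phi> x = cgrad \<phi> x"
  using grad_AE_eq[OF L2_test_function[OF assms] cgrad_L2[OF assms] is_weak_gradient_cgrad[OF assms]] by auto

text \<open>Exhibits \<open>V\<close> as the closure of a subspace of a complete space, from which
  its completeness is inherited.\<close>

lemma V_eq_sclosure: "V_space \<Omega> = sclosure (W12 \<Omega>) (W_ip \<Omega>) (test_functions \<Omega>)"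
proof -
  have "W12_norm \<Omega> (v - \<phi>) = snorm (W_ip \<Omega>) (v - \<phi>)" if "v \<in> W12 \<Omega>" "\<phi> \<in> test_functions \<Omega>" for v \<phi>
    using W12_norm_eq[OF W.S_diff[OF that(1) test_function_W12(1)[OF that(2)]]] .
  then show ?thesis by (simp add: W12_0_def sclosure_def cong: conj_cong bex_cong)
qed

sublocale A: semi_inner "W12 \<Omega>" "V_ip \<Omega>" by (rule semi_inner_W12_V_ip)

text \<open>The gradient of a difference equals the difference of the gradients only almost
  everywhere, so additivity is used inside the integrals.\<close>

lemma sn_V_diff:
  assumes u: "u \<in> W12 \<Omega>" and v: "v \<in> W12 \<Omega>"
  shows "A.sn (u - v) = Y.sn (grad \<Omega> u - grad \<Omega> v)"
proof -
  have m: "u - v \<in> W12 \<Omega>" using u v by simp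
  have "V_ip \<Omega> (u - v) (u - v) = L2_ip M (grad \<Omega> (u) - grad \<Omega> v) (grad \<Omega> (u - v))"
    unfolding V_ip_def
    by (rule L2_ip_cong_AE) (use grad_diff[OF u v] m v u in \<open>auto intro: W12_D Y.S_diff\<close>)
  also have "\<dots> = L2_ip M (grad \<Omega> (u - v)) (grad \<Omega> (u) - grad \<Omega> v)"
    by (rule Y.ip_commute) (use m v u in \<open>auto intro: W12_D Y.S_diff\<close>)
  also have "\<dots> = L2_ip M (grad \<Omega> (u) - grad \<Omega> v) (grad \<Omega> (u) - grad \<Omega> v)"
    by (rule L2_ip_cong_AE) (use grad_diff[OF u v] m v u in \<open>auto intro: W12_D Y.S_diff\<close>)
  finally show ?thesis by (simp add: snorm_def)
qed

text \<open>Functions and gradients converge separately in L2; the weak gradient identity is an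
  equation between continuous linear expressions and survives the limit.\<close>

lemma semi_hilbert_W12: "semi_hilbert (W12 \<Omega>) (W_ip \<Omega>)"
proof
  fix X :: "nat \<Rightarrow> real^'d \<Rightarrow> real^'d"
  assume "\<forall>n. X n \<in> W12 \<Omega>" and C: "\<forall>e>0. \<exists>N. \<forall>m\<ge>N. \<forall>n\<ge>N. W.sn (X m - X n) < e"
  then have X: "X n \<in> W12 \<Omega>" for n by simp
  note d = W12_D[OF X]
  have sq: "(W.sn (X n - v))\<^sup>2 = (H.sn (X n - v))\<^sup>2 + (Y.sn (grad \<Omega> (X n) - grad \<Omega> v))\<^sup>2"
    if v: "v \<in> W12 \<Omega>" for n v
  proof -
    have m: "X n - v \<in> W12 \<Omega>" using X v by simp
    then show ?thesis using W12_norm_sq[OF m] sn_V_diff[OF X v] by simp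
  qed
  have le: "H.sn (X m - X n) \<le> W.sn (X m - X n)" "Y.sn (grad \<Omega> (X m) - grad \<Omega> (X n)) \<le> W.sn (X m - X n)" for m n
    by (rule power2_le_imp_le; use sq[OF X] X W.sn_nonneg in simp)+
  have "\<forall>n. X n \<in> L2 M" "\<forall>e>0. \<exists>N. \<forall>m\<ge>N. \<forall>n\<ge>N. H.sn (X m - X n) < e"
    using d C le(1) by (auto, meson le_less_trans)
  from H.complete[OF this] obtain v where v: "v \<in> L2 M" "(\<lambda>n. H.sn (X n - v)) \<longlonglongrightarrow> 0" by blast
  have "\<forall>n. grad \<Omega> (X n) \<in> L2 M"
    "\<forall>e>0. \<exists>N. \<forall>m\<ge>N. \<forall>n\<ge>N. Y.sn (grad \<Omega> (X m) - grad \<Omega> (X n)) < e"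
    using d C le(2) by (auto, meson le_less_trans)
  from Y.complete[OF this] obtain G where G: "G \<in> L2 M" "(\<lambda>n. Y.sn (grad \<Omega> (X n) - G)) \<longlonglongrightarrow> 0" by blast
  have "is_weak_gradient \<Omega> v G"
    unfolding is_weak_gradient_def
  proof (intro ballI allI)
    fix \<phi> :: "real^'d \<Rightarrow> real" and i j assume \<phi>: "\<phi> \<in> test_functions \<Omega>"
    let ?D = "\<lambda>x. frechet_derivative \<phi> (at x) (axis j 1)"
    have D: "?D \<in> L2 M" by (rule L2_test_function_deriv[OF \<phi> _ axis_Basis]) simp
    have p: "\<phi> \<in> L2 M" by (rule L2_test_function[OF \<phi>]) simp
    \<comment> \<open>The test derivative, placed in a single component, turns one side of the weak
      identity for \<open>i\<close>, \<open>j\<close> into an L2 inner product; \<open>b\<close>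
      does the same for the other side.\<close>
    have a: "(\<lambda>x. ?D x *\<^sub>R axis i 1 :: real^'d) \<in> L2 M"
      by (rule L2_bounded_linear[OF bounded_linear_scaleR_left D])
    have b: "(\<lambda>x. \<phi> x *\<^sub>R axis i (axis j 1) :: real^'d^'d) \<in> L2 M"
      by (rule L2_bounded_linear[OF bounded_linear_scaleR_left p])
    show "(\<integral>x. v x $ i * ?D x \<partial>M) = - (\<integral>x. G x $ i $ j * \<phi> x \<partial>M)"
    proof (rule LIMSEQ_unique)
      show "(\<lambda>n. \<integral>x. X n x $ i * ?D x \<partial>M) \<longlonglongrightarrow> (\<integral>x. v x $ i * ?D x \<partial>M)"
        using H.tendsto_ip_left[OF d(1) v(1,2) a] by (simp add: L2_ip_def inner_axis mult.commute)
      have "(\<lambda>n. \<integral>x. grad \<Omega> (X n) x $ i $ j * \<phi> x \<partial>M) \<longlonglongrightarrow> (\<integral>x. G x $ i $ j * \<phi> x \<partial>M)"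
        using Y.tendsto_ip_left[OF d(2) G(1,2) b] by (simp add: L2_ip_def inner_axis mult.commute)
      then have "(\<lambda>n. - (\<integral>x. grad \<Omega> (X n) x $ i $ j * \<phi> x \<partial>M)) \<longlonglongrightarrow> - (\<integral>x. G x $ i $ j * \<phi> x \<partial>M)"
        by (rule tendsto_minus)
      then show "(\<lambda>n. \<integral>x. X n x $ i * ?D x \<partial>M) \<longlonglongrightarrow> - (\<integral>x. G x $ i $ j * \<phi> x \<partial>M)"
        using d(3) \<phi> by (simp add: is_weak_gradient_def)
    qed
  qed
  note g = grad_AE_eq[OF v(1) G(1) this]
  have gY: "Y.sn (grad \<Omega> (X n) - grad \<Omega> v) = Y.sn (grad \<Omega> (X n) - G)" for n
    unfolding snorm_def L2_ip_def
    by (rule arg_cong[where f = sqrt], rule integral_cong_AE)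
      (use g(2) L2_measurable[OF G(1)] L2_measurable[OF W12_D(2)[OF g(1)]] L2_measurable[OF d(2)] in \<open>auto elim!: eventually_mono\<close>)
  have "(\<lambda>n. sqrt ((H.sn (X n - v))\<^sup>2 + (Y.sn (grad \<Omega> (X n) - G))\<^sup>2)) \<longlonglongrightarrow> sqrt (0\<^sup>2 + 0\<^sup>2)"
    using v(2) G(2) by (intro tendsto_intros)
  moreover have "W.sn (X n - v) = sqrt ((H.sn (X n - v))\<^sup>2 + (Y.sn (grad \<Omega> (X n) - G))\<^sup>2)" for n
    using sq[OF g(1), of n] W.sn_nonneg[of "X n - v"] X g(1) by (simp add: gY real_sqrt_unique)
  ultimately have "(\<lambda>n. W.sn (X n - v)) \<longlonglongrightarrow> 0" by simp
  then show "\<exists>v\<in>W12 \<Omega>. (\<lambda>n. W.sn (X n - v)) \<longlonglongrightarrow> 0" using g(1) by blast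
qed

end

section \<open>Poincare inequality and completeness of \<open>V\<close>\<close>

context bounded_open
begin

lemma test_functions_subset_W12: "test_functions \<Omega> \<subseteq> W12 \<Omega>"
  using test_function_W12(1) by auto

sublocale WH: semi_hilbert "W12 \<Omega>" "W_ip \<Omega>" by (rule semi_hilbert_W12)

lemma semi_hilbert_V_W_ip: "semi_hilbert (V_space \<Omega>) (W_ip \<Omega>)"
  unfolding V_eq_sclosure
  by (rule WH.semi_hilbert_sclosure[OF subspace_test_functions test_functions_subset_W12])

lemma V_subset_W12: "V_space \<Omega> \<subseteq> W12 \<Omega>"
  by (auto simp: W12_0_def)

lemma V_D:
  assumes "v \<in> V_space \<Omega>"
  shows "v \<in> W12 \<Omega>" "v \<in> L2 M" "grad \<Omega> v \<in> L2 M"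
  using assms V_subset_W12 W12_D by auto

lemma H_sn_le_W: "v \<in> W12 \<Omega> \<Longrightarrow> H.sn v \<le> W.sn v"
  and A_sn_le_W: "v \<in> W12 \<Omega> \<Longrightarrow> A.sn v \<le> W.sn v"
  by (rule power2_le_imp_le; simp add: W12_norm_sq W.sn_nonneg)+

text \<open>Both seminorms are continuous for the W12 norm, in which test functions are dense in
  \<open>V\<close>. The \<open>+ 1\<close> in the constant makes it positive.\<close>

lemma poincare: "\<exists>C>0. \<forall>v\<in>V_space \<Omega>. H.sn v \<le> C * A.sn v"
proof -
  obtain R where "\<forall>x\<in>\<Omega>. norm x < R"
    using bounded_\<Omega> unfolding bounded_pos_less by blast
  then have R: "\<Omega> \<subseteq> ball 0 R" by auto
  have test: "H.sn \<phi> \<le> (2 * \<bar>R\<bar> + 1) * A.sn \<phi>" if \<phi>: "\<phi> \<in> test_functions \<Omega>" for \<phi>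
  proof -
    have W: "\<phi> \<in> W12 \<Omega>" by (rule test_function_W12(1)[OF \<phi>])
    have "(H.sn \<phi>)\<^sup>2 = (\<integral>x. (norm (\<phi> x))\<^sup>2 \<partial>M)"
      using W12_D(1)[OF W] by (simp add: H.sn_sq) (simp add: L2_ip_def power2_norm_eq_inner)
    also have "\<dots> \<le> 4 * R\<^sup>2 * (\<integral>x. (norm (cgrad \<phi> x))\<^sup>2 \<partial>M)"
      by (rule poincare_test_functions[OF \<phi> \<Omega>_sets R])
    also have "(\<integral>x. (norm (cgrad \<phi> x))\<^sup>2 \<partial>M) = (\<integral>x. (norm (grad \<Omega> \<phi> x))\<^sup>2 \<partial>M)"
    proof (rule integral_cong_AE)
      note [measurable] = L2_measurable[OF cgrad_L2[OF \<phi> \<Omega>_sets]] L2_measurable[OF W12_D(2)[OF W]]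
      show "(\<lambda>x. (norm (cgrad \<phi> x))\<^sup>2) \<in> borel_measurable M"
        "(\<lambda>x. (norm (grad \<Omega> \<phi> x))\<^sup>2) \<in> borel_measurable M" by measurable
    qed (use test_function_W12(2)[OF \<phi>] in eventually_elim, simp)
    also have "(\<integral>x. (norm (grad \<Omega> \<phi> x))\<^sup>2 \<partial>M) = (A.sn \<phi>)\<^sup>2"
      using W by (simp add: A.sn_sq) (simp add: V_ip_def L2_ip_def power2_norm_eq_inner)
    also have "4 * R\<^sup>2 * (A.sn \<phi>)\<^sup>2 = (2 * \<bar>R\<bar> * A.sn \<phi>)\<^sup>2" by (simp add: power_mult_distrib)
    finally have "H.sn \<phi> \<le> 2 * \<bar>R\<bar> * A.sn \<phi>"
      by (rule power2_le_imp_le) (simp add: A.sn_nonneg[OF W])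
    then show ?thesis using A.sn_nonneg[OF W] by (simp add: algebra_simps)
  qed
  have "H.sn v \<le> (2 * \<bar>R\<bar> + 1) * A.sn v" if v: "v \<in> V_space \<Omega>" for v
  proof -
    obtain \<phi> where \<phi>: "\<And>n::nat. \<phi> n \<in> test_functions \<Omega>" "(\<lambda>n. W.sn (\<phi> n - v)) \<longlonglongrightarrow> 0"
      using WH.sclosure_approx[OF _ test_functions_subset_W12] v unfolding V_eq_sclosure by metis
    have W: "\<phi> n \<in> W12 \<Omega>" for n by (rule test_function_W12(1)[OF \<phi>(1)])
    note v = V_D[OF v]
    have "(\<lambda>n. H.sn (\<phi> n - v)) \<longlonglongrightarrow> 0"
      by (rule Lim_null_comparison[OF _ \<phi>(2)])
        (use W v H_sn_le_W H.sn_nonneg W12_D(1) in \<open>simp add: W.S_diff\<close>)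
    then have h: "(\<lambda>n. H.sn (\<phi> n)) \<longlonglongrightarrow> H.sn v" using W12_D(1)[OF W] v(2) by (intro H.tendsto_sn)
    have "(\<lambda>n. A.sn (\<phi> n - v)) \<longlonglongrightarrow> 0"
      by (rule Lim_null_comparison[OF _ \<phi>(2)])
        (use W v A_sn_le_W A.sn_nonneg in \<open>simp add: W.S_diff\<close>)
    then have a: "(\<lambda>n. A.sn (\<phi> n)) \<longlonglongrightarrow> A.sn v" using W v(1) by (intro A.tendsto_sn)
    show ?thesis
      by (rule LIMSEQ_le[OF h tendsto_mult_left[OF a]]) (use test[OF \<phi>(1)] in auto)
  qed
  then show ?thesis by (intro exI[of _ "2 * \<bar>R\<bar> + 1"]) auto
qed

text \<open>By the Poincare inequality the gradient seminorm is equivalent on \<open>V\<close> to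
  the W12 norm, so completeness carries over from the closure of the test functions.\<close>

sublocale V: semi_hilbert "V_space \<Omega>" "V_ip \<Omega>"
proof -
  interpret VW: semi_hilbert "V_space \<Omega>" "W_ip \<Omega>" by (rule semi_hilbert_V_W_ip)
  interpret V: semi_inner "V_space \<Omega>" "V_ip \<Omega>"
    by (rule A.semi_inner_subspace[OF VW.subspace_S V_subset_W12])
  obtain C where C: "0 < C" "\<And>v. v \<in> V_space \<Omega> \<Longrightarrow> H.sn v \<le> C * V.sn v" using poincare by blast
  have W_le: "W.sn v \<le> (C + 1) * V.sn v" if v: "v \<in> V_space \<Omega>" for v
  proof (rule power2_le_imp_le)
    note vv = V_D[OF v]
    have "(W.sn v)\<^sup>2 \<le> (C * V.sn v)\<^sup>2 + (V.sn v)\<^sup>2"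
      unfolding W12_norm_sq[OF vv(1)] using C(2)[OF v] H.sn_nonneg[OF vv(2)] by (intro add_right_mono power_mono)
    also have "\<dots> \<le> ((C + 1) * V.sn v)\<^sup>2"
      using C(1) by (simp add: power_mult_distrib power2_sum algebra_simps)
    finally show "(W.sn v)\<^sup>2 \<le> ((C + 1) * V.sn v)\<^sup>2" .
    show "0 \<le> (C + 1) * V.sn v" using C(1) V.sn_nonneg[OF v] by simp
  qed
  show "semi_hilbert (V_space \<Omega>) (V_ip \<Omega>)"
  proof
    fix X :: "nat \<Rightarrow> real^'d \<Rightarrow> real^'d"
    assume X: "\<forall>n. X n \<in> V_space \<Omega>" and Cau: "\<forall>e>0. \<exists>N. \<forall>m\<ge>N. \<forall>n\<ge>N. V.sn (X m - X n) < e"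
    have "\<forall>e>0. \<exists>N. \<forall>m\<ge>N. \<forall>n\<ge>N. W.sn (X m - X n) < e"
    proof (intro allI impI)
      fix e :: real assume "0 < e"
      then have "0 < e / (C + 1)" using C by simp
      then obtain N where N: "\<And>m n. m \<ge> N \<Longrightarrow> n \<ge> N \<Longrightarrow> V.sn (X m - X n) < e / (C + 1)" using Cau by meson
      have "W.sn (X m - X n) < e" if "m \<ge> N" "n \<ge> N" for m n
      proof -
        have "W.sn (X m - X n) \<le> (C + 1) * V.sn (X m - X n)" using X by (intro W_le) auto
        also have "\<dots> < e" using N[OF that] C(1) by (simp add: field_simps)
        finally show ?thesis .
      qed
      then show "\<exists>N. \<forall>m\<ge>N. \<forall>n\<ge>N. W.sn (X m - X n) < e" by blast
    qed
    from VW.complete[OF X this] obtain v where v: "v \<in> V_space \<Omega>" "(\<lambda>n. W.sn (X n - v)) \<longlonglongrightarrow> 0" by blast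
    have "norm (V.sn (X n - v)) \<le> W.sn (X n - v)" for n
      using A_sn_le_W[OF V_D(1)[OF V.S_diff]] V.sn_nonneg[OF V.S_diff] X v(1) by simp
    then have "(\<lambda>n. V.sn (X n - v)) \<longlonglongrightarrow> 0"
      by (intro Lim_null_comparison[OF _ v(2)]) simp
    then show "\<exists>v\<in>V_space \<Omega>. (\<lambda>n. V.sn (X n - v)) \<longlonglongrightarrow> 0" using v(1) by blast
  qed
qed

end

section \<open>Trace and deviator\<close>

lemma trace_eq_inner_mat: "trace A = A \<bullet> (mat 1 :: real^'d^'d)"
  by (simp add: trace_def inner_vec_def mat_def if_distrib[where f = "(*) _"] cong: if_cong)

lemma bounded_linear_trace: "bounded_linear (trace :: real^'d^'d \<Rightarrow> real)"
  unfolding trace_eq_inner_mat[abs_def] by (rule bounded_linear_inner_left)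

lemma trace_mat_1: "trace (mat 1 :: real^'d^'d) = real CARD('d)"
  by (simp add: trace_def mat_def)

lemma bounded_linear_dev: "bounded_linear (dev :: real^'d^'d \<Rightarrow> real^'d^'d)"
  unfolding dev_def[abs_def] trace_eq_inner_mat[abs_def] divide_inverse
  by (intro bounded_linear_sub bounded_linear_ident
      bounded_linear_compose[OF bounded_linear_scaleR_left]
      bounded_linear_compose[OF bounded_linear_mult_left] bounded_linear_inner_left)

lemma dev_inner_commute: "dev A \<bullet> B = A \<bullet> dev (B :: real^'d^'d)"
  by (simp add: dev_def inner_diff_left inner_diff_right trace_eq_inner_mat inner_commute)

lemma trace_dev: "trace (dev (A :: real^'d^'d)) = 0"
  using trace_mat_1[where 'd = 'd] by (simp add: dev_def trace_eq_inner_mat inner_diff_left)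

lemma dev_eq_self: "trace A = 0 \<Longrightarrow> dev A = A"
  by (simp add: dev_def)

text \<open>\<open>dev\<close> is the orthogonal projection onto the trace-free matrices.\<close>

lemma norm_dev_le: "norm (dev A) \<le> norm A"
proof -
  have "(norm (dev A))\<^sup>2 = A \<bullet> dev A"
    unfolding power2_norm_eq_inner dev_inner_commute by (simp add: dev_eq_self trace_dev)
  also have "\<dots> \<le> norm A * norm (dev A)" by (rule norm_cauchy_schwarz)
  finally show ?thesis by (cases "dev A = 0") (auto simp: power2_eq_square)
qed

definition dev_field :: "('a \<Rightarrow> real^'d^'d) \<Rightarrow> 'a \<Rightarrow> real^'d^'d" where
  "dev_field y = (\<lambda>x. dev (y x))"

lemma dev_field_linear:
  "dev_field (x + y) = dev_field x + dev_field y" "dev_field (c *\<^sub>R x) = c *\<^sub>R dev_field x"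
  "dev_field (x - y) = dev_field x - dev_field y" "dev_field 0 = 0"
  by (simp_all add: dev_field_def fun_eq_iff scaleR_fun_def
      linear_add[OF bounded_linear.linear[OF bounded_linear_dev]]
      linear_diff[OF bounded_linear.linear[OF bounded_linear_dev]]
      linear_scale[OF bounded_linear.linear[OF bounded_linear_dev]]
      linear_0[OF bounded_linear.linear[OF bounded_linear_dev]])

lemma L2_dev_field: "y \<in> L2 M \<Longrightarrow> dev_field y \<in> L2 M"
  unfolding dev_field_def by (rule L2_bounded_linear[OF bounded_linear_dev])

lemma L2_ip_dev_field: "L2_ip M (dev_field x) y = L2_ip M x (dev_field y)"
  by (simp add: L2_ip_def dev_field_def dev_inner_commute)

lemma L2_sn_dev_field_le:
  assumes "y \<in> L2 M" shows "snorm (L2_ip M) (dev_field y) \<le> snorm (L2_ip M) y"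
  unfolding snorm_def
proof (rule real_sqrt_le_mono)
  show "L2_ip M (dev_field y) (dev_field y) \<le> L2_ip M y y"
    unfolding L2_ip_def
  proof (rule integral_mono)
    show "integrable M (\<lambda>x. dev_field y x \<bullet> dev_field y x)" "integrable M (\<lambda>x. y x \<bullet> y x)"
      using assms L2_dev_field L2_inner_integrable by blast+
    show "dev_field y x \<bullet> dev_field y x \<le> y x \<bullet> y x" for x
      using power_mono[OF norm_dev_le[of "y x"], of 2] by (simp add: power2_norm_eq_inner dev_field_def)
  qed
qed

text \<open>With the self-adjointness of \<open>dev\<close> this lets a field and its deviator be
  exchanged when tested with gradients of functions in \<open>V\<^sub>\<sigma>\<close>.\<close>

lemma L2_ip_AE_dev:
  assumes "AE x in M. trace (y x) = 0" "x \<in> L2 M" "y \<in> L2 M"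
  shows "L2_ip M x (dev_field y) = L2_ip M x y"
  unfolding L2_ip_def
proof (rule integral_cong_AE)
  note [measurable] = assms(2,3)[THEN L2_measurable] L2_measurable[OF L2_dev_field[OF assms(3)]]
  show "(\<lambda>xa. x xa \<bullet> dev_field y xa) \<in> borel_measurable M" "(\<lambda>xa. x xa \<bullet> y xa) \<in> borel_measurable M"
    by measurable
qed (use assms(1) in eventually_elim, simp add: dev_field_def dev_eq_self)

context bounded_open
begin

text \<open>\<open>f = trace y\<close> satisfies \<open>\<parallel>f\<parallel>\<^sup>2 = \<langle>y, f I\<rangle>\<close>, so a weak limit of trace-free fields is trace-free.\<close>

lemma trace_zero_limit:
  fixes X :: "nat \<Rightarrow> real^'d \<Rightarrow> real^'d^'d"
  assumes X: "\<And>n. X n \<in> L2 M" "\<And>n. AE x in M. trace (X n x) = 0"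
    and y: "y \<in> L2 M" "(\<lambda>n. Y.sn (X n - y)) \<longlonglongrightarrow> 0"
  shows "AE x in M. trace (y x) = 0"
proof -
  let ?f = "\<lambda>x. trace (y x)"
  have f: "?f \<in> L2 M" by (rule L2_bounded_linear[OF bounded_linear_trace y(1)])
  let ?g = "\<lambda>x. ?f x *\<^sub>R (mat 1 :: real^'d^'d)"
  have g: "?g \<in> L2 M" by (rule L2_bounded_linear[OF bounded_linear_scaleR_left f])
  have "L2_ip M (X n) ?g = 0" for n
    unfolding L2_ip_def
    by (rule integral_eq_zero_AE) (use X(2)[of n] in \<open>auto simp: trace_eq_inner_mat\<close>)
  moreover have "(\<lambda>n. L2_ip M (X n) ?g) \<longlonglongrightarrow> L2_ip M y ?g"
    by (rule Y.tendsto_ip_left[OF X(1) y g])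
  ultimately have "L2_ip M y ?g = 0" by (simp add: LIMSEQ_const_iff)
  then have "(\<integral>x. ?f x * ?f x \<partial>M) = 0"
    by (simp add: L2_ip_def trace_eq_inner_mat)
  then have "AE x in M. ?f x * ?f x = 0"
    by (subst (asm) integral_nonneg_eq_0_iff_AE[OF L2_mult_integrable[OF f f]]) auto
  then show ?thesis by simp
qed

lemma tendsto_grad:
  assumes "\<And>n. X n \<in> W12 \<Omega>" "v \<in> W12 \<Omega>" "(\<lambda>n::nat. A.sn (X n - v)) \<longlonglongrightarrow> 0"
  shows "(\<lambda>n. Y.sn (grad \<Omega> (X n) - grad \<Omega> v)) \<longlonglongrightarrow> 0"
  using assms by (simp add: sn_V_diff)

lemma V_sigma_D:
  assumes "v \<in> V_sigma \<Omega>"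
  shows "v \<in> V_space \<Omega>" "AE x in M. trace (grad \<Omega> v x) = 0"
  using assms by (auto simp: V_sigma_def div_free_def divergence_def)

text \<open>Completeness of \<open>V\<^sub>\<sigma>\<close>: limits exist in \<open>V\<close>, and
  vanishing divergence survives L2 limits of the gradients.\<close>

sublocale Vs: semi_hilbert_sub "V_space \<Omega>" "V_sigma \<Omega>" "V_ip \<Omega>"
proof -
  have sub: "V_sigma \<Omega> \<subseteq> V_space \<Omega>" by (auto simp: V_sigma_def)
  note lin = linear_add[OF bounded_linear.linear[OF bounded_linear_trace]]
    linear_scale[OF bounded_linear.linear[OF bounded_linear_trace]]
  have "subspace (V_sigma \<Omega>)"
  proof (rule subspaceI)
    show "0 \<in> V_sigma \<Omega>"
      using zero_W12(2) by (auto simp: V_sigma_def div_free_def divergence_def trace_eq_inner_mat elim!: eventually_mono)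
  next
    fix v w assume v: "v \<in> V_sigma \<Omega>" and w: "w \<in> V_sigma \<Omega>"
    have "AE x in M. trace (grad \<Omega> (v + w) x) = 0"
      using V_sigma_D(2)[OF v] V_sigma_D(2)[OF w] 
        grad_add[OF V_D(1)[OF V_sigma_D(1)[OF v]] V_D(1)[OF V_sigma_D(1)[OF w]]]
      by eventually_elim (simp add: lin)
    then show "v + w \<in> V_sigma \<Omega>"
      using V_sigma_D(1)[OF v] V_sigma_D(1)[OF w] by (simp add: V_sigma_def div_free_def divergence_def)
  next
    fix c :: real and v assume v: "v \<in> V_sigma \<Omega>"
    have "AE x in M. trace (grad \<Omega> (c *\<^sub>R v) x) = 0"
      using V_sigma_D(2)[OF v] grad_scale[OF V_D(1)[OF V_sigma_D(1)[OF v]], of c]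
      by eventually_elim (simp add: lin)
    then show "c *\<^sub>R v \<in> V_sigma \<Omega>"
      using V_sigma_D(1)[OF v] by (simp add: V_sigma_def div_free_def divergence_def)
  qed
  then interpret S: semi_inner "V_sigma \<Omega>" "V_ip \<Omega>" by (rule V.semi_inner_subspace[OF _ sub])
  show "semi_hilbert_sub (V_space \<Omega>) (V_sigma \<Omega>) (V_ip \<Omega>)"
  proof (unfold_locales)
    fix X :: "nat \<Rightarrow> real^'d \<Rightarrow> real^'d"
    assume X: "\<forall>n. X n \<in> V_sigma \<Omega>" and Cau: "\<forall>e>0. \<exists>N. \<forall>m\<ge>N. \<forall>n\<ge>N. S.sn (X m - X n) < e"
    have XV: "\<forall>n. X n \<in> V_space \<Omega>" using X sub by auto
    from V.complete[OF this Cau] obtain v where v: "v \<in> V_space \<Omega>" "(\<lambda>n. S.sn (X n - v)) \<longlonglongrightarrow> 0" by blast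
    have "AE x in M. trace (grad \<Omega> v x) = 0"
      by (rule trace_zero_limit[OF _ _ _ tendsto_grad[of X v]])
        (use V_D XV v V_sigma_D(2) X in auto)
    then show "\<exists>v\<in>V_sigma \<Omega>. (\<lambda>n. S.sn (X n - v)) \<longlonglongrightarrow> 0"
      using v by (intro bexI[of _ v]) (auto simp: V_sigma_def div_free_def divergence_def)
  qed (rule sub)
qed

section \<open>Fields with vanishing weak divergence\<close>

text \<open>Kernel of \<open>L\<^sup>*\<close>: the freedom left in \<open>y\<close> once
  \<open>L\<^sup>*y\<close> is prescribed. \<open>dev_K\<close> below is the resulting freedom in
  \<open>dev y\<close>, and its closure decides how small the functional can be made.\<close>

definition K_space :: "(real^'d \<Rightarrow> real^'d^'d) set" where
  "K_space = {k \<in> L2 M. \<forall>w\<in>V_space \<Omega>. L2_ip M k (grad \<Omega> w) = 0}"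

definition dev_K :: "(real^'d \<Rightarrow> real^'d^'d) set" where
  "dev_K = dev_field ` K_space"

lemma subspace_dev_K: "subspace dev_K" and dev_K_subset: "dev_K \<subseteq> L2 M"
proof -
  have "subspace K_space"
    by (rule subspaceI) (auto simp: K_space_def V_D Y.ip_simps)
  moreover have "linear (dev_field :: (real^'d \<Rightarrow> real^'d^'d) \<Rightarrow> _)"
    by (rule linearI) (simp_all add: dev_field_linear)
  ultimately show "subspace dev_K" unfolding dev_K_def by (intro linear_subspace_image)
  show "dev_K \<subseteq> L2 M" by (auto simp: dev_K_def K_space_def L2_dev_field)
qed

text \<open>Helmholtz-type splitting: \<open>B\<close> minus the gradient of \<open>r\<close> lies
  in \<open>K_space\<close>, so the gradient of \<open>r\<close> is the projection of
  \<open>B\<close> onto gradients.\<close>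

lemma grad_riesz:
  assumes B: "B \<in> L2 M" obtains r where "r \<in> V_space \<Omega>" "\<And>w. w \<in> V_space \<Omega> \<Longrightarrow> L2_ip M B (grad \<Omega> w) = V_ip \<Omega> r w"
proof -
  have ip_cong: "L2_ip M B f = L2_ip M B g" if "f \<in> L2 M" "g \<in> L2 M" "AE x in M. f x = g x" for f g
    using L2_ip_cong_AE[OF that B] Y.ip_commute[OF B that(1)] Y.ip_commute[OF B that(2)] by simp
  have "\<exists>r\<in>V_space \<Omega>. \<forall>w\<in>V_space \<Omega>. L2_ip M B (grad \<Omega> w) = V_ip \<Omega> r w"
  proof (rule V.riesz[where C = "Y.sn B"])
    fix v w assume v: "v \<in> V_space \<Omega>" and w: "w \<in> V_space \<Omega>"
    have "L2_ip M B (grad \<Omega> (v + w)) = L2_ip M B (grad \<Omega> v + grad \<Omega> w)"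
      by (rule ip_cong) (use grad_add V_D[OF v] V_D[OF w] V_D[OF V.S_add[OF v w]] in auto)
    then show "L2_ip M B (grad \<Omega> (v + w)) = L2_ip M B (grad \<Omega> v) + L2_ip M B (grad \<Omega> w)"
      using V_D[OF v] V_D[OF w] B by (simp add: Y.ip_simps)
  next
    fix c v assume v: "v \<in> V_space \<Omega>"
    have "L2_ip M B (grad \<Omega> (c *\<^sub>R v)) = L2_ip M B (c *\<^sub>R grad \<Omega> v)"
    proof (rule ip_cong)
      show "AE x in M. grad \<Omega> (c *\<^sub>R v) x = (c *\<^sub>R grad \<Omega> v) x"
        using grad_scale[OF V_D(1)[OF v]] by (simp add: scaleR_fun_def)
    qed (use V_D[OF v] V_D[OF V.S_scale[OF v]] in auto)
    then show "L2_ip M B (grad \<Omega> (c *\<^sub>R v)) = c * L2_ip M B (grad \<Omega> v)"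
      using V_D[OF v] B by (simp add: Y.ip_simps)
  next
    fix v assume v: "v \<in> V_space \<Omega>"
    show "\<bar>L2_ip M B (grad \<Omega> v)\<bar> \<le> Y.sn B * V.sn v"
      using Y.ip_le_sn[OF B V_D(3)[OF v]] by (simp add: snorm_def V_ip_def)
  qed
  then show ?thesis using that by blast
qed

text \<open>A trace-free field orthogonal to \<open>dev_K\<close> is orthogonal to \<open>K_space\<close>, hence the gradient of a
  function in \<open>V\<close>, and of one in \<open>V\<^sub>\<sigma>\<close> because it is trace-free. This replaces the closed range
  of the divergence operator.\<close>

lemma mem_sclosure_dev_K:
  assumes b: "b \<in> L2 M" "AE x in M. trace (b x) = 0"
    and orth: "\<And>w. w \<in> V_sigma \<Omega> \<Longrightarrow> L2_ip M b (grad \<Omega> w) = 0"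
  shows "b \<in> sclosure (L2 M) (L2_ip M) dev_K"
proof -
  let ?C = "sclosure (L2 M) (L2_ip M) dev_K"
  have CS: "?C \<subseteq> L2 M" by (auto simp: sclosure_def)
  interpret C: semi_hilbert_sub "L2 M" ?C "L2_ip M"
    using Y.semi_hilbert_sclosure[OF subspace_dev_K dev_K_subset] CS
    by (intro semi_hilbert_sub.intro Y.semi_inner_axioms semi_hilbert_sub_axioms.intro)
  \<comment> \<open>It suffices that the remainder \<open>b - q\<close> has seminorm zero, since
    then \<open>b\<close> is approximated as well as \<open>q\<close> is.\<close>
  define q where "q = proj ?C (L2_ip M) b"
  have q: "q \<in> ?C" "q \<in> L2 M" "\<And>m. m \<in> ?C \<Longrightarrow> L2_ip M q m = L2_ip M b m"
    using C.proj_mem[OF b(1)] CS C.ip_proj[OF b(1)] by (auto simp: q_def)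
  obtain d where d: "\<And>n::nat. d n \<in> dev_K" "(\<lambda>n. Y.sn (d n - q)) \<longlonglongrightarrow> 0"
    using Y.sclosure_approx[OF q(1) dev_K_subset] by blast
  have dY: "d n \<in> L2 M" for n using d(1) dev_K_subset by auto
  have "AE x in M. trace (d n x) = 0" for n
    using d(1)[of n] by (auto simp: dev_K_def dev_field_def trace_dev)
  then have tq: "AE x in M. trace (q x) = 0" by (rule trace_zero_limit[OF dY _ q(2) d(2)])
  define B where "B = b - q"
  have B: "B \<in> L2 M" using b q by (simp add: B_def)
  have tB: "AE x in M. trace (B x) = 0"
    using b(2) tq by eventually_elim (simp add: B_def trace_sub)
  have BK: "L2_ip M B k = 0" if k: "k \<in> K_space" for k
  proof -
    have kY: "k \<in> L2 M" using k by (simp add: K_space_def)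
    have "dev_field k \<in> ?C" using k Y.subset_sclosure[OF dev_K_subset] by (auto simp: dev_K_def)
    then have "L2_ip M B (dev_field k) = 0"
      using q b L2_dev_field[OF kY] by (simp add: B_def Y.ip_simps)
    moreover have "L2_ip M B (dev_field k) = L2_ip M k (dev_field B)"
      using Y.ip_commute[OF B L2_dev_field[OF kY]] by (simp add: L2_ip_dev_field)
    ultimately show ?thesis using L2_ip_AE_dev[OF tB kY B] Y.ip_commute[OF B kY] by simp
  qed
  obtain r where r: "r \<in> V_space \<Omega>" "\<And>w. w \<in> V_space \<Omega> \<Longrightarrow> L2_ip M B (grad \<Omega> w) = V_ip \<Omega> r w"
    using grad_riesz[OF B] by blast
  note rY = V_D(3)[OF r(1)]
  \<comment> \<open>\<open>B\<close> and the gradient of \<open>r\<close> are both orthogonal to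
    \<open>K_space\<close>, while their difference lies in it; the difference is therefore
    orthogonal to itself.\<close>
  have kK: "B - grad \<Omega> r \<in> K_space"
    using r B V_D by (auto simp: K_space_def Y.ip_simps V_ip_def)
  have "L2_ip M (B - grad \<Omega> r) (B - grad \<Omega> r) = L2_ip M B (B - grad \<Omega> r) - L2_ip M (grad \<Omega> r) (B - grad \<Omega> r)"
    using B rY by (simp add: Y.ip_simps)
  also have "\<dots> = 0" using BK[OF kK] kK r(1) Y.ip_commute[of "grad \<Omega> r" "B - grad \<Omega> r"] B rY
    by (simp add: K_space_def)
  finally have z: "Y.sn (B - grad \<Omega> r) = 0" by (simp add: snorm_def)
  have "AE x in M. trace (grad \<Omega> r x) = 0"
    by (rule trace_zero_limit[of "\<lambda>_. B"]) (use B tB rY z in auto)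
  then have rs: "r \<in> V_sigma \<Omega>" using r(1) by (simp add: V_sigma_def div_free_def divergence_def)
  have dr: "L2_ip M (d n) (grad \<Omega> r) = 0" for n
  proof -
    obtain k where k: "k \<in> K_space" "d n = dev_field k" using d(1)[of n] by (auto simp: dev_K_def)
    have "L2_ip M (d n) (grad \<Omega> r) = L2_ip M k (grad \<Omega> r)"
      unfolding k(2) L2_ip_dev_field
      by (rule L2_ip_AE_dev[OF V_sigma_D(2)[OF rs] _ rY]) (use k in \<open>simp add: K_space_def\<close>)
    then show ?thesis using k(1) r(1) by (simp add: K_space_def)
  qed
  have "(\<lambda>n. L2_ip M (d n) (grad \<Omega> r)) \<longlonglongrightarrow> L2_ip M q (grad \<Omega> r)"
    by (rule Y.tendsto_ip_left[OF dY q(2) d(2) rY])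
  then have "L2_ip M q (grad \<Omega> r) = 0" by (simp add: dr LIMSEQ_const_iff)
  then have Br: "L2_ip M B (grad \<Omega> r) = 0" using orth[OF rs] b q rY by (simp add: B_def Y.ip_simps)
  have "L2_ip M B B = L2_ip M B (B - grad \<Omega> r) + L2_ip M B (grad \<Omega> r)"
    using B rY by (simp add: Y.ip_simps)
  then have B0: "Y.sn B = 0" using BK[OF kK] Br by (simp add: snorm_def)
  have "\<exists>e\<in>dev_K. Y.sn (b - e) < \<epsilon>" if "0 < \<epsilon>" for \<epsilon>
  proof -
    have "\<exists>e\<in>dev_K. Y.sn (q - e) < \<epsilon>" using q(1) \<open>0 < \<epsilon>\<close> unfolding sclosure_def by blast
    then obtain e where e: "e \<in> dev_K" "Y.sn (q - e) < \<epsilon>" by blast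
    have "Y.sn (b - e) \<le> Y.sn (b - q) + Y.sn (q - e)"
      using e dev_K_subset b q by (intro Y.sn_diff_triangle) auto
    then have "Y.sn (b - e) < \<epsilon>" using e(2) B0 by (simp add: B_def)
    then show ?thesis using e(1) by blast
  qed
  then show ?thesis using b by (auto simp: sclosure_def)
qed

end

section \<open>Weak derivatives on an interval\<close>

lemma complete_measure_lebesgue_on: "S \<in> sets lebesgue \<Longrightarrow> complete_measure (lebesgue_on S)"
proof
  fix A B assume S: "S \<in> sets lebesgue" and "B \<subseteq> A" "A \<in> null_sets (lebesgue_on S)"
  then have "A \<subseteq> S" "A \<in> null_sets lebesgue" by (auto simp: null_sets_restrict_space)
  then have "B \<in> null_sets lebesgue" using \<open>B \<subseteq> A\<close> completion.complete2 by blast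
  then show "B \<in> sets (lebesgue_on S)"
    using \<open>A \<subseteq> S\<close> \<open>B \<subseteq> A\<close> S by (auto simp: sets_restrict_space_iff)
qed

lemma space_time_interval [simp]: "space (time_interval T) = {0<..<T}"
  by (simp add: space_restrict_space)

lemma finite_measure_time_interval: "finite_measure (time_interval T)"
proof
  have "emeasure lborel {0<..<T} < \<infinity>" by (cases "0 \<le> T") auto
  then show "emeasure (time_interval T) (space (time_interval T)) \<noteq> \<infinity>"
    by (simp add: emeasure_restrict_space)
qed

lemma measurable_time_interval:
  "f \<in> borel_measurable borel \<Longrightarrow> f \<in> borel_measurable (time_interval T)"
  by (intro measurable_restrict_space1 measurable_completion) simp

text \<open>The primitive that vanishes at 0, extended to all real \<open>t\<close>: it is 0 for
  \<open>t \<le> 0\<close> and constant for \<open>t \<ge> T\<close>, so continuity and estimates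
  need no cases at the end points.\<close>

definition prim :: "real \<Rightarrow> (real \<Rightarrow> real) \<Rightarrow> real \<Rightarrow> real" where
  "prim T \<beta> t = (\<integral>s. indicator {..<t} s * \<beta> s \<partial>time_interval T)"

lemma integrable_indicator_mult:
  fixes \<beta> :: "real \<Rightarrow> real"
  assumes "integrable (time_interval T) \<beta>" "A \<in> sets borel"
  shows "integrable (time_interval T) (\<lambda>s. indicator A s * \<beta> s)"
proof (rule Bochner_Integration.integrable_bound[OF assms(1)])
  have [measurable]: "\<beta> \<in> borel_measurable (time_interval T)" using assms(1) by simp
  have [measurable]: "(indicator A :: real \<Rightarrow> real) \<in> borel_measurable (time_interval T)"
    using assms(2) by (intro measurable_time_interval) simp
  show "(\<lambda>s. indicator A s * \<beta> s) \<in> borel_measurable (time_interval T)" by measurable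
qed (auto simp: indicator_def)

lemma prim_add: "integrable (time_interval T) f \<Longrightarrow> integrable (time_interval T) g \<Longrightarrow>
    prim T (\<lambda>s. f s + g s) t = prim T f t + prim T g t"
  by (simp add: prim_def distrib_left integrable_indicator_mult)

lemma prim_diff_fun: "integrable (time_interval T) f \<Longrightarrow> integrable (time_interval T) g \<Longrightarrow>
    prim T (\<lambda>s. f s - g s) t = prim T f t - prim T g t"
  by (simp add: prim_def right_diff_distrib integrable_indicator_mult)

lemma prim_mult: "prim T (\<lambda>s. c * f s) t = c * prim T f t"
  by (simp add: prim_def mult.left_commute)

lemma prim_diff:
  assumes "integrable (time_interval T) \<beta>" "s \<le> t"
  shows "prim T \<beta> t - prim T \<beta> s = (\<integral>r. indicator {s..<t} r * \<beta> r \<partial>time_interval T)"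
proof -
  have "prim T \<beta> t - prim T \<beta> s = (\<integral>r. indicator {..<t} r * \<beta> r - indicator {..<s} r * \<beta> r \<partial>time_interval T)"
    unfolding prim_def using assms(1) by (simp add: integrable_indicator_mult)
  also have "\<dots> = (\<integral>r. indicator {s..<t} r * \<beta> r \<partial>time_interval T)"
    using assms(2) by (intro Bochner_Integration.integral_cong) (auto simp: indicator_def)
  finally show ?thesis .
qed

lemma prim_mono:
  assumes "integrable (time_interval T) \<beta>" "\<And>r. 0 \<le> \<beta> r" "s \<le> t"
  shows "prim T \<beta> s \<le> prim T \<beta> t"
proof -
  have "0 \<le> (\<integral>r. indicator {s..<t} r * \<beta> r \<partial>time_interval T)"
    using assms(2) by (intro Bochner_Integration.integral_nonneg mult_nonneg_nonneg) auto
  then show ?thesis using prim_diff[OF assms(1,3)] by simp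
qed

lemma abs_prim_diff_le:
  assumes "integrable (time_interval T) \<beta>" "integrable (time_interval T) h"
    "AE r in time_interval T. \<bar>\<beta> r\<bar> \<le> h r" "s \<le> t"
  shows "\<bar>prim T \<beta> t - prim T \<beta> s\<bar> \<le> prim T h t - prim T h s"
  unfolding prim_diff[OF assms(1,4)] prim_diff[OF assms(2,4)]
proof (rule order_trans[OF integral_abs_bound], rule integral_mono_AE)
  show "AE r in time_interval T. \<bar>indicator {s..<t} r * \<beta> r\<bar> \<le> indicator {s..<t} r * h r"
    using assms(3) by eventually_elim (auto simp: indicator_def)
qed (use assms in \<open>auto intro!: integrable_indicator_mult integrable_abs\<close>)

lemma prim_le_integral:
  assumes "integrable (time_interval T) h" "AE r in time_interval T. \<bar>\<beta> r\<bar> \<le> h r" "integrable (time_interval T) \<beta>"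
  shows "\<bar>prim T \<beta> t\<bar> \<le> (\<integral>r. h r \<partial>time_interval T)"
  unfolding prim_def
proof (rule order_trans[OF integral_abs_bound], rule integral_mono_AE)
  show "AE r in time_interval T. \<bar>indicator {..<t} r * \<beta> r\<bar> \<le> h r"
    using assms(2) by eventually_elim (auto simp: indicator_def)
qed (use assms in \<open>auto intro!: integrable_indicator_mult integrable_abs\<close>)

lemma tendsto_prim:
  assumes "integrable (time_interval T) \<beta>" "X \<longlonglongrightarrow> t"
  shows "(\<lambda>n. prim T \<beta> (X n)) \<longlonglongrightarrow> prim T \<beta> t"
  unfolding prim_def
proof (rule integral_dominated_convergence[where w = "\<lambda>r. norm (\<beta> r)"])
  have "{t} \<in> null_sets lebesgue" by simp
  then have "AE r in lebesgue. r \<notin> {t}" by (rule AE_not_in)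
  then have "AE r in lebesgue. r \<in> {0<..<T} \<longrightarrow> r \<noteq> t" by eventually_elim simp
  then have "AE r in time_interval T. r \<noteq> t" by (simp add: AE_restrict_space_iff)
  then show "AE r in time_interval T. (\<lambda>n. indicator {..<X n} r * \<beta> r) \<longlonglongrightarrow> indicator {..<t} r * \<beta> r"
  proof eventually_elim
    case (elim r)
    have "\<forall>\<^sub>F n in sequentially. indicator {..<t} r * \<beta> r = indicator {..<X n} r * \<beta> r"
    proof (cases "r < t")
      case True
      from order_tendstoD(1)[OF assms(2) True] show ?thesis by eventually_elim (use True in simp)
    next
      case False
      with elim have "t < r" by simp
      from order_tendstoD(2)[OF assms(2) this] show ?thesis
        by eventually_elim (use \<open>t < r\<close> in simp)
    qed
    then show ?case by (rule Lim_transform_eventually[OF tendsto_const])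
  qed
  show "(\<lambda>s. indicator {..<t} s * \<beta> s) \<in> borel_measurable (time_interval T)"
    "(\<lambda>s. indicator {..<X n} s * \<beta> s) \<in> borel_measurable (time_interval T)" for n
    by (rule borel_measurable_integrable[OF integrable_indicator_mult[OF assms(1)]], simp)+
qed (use assms(1) in \<open>auto simp: indicator_def\<close>)

lemma prim_0: "prim T \<beta> 0 = 0"
  unfolding prim_def by (rule integral_eq_zero_AE) (auto intro!: AE_I2 simp: indicator_def)

lemma prim_T: "prim T \<beta> T = (\<integral>s. \<beta> s \<partial>time_interval T)"
  unfolding prim_def by (rule Bochner_Integration.integral_cong) auto

lemma prim_measurable [measurable]:
  assumes "integrable (time_interval T) \<beta>" shows "prim T \<beta> \<in> borel_measurable borel"
proof (rule borel_measurable_continuous_onI)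
  show "continuous_on UNIV (prim T \<beta>)"
    by (simp add: continuous_on_sequentially comp_def tendsto_prim[OF assms])
qed

lemma integrable_prim:
  assumes "integrable (time_interval T) \<beta>" shows "integrable (time_interval T) (prim T \<beta>)"
proof -
  interpret finite_measure "time_interval T" by (rule finite_measure_time_interval)
  show ?thesis
  proof (rule integrable_const_bound)
    show "AE t in time_interval T. norm (prim T \<beta> t) \<le> (\<integral>r. \<bar>\<beta> r\<bar> \<partial>time_interval T)"
      using prim_le_integral[OF integrable_abs[OF assms] _ assms] by auto
    show "prim T \<beta> \<in> borel_measurable (time_interval T)"
      using prim_measurable[OF assms] by (rule measurable_time_interval)
  qed
qed

text \<open>Both sides integrate \<open>f s * g t\<close> over the triangle
  \<open>s \<le> t\<close>. The closed \<open>{..t}\<close> on the left matches the half-open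
  \<open>{..<s}\<close> in \<open>prim\<close>: the complement of \<open>t < s\<close> is exactly
  \<open>s \<le> t\<close>.\<close>

lemma prim_Fubini:
  assumes f: "integrable (time_interval T) f" and g: "integrable (time_interval T) g"
  shows "(\<integral>t. (\<integral>s. indicator {..t} s * f s \<partial>time_interval T) * g t \<partial>time_interval T)
    = (\<integral>s. f s * ((\<integral>t. g t \<partial>time_interval T) - prim T g s) \<partial>time_interval T)"
proof -
  let ?M = "time_interval T"
  interpret finite_measure ?M by (rule finite_measure_time_interval)
  interpret pair_sigma_finite ?M ?M ..
  have [measurable]: "f \<in> borel_measurable ?M" "g \<in> borel_measurable ?M" using f g by auto
  have [measurable]: "(\<lambda>x. x) \<in> borel_measurable ?M" by (rule measurable_time_interval) simp
  have [measurable]: "fst \<in> borel_measurable (?M \<Otimes>\<^sub>M ?M)" "snd \<in> borel_measurable (?M \<Otimes>\<^sub>M ?M)"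
    using measurable_compose[OF measurable_fst[of ?M ?M], of "\<lambda>x. x" borel]
      measurable_compose[OF measurable_snd[of ?M ?M], of "\<lambda>x. x" borel] by auto
  let ?F = "\<lambda>s t. if s \<le> t then f s * g t else 0"
  have [measurable]: "case_prod ?F \<in> borel_measurable (?M \<Otimes>\<^sub>M ?M)"
    unfolding split_beta' by measurable
  have "integrable (?M \<Otimes>\<^sub>M ?M) (case_prod ?F)"
  proof (rule Fubini_integrable)
    have bd: "norm (?F s t) \<le> norm (f s) * norm (g t)" for s t by (auto simp: abs_mult)
    have i: "integrable ?M (\<lambda>t. norm (f s) * norm (g t))" for s using g by simp
    have Fi: "integrable ?M (?F s)" if "s \<in> space ?M" for s
    proof (rule Bochner_Integration.integrable_bound[OF i])
      show "?F s \<in> borel_measurable ?M" using that by measurable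
    qed (use bd in \<open>auto simp: abs_mult\<close>)
    then show "AE s in ?M. integrable ?M (\<lambda>t. case_prod ?F (s, t))" by (intro AE_I2) simp
    show "integrable ?M (\<lambda>s. \<integral>t. norm (case_prod ?F (s, t)) \<partial>?M)"
    proof (rule Bochner_Integration.integrable_bound)
      show "integrable ?M (\<lambda>s. norm (f s) * (\<integral>t. norm (g t) \<partial>?M))" using f by simp
      show "AE s in ?M. norm (\<integral>t. norm (case_prod ?F (s, t)) \<partial>?M) \<le> norm (norm (f s) * (\<integral>t. norm (g t) \<partial>?M))"
      proof (rule AE_I2)
        fix s assume "s \<in> space ?M"
        have "(\<integral>t. norm (case_prod ?F (s, t)) \<partial>?M) \<le> (\<integral>t. norm (f s) * norm (g t) \<partial>?M)"
          using Fi[OF \<open>s \<in> space ?M\<close>] i bd by (intro integral_mono) auto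
        then show "norm (\<integral>t. norm (case_prod ?F (s, t)) \<partial>?M) \<le> norm (norm (f s) * (\<integral>t. norm (g t) \<partial>?M))"
          by simp
      qed
    qed measurable
  qed measurable
  from Fubini_integral[OF this] have "(\<integral>t. (\<integral>s. ?F s t \<partial>?M) \<partial>?M) = (\<integral>s. (\<integral>t. ?F s t \<partial>?M) \<partial>?M)" .
  moreover have "(\<integral>s. ?F s t \<partial>?M) = (\<integral>s. indicator {..t} s * f s \<partial>?M) * g t" for t
  proof -
    have "(\<integral>s. ?F s t \<partial>?M) = (\<integral>s. indicator {..t} s * f s * g t \<partial>?M)"
      by (rule Bochner_Integration.integral_cong) (auto simp: indicator_def)
    then show ?thesis by simp
  qed
  moreover have "(\<integral>t. ?F s t \<partial>?M) = f s * ((\<integral>t. g t \<partial>?M) - prim T g s)" for s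
  proof -
    have "(\<integral>t. ?F s t \<partial>?M) = (\<integral>t. f s * (g t - indicator {..<s} t * g t) \<partial>?M)"
      by (rule Bochner_Integration.integral_cong) (auto simp: indicator_def)
    also have "\<dots> = f s * (\<integral>t. g t - indicator {..<s} t * g t \<partial>?M)" by simp
    also have "(\<integral>t. g t - indicator {..<s} t * g t \<partial>?M) = (\<integral>t. g t \<partial>?M) - prim T g s"
      using g by (simp add: prim_def integrable_indicator_mult)
    finally show ?thesis .
  qed
  ultimately show ?thesis by simp
qed

lemma test_function_interval:
  assumes "\<phi> \<in> test_functions {0<..<T::real}" "0 < T"
  obtains a b where "0 < a" "a \<le> b" "b < T" "\<And>x. x \<notin> {a..b} \<Longrightarrow> \<phi> x = 0"
proof -
  obtain K where K: "compact K" "K \<subseteq> {0<..<T}" "\<And>x. x \<notin> K \<Longrightarrow> \<phi> x = 0"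
    using assms(1) by (auto simp: test_functions_def)
  show ?thesis
  proof (cases "K = {}")
    case True
    then show ?thesis using that[of "T/2" "T/2"] K(3) assms(2) by auto
  next
    case False
    obtain a where a: "a \<in> K" "\<And>x. x \<in> K \<Longrightarrow> a \<le> x" using compact_attains_inf[OF K(1) False] by blast
    obtain b where b: "b \<in> K" "\<And>x. x \<in> K \<Longrightarrow> x \<le> b" using compact_attains_sup[OF K(1) False] by blast
    show ?thesis by (rule that[of a b]) (use a b K in auto)
  qed
qed

lemma test_function_real:
  fixes \<phi> :: "real \<Rightarrow> real"
  assumes "\<phi> \<in> test_functions S"
  shows "(\<phi> has_real_derivative deriv \<phi> x) (at x)" "continuous_on UNIV \<phi>" "continuous_on UNIV (deriv \<phi>)"
proof -
  have d: "(\<phi> has_real_derivative frechet_derivative \<phi> (at x) 1) (at x)" for x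
  proof -
    have h: "(\<phi> has_derivative frechet_derivative \<phi> (at x)) (at x)"
      by (rule test_functions_derivative(1)[OF assms])
    have "frechet_derivative \<phi> (at x) h = frechet_derivative \<phi> (at x) 1 * h" for h
      using linear_scale[OF has_derivative_linear[OF h], of h 1] by simp
    then have "frechet_derivative \<phi> (at x) = (\<lambda>h. frechet_derivative \<phi> (at x) 1 * h)" by (rule ext)
    then show ?thesis using h by (simp add: has_field_derivative_def)
  qed
  then have eq: "deriv \<phi> = (\<lambda>x. frechet_derivative \<phi> (at x) 1)" using DERIV_imp_deriv by blast
  show "(\<phi> has_real_derivative deriv \<phi> x) (at x)" using d eq by simp
  show "continuous_on UNIV \<phi>" by (rule test_functions_derivative(2)[OF assms])
  show "continuous_on UNIV (deriv \<phi>)"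
    using test_functions_derivative(3)[OF assms, of 1] eq by simp
qed

text \<open>The primitive starting at 0 is constant on either side of the support of
  \<open>\<eta>\<close>: equal to 0 on the left and to the total integral, again 0, on the
  right.\<close>

lemma test_primitive:
  fixes \<eta> :: "real \<Rightarrow> real"
  assumes \<eta>: "\<eta> \<in> test_functions {0<..<T}" and T: "0 < T" and z: "(\<integral>t. \<eta> t \<partial>time_interval T) = 0"
  obtains \<phi> where "\<phi> \<in> test_functions {0<..<T}" "deriv \<phi> = \<eta>"
    "\<And>t. t \<in> {0<..<T} \<Longrightarrow> \<phi> t = (\<integral>s. indicator {..t} s * \<eta> s \<partial>time_interval T)"
proof -
  obtain a b where ab: "0 < a" "a \<le> b" "b < T" "\<And>x. x \<notin> {a..b} \<Longrightarrow> \<eta> x = 0"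
    using test_function_interval[OF \<eta> T] by blast
  have c\<eta>: "continuous_on UNIV \<eta>" by (rule test_functions_derivative(2)[OF \<eta>])
  then have ic: "isCont \<eta> x" for x by (simp add: continuous_on_eq_continuous_at)
  obtain F where F: "\<And>x. (F has_vector_derivative \<eta> x) (at x)"
    using einterval_antiderivative[of "-\<infinity>" \<infinity> \<eta>] ic by auto
  define \<phi> where "\<phi> t = F t - F 0" for t
  have d: "(\<phi> has_real_derivative \<eta> x) (at x)" for x
    unfolding \<phi>_def using F[of x] by (auto simp: has_real_derivative_iff_has_vector_derivative intro!: derivative_eq_intros)
  have ind: "(\<integral>s. indicator {..t} s * \<eta> s \<partial>time_interval T) = \<phi> t" if "0 \<le> t" "t \<le> T" for t
  proof -
    have "(\<integral>s. indicator {..t} s * \<eta> s \<partial>time_interval T)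
        = (\<integral>s. indicator {0<..<T} s *\<^sub>R (indicator {..t} s * \<eta> s) \<partial>lebesgue)"
      by (subst integral_restrict_space) auto
    also have "\<dots> = (\<integral>s. \<eta> s * indicator {0..t} s \<partial>lebesgue)"
    proof (rule Bochner_Integration.integral_cong)
      fix s show "indicator {0<..<T} s *\<^sub>R (indicator {..t} s * \<eta> s) = \<eta> s * indicator {0..t} s"
        using ab that by (cases "s \<in> {a..b}") (auto simp: indicator_def)
    qed simp
    also have "\<dots> = (\<integral>s. \<eta> s * indicator {0..t} s \<partial>lborel)"
    proof (rule integral_completion)
      have [measurable]: "\<eta> \<in> borel_measurable borel" using c\<eta> by (rule borel_measurable_continuous_onI)
      show "(\<lambda>s. \<eta> s * indicator {0..t} s) \<in> borel_measurable lborel" by measurable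
    qed
    also have "\<dots> = \<phi> t - \<phi> 0" by (rule integral_FTC_Icc_real) (use that d ic in auto)
    finally show ?thesis by (simp add: \<phi>_def)
  qed
  have "\<phi> t = 0" if out: "t \<notin> {a..b}" for t
  proof -
    consider "t < a" | "b < t" using out by (meson atLeastAtMost_iff not_le)
    then show ?thesis
    proof cases
      case 1
      have "\<phi> t = \<phi> 0"
      proof (rule has_field_derivative_zero_constant[where s = "{..<a}", THEN exE])
        show "(\<phi> has_field_derivative 0) (at x within {..<a})" if "x \<in> {..<a}" for x
          using d[of x] ab(4)[of x] that by (auto intro: has_field_derivative_at_within)
      qed (use 1 ab in auto)
      then show ?thesis by (simp add: \<phi>_def)
    next
      case 2
      have "\<phi> T = 0"
      proof -
        have "\<phi> T = (\<integral>s. indicator {..T} s * \<eta> s \<partial>time_interval T)" using ind[of T] T by simp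
        also have "\<dots> = (\<integral>s. \<eta> s \<partial>time_interval T)" by (rule Bochner_Integration.integral_cong) auto
        finally show ?thesis using z by simp
      qed
      moreover have "\<phi> t = \<phi> T"
      proof (rule has_field_derivative_zero_constant[where s = "{b<..}", THEN exE])
        show "(\<phi> has_field_derivative 0) (at x within {b<..})" if "x \<in> {b<..}" for x
          using d[of x] ab(4)[of x] that by (auto intro: has_field_derivative_at_within)
      qed (use 2 ab in auto)
      ultimately show ?thesis by simp
    qed
  qed
  note zero = this
  have hd: "(\<phi> has_derivative (\<lambda>h. \<eta> x * h)) (at x)" for x
    using d[of x] by (simp add: has_field_derivative_def)
  have "C_k k \<phi>" for k
  proof (cases k)
    case 0
    have "continuous_on UNIV \<phi>" by (rule DERIV_continuous_on[where D = \<eta>]) (simp add: d)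
    then show ?thesis using 0 by simp
  next
    case (Suc m)
    have "frechet_derivative \<phi> (at x) = (\<lambda>h. \<eta> x * h)" for x
      by (rule frechet_derivative_at[OF hd, symmetric])
    moreover have "C_k m \<eta>" using \<eta> by (simp add: test_functions_def)
    moreover have "\<phi> differentiable (at x)" for x using hd unfolding differentiable_def by blast
    ultimately show ?thesis using Suc by simp
  qed
  then have "\<phi> \<in> test_functions {0<..<T}"
    unfolding test_functions_def using ab zero
    by (intro CollectI conjI allI exI[of _ "{a..b}"]) auto
  moreover have "deriv \<phi> = \<eta>" by (rule ext) (rule DERIV_imp_deriv[OF d])
  ultimately show ?thesis
  proof (rule that)
    show "\<phi> t = (\<integral>s. indicator {..t} s * \<eta> s \<partial>time_interval T)" if "t \<in> {0<..<T}" for t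
      using ind[of t] that by simp
  qed
qed

lemma integrable_continuous_times:
  fixes g \<phi> :: "real \<Rightarrow> real"
  assumes "integrable (time_interval T) g" "continuous_on UNIV \<phi>" "\<And>t. \<bar>\<phi> t\<bar> \<le> C"
  shows "integrable (time_interval T) (\<lambda>t. \<phi> t * g t)"
proof (rule Bochner_Integration.integrable_bound)
  show "integrable (time_interval T) (\<lambda>t. C * g t)" using assms(1) by simp
  have [measurable]: "\<phi> \<in> borel_measurable (time_interval T)"
    using assms(2) by (intro measurable_time_interval borel_measurable_continuous_onI)
  have [measurable]: "g \<in> borel_measurable (time_interval T)" using assms(1) by simp
  show "(\<lambda>t. \<phi> t * g t) \<in> borel_measurable (time_interval T)" by measurable
  have "\<bar>\<phi> t\<bar> * \<bar>g t\<bar> \<le> \<bar>C\<bar> * \<bar>g t\<bar>" for t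
    using assms(3)[of t] by (intro mult_right_mono) auto
  then show "AE t in time_interval T. norm (\<phi> t * g t) \<le> norm (C * g t)" by (simp add: abs_mult)
qed

lemma test_function_bounded:
  fixes \<phi> :: "real \<Rightarrow> real"
  assumes "\<phi> \<in> test_functions {0<..<T}" "0 < T"
  obtains C where "0 < C" "\<And>t. \<bar>\<phi> t\<bar> \<le> C" "\<And>t. \<bar>deriv \<phi> t\<bar> \<le> C"
proof -
  obtain a b where ab: "\<And>x. x \<notin> {a..b} \<Longrightarrow> \<phi> x = 0" using test_function_interval[OF assms] by metis
  note r = test_function_real[OF assms(1)]
  have z: "deriv \<phi> x = 0" if "x \<notin> {a..b}" for x
  proof -
    have "((\<lambda>_. 0) has_real_derivative 0) (at x)" by simp
    then have "(\<phi> has_real_derivative 0) (at x)"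
      by (rule has_field_derivative_transform_within_open[where S = "- {a..b}"]) (use that ab in auto)
    then show ?thesis by (rule DERIV_imp_deriv)
  qed
  have "bounded (\<phi> ` {a..b})" "bounded (deriv \<phi> ` {a..b})"
    using r(2,3) by (auto intro!: compact_imp_bounded compact_continuous_image intro: continuous_on_subset)
  then obtain C1 C2 where C: "0 < C1" "0 < C2" "\<And>x. x \<in> {a..b} \<Longrightarrow> \<bar>\<phi> x\<bar> \<le> C1" "\<And>x. x \<in> {a..b} \<Longrightarrow> \<bar>deriv \<phi> x\<bar> \<le> C2"
    unfolding bounded_pos by auto
  have "\<bar>\<phi> t\<bar> \<le> C1 + C2" "\<bar>deriv \<phi> t\<bar> \<le> C1 + C2" for t
    using C(3)[of t] C(4)[of t] ab[of t] z[of t] C(1,2) by (cases "t \<in> {a..b}"; force)+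
  then show ?thesis using that[of "C1 + C2"] C by auto
qed

text \<open>A test function with vanishing integral is the derivative of a test function.\<close>

lemma du_Bois_Reymond:
  assumes T: "0 < T" and \<alpha>: "integrable (time_interval T) \<alpha>" and \<beta>: "integrable (time_interval T) \<beta>"
    and weak: "\<And>\<phi>. \<phi> \<in> test_functions {0<..<T} \<Longrightarrow>
      (\<integral>t. deriv \<phi> t * \<alpha> t \<partial>time_interval T) = - (\<integral>t. \<phi> t * \<beta> t \<partial>time_interval T)"
  shows "\<exists>c. AE t in time_interval T. \<alpha> t = c + prim T \<beta> t"
proof -
  let ?M = "time_interval T"
  \<comment> \<open>A reference test function of positive integral; subtracting multiples of it
    normalises other test functions to integral zero.\<close>
  define \<omega> :: "real \<Rightarrow> real" where "\<omega> = bump (T/2) (T/4) 1"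
  have \<omega>: "\<omega> \<in> test_functions {0<..<T}"
  proof (rule test_functions_smooth_expr)
    show "smooth_expr \<omega>" unfolding \<omega>_def by (rule smooth_expr_bump)
    show "cball (T/2) (T/4) \<subseteq> {0<..<T}"
    proof
      fix x assume "x \<in> cball (T/2) (T/4)"
      then have "\<bar>T/2 - x\<bar> \<le> T/4" by (simp add: dist_real_def)
      then have "0 < x" "x < T" using T by arith+
      then show "x \<in> {0<..<T}" by simp
    qed
    show "\<omega> x = 0" if "x \<notin> cball (T/2) (T/4)" for x
      unfolding \<omega>_def by (rule bump_eq_0) (use T that in auto)
  qed simp
  have L2i: "integrable ?M \<eta>" if \<eta>: "\<eta> \<in> test_functions {0<..<T}" for \<eta> :: "real \<Rightarrow> real"
  proof -
    obtain K where "compact K" "K \<subseteq> {0<..<T}" "\<And>x. x \<notin> K \<Longrightarrow> \<eta> x = 0" using test_functionsE[OF \<eta>] by metis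
    then show ?thesis by (intro compact_support_lebesgue_on(1)[OF test_functions_derivative(2)[OF \<eta>]]) auto
  qed
  have \<omega>_pos: "0 < (\<integral>t. \<omega> t \<partial>?M)"
  proof -
    have nn: "0 \<le> \<omega> t" for t by (simp add: \<omega>_def bump_bounds)
    have "(\<integral>t. \<omega> t \<partial>?M) \<noteq> 0"
    proof
      assume "(\<integral>t. \<omega> t \<partial>?M) = 0"
      then have "AE t in ?M. \<omega> t = 0"
        using integral_nonneg_eq_0_iff_AE[OF L2i[OF \<omega>]] nn by simp
      then have "AE t in lebesgue. t \<in> {0<..<T} \<longrightarrow> \<omega> t = 0" by (simp add: AE_restrict_space_iff)
      then have "AE t in lebesgue. t \<notin> ball (T/2) (T/4)"
      proof eventually_elim
        case (elim t)
        show ?case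
        proof
          assume t: "t \<in> ball (T/2) (T/4)"
          then have "\<bar>T/2 - t\<bar> < T/4" by (simp add: dist_real_def)
          then have "0 < t" "t < T" using T by arith+
          then show False using elim bump_pos[OF _ t, of 1] by (simp add: \<omega>_def)
        qed
      qed
      then have "ball (T/2) (T/4) \<in> null_sets lebesgue"
        by (subst AE_iff_null_sets) auto
      then have "emeasure lebesgue (ball (T/2) (T/4)) = 0" by (rule null_setsD1)
      then show False using T by (simp add: ball_eq_greaterThanLessThan)
    qed
    moreover have "0 \<le> (\<integral>t. \<omega> t \<partial>?M)" using nn by simp
    ultimately show ?thesis by simp
  qed
  define \<gamma> where "\<gamma> t = \<alpha> t - prim T \<beta> t" for t
  have \<gamma>: "integrable ?M \<gamma>" unfolding \<gamma>_def using \<alpha> integrable_prim[OF \<beta>] by simp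
  have test: "(\<integral>t. \<eta> t * \<gamma> t \<partial>?M) = 0" if \<eta>: "\<eta> \<in> test_functions {0<..<T}" "(\<integral>t. \<eta> t \<partial>?M) = 0" for \<eta>
  proof -
    obtain \<phi> where \<phi>: "\<phi> \<in> test_functions {0<..<T}" "deriv \<phi> = \<eta>"
      "\<And>t. t \<in> {0<..<T} \<Longrightarrow> \<phi> t = (\<integral>s. indicator {..t} s * \<eta> s \<partial>?M)"
      using test_primitive[OF \<eta>(1) T \<eta>(2)] by metis
    obtain C where C: "\<And>t. \<bar>\<eta> t\<bar> \<le> C" using test_function_bounded[OF \<eta>(1) T] by metis
    note c\<eta> = test_functions_derivative(2)[OF \<eta>(1)]
    have i: "integrable ?M (\<lambda>t. \<eta> t * \<alpha> t)" "integrable ?M (\<lambda>t. \<eta> t * prim T \<beta> t)"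
      using integrable_continuous_times[OF \<alpha> c\<eta> C] integrable_continuous_times[OF integrable_prim[OF \<beta>] c\<eta> C] by auto
    have "(\<integral>t. \<phi> t * \<beta> t \<partial>?M) = (\<integral>t. (\<integral>s. indicator {..t} s * \<eta> s \<partial>?M) * \<beta> t \<partial>?M)"
      by (rule Bochner_Integration.integral_cong) (auto simp: \<phi>(3))
    also have "\<dots> = (\<integral>s. \<eta> s * ((\<integral>t. \<beta> t \<partial>?M) - prim T \<beta> s) \<partial>?M)"
      by (rule prim_Fubini[OF L2i[OF \<eta>(1)] \<beta>])
    also have "\<dots> = (\<integral>s. \<eta> s * (\<integral>t. \<beta> t \<partial>?M) - \<eta> s * prim T \<beta> s \<partial>?M)"
      by (simp add: right_diff_distrib)
    also have "\<dots> = - (\<integral>s. \<eta> s * prim T \<beta> s \<partial>?M)"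
      using i L2i[OF \<eta>(1)] \<eta>(2) by simp
    finally have "(\<integral>t. \<eta> t * \<alpha> t \<partial>?M) = (\<integral>s. \<eta> s * prim T \<beta> s \<partial>?M)"
      using weak[OF \<phi>(1)] \<phi>(2) by simp
    then show ?thesis using i by (simp add: \<gamma>_def right_diff_distrib)
  qed
  \<comment> \<open>The mean of \<open>\<gamma>\<close> weighted by \<open>\<omega>\<close>, the
    only constant that \<open>\<gamma>\<close> can equal.\<close>
  define c where "c = (\<integral>t. \<omega> t * \<gamma> t \<partial>?M) / (\<integral>t. \<omega> t \<partial>?M)"
  have "AE t in ?M. \<gamma> t - c = 0"
  proof (rule fundamental_lemma)
    interpret finite_measure ?M by (rule finite_measure_time_interval)
    show "integrable ?M (\<lambda>t. \<gamma> t - c)" using \<gamma> by simp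
    fix \<eta> :: "real \<Rightarrow> real" assume \<eta>: "\<eta> \<in> test_functions {0<..<T}"
    define k where "k = (\<integral>t. \<eta> t \<partial>?M) / (\<integral>t. \<omega> t \<partial>?M)"
    have \<eta>': "\<eta> + (- k) *\<^sub>R \<omega> \<in> test_functions {0<..<T}"
      by (intro subspace_add subspace_scale subspace_test_functions \<eta> \<omega>)
    have eq: "\<eta> + (- k) *\<^sub>R \<omega> = (\<lambda>t. \<eta> t - k * \<omega> t)" by (auto simp: scaleR_fun_def)
    obtain C1 where C1: "\<And>t. \<bar>\<eta> t\<bar> \<le> C1" using test_function_bounded[OF \<eta> T] by metis
    obtain C2 where C2: "\<And>t. \<bar>\<omega> t\<bar> \<le> C2" using test_function_bounded[OF \<omega> T] by metis
    have i: "integrable ?M (\<lambda>t. \<eta> t * \<gamma> t)" "integrable ?M (\<lambda>t. \<omega> t * \<gamma> t)"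
      using integrable_continuous_times[OF \<gamma> test_functions_derivative(2)[OF \<eta>] C1]
        integrable_continuous_times[OF \<gamma> test_functions_derivative(2)[OF \<omega>] C2] by auto
    have "(\<integral>t. \<eta> t - k * \<omega> t \<partial>?M) = 0"
      using L2i[OF \<eta>] L2i[OF \<omega>] \<omega>_pos by (simp add: k_def)
    then have "(\<integral>t. (\<eta> t - k * \<omega> t) * \<gamma> t \<partial>?M) = 0"
      by (rule test[OF \<eta>'[unfolded eq]])
    then have "(\<integral>t. \<eta> t * \<gamma> t \<partial>?M) = k * (\<integral>t. \<omega> t * \<gamma> t \<partial>?M)"
      using i by (simp add: left_diff_distrib mult.assoc)
    also have "\<dots> = c * (\<integral>t. \<eta> t \<partial>?M)" by (simp add: k_def c_def)
    finally have e: "(\<integral>t. \<eta> t * \<gamma> t \<partial>?M) = c * (\<integral>t. \<eta> t \<partial>?M)" .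
    have "(\<integral>t. (\<gamma> t - c) * \<eta> t \<partial>?M) = (\<integral>t. \<eta> t * \<gamma> t - c * \<eta> t \<partial>?M)"
      by (simp add: algebra_simps)
    also have "\<dots> = 0" using i(1) L2i[OF \<eta>] e by simp
    finally show "(\<integral>t. (\<gamma> t - c) * \<eta> t \<partial>?M) = 0" .
  qed simp
  then show ?thesis by (intro exI[of _ c]) (auto elim!: eventually_mono simp: \<gamma>_def)
qed

text \<open>Fubini on the triangle with the derivative of \<open>\<phi>\<close> in the role of
  \<open>f\<close>: its primitive is \<open>\<phi>\<close>, and its total integral vanishes by
  compact support.\<close>

lemma prim_weak_derivative:
  assumes T: "0 < T" and \<beta>: "integrable (time_interval T) \<beta>" and \<phi>: "\<phi> \<in> test_functions {0<..<T}"
  shows "(\<integral>t. deriv \<phi> t * prim T \<beta> t \<partial>time_interval T) = - (\<integral>t. \<phi> t * \<beta> t \<partial>time_interval T)"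
proof -
  let ?M = "time_interval T"
  obtain a b where ab: "0 < a" "a \<le> b" "b < T" "\<And>x. x \<notin> {a..b} \<Longrightarrow> \<phi> x = 0" using test_function_interval[OF \<phi> T] by metis
  note r = test_function_real[OF \<phi>]
  obtain C where C: "\<And>t. \<bar>deriv \<phi> t\<bar> \<le> C" using test_function_bounded[OF \<phi> T] by metis
  interpret finite_measure ?M by (rule finite_measure_time_interval)
  have id: "integrable ?M (deriv \<phi>)"
    using integrable_continuous_times[OF _ r(3) C, of T "\<lambda>_. 1"] by simp
  have ind: "(\<integral>s. indicator {..t} s * deriv \<phi> s \<partial>?M) = \<phi> t" if "0 \<le> t" "t \<le> T" for t
  proof -
    have "deriv \<phi> s = 0" if "s \<le> 0 \<or> T \<le> s" for s
    proof -
      have "((\<lambda>_. 0) has_real_derivative 0) (at s)" by simp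
      then have "(\<phi> has_real_derivative 0) (at s)"
        by (rule has_field_derivative_transform_within_open[where S = "- {a..b}"]) (use that ab in auto)
      then show ?thesis by (rule DERIV_imp_deriv)
    qed
    then have z: "deriv \<phi> s = 0" if "s \<notin> {0<..<T}" for s using that by force
    have "(\<integral>s. indicator {..t} s * deriv \<phi> s \<partial>?M)
        = (\<integral>s. indicator {0<..<T} s *\<^sub>R (indicator {..t} s * deriv \<phi> s) \<partial>lebesgue)"
      by (subst integral_restrict_space) auto
    also have "\<dots> = (\<integral>s. deriv \<phi> s * indicator {0..t} s \<partial>lebesgue)"
    proof (rule Bochner_Integration.integral_cong)
      fix s show "indicator {0<..<T} s *\<^sub>R (indicator {..t} s * deriv \<phi> s) = deriv \<phi> s * indicator {0..t} s"
        using z[of s] that by (cases "s \<in> {0<..<T}") (auto simp: indicator_def)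
    qed simp
    also have "\<dots> = (\<integral>s. deriv \<phi> s * indicator {0..t} s \<partial>lborel)"
    proof (rule integral_completion)
      have [measurable]: "deriv \<phi> \<in> borel_measurable borel" using r(3) by (rule borel_measurable_continuous_onI)
      show "(\<lambda>s. deriv \<phi> s * indicator {0..t} s) \<in> borel_measurable lborel" by measurable
    qed
    also have "\<dots> = \<phi> t - \<phi> 0"
      by (rule integral_FTC_Icc_real) (use that r in \<open>auto simp: continuous_on_eq_continuous_at\<close>)
    finally show ?thesis using ab(4)[of 0] ab(1) by simp
  qed
  have z: "(\<integral>s. deriv \<phi> s \<partial>?M) = 0"
  proof -
    have "(\<integral>s. deriv \<phi> s \<partial>?M) = (\<integral>s. indicator {..T} s * deriv \<phi> s \<partial>?M)"
      by (rule Bochner_Integration.integral_cong) auto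
    then show ?thesis using ind[of T] T ab(4)[of T] ab(3) by simp
  qed
  have ip: "integrable ?M (\<lambda>t. deriv \<phi> t * prim T \<beta> t)"
    by (rule integrable_continuous_times[OF integrable_prim[OF \<beta>] r(3) C])
  have "(\<integral>t. \<phi> t * \<beta> t \<partial>?M) = (\<integral>t. (\<integral>s. indicator {..t} s * deriv \<phi> s \<partial>?M) * \<beta> t \<partial>?M)"
    by (rule Bochner_Integration.integral_cong) (auto simp: ind)
  also have "\<dots> = (\<integral>s. deriv \<phi> s * ((\<integral>t. \<beta> t \<partial>?M) - prim T \<beta> s) \<partial>?M)"
    by (rule prim_Fubini[OF id \<beta>])
  also have "\<dots> = (\<integral>s. deriv \<phi> s * (\<integral>t. \<beta> t \<partial>?M) - deriv \<phi> s * prim T \<beta> s \<partial>?M)"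
    by (simp add: right_diff_distrib)
  also have "\<dots> = - (\<integral>s. deriv \<phi> s * prim T \<beta> s \<partial>?M)"
    using ip id z by simp
  finally show ?thesis by simp
qed

section \<open>Translations and difference quotients\<close>

lemma AE_translation:
  assumes "AE x in lebesgue. P (x :: real)" shows "AE x in lebesgue. P (x + h)"
proof -
  have "AE x in lborel. P x" using assms by (simp add: AE_completion_iff)
  then obtain N where N: "N \<in> null_sets lborel" "{x. \<not> P x} \<subseteq> N" by (auto simp: eventually_ae_filter)
  have "{x. x - (- h) \<in> N} \<in> null_sets lborel" by (rule null_sets_translation[OF N(1)])
  then have "AE x in lborel. x \<notin> {x. x - (- h) \<in> N}" by (rule AE_not_in)
  then have "AE x in lborel. P (x + h)" by eventually_elim (use N(2) in auto)
  then show ?thesis by (rule AE_completion)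
qed

text \<open>Translation invariance is transported from \<open>lborel\<close> through a Borel version
  \<open>g\<close> of \<open>f\<close>.\<close>

lemma lebesgue_integral_translation:
  fixes f :: "real \<Rightarrow> real"
  assumes f: "integrable lebesgue f"
  shows "integrable lebesgue (\<lambda>x. f (x + h))" "(\<integral>x. f (x + h) \<partial>lebesgue) = (\<integral>x. f x \<partial>lebesgue)"
proof -
  have fm: "f \<in> borel_measurable lebesgue" using f by simp
  obtain g where g: "g \<in> borel_measurable lborel" "AE x in lborel. f x = g x"
    using completion_ex_borel_measurable_real[OF fm] by auto
  then have fg: "AE x in lebesgue. f x = g x" by (simp add: AE_completion)
  have fgh: "AE x in lebesgue. f (x + h) = g (x + h)" by (rule AE_translation[OF fg])
  have gL: "g \<in> borel_measurable lebesgue" using g(1) by (rule measurable_completion)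
  have gi: "integrable lborel g"
    using integrable_cong_AE_imp[OF f gL] fg g(1) by (simp add: integrable_completion eq_commute)
  have gh[measurable]: "(\<lambda>x. g (x + h)) \<in> borel_measurable lborel" using g(1) by measurable
  have gih: "integrable lborel (\<lambda>x. g (x + h))" "(\<integral>x. g (x + h) \<partial>lborel) = (\<integral>x. g x \<partial>lborel)"
  proof -
    have "integrable (distr lborel borel ((+) h)) g" using gi by (simp add: lborel_distr_plus)
    then show "integrable lborel (\<lambda>x. g (x + h))"
      using g(1) by (subst (asm) integrable_distr_eq) (auto simp: add.commute)
    have "(\<integral>x. g x \<partial>distr lborel borel ((+) h)) = (\<integral>x. g (h + x) \<partial>lborel)"
      using g(1) by (intro integral_distr) auto
    then show "(\<integral>x. g (x + h) \<partial>lborel) = (\<integral>x. g x \<partial>lborel)" by (simp add: lborel_distr_plus add.commute)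
  qed
  have ghL: "(\<lambda>x. g (x + h)) \<in> borel_measurable lebesgue" using gh by (rule measurable_completion)
  have fhL: "(\<lambda>x. f (x + h)) \<in> borel_measurable lebesgue"
    by (rule borel_measurable_AE[OF ghL]) (use fgh in \<open>auto elim!: eventually_mono\<close>)
  show "integrable lebesgue (\<lambda>x. f (x + h))"
    by (rule integrable_cong_AE_imp[of _ "\<lambda>x. g (x + h)"])
      (use gih gh fhL fgh in \<open>auto simp: integrable_completion elim!: eventually_mono\<close>)
  have "(\<integral>x. f (x + h) \<partial>lebesgue) = (\<integral>x. g (x + h) \<partial>lebesgue)" by (rule integral_cong_AE[OF fhL ghL fgh])
  also have "\<dots> = (\<integral>x. g x \<partial>lebesgue)" using gih g gh by (simp add: integral_completion)
  also have "\<dots> = (\<integral>x. f x \<partial>lebesgue)" by (rule integral_cong_AE[OF gL fm]) (use fg in \<open>auto elim!: eventually_mono\<close>)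
  finally show "(\<integral>x. f (x + h) \<partial>lebesgue) = (\<integral>x. f x \<partial>lebesgue)" .
qed

lemma integrable_time_interval_iff:
  fixes f :: "real \<Rightarrow> real"
  shows "integrable (time_interval T) f \<longleftrightarrow> integrable lebesgue (\<lambda>t. indicator {0<..<T} t * f t)"
    "(\<integral>t. f t \<partial>time_interval T) = (\<integral>t. indicator {0<..<T} t * f t \<partial>lebesgue)"
  by (simp_all add: integrable_restrict_space integral_restrict_space)

text \<open>Translation invariance moves the difference quotient of \<open>Q\<close> onto the test
  function, so pointwise lower bounds for quotients become a lower bound for the distributional
  derivative. The increments may have either sign. The bound is asked only when both end points are
  good, which for fixed \<open>n\<close> excludes a null set of \<open>r\<close>.\<close>

lemma weak_derivative_ge:
  assumes T: "0 < T" and Q: "integrable (time_interval T) Q" and g: "integrable (time_interval T) g"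
    and good: "AE t in time_interval T. good t"
    and h: "h \<longlonglongrightarrow> 0" "\<And>n::nat. h n \<noteq> 0"
    and d: "0 < d" "\<And>r n. good r \<Longrightarrow> good (r + h n) \<Longrightarrow> r \<in> {0<..<T} \<Longrightarrow> r + h n \<in> {0<..<T} \<Longrightarrow> \<bar>h n\<bar> < d \<Longrightarrow>
      g r \<le> (Q (r + h n) - Q r) / h n"
    and \<phi>: "\<phi> \<in> test_functions {0<..<T}" "\<And>t. 0 \<le> \<phi> t"
  shows "(\<integral>t. \<phi> t * g t \<partial>time_interval T) \<le> - (\<integral>t. deriv \<phi> t * Q t \<partial>time_interval T)"
proof -
  let ?I = "{0<..<T}"
  obtain a b where ab: "0 < a" "a \<le> b" "b < T" "\<And>x. x \<notin> {a..b} \<Longrightarrow> \<phi> x = 0" using test_function_interval[OF \<phi>(1) T] by metis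
  obtain C where C: "0 < C" "\<And>t. \<bar>\<phi> t\<bar> \<le> C" "\<And>t. \<bar>deriv \<phi> t\<bar> \<le> C" using test_function_bounded[OF \<phi>(1) T] by metis
  note r = test_function_real[OF \<phi>(1)]
  \<comment> \<open>Extension by zero, so that translations act on the whole line; the bound
    \<open>m\<close> below keeps shifted points of the support inside the interval.\<close>
  define q where "q t = indicator ?I t * Q t" for t
  have q: "integrable lebesgue q" using Q by (simp add: integrable_time_interval_iff q_def[abs_def])
  have [measurable]: "q \<in> borel_measurable lebesgue" using q by simp
  have [measurable]: "\<phi> \<in> borel_measurable borel" using r(2) by (rule borel_measurable_continuous_onI)
  have bdd: "integrable lebesgue (\<lambda>t. \<psi> t * q' t)"
    if "\<psi> \<in> borel_measurable borel" "\<And>t. \<bar>\<psi> t\<bar> \<le> K" "integrable lebesgue q'" for \<psi> q' :: "real \<Rightarrow> real" and K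
  proof (rule Bochner_Integration.integrable_bound)
    show "integrable lebesgue (\<lambda>t. K * q' t)" using that(3) by simp
    have [measurable]: "\<psi> \<in> borel_measurable lebesgue" using that(1) by (intro measurable_completion) simp
    have [measurable]: "q' \<in> borel_measurable lebesgue" using that(3) by simp
    show "(\<lambda>t. \<psi> t * q' t) \<in> borel_measurable lebesgue" by measurable
    have "\<bar>\<psi> t\<bar> * \<bar>q' t\<bar> \<le> \<bar>K\<bar> * \<bar>q' t\<bar>" for t using that(2)[of t] by (intro mult_right_mono) auto
    then show "AE t in lebesgue. norm (\<psi> t * q' t) \<le> norm (K * q' t)" by (simp add: abs_mult)
  qed
  define D where "D n t = (\<phi> (t - h n) - \<phi> t) / h n" for n t
  have Dm: "D n \<in> borel_measurable borel" for n unfolding D_def by measurable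
  have Db: "\<bar>D n t\<bar> \<le> C" for n t
  proof -
    have "\<bar>\<phi> (t - h n) - \<phi> t\<bar> \<le> C * \<bar>(t - h n) - t\<bar>"
      using field_differentiable_bound[of UNIV \<phi> "deriv \<phi>" C "t - h n" t] r(1) C(3)
      by (simp add: norm_minus_commute)
    then show ?thesis using h(2)[of n] by (simp add: D_def field_simps)
  qed
  have Dl: "(\<lambda>n. D n t) \<longlonglongrightarrow> - deriv \<phi> t" for t
  proof -
    have "((\<lambda>s. (\<phi> (t + s) - \<phi> t) / s) \<longlongrightarrow> deriv \<phi> t) (at 0)" using r(1)[of t] by (simp add: DERIV_def)
    moreover have "filterlim (\<lambda>n. - h n) (at 0) sequentially"
      unfolding filterlim_at using tendsto_minus[OF h(1)] h(2) by simp
    ultimately have "(\<lambda>n. (\<phi> (t + - h n) - \<phi> t) / (- h n)) \<longlonglongrightarrow> deriv \<phi> t" by (rule filterlim_compose)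
    from tendsto_minus[OF this] show ?thesis by (simp add: D_def)
  qed
  have eqn: "(\<integral>t. \<phi> t * ((q (t + h n) - q t) / h n) \<partial>lebesgue) = (\<integral>t. D n t * q t \<partial>lebesgue)"
    and int: "integrable lebesgue (\<lambda>t. \<phi> t * ((q (t + h n) - q t) / h n))" for n
  proof -
    note tr = lebesgue_integral_translation[OF q, of "h n"]
    have i1: "integrable lebesgue (\<lambda>t. \<phi> (t - h n) * q t)" by (rule bdd[OF _ _ q, of _ C]) (use C in auto)
    have i2: "integrable lebesgue (\<lambda>t. \<phi> t * q t)" by (rule bdd[OF _ _ q, of _ C]) (use C in auto)
    have i3: "integrable lebesgue (\<lambda>t. \<phi> t * q (t + h n))" by (rule bdd[OF _ _ tr(1), of _ C]) (use C in auto)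
    have "(\<lambda>t. \<phi> t * ((q (t + h n) - q t) / h n)) = (\<lambda>t. (\<phi> t * q (t + h n) - \<phi> t * q t) / h n)"
      by (simp add: fun_eq_iff right_diff_distrib diff_divide_distrib)
    then show "integrable lebesgue (\<lambda>t. \<phi> t * ((q (t + h n) - q t) / h n))"
      and "(\<integral>t. \<phi> t * ((q (t + h n) - q t) / h n) \<partial>lebesgue) = (\<integral>t. D n t * q t \<partial>lebesgue)"
    proof -
      assume eq: "(\<lambda>t. \<phi> t * ((q (t + h n) - q t) / h n)) = (\<lambda>t. (\<phi> t * q (t + h n) - \<phi> t * q t) / h n)"
      show "integrable lebesgue (\<lambda>t. \<phi> t * ((q (t + h n) - q t) / h n))" unfolding eq using i2 i3 by simp
      have "(\<integral>t. \<phi> t * q (t + h n) \<partial>lebesgue) = (\<integral>t. \<phi> (t - h n) * q t \<partial>lebesgue)"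
        using lebesgue_integral_translation(2)[OF i1, of "h n"] by simp
      then have "(\<integral>t. (\<phi> t * q (t + h n) - \<phi> t * q t) / h n \<partial>lebesgue)
          = (\<integral>t. (\<phi> (t - h n) * q t - \<phi> t * q t) / h n \<partial>lebesgue)"
        using i1 i2 i3 by simp
      also have "\<dots> = (\<integral>t. D n t * q t \<partial>lebesgue)" by (simp add: D_def left_diff_distrib)
      finally show "(\<integral>t. \<phi> t * ((q (t + h n) - q t) / h n) \<partial>lebesgue) = (\<integral>t. D n t * q t \<partial>lebesgue)" unfolding eq .
    qed
  qed
  have lim: "(\<lambda>n. \<integral>t. D n t * q t \<partial>lebesgue) \<longlonglongrightarrow> (\<integral>t. - deriv \<phi> t * q t \<partial>lebesgue)"
  proof (rule integral_dominated_convergence[where w = "\<lambda>t. C * \<bar>q t\<bar>"])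
    have [measurable]: "deriv \<phi> \<in> borel_measurable borel" using r(3) by (rule borel_measurable_continuous_onI)
    have "deriv \<phi> \<in> borel_measurable lebesgue" by (intro measurable_completion) simp
    then show "(\<lambda>t. - deriv \<phi> t * q t) \<in> borel_measurable lebesgue" by measurable
    show "(\<lambda>t. D n t * q t) \<in> borel_measurable lebesgue" for n
      using bdd[OF Dm Db q] by (rule borel_measurable_integrable)
    show "integrable lebesgue (\<lambda>t. C * \<bar>q t\<bar>)" using q by simp
    show "AE t in lebesgue. (\<lambda>n. D n t * q t) \<longlonglongrightarrow> - deriv \<phi> t * q t"
      by (intro AE_I2 tendsto_mult tendsto_const Dl)
    show "AE t in lebesgue. norm (D n t * q t) \<le> C * \<bar>q t\<bar>" for n
      using Db[of n] by (auto simp: abs_mult intro!: mult_right_mono)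
  qed
  define \<phi>g where "\<phi>g t = \<phi> t * (indicator ?I t * g t)" for t
  have \<phi>g: "integrable lebesgue \<phi>g"
    unfolding \<phi>g_def by (rule bdd[of _ C]) (use C g in \<open>auto simp: integrable_time_interval_iff\<close>)
  define m where "m = min d (min a (T - b))"
  have "0 < m" using d(1) ab by (simp add: m_def)
  have "\<forall>\<^sub>F n in sequentially. \<bar>h n\<bar> < m"
    using tendsto_rabs[OF h(1)] \<open>0 < m\<close> by (simp add: order_tendstoD)
  then have ev: "\<forall>\<^sub>F n in sequentially. (\<integral>t. \<phi>g t \<partial>lebesgue) \<le> (\<integral>t. D n t * q t \<partial>lebesgue)"
  proof eventually_elim
    case (elim n)
    have gl: "AE t in lebesgue. t \<in> ?I \<longrightarrow> good t" using good by (simp add: AE_restrict_space_iff)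
    have "(\<integral>t. \<phi>g t \<partial>lebesgue) \<le> (\<integral>t. \<phi> t * ((q (t + h n) - q t) / h n) \<partial>lebesgue)"
    proof (rule integral_mono_AE[OF \<phi>g int])
      show "AE t in lebesgue. \<phi>g t \<le> \<phi> t * ((q (t + h n) - q t) / h n)"
        using gl AE_translation[OF gl, of "h n"]
      proof eventually_elim
        case (elim t)
        show ?case
        proof (cases "t \<in> {a..b}")
          case True
          have I: "t \<in> ?I" "t + h n \<in> ?I" using True ab \<open>\<bar>h n\<bar> < m\<close> by (auto simp: m_def)
          have "g t \<le> (Q (t + h n) - Q t) / h n"
            using elim I \<open>\<bar>h n\<bar> < m\<close> by (intro d(2)) (auto simp: m_def)
          from mult_left_mono[OF this \<phi>(2)[of t]] show ?thesis using I by (simp add: \<phi>g_def q_def)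
        qed (simp add: ab(4) \<phi>g_def)
      qed
    qed
    then show ?case unfolding eqn .
  qed
  have "(\<integral>t. \<phi>g t \<partial>lebesgue) \<le> (\<integral>t. - deriv \<phi> t * q t \<partial>lebesgue)"
    by (rule tendsto_lowerbound[OF lim ev]) simp
  moreover have "(\<integral>t. \<phi>g t \<partial>lebesgue) = (\<integral>t. \<phi> t * g t \<partial>time_interval T)"
    by (simp add: integrable_time_interval_iff(2) \<phi>g_def mult.left_commute)
  moreover have "(\<integral>t. - deriv \<phi> t * q t \<partial>lebesgue) = - (\<integral>t. deriv \<phi> t * Q t \<partial>time_interval T)"
    by (simp add: integrable_time_interval_iff(2) q_def mult.left_commute)
  ultimately show ?thesis by simp
qed

section \<open>Evolution triples\<close>

context bochner_space
begin

lemma BL_sn_integrable: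
  assumes "finite_measure M" "g \<in> BL" shows "integrable M (\<lambda>t. sn (g t))"
proof (rule Bochner_Integration.integrable_bound)
  interpret finite_measure M by fact
  show "integrable M (\<lambda>t. 1 + (sn (g t))\<^sup>2)" using BL_integrable[OF assms(2)] by simp
  show "(\<lambda>t. sn (g t)) \<in> borel_measurable M" using BM_sn_measurable[OF BL_BM[OF assms(2)]] .
  have "\<bar>x\<bar> \<le> 1 + x\<^sup>2" for x :: real
  proof -
    have "2 * \<bar>x\<bar> \<le> 1 + x\<^sup>2" using sum_squares_bound[of 1 "\<bar>x\<bar>"] by simp
    then show ?thesis using abs_ge_zero[of x] by linarith
  qed
  then show "AE t in M. norm (sn (g t)) \<le> norm (1 + (sn (g t))\<^sup>2)" by simp
qed

lemma BL_ip_const_integrable: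
  assumes "finite_measure M" "g \<in> BL" "w \<in> S" shows "integrable M (\<lambda>t. ip (g t) w)"
proof -
  interpret finite_measure M by fact
  have "(\<lambda>_. w) \<in> BL" using BM_simple[of "\<lambda>_. w"] assms(3) by (simp add: bochner_L2_def)
  from BL_ip_integrable[OF assms(2) this] show ?thesis .
qed

end

section \<open>An integrable modulus of continuity for Bochner square-integrable functions\<close>

lemma finite_min_separation:
  fixes K :: "'i \<Rightarrow> 'a::heine_borel set"
  assumes "finite A" "\<And>i. i \<in> A \<Longrightarrow> compact (K i)"
    and "\<And>i j. i \<in> A \<Longrightarrow> j \<in> A \<Longrightarrow> i \<noteq> j \<Longrightarrow> K i \<inter> K j = {}"
  shows "\<exists>d>0. \<forall>i\<in>A. \<forall>j\<in>A. i \<noteq> j \<longrightarrow> (\<forall>x\<in>K i. \<forall>y\<in>K j. d \<le> dist x y)"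
proof -
  have "\<exists>d>0. \<forall>x\<in>K i. \<forall>y\<in>K j. d \<le> dist x y" if "i \<in> A" "j \<in> A" "i \<noteq> j" for i j
    using separate_compact_closed[of "K i" "K j"] assms that by (simp add: compact_imp_closed)
  then have "\<forall>p\<in>{p \<in> A \<times> A. fst p \<noteq> snd p}. \<exists>d>0. \<forall>x\<in>K (fst p). \<forall>y\<in>K (snd p). d \<le> dist x y" by auto
  then obtain D where D: "\<And>p. p \<in> A \<times> A \<Longrightarrow> fst p \<noteq> snd p \<Longrightarrow> 0 < D p"
    "\<And>p x y. p \<in> A \<times> A \<Longrightarrow> fst p \<noteq> snd p \<Longrightarrow> x \<in> K (fst p) \<Longrightarrow> y \<in> K (snd p) \<Longrightarrow> D p \<le> dist x y"
    by (metis (mono_tags, lifting) mem_Collect_eq)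
  \<comment> \<open>The element 1 keeps the minimum defined when there are no two distinct
    indices.\<close>
  define d where "d = Min (insert 1 (D ` {p \<in> A \<times> A. fst p \<noteq> snd p}))"
  have fin: "finite (insert 1 (D ` {p \<in> A \<times> A. fst p \<noteq> snd p}))" using assms(1) by simp
  have "0 < d" unfolding d_def using fin D(1) by (subst Min_gr_iff) auto
  moreover have "d \<le> dist x y" if "i \<in> A" "j \<in> A" "i \<noteq> j" "x \<in> K i" "y \<in> K j" for i j x y
  proof -
    have "d \<le> D (i, j)" unfolding d_def using fin that by (intro Min_le) auto
    also have "\<dots> \<le> dist x y" using D(2)[of "(i, j)"] that by auto
    finally show ?thesis .
  qed
  ultimately show ?thesis by blast
qed

text \<open>\<open>\<gamma>\<close> is close to a simple function, whose level sets are
  up to small measure disjoint compact sets.\<close>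

lemma bochner_modulus:
  assumes bs: "bochner_space S ip (time_interval T)"
    and \<gamma>: "\<gamma> \<in> bochner_L2 (time_interval T) S (snorm ip)" and e: "0 < e"
  obtains b d P where "integrable (time_interval T) b" "\<And>t. 0 \<le> b t" "(\<integral>t. b t \<partial>time_interval T) \<le> e" "0 < d"
    "AE t in time_interval T. P t"
    "\<And>s r. s \<in> {0<..<T} \<Longrightarrow> r \<in> {0<..<T} \<Longrightarrow> P s \<Longrightarrow> P r \<Longrightarrow> \<bar>s - r\<bar> < d \<Longrightarrow> (snorm ip (\<gamma> s - \<gamma> r))\<^sup>2 \<le> b s + b r"
proof -
  let ?M = "time_interval T"
  interpret bochner_space S ip ?M by fact
  interpret finite_measure ?M by (rule finite_measure_time_interval)
  have "0 < e / 12" using e by simp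
  obtain s where s: "simple_function ?M s" "\<And>t. t \<in> space ?M \<Longrightarrow> s t \<in> S" "s \<in> BL"
    "(\<integral>t. (sn (\<gamma> t - s t))\<^sup>2 \<partial>?M) < e / 12"
    by (rule BL_approx[OF \<gamma> \<open>0 < e / 12\<close>]) (rule that)
  let ?V = "s ` {0<..<T}"
  have finV: "finite ?V" using simple_functionD(1)[OF s(1)] by simp
  \<comment> \<open>A crude bound for the squared jump between any two values of \<open>s\<close>,
    to be charged to the exceptional set \<open>Z\<close>.\<close>
  define B where "B = (\<Sum>x\<in>?V. \<Sum>y\<in>?V. (sn (x - y))\<^sup>2)"
  have B: "0 \<le> B" by (auto simp: B_def intro!: sum_nonneg)
  have B_ge: "(sn (x - y))\<^sup>2 \<le> B" if "x \<in> ?V" "y \<in> ?V" for x y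
  proof -
    have "(sn (x - y))\<^sup>2 \<le> (\<Sum>y\<in>?V. (sn (x - y))\<^sup>2)" using finV that(2) by (intro member_le_sum) auto
    also have "\<dots> \<le> B" unfolding B_def using finV that(1)
      by (intro member_le_sum[of x ?V "\<lambda>x. \<Sum>y\<in>?V. (sn (x - y))\<^sup>2"]) (auto intro!: sum_nonneg)
    finally show ?thesis .
  qed
  \<comment> \<open>Chosen so that \<open>3 * B\<close> times the measure of \<open>Z\<close> is at
    most \<open>e / 4\<close>; the other part of \<open>b\<close> contributes at most
    \<open>3 * (e / 12)\<close>. The added ones avoid division by zero.\<close>
  define \<eta> where "\<eta> = e / (12 * (B + 1) * (real (card ?V) + 1))"
  have \<eta>: "0 < \<eta>" using e B by (simp add: \<eta>_def)
  define A where "A x = s -` {x} \<inter> {0<..<T}" for x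
  have As: "A x \<in> sets lebesgue" for x
  proof -
    have "s -` {x} \<inter> space ?M \<in> sets ?M" using s(1) by (rule simple_functionD(2))
    then show ?thesis by (simp add: A_def sets_restrict_space_iff)
  qed
  have "\<exists>K. closed K \<and> K \<subseteq> A x \<and> A x - K \<in> sets lebesgue \<and> emeasure lebesgue (A x - K) < ennreal \<eta>" for x
    using sets_lebesgue_inner_closed[OF As \<eta>, of x] by (metis fmeasurableD)
  then obtain K where K: "\<And>x. closed (K x)" "\<And>x. K x \<subseteq> A x" "\<And>x. A x - K x \<in> sets lebesgue"
    "\<And>x. emeasure lebesgue (A x - K x) < ennreal \<eta>" by metis
  have Kc: "compact (K x)" for x
  proof -
    have "K x \<subseteq> {0..T}" using K(2)[of x] by (auto simp: A_def)
    then show ?thesis using K(1) bounded_subset[OF bounded_closed_interval] by (auto simp: compact_eq_bounded_closed)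
  qed
  have disj: "K x \<inter> K y = {}" if "x \<noteq> y" for x y using K(2)[of x] K(2)[of y] that by (auto simp: A_def)
  obtain d where d: "0 < d" "\<And>x y p q. x \<in> ?V \<Longrightarrow> y \<in> ?V \<Longrightarrow> x \<noteq> y \<Longrightarrow> p \<in> K x \<Longrightarrow> q \<in> K y \<Longrightarrow> d \<le> dist p q"
    using finite_min_separation[OF finV, of K] Kc disj by metis
  define Z where "Z = (\<Union>x\<in>?V. A x - K x)"
  have Zl: "Z \<in> sets lebesgue" unfolding Z_def using finV K(3) by (intro sets.finite_UN) auto
  have ZI: "Z \<subseteq> {0<..<T}" by (auto simp: Z_def A_def)
  have Zs[measurable]: "Z \<in> sets ?M" using Zl ZI by (simp add: sets_restrict_space_iff)
  have mZ: "measure ?M Z \<le> real (card ?V) * \<eta>"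
  proof -
    have "emeasure ?M Z = emeasure lebesgue Z" using ZI by (simp add: emeasure_restrict_space)
    also have "\<dots> \<le> (\<Sum>x\<in>?V. emeasure lebesgue (A x - K x))"
      unfolding Z_def using finV K(3) by (intro emeasure_subadditive_finite) auto
    also have "\<dots> \<le> (\<Sum>x\<in>?V. ennreal \<eta>)" using K(4) by (intro sum_mono less_imp_le)
    also have "\<dots> = ennreal (real (card ?V) * \<eta>)" using \<eta> by (simp add: ennreal_mult ennreal_of_nat_eq_real_of_nat)
    finally show ?thesis using \<eta> by (simp add: emeasure_eq_measure)
  qed
  \<comment> \<open>The 3 comes from the square of a sum of three terms, along the path from
    \<open>\<gamma> p\<close> over \<open>s p\<close> and \<open>s r\<close> to
    \<open>\<gamma> r\<close>. Off \<open>Z\<close>, points closer than \<open>d\<close> lie in the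
    same compact set, so the middle term vanishes.\<close>
  define b where "b t = 3 * (sn (\<gamma> t - s t))\<^sup>2 + 3 * B * indicator Z t" for t
  have \<gamma>s: "integrable ?M (\<lambda>t. (sn (\<gamma> t - s t))\<^sup>2)"
    using BL_integrable[OF BL_diff[OF \<gamma> s(3)]] by simp
  have iZ: "integrable ?M (indicator Z :: real \<Rightarrow> real)" using Zs by (simp add: less_top[symmetric])
  have "integrable ?M b" unfolding b_def using \<gamma>s iZ by auto
  moreover have "0 \<le> b t" for t using B by (simp add: b_def)
  moreover have "(\<integral>t. b t \<partial>?M) \<le> e"
  proof -
    have "(\<integral>t. b t \<partial>?M) = 3 * (\<integral>t. (sn (\<gamma> t - s t))\<^sup>2 \<partial>?M) + 3 * B * measure ?M Z"
      unfolding b_def using \<gamma>s iZ ZI by (simp add: Int_absorb2)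
    also have "3 * B * measure ?M Z \<le> 3 * (B + 1) * ((real (card ?V) + 1) * \<eta>)"
      using mZ B \<eta> by (intro mult_mono) (auto intro: order_trans[OF mZ])
    also have "\<dots> = e / 4"
    proof -
      have "3 * x * (y * (e / (12 * x * y))) = e / 4" if "0 < x" "0 < y" for x y :: real
        using that by simp
      from this[of "B + 1" "real (card ?V) + 1"] show ?thesis unfolding \<eta>_def using B by linarith
    qed
    finally show ?thesis using s(4) e by linarith
  qed
  moreover have "AE t in ?M. \<gamma> t \<in> S" using BL_AE_mem[OF \<gamma>] .
  moreover have "(sn (\<gamma> p - \<gamma> r))\<^sup>2 \<le> b p + b r"
    if pr: "p \<in> {0<..<T}" "r \<in> {0<..<T}" "\<gamma> p \<in> S" "\<gamma> r \<in> S" "\<bar>p - r\<bar> < d" for p r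
  proof -
    have ss: "s p \<in> S" "s r \<in> S" using s(2) pr by auto
    have s3: "(sn (s p - s r))\<^sup>2 \<le> B * indicator Z p + B * indicator Z r"
    proof (cases "p \<in> Z \<or> r \<in> Z")
      case True
      then show ?thesis using B_ge[of "s p" "s r"] pr B by (auto simp: indicator_def)
    next
      case False
      then have "p \<in> K (s p)" "r \<in> K (s r)" using pr by (auto simp: Z_def A_def)
      then have "s p = s r" using d(2)[of "s p" "s r" p r] pr by (force simp: dist_real_def)
      then show ?thesis using B by simp
    qed
    have "\<gamma> p - \<gamma> r = (\<gamma> p - s p) + ((s p - s r) + (s r - \<gamma> r))" by simp
    then have "sn (\<gamma> p - \<gamma> r) \<le> sn (\<gamma> p - s p) + (sn (s p - s r) + sn (s r - \<gamma> r))"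
      using sn_triangle[of "\<gamma> p - s p" "(s p - s r) + (s r - \<gamma> r)"] sn_triangle[of "s p - s r" "s r - \<gamma> r"] pr ss by simp
    then have "(sn (\<gamma> p - \<gamma> r))\<^sup>2 \<le> (sn (\<gamma> p - s p) + (sn (s p - s r) + sn (s r - \<gamma> r)))\<^sup>2"
      using pr by (intro power_mono sn_nonneg) auto
    also have "\<dots> \<le> 3 * (sn (\<gamma> p - s p))\<^sup>2 + 3 * (sn (s p - s r))\<^sup>2 + 3 * (sn (s r - \<gamma> r))\<^sup>2"
    proof -
      have "(x + (y + z))\<^sup>2 \<le> 3 * x\<^sup>2 + 3 * y\<^sup>2 + 3 * z\<^sup>2" for x y z :: real
        using sum_squares_bound[of x y] sum_squares_bound[of x z] sum_squares_bound[of y z]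
        by (simp add: power2_eq_square algebra_simps)
      then show ?thesis .
    qed
    finally show ?thesis using s3 sn_minus_commute[of "s r" "\<gamma> r"] pr ss by (simp add: b_def)
  qed
  ultimately show ?thesis using that[of b d "\<lambda>t. \<gamma> t \<in> S"] d(1) by blast
qed

text \<open>Isolates the energy identity from the Stokes setting. The time derivative enters through
  its Riesz representative: \<open>ipV (\<gamma> t) w\<close> is the value of the derivative of
  \<open>e\<close> at \<open>w\<close>. Completeness is asked of \<open>H\<close>, where the
  continuous representative is built as a limit.\<close>

locale evolution = V: semi_inner V ipV + H: semi_hilbert H ipH
  for V H :: "'v::real_vector set" and ipV ipH +
  fixes C T :: real and e \<gamma> :: "real \<Rightarrow> 'v"
  assumes VH: "V \<subseteq> H" and embed: "v \<in> V \<Longrightarrow> snorm ipH v \<le> C * snorm ipV v"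
    and T: "0 < T"
    and e: "e \<in> bochner_L2 (time_interval T) V (snorm ipV)"
    and \<gamma>: "\<gamma> \<in> bochner_L2 (time_interval T) V (snorm ipV)"
    and weak: "\<phi> \<in> test_functions {0<..<T} \<Longrightarrow> w \<in> V \<Longrightarrow>
      (\<integral>t. deriv \<phi> t * ipH (e t) w \<partial>time_interval T) = - (\<integral>t. \<phi> t * ipV (\<gamma> t) w \<partial>time_interval T)"
begin

abbreviation "M \<equiv> time_interval T"

sublocale M: finite_measure M by (rule finite_measure_time_interval)
sublocale MC: complete_measure M by (rule complete_measure_lebesgue_on) simp
sublocale BV: bochner_space V ipV M ..
sublocale BH: bochner_space H ipH M ..

lemma eH: "e \<in> BH.BL"
proof (rule bochner_L2_lipschitz[OF BV.bochner_space_axioms BH.bochner_space_axioms e, of "\<lambda>x. x" C])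
qed (use VH embed V.S_diff in auto)

lemma VH_mem: "v \<in> V \<Longrightarrow> v \<in> H" using VH by auto

text \<open>Integrated derivative: \<open>pairing w t - pairing w s\<close> is the increment of
  \<open>ipH (e t) w\<close> that the weak derivative predicts.\<close>

definition pairing :: "'v \<Rightarrow> real \<Rightarrow> real" where
  "pairing w = prim T (\<lambda>r. ipV (\<gamma> r) w)"

lemma pairing_integrable: "w \<in> V \<Longrightarrow> integrable M (\<lambda>r. ipV (\<gamma> r) w)"
  by (rule BV.BL_ip_const_integrable[OF finite_measure_time_interval \<gamma>])

lemma pairing_diff: "v \<in> V \<Longrightarrow> w \<in> V \<Longrightarrow> pairing (v - w) t = pairing v t - pairing w t"
proof -
  assume v: "v \<in> V" and w: "w \<in> V"
  have "pairing (v - w) t = prim T (\<lambda>r. ipV (\<gamma> r) v - ipV (\<gamma> r) w) t"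
    unfolding pairing_def prim_def
  proof (rule integral_cong_AE)
    note [measurable] = pairing_integrable[OF V.S_diff[OF v w], THEN borel_measurable_integrable]
      pairing_integrable[OF v, THEN borel_measurable_integrable] pairing_integrable[OF w, THEN borel_measurable_integrable]
    have [measurable]: "(indicator {..<t} :: real \<Rightarrow> real) \<in> borel_measurable M"
      by (intro measurable_time_interval) simp
    show "(\<lambda>s. indicator {..<t} s * ipV (\<gamma> s) (v - w)) \<in> borel_measurable M"
      "(\<lambda>s. indicator {..<t} s * (ipV (\<gamma> s) v - ipV (\<gamma> s) w)) \<in> borel_measurable M" by measurable
    show "AE s in M. indicator {..<t} s * ipV (\<gamma> s) (v - w) = indicator {..<t} s * (ipV (\<gamma> s) v - ipV (\<gamma> s) w)"
      using BV.BL_AE_mem[OF \<gamma>] by eventually_elim (use v w in \<open>simp add: V.ip_diff_right\<close>)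
  qed
  then show ?thesis using prim_diff_fun[OF pairing_integrable[OF v] pairing_integrable[OF w]] by (simp add: pairing_def)
qed

lemma abs_pairing_le: "w \<in> V \<Longrightarrow> \<bar>pairing w t\<bar> \<le> (\<integral>r. snorm ipV (\<gamma> r) \<partial>M) * snorm ipV w"
proof -
  assume w: "w \<in> V"
  have "\<bar>pairing w t\<bar> \<le> (\<integral>r. snorm ipV (\<gamma> r) * snorm ipV w \<partial>M)"
    unfolding pairing_def
  proof (rule prim_le_integral)
    show "integrable M (\<lambda>r. snorm ipV (\<gamma> r) * snorm ipV w)"
      using BV.BL_sn_integrable[OF finite_measure_time_interval \<gamma>] by simp
    show "AE r in M. \<bar>ipV (\<gamma> r) w\<bar> \<le> snorm ipV (\<gamma> r) * snorm ipV w"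
      using BV.BL_AE_mem[OF \<gamma>] by eventually_elim (use w V.ip_le_sn in auto)
  qed (rule pairing_integrable[OF w])
  then show ?thesis by simp
qed

text \<open>Only countably many test vectors are needed to identify the increments of \<open>e\<close> tested with
  the values of \<open>e\<close> itself.\<close>

lemma ex_good:
  obtains good where "AE t in M. good t" "\<And>t. good t \<Longrightarrow> t \<in> {0<..<T} \<and> e t \<in> V"
    "\<And>s t r. good s \<Longrightarrow> good t \<Longrightarrow> good r \<Longrightarrow> ipH (e t - e s) (e r) = pairing (e r) t - pairing (e r) s"
proof -
  obtain s where s: "\<And>n. simple_function M (s n)" "\<And>n t. t \<in> space M \<Longrightarrow> s n t \<in> V"
    "AE t in M. e t \<in> V" "AE t in M. (\<lambda>n::nat. snorm ipV (s n t - e t)) \<longlonglongrightarrow> 0"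
    by (rule BV.BM_obtain[OF BV.BL_BM[OF e]]) (rule that)
  define W0 where "W0 = (\<Union>n. s n ` space M)"
  have "countable (s n ` space M)" for n by (rule countable_finite[OF simple_functionD(1)[OF s(1)]])
  then have W0: "countable W0" "W0 \<subseteq> V"
    using s(2) by (auto simp: W0_def simp del: space_time_interval intro!: countable_UN)
  have "\<exists>c. AE t in M. ipH (e t) w = c + pairing w t" if "w \<in> V" for w
    unfolding pairing_def
    by (rule du_Bois_Reymond[OF T BH.BL_ip_const_integrable[OF finite_measure_time_interval eH VH_mem[OF that]]
          pairing_integrable[OF that] weak[OF _ that]])
  \<comment> \<open>The exceptional null set and the constant \<open>c w\<close> depend on
    \<open>w\<close>. Restricting to the countable \<open>W0\<close> leaves one null set, and taking
    increments removes the constant.\<close>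
  then obtain c where c: "\<And>w. w \<in> V \<Longrightarrow> AE t in M. ipH (e t) w = c w + pairing w t" by metis
  have W0c: "AE t in M. \<forall>w\<in>W0. ipH (e t) w = c w + pairing w t"
    using W0 c by (intro AE_ball_countable[THEN iffD2]) auto
  define good where "good t \<longleftrightarrow> t \<in> {0<..<T} \<and> e t \<in> V \<and> (\<lambda>n. snorm ipV (s n t - e t)) \<longlonglongrightarrow> 0
      \<and> (\<forall>w\<in>W0. ipH (e t) w = c w + pairing w t)" for t
  have "AE t in M. good t"
    using s(3,4) W0c AE_space by eventually_elim (auto simp: good_def)
  moreover have "t \<in> {0<..<T} \<and> e t \<in> V" if "good t" for t using that by (simp add: good_def)
  moreover have "ipH (e t - e s') (e r) = pairing (e r) t - pairing (e r) s'" if g: "good s'" "good t" "good r" for s' t r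
  proof (rule LIMSEQ_unique)
    have rI: "r \<in> space M" and er: "e r \<in> V" "\<And>n. s n r \<in> V" and l: "(\<lambda>n. snorm ipV (s n r - e r)) \<longlonglongrightarrow> 0"
      using g(3) s(2) by (auto simp: good_def)
    have ets: "e t - e s' \<in> H" "e t \<in> H" "e s' \<in> H" using g VH by (auto simp: good_def)
    have lH: "(\<lambda>n. snorm ipH (s n r - e r)) \<longlonglongrightarrow> 0"
    proof (rule Lim_null_comparison)
      show "(\<lambda>n. C * snorm ipV (s n r - e r)) \<longlonglongrightarrow> 0" using tendsto_mult_right_zero[OF l] .
      show "\<forall>\<^sub>F n in sequentially. norm (snorm ipH (s n r - e r)) \<le> C * snorm ipV (s n r - e r)"
        using embed H.sn_nonneg er VH by (auto simp: subset_eq)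
    qed
    show "(\<lambda>n. ipH (e t - e s') (s n r)) \<longlonglongrightarrow> ipH (e t - e s') (e r)"
      using H.tendsto_ip[OF _ ets(1) _ _ _ lH, of "\<lambda>_. e t - e s'"] er VH ets by (auto simp: subset_eq)
    have "ipH (e t - e s') (s n r) = pairing (s n r) t - pairing (s n r) s'" for n
    proof -
      have "s n r \<in> W0" unfolding W0_def using rI by blast
      then show ?thesis using g ets er VH by (auto simp: good_def H.ip_diff_left subset_eq)
    qed
    moreover have "(\<lambda>n. pairing (s n r) q) \<longlonglongrightarrow> pairing (e r) q" for q
    proof -
      have "(\<lambda>n. pairing (s n r) q - pairing (e r) q) \<longlonglongrightarrow> 0"
      proof (rule Lim_null_comparison)
        show "(\<lambda>n. (\<integral>r. snorm ipV (\<gamma> r) \<partial>M) * snorm ipV (s n r - e r)) \<longlonglongrightarrow> 0" using tendsto_mult_right_zero[OF l] .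
        show "\<forall>\<^sub>F n in sequentially. norm (pairing (s n r) q - pairing (e r) q) \<le> (\<integral>r. snorm ipV (\<gamma> r) \<partial>M) * snorm ipV (s n r - e r)"
          using abs_pairing_le[of "s _ r - e r" q] pairing_diff er by (auto simp: V.S_diff)
      qed
      then show ?thesis by (simp add: LIM_zero_iff)
    qed
    ultimately show "(\<lambda>n. ipH (e t - e s') (s n r)) \<longlonglongrightarrow> pairing (e r) t - pairing (e r) s'"
      by (simp add: tendsto_diff)
  qed
  ultimately show ?thesis using that by blast
qed

end

lemma prim_const_diff:
  assumes "0 \<le> s" "s \<le> t" "t \<le> T"
  shows "prim T (\<lambda>_. c) t - prim T (\<lambda>_. c) s = c * (t - s)"
proof -
  interpret finite_measure "time_interval T" by (rule finite_measure_time_interval)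
  have "prim T (\<lambda>_. c) t - prim T (\<lambda>_. c) s = (\<integral>r. indicator {s..<t} r * c \<partial>time_interval T)"
    by (rule prim_diff) (use assms in auto)
  also have "\<dots> = (\<integral>r. indicator {0<..<T} r *\<^sub>R (indicator {s..<t} r * c) \<partial>lebesgue)"
    by (subst integral_restrict_space) auto
  also have "\<dots> = (\<integral>r. indicator {s..<t} r * c \<partial>lebesgue)"
  proof (rule integral_cong_AE)
    \<comment> \<open>For \<open>s = 0\<close> the half-open interval contains the end point 0,
      which lies outside \<open>{0<..<T}\<close>.\<close>
    have "{0} \<in> null_sets (lebesgue :: real measure)" by simp
    then have "AE r in lebesgue. (r::real) \<notin> {0}" by (rule AE_not_in)
    then show "AE r in lebesgue. indicator {0<..<T} r *\<^sub>R (indicator {s..<t} r * c) = indicator {s..<t} r * c"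
      by eventually_elim (use assms in \<open>auto simp: indicator_def\<close>)
  qed (auto intro!: borel_measurable_times borel_measurable_indicator)
  also have "\<dots> = c * (t - s)" using assms by simp
  finally show ?thesis .
qed

lemma abs_prim_diff_le_between:
  assumes "integrable (time_interval T) \<beta>" "integrable (time_interval T) h" "\<And>r. 0 \<le> h r"
    "AE r in time_interval T. \<bar>\<beta> r\<bar> \<le> h r" "x \<in> {s..t}" "y \<in> {s..t}"
  shows "\<bar>prim T \<beta> y - prim T \<beta> x\<bar> \<le> prim T h t - prim T h s"
proof -
  have *: "\<bar>prim T \<beta> y - prim T \<beta> x\<bar> \<le> prim T h t - prim T h s" if "x \<in> {s..t}" "y \<in> {s..t}" "x \<le> y" for x y
    using abs_prim_diff_le[OF assms(1,2,4) that(3)] prim_mono[OF assms(2,3), of s x] prim_mono[OF assms(2,3), of y t] that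
    by simp
  show ?thesis
  proof (cases "x \<le> y")
    case False
    then show ?thesis using *[of y x] assms(5,6) by (simp add: abs_minus_commute)
  qed (use * assms in auto)
qed

text \<open>Makes \<open>\<phi>\<close> the difference of the nonnegative test functions
  \<open>\<phi> + \<omega>\<close> and \<open>\<omega>\<close>, so that identities known for
  nonnegative test functions extend by linearity.\<close>

lemma test_function_dominate:
  fixes \<phi> :: "real \<Rightarrow> real"
  assumes \<phi>: "\<phi> \<in> test_functions {0<..<T}" and T: "0 < T"
  shows "\<exists>\<omega>\<in>test_functions {0<..<T}. (\<forall>t. 0 \<le> \<omega> t) \<and> (\<forall>t. 0 \<le> \<phi> t + \<omega> t)"
proof -
  obtain a b where ab: "0 < a" "a \<le> b" "b < T" "\<And>x. x \<notin> {a..b} \<Longrightarrow> \<phi> x = 0" using test_function_interval[OF \<phi> T] by metis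
  obtain C where C: "0 < C" "\<And>t. \<bar>\<phi> t\<bar> \<le> C" using test_function_bounded[OF \<phi> T] by metis
  \<comment> \<open>The largest distance from \<open>T/2\<close> to a point of
    \<open>{a..b}\<close>. As \<open>\<rho>\<close> lies halfway between \<open>m\<close> and
    \<open>T/2\<close>, the bump is positive on \<open>{a..b}\<close> and supported inside the
    interval.\<close>
  define m where "m = max (T/2 - a) (b - T/2)"
  define \<rho> where "\<rho> = (T/2 + m) / 2"
  have m: "m < \<rho>" "\<rho> < T/2" "0 \<le> \<rho>" using ab by (auto simp: \<rho>_def m_def max_def field_simps)
  define w where "w = bump (T/2) \<rho> 1"
  have sm: "smooth_expr w" unfolding w_def by (rule smooth_expr_bump)
  have w: "w \<in> test_functions {0<..<T}"
  proof (rule test_functions_smooth_expr[OF sm])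
    show "cball (T/2) \<rho> \<subseteq> {0<..<T}"
    proof
      fix x assume "x \<in> cball (T/2) \<rho>"
      then have "\<bar>T/2 - x\<bar> \<le> \<rho>" by (simp add: dist_real_def)
      then have "0 < x" "x < T" using m by arith+
      then show "x \<in> {0<..<T}" by simp
    qed
    show "w x = 0" if "x \<notin> cball (T/2) \<rho>" for x
      unfolding w_def by (rule bump_eq_0) (use m that in auto)
  qed simp
  have wp: "0 < w x" if "x \<in> {a..b}" for x
  proof -
    have "\<bar>T/2 - x\<bar> \<le> m" using that by (auto simp: m_def)
    then have "x \<in> ball (T/2) \<rho>" using m by (simp add: dist_real_def)
    then show ?thesis unfolding w_def by (intro bump_pos) auto
  qed
  have "continuous_on {a..b} w" using test_functions_derivative(2)[OF w] by (rule continuous_on_subset) simp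
  from continuous_attains_inf[OF compact_Icc _ this] ab(2)
  obtain x0 where x0: "x0 \<in> {a..b}" "\<And>y. y \<in> {a..b} \<Longrightarrow> w x0 \<le> w y" by auto
  have w0: "0 < w x0" by (rule wp[OF x0(1)])
  have wnn: "0 \<le> w t" for t by (simp add: w_def bump_bounds)
  define k where "k = C / w x0"
  have k: "0 \<le> k" using C w0 by (simp add: k_def)
  have "0 \<le> \<phi> t + k * w t" for t
  proof (cases "t \<in> {a..b}")
    case True
    have "C = k * w x0" using w0 by (simp add: k_def)
    also have "\<dots> \<le> k * w t" by (rule mult_left_mono[OF x0(2)[OF True] k])
    finally show ?thesis using C(2)[of t] by linarith
  qed (use ab(4) k wnn in auto)
  moreover have "k *\<^sub>R w \<in> test_functions {0<..<T}" using subspace_scale[OF subspace_test_functions w] .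
  ultimately show ?thesis using k wnn by (intro bexI[of _ "k *\<^sub>R w"]) (auto simp: scaleR_fun_def)
qed

section \<open>Distributional derivative of the squared norm\<close>

context evolution
begin

definition q :: "real \<Rightarrow> real" where "q t = ipH (e t) (e t)"
definition \<beta> :: "real \<Rightarrow> real" where "\<beta> t = ipV (\<gamma> t) (e t)"
definition ne :: "real \<Rightarrow> real" where "ne t = (snorm ipV (e t))\<^sup>2"

lemma ne_nonneg: "0 \<le> ne t"
  by (simp add: ne_def)

lemma q_integrable: "integrable M q"
  unfolding q_def[abs_def] by (rule BH.BL_ip_integrable[OF eH eH])
lemma \<beta>_integrable: "integrable M \<beta>"
  unfolding \<beta>_def[abs_def] by (rule BV.BL_ip_integrable[OF \<gamma> e])
lemma ne_integrable: "integrable M ne"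
  unfolding ne_def[abs_def] by (rule BV.BL_integrable[OF e])

text \<open>The sign \<open>sg\<close> of \<open>h\<close> selects forward or backward difference quotients; both give a one-sided
  bound because \<open>q (r + h) - q r \<ge> 2 ipH (e (r + h) - e r) (e r)\<close>.\<close>

lemma difference_quotient_ge:
  assumes b: "integrable M b" and \<kappa>: "0 < \<kappa>"
    and P: "AE t in M. P t"
    and mod: "\<And>s r. s \<in> {0<..<T} \<Longrightarrow> r \<in> {0<..<T} \<Longrightarrow> P s \<Longrightarrow> P r \<Longrightarrow> \<bar>s - r\<bar> < d \<Longrightarrow> (snorm ipV (\<gamma> s - \<gamma> r))\<^sup>2 \<le> b s + b r"
    and r: "e r \<in> V" "\<gamma> r \<in> V" "P r" "r \<in> {0<..<T}"
    and rh: "e (r + h) \<in> V" "r + h \<in> {0<..<T}" "\<bar>h\<bar> < d" "0 < sg * h" "\<bar>sg\<bar> = 1"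
    and inc: "ipH (e (r + h) - e r) (e r) = pairing (e r) (r + h) - pairing (e r) r"
  shows "sg * 2 * \<beta> r - b r / \<kappa> - \<kappa> * ne r
    \<le> (sg * q (r + h) + prim T b (r + h) / \<kappa> - (sg * q r + prim T b r / \<kappa>)) / h"
proof -
  interpret finite_measure M by (rule finite_measure_time_interval)
  \<comment> \<open>The part of the error that depends only on \<open>r\<close>, from Young's
    inequality with parameter \<open>\<kappa>\<close>. The remaining part
    \<open>b s / (2 * \<kappa>)\<close> is integrated over \<open>s\<close> and becomes the
    increment of \<open>prim T b\<close> in the conclusion.\<close>
  define c where "c = b r / (2 * \<kappa>) + \<kappa> / 2 * ne r"
  define F where "F s = ipV (\<gamma> s) (e r)" for s
  have F: "integrable M F" unfolding F_def[abs_def] by (rule pairing_integrable[OF r(1)])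
  have dev: "\<bar>F s - \<beta> r\<bar> \<le> b s / (2 * \<kappa>) + c"
    if s: "\<gamma> s \<in> V" "P s" "s \<in> {0<..<T}" "\<bar>s - r\<bar> < d" for s
  proof -
    have "F s - \<beta> r = ipV (\<gamma> s - \<gamma> r) (e r)" using s r by (simp add: F_def \<beta>_def V.ip_diff_left)
    also have "\<bar>\<dots>\<bar> \<le> snorm ipV (\<gamma> s - \<gamma> r) * snorm ipV (e r)" using s r by (intro V.ip_le_sn) auto
    also have "\<dots> \<le> (snorm ipV (\<gamma> s - \<gamma> r))\<^sup>2 / (2 * \<kappa>) + \<kappa> / 2 * ne r"
    proof -
      have "0 \<le> (snorm ipV (\<gamma> s - \<gamma> r) - \<kappa> * snorm ipV (e r))\<^sup>2 / (2 * \<kappa>)" using \<kappa> by simp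
      also have "\<dots> = (snorm ipV (\<gamma> s - \<gamma> r))\<^sup>2 / (2 * \<kappa>) + \<kappa> / 2 * ne r - snorm ipV (\<gamma> s - \<gamma> r) * snorm ipV (e r)"
        using \<kappa> by (simp add: ne_def power2_diff power_mult_distrib field_simps power2_eq_square)
      finally show ?thesis by simp
    qed
    also have "\<dots> \<le> (b s + b r) / (2 * \<kappa>) + \<kappa> / 2 * ne r"
      using mod[of s r] s r \<kappa> by (intro add_right_mono divide_right_mono) auto
    finally show ?thesis by (simp add: c_def add_divide_distrib)
  qed
  have b2: "integrable M (\<lambda>s. b s / (2 * \<kappa>))" using b by simp
  have inter: "\<bar>(prim T F y - prim T F x) - \<beta> r * (y - x)\<bar> \<le> (prim T b y - prim T b x) / (2 * \<kappa>) + c * (y - x)"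
    if xy: "x \<le> y" "0 \<le> x" "y \<le> T" "\<And>s. x \<le> s \<Longrightarrow> s < y \<Longrightarrow> \<bar>s - r\<bar> < d" for x y
  proof -
    have "(prim T F y - prim T F x) - \<beta> r * (y - x) = (\<integral>s. indicator {x..<y} s * (F s - \<beta> r) \<partial>M)"
    proof -
      have "(\<integral>s. indicator {x..<y} s * (F s - \<beta> r) \<partial>M) = prim T (\<lambda>s. F s - \<beta> r) y - prim T (\<lambda>s. F s - \<beta> r) x"
        using F xy by (intro prim_diff[symmetric]) auto
      then show ?thesis using prim_const_diff[OF xy(2,1,3), of "\<beta> r"] prim_diff_fun[OF F, of "\<lambda>_. \<beta> r"] by simp
    qed
    also have "\<bar>\<dots>\<bar> \<le> (\<integral>s. indicator {x..<y} s * (b s / (2 * \<kappa>) + c) \<partial>M)"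
    proof (rule order_trans[OF integral_abs_bound], rule integral_mono_AE)
      show "AE s in M. \<bar>indicator {x..<y} s * (F s - \<beta> r)\<bar> \<le> indicator {x..<y} s * (b s / (2 * \<kappa>) + c)"
        using P BV.BL_AE_mem[OF \<gamma>] AE_space
        by eventually_elim (use dev xy(4) in \<open>auto simp: indicator_def abs_mult\<close>)
    qed (use F b2 in \<open>auto intro!: integrable_indicator_mult integrable_abs\<close>)
    also have "\<dots> = prim T (\<lambda>s. b s / (2 * \<kappa>) + c) y - prim T (\<lambda>s. b s / (2 * \<kappa>) + c) x"
      using b2 xy by (intro prim_diff[symmetric]) auto
    also have "\<dots> = (prim T b y - prim T b x) / (2 * \<kappa>) + c * (y - x)"
      using prim_const_diff[OF xy(2,1,3), of c] prim_add[OF b2, of "\<lambda>_. c"] prim_mult[of T "1 / (2 * \<kappa>)" b]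
      by (simp add: diff_divide_distrib)
    finally show ?thesis .
  qed
  have "0 \<le> ipH (e (r + h) - e r) (e (r + h) - e r)"
    using r rh VH_mem by (intro H.ip_nonneg) auto
  also have "\<dots> = q (r + h) - q r - 2 * ipH (e (r + h) - e r) (e r)"
    using r rh VH_mem H.ip_commute[of "e r" "e (r + h)"] by (simp add: q_def H.ip_simps)
  finally have qq: "q (r + h) - q r \<ge> 2 * (prim T F (r + h) - prim T F r)"
    unfolding inc by (simp add: pairing_def F_def[abs_def])
  have c2: "sg * 2 * \<beta> r - b r / \<kappa> - \<kappa> * ne r = sg * 2 * \<beta> r - 2 * c" using \<kappa> by (simp add: c_def field_simps)
  define D where "D = (prim T b (r + h) - prim T b r) / \<kappa>"
  have D: "(prim T b (r + h) - prim T b r) / (2 * \<kappa>) = D / 2" "(prim T b r - prim T b (r + h)) / (2 * \<kappa>) = - D / 2"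
    "prim T b (r + h) / \<kappa> - prim T b r / \<kappa> = D"
    using \<kappa> by (auto simp: D_def field_simps)
  have eq: "sg * q (r + h) + prim T b (r + h) / \<kappa> - (sg * q r + prim T b r / \<kappa>) = sg * (q (r + h) - q r) + D"
    using D(3) by (simp add: algebra_simps)
  show ?thesis
  proof (cases "0 < h")
    case True
    then have sg: "sg = 1" using rh(4,5) by (auto simp: zero_less_mult_iff abs_if split: if_splits)
    have "\<bar>(prim T F (r + h) - prim T F r) - \<beta> r * h\<bar> \<le> (prim T b (r + h) - prim T b r) / (2 * \<kappa>) + c * h"
      using inter[of r "r + h"] True r(4) rh(2,3) by simp
    then have "(prim T F (r + h) - prim T F r) - \<beta> r * h \<ge> - (D / 2 + c * h)" unfolding D by linarith
    then have "(2 * \<beta> r - 2 * c) * h \<le> q (r + h) - q r + D" using qq by (simp add: algebra_simps)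
    then have "sg * 2 * \<beta> r - 2 * c \<le> (sg * (q (r + h) - q r) + D) / h"
      unfolding sg using True by (simp add: pos_le_divide_eq)
    then show ?thesis unfolding c2 eq .
  next
    case False
    \<comment> \<open>Division by the negative \<open>h\<close> reverses the inequality, so the
      lower bound for the increment of \<open>q\<close> becomes an upper bound for its derivative;
      \<open>sg = -1\<close> writes it as a lower bound for the negative.\<close>
    then have h: "h < 0" using rh(4) by (cases "h = 0") auto
    then have sg: "sg = -1" using rh(4,5) by (auto simp: zero_less_mult_iff abs_if split: if_splits)
    have "\<bar>(prim T F r - prim T F (r + h)) - \<beta> r * (- h)\<bar> \<le> (prim T b r - prim T b (r + h)) / (2 * \<kappa>) + c * (- h)"
      using inter[of "r + h" r] h r(4) rh(2,3) by simp
    then have "(prim T F r - prim T F (r + h)) - \<beta> r * (- h) \<le> - D / 2 + c * (- h)" unfolding D by linarith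
    then have "- (q (r + h) - q r) + D \<le> (- 2 * \<beta> r - 2 * c) * h" using qq by (simp add: algebra_simps)
    then have "sg * 2 * \<beta> r - 2 * c \<le> (sg * (q (r + h) - q r) + D) / h"
      unfolding sg using h by (simp add: neg_le_divide_eq)
    then show ?thesis unfolding c2 eq .
  qed
qed

text \<open>After testing with \<open>\<phi>\<close>, the error \<open>b / \<kappa>\<close> occurs
  twice, once directly and once through the distributional derivative of \<open>prim T b\<close>,
  and the error \<open>\<kappa> * ne\<close> once. All are made small by choosing
  \<open>\<kappa>\<close> and then the integral of \<open>b\<close>.\<close>

lemma energy_one_sided:
  assumes \<phi>: "\<phi> \<in> test_functions {0<..<T}" "\<And>t. 0 \<le> \<phi> t" and sg: "\<bar>sg\<bar> = 1"
  shows "sg * 2 * (\<integral>t. \<phi> t * \<beta> t \<partial>M) \<le> - sg * (\<integral>t. deriv \<phi> t * q t \<partial>M)"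
proof (rule field_le_epsilon)
  fix \<delta> :: real assume \<delta>: "0 < \<delta>"
  obtain C where C: "0 < C" "\<And>t. \<bar>\<phi> t\<bar> \<le> C" "\<And>t. \<bar>deriv \<phi> t\<bar> \<le> C" using test_function_bounded[OF \<phi>(1) T] by metis
  note rt = test_function_real[OF \<phi>(1)]
  define N where "N = (\<integral>t. ne t \<partial>M)"
  have N: "0 \<le> N" by (simp add: N_def ne_def)
  \<comment> \<open>This \<open>\<kappa>\<close> bounds the \<open>ne\<close> term by
    \<open>\<delta> / 2\<close>; then \<open>\<epsilon>\<close> is taken so small, relative to
    \<open>\<kappa>\<close>, that each of the two \<open>b\<close> terms is at most
    \<open>\<delta> / 4\<close>.\<close>
  define \<kappa> where "\<kappa> = \<delta> / (2 * (C * N + 1))"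
  have \<kappa>: "0 < \<kappa>" using \<delta> N C(1) by (simp add: \<kappa>_def add_nonneg_pos)
  define \<epsilon> where "\<epsilon> = \<delta> * \<kappa> / (4 * C)"
  have \<epsilon>: "0 < \<epsilon>" using \<delta> \<kappa> C by (simp add: \<epsilon>_def)
  obtain b d P where b: "integrable M b" "\<And>t. 0 \<le> b t" "(\<integral>t. b t \<partial>M) \<le> \<epsilon>" "0 < d" "AE t in M. P t"
    "\<And>s r. s \<in> {0<..<T} \<Longrightarrow> r \<in> {0<..<T} \<Longrightarrow> P s \<Longrightarrow> P r \<Longrightarrow> \<bar>s - r\<bar> < d \<Longrightarrow> (snorm ipV (\<gamma> s - \<gamma> r))\<^sup>2 \<le> b s + b r"
    by (rule bochner_modulus[OF BV.bochner_space_axioms \<gamma> \<epsilon>]) (rule that)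
  obtain good where good: "AE t in M. good t" "\<And>t. good t \<Longrightarrow> t \<in> {0<..<T} \<and> e t \<in> V"
    "\<And>s t r. good s \<Longrightarrow> good t \<Longrightarrow> good r \<Longrightarrow> ipH (e t - e s) (e r) = pairing (e r) t - pairing (e r) s"
    by (rule ex_good) (rule that)
  have ae: "AE t in M. good t \<and> P t \<and> \<gamma> t \<in> V" using good(1) b(5) BV.BL_AE_mem[OF \<gamma>] by eventually_elim simp
  let ?Q = "\<lambda>t. sg * q t + prim T b t / \<kappa>"
  let ?g = "\<lambda>t. sg * 2 * \<beta> t - b t / \<kappa> - \<kappa> * ne t"
  have ig: "integrable M ?g" using \<beta>_integrable ne_integrable b(1) by auto
  have iQ: "integrable M ?Q" using q_integrable integrable_prim[OF b(1)] by auto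
  have "(\<integral>t. \<phi> t * ?g t \<partial>M) \<le> - (\<integral>t. deriv \<phi> t * ?Q t \<partial>M)"
  proof (rule weak_derivative_ge[OF T iQ ig ae _ _ b(4) _ \<phi>])
    show "(\<lambda>n. sg * (1 / real (Suc n))) \<longlonglongrightarrow> 0" using tendsto_mult_left[OF LIMSEQ_Suc[OF lim_1_over_n], of sg] by simp
    show "sg * (1 / real (Suc n)) \<noteq> 0" for n using sg by auto
    fix r n assume A: "good r \<and> P r \<and> \<gamma> r \<in> V"
      "good (r + sg * (1 / real (Suc n))) \<and> P (r + sg * (1 / real (Suc n))) \<and> \<gamma> (r + sg * (1 / real (Suc n))) \<in> V"
      "r \<in> {0<..<T}" "r + sg * (1 / real (Suc n)) \<in> {0<..<T}" "\<bar>sg * (1 / real (Suc n))\<bar> < d"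
    have "sg * sg = 1" using sg by (auto simp: abs_if split: if_splits)
    then have pos: "0 < sg * (sg * (1 / real (Suc n)))" by (simp flip: mult.assoc)
    show "?g r \<le> (?Q (r + sg * (1 / real (Suc n))) - ?Q r) / (sg * (1 / real (Suc n)))"
      by (rule difference_quotient_ge[OF b(1) \<kappa> b(5,6) _ _ _ A(3) _ A(4,5) pos sg])
        (use A good in auto)
  qed
  moreover have "(\<integral>t. \<phi> t * ?g t \<partial>M) = sg * 2 * (\<integral>t. \<phi> t * \<beta> t \<partial>M) - (\<integral>t. \<phi> t * b t \<partial>M) / \<kappa> - \<kappa> * (\<integral>t. \<phi> t * ne t \<partial>M)"
  proof -
    have "(\<integral>t. \<phi> t * ?g t \<partial>M) = (\<integral>t. sg * 2 * (\<phi> t * \<beta> t) - \<phi> t * b t / \<kappa> - \<kappa> * (\<phi> t * ne t) \<partial>M)"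
      by (rule Bochner_Integration.integral_cong) (simp_all add: algebra_simps)
    then show ?thesis
      using integrable_continuous_times[OF \<beta>_integrable rt(2) C(2)] integrable_continuous_times[OF b(1) rt(2) C(2)]
        integrable_continuous_times[OF ne_integrable rt(2) C(2)] by simp
  qed
  moreover have "(\<integral>t. deriv \<phi> t * ?Q t \<partial>M) = sg * (\<integral>t. deriv \<phi> t * q t \<partial>M) - (\<integral>t. \<phi> t * b t \<partial>M) / \<kappa>"
  proof -
    have "(\<integral>t. deriv \<phi> t * ?Q t \<partial>M) = (\<integral>t. sg * (deriv \<phi> t * q t) + deriv \<phi> t * prim T b t / \<kappa> \<partial>M)"
      by (rule Bochner_Integration.integral_cong) (simp_all add: algebra_simps)
    also have "\<dots> = sg * (\<integral>t. deriv \<phi> t * q t \<partial>M) + (\<integral>t. deriv \<phi> t * prim T b t \<partial>M) / \<kappa>"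
      using integrable_continuous_times[OF q_integrable rt(3) C(3)]
        integrable_continuous_times[OF integrable_prim[OF b(1)] rt(3) C(3)] by simp
    finally show ?thesis using prim_weak_derivative[OF T b(1) \<phi>(1)] by simp
  qed
  moreover have "(\<integral>t. \<phi> t * b t \<partial>M) / \<kappa> \<le> \<delta> / 4"
  proof -
    have "(\<integral>t. \<phi> t * b t \<partial>M) \<le> (\<integral>t. C * b t \<partial>M)"
      using C(2) b(2) by (intro integral_mono integrable_continuous_times[OF b(1) rt(2) C(2)])
        (auto intro!: mult_right_mono b(1) simp: abs_le_iff)
    also have "\<dots> \<le> C * \<epsilon>" using b(3) C(1) by simp
    also have "\<dots> = \<delta> / 4 * \<kappa>" using C(1) by (simp add: \<epsilon>_def)
    finally show ?thesis using \<kappa> by (simp add: pos_divide_le_eq)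
  qed
  moreover have "\<kappa> * (\<integral>t. \<phi> t * ne t \<partial>M) \<le> \<delta> / 2"
  proof -
    have "(\<integral>t. \<phi> t * ne t \<partial>M) \<le> (\<integral>t. C * ne t \<partial>M)"
      using C(2) by (intro integral_mono integrable_continuous_times[OF ne_integrable rt(2) C(2)])
        (auto intro!: mult_right_mono ne_integrable simp: abs_le_iff ne_nonneg)
    also have "\<dots> \<le> C * N + 1" by (simp add: N_def)
    finally have "\<kappa> * (\<integral>t. \<phi> t * ne t \<partial>M) \<le> \<kappa> * (C * N + 1)" using \<kappa> by simp
    also have "\<dots> = \<delta> / 2"
    proof -
      have "\<delta> / (2 * x) * x = \<delta> / 2" if "0 < x" for x using that by simp
      moreover have "0 < C * N + 1" using C N by (simp add: add_nonneg_pos)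
      ultimately show ?thesis unfolding \<kappa>_def by blast
    qed
    finally show ?thesis .
  qed
  moreover have "- sg * (\<integral>t. deriv \<phi> t * q t \<partial>M) = - (sg * (\<integral>t. deriv \<phi> t * q t \<partial>M))" by simp
  ultimately show "sg * 2 * (\<integral>t. \<phi> t * \<beta> t \<partial>M) \<le> - sg * (\<integral>t. deriv \<phi> t * q t \<partial>M) + \<delta>"
    using \<delta> by linarith
qed

text \<open>The two signs give opposite inequalities, hence equality for nonnegative test functions;
  domination removes the sign restriction, and the du Bois-Reymond lemma integrates the
  identity.\<close>

lemma energy_identity_AE: "\<exists>c. AE t in M. q t = c + 2 * prim T \<beta> t"
proof -
  have nn: "(\<integral>t. deriv \<phi> t * q t \<partial>M) = - (2 * (\<integral>t. \<phi> t * \<beta> t \<partial>M))"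
    if \<phi>: "\<phi> \<in> test_functions {0<..<T}" "\<And>t. 0 \<le> \<phi> t" for \<phi>
    using energy_one_sided[OF \<phi>, of 1] energy_one_sided[OF \<phi>, of "-1"] by simp
  have "\<exists>c. AE t in M. q t = c + prim T (\<lambda>t. 2 * \<beta> t) t"
  proof (rule du_Bois_Reymond[OF T q_integrable])
    show "integrable M (\<lambda>t. 2 * \<beta> t)" using \<beta>_integrable by simp
    fix \<phi> :: "real \<Rightarrow> real" assume \<phi>: "\<phi> \<in> test_functions {0<..<T}"
    obtain \<omega> where \<omega>: "\<omega> \<in> test_functions {0<..<T}" "\<And>t. 0 \<le> \<omega> t" "\<And>t. 0 \<le> \<phi> t + \<omega> t"
      using test_function_dominate[OF \<phi> T] by blast
    have sum: "(\<lambda>t. \<phi> t + \<omega> t) \<in> test_functions {0<..<T}"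
      using subspace_add[OF subspace_test_functions \<phi> \<omega>(1)] by (simp add: plus_fun_def)
    have d: "deriv (\<lambda>t. \<phi> t + \<omega> t) t = deriv \<phi> t + deriv \<omega> t" for t
      by (rule DERIV_imp_deriv[OF DERIV_add[OF test_function_real(1)[OF \<phi>] test_function_real(1)[OF \<omega>(1)]]])
    obtain C1 where C1: "\<And>t. \<bar>\<phi> t\<bar> \<le> C1" "\<And>t. \<bar>deriv \<phi> t\<bar> \<le> C1" using test_function_bounded[OF \<phi> T] by metis
    obtain C2 where C2: "\<And>t. \<bar>\<omega> t\<bar> \<le> C2" "\<And>t. \<bar>deriv \<omega> t\<bar> \<le> C2" using test_function_bounded[OF \<omega>(1) T] by metis
    note r1 = test_function_real[OF \<phi>] and r2 = test_function_real[OF \<omega>(1)]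
    have "(\<integral>t. (deriv \<phi> t + deriv \<omega> t) * q t \<partial>M) = - (2 * (\<integral>t. (\<phi> t + \<omega> t) * \<beta> t \<partial>M))"
      using nn[OF sum \<omega>(3)] by (simp add: d)
    then have "(\<integral>t. deriv \<phi> t * q t \<partial>M) + (\<integral>t. deriv \<omega> t * q t \<partial>M)
        = - (2 * ((\<integral>t. \<phi> t * \<beta> t \<partial>M) + (\<integral>t. \<omega> t * \<beta> t \<partial>M)))"
      using integrable_continuous_times[OF q_integrable r1(3) C1(2)] integrable_continuous_times[OF q_integrable r2(3) C2(2)]
        integrable_continuous_times[OF \<beta>_integrable r1(2) C1(1)] integrable_continuous_times[OF \<beta>_integrable r2(2) C2(1)]
      by (simp add: distrib_right)
    then have "(\<integral>t. deriv \<phi> t * q t \<partial>M) = - (2 * (\<integral>t. \<phi> t * \<beta> t \<partial>M))" using nn[OF \<omega>(1,2)] by simp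
    moreover have "(\<integral>t. \<phi> t * (2 * \<beta> t) \<partial>M) = (\<integral>t. 2 * (\<phi> t * \<beta> t) \<partial>M)"
      by (rule Bochner_Integration.integral_cong) simp_all
    ultimately show "(\<integral>t. deriv \<phi> t * q t \<partial>M) = - (\<integral>t. \<phi> t * (2 * \<beta> t) \<partial>M)" by simp
  qed
  then show ?thesis by (simp add: prim_mult)
qed

end

lemma AE_time_imp_ex:
  assumes "AE t in time_interval T. P t" "0 \<le> s" "s < t" "t \<le> T"
  shows "\<exists>r. s < r \<and> r < t \<and> P r"
proof (rule ccontr)
  assume n: "\<not> ?thesis"
  have "AE r in lebesgue. r \<in> {0<..<T} \<longrightarrow> P r" using assms(1) by (simp add: AE_restrict_space_iff)
  then have "AE r in lebesgue. r \<notin> {s<..<t}"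
    by eventually_elim (use n assms(2,4) in auto)
  then have "{s<..<t} \<in> null_sets lebesgue" by (subst AE_iff_null_sets) auto
  then have "emeasure lebesgue {s<..<t} = 0" by (rule null_setsD1)
  then show False using assms(3) by simp
qed

section \<open>The continuous representative with values in \<open>H\<close>\<close>

context evolution
begin

text \<open>Integrable density whose primitive serves as a modulus of continuity for the squared
  increments of \<open>e\<close> in \<open>H\<close>.\<close>

definition dens :: "real \<Rightarrow> real" where
  "dens t = (snorm ipV (\<gamma> t))\<^sup>2 + (snorm ipV (e t))\<^sup>2"

lemma dens_integrable: "integrable M dens"
  unfolding dens_def[abs_def] using BV.BL_integrable[OF \<gamma>] BV.BL_integrable[OF e] by simp

lemma dens_nonneg: "0 \<le> dens t"
  by (simp add: dens_def)

text \<open>Mean value argument: otherwise \<open>(t - s) * ne r\<close> minus the integral of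
  \<open>ne\<close> over the interval would be positive for almost every \<open>r\<close> in it,
  although its integral is zero. The left end point of the half-open interval is discarded as a null
  set.\<close>

lemma ex_small_norm:
  assumes good: "AE t in M. good t" and st: "0 \<le> s" "s < t" "t \<le> T"
  shows "\<exists>r. s < r \<and> r < t \<and> good r \<and> (t - s) * ne r \<le> prim T ne t - prim T ne s"
proof (rule ccontr)
  assume n: "\<not> ?thesis"
  let ?I = "prim T ne t - prim T ne s"
  let ?f = "\<lambda>r. indicator {s..<t} r * ((t - s) * ne r - ?I)"
  have io: "integrable M (\<lambda>r. (t - s) * ne r - ?I)" using ne_integrable by simp
  have i: "integrable M ?f" by (rule integrable_indicator_mult[OF io]) simp
  have sn: "{s} \<in> null_sets (lebesgue :: real measure)" by simp
  have "AE r in lebesgue. r \<in> {0<..<T} \<longrightarrow> r \<noteq> s" using AE_not_in[OF sn] by eventually_elim simp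
  then have "AE r in M. r \<noteq> s" by (simp add: AE_restrict_space_iff)
  then have pos: "AE r in M. 0 \<le> ?f r \<and> (s < r \<and> r < t \<longrightarrow> 0 < ?f r)"
    using good by eventually_elim (use n in \<open>auto simp: indicator_def not_le intro: less_imp_le\<close>)
  have "(\<integral>r. ?f r \<partial>M) = prim T (\<lambda>r. (t - s) * ne r - ?I) t - prim T (\<lambda>r. (t - s) * ne r - ?I) s"
    using io st by (intro prim_diff[symmetric]) auto
  also have "\<dots> = (t - s) * ?I - ?I * (t - s)"
    using prim_diff_fun[of T "\<lambda>r. (t - s) * ne r" "\<lambda>_. ?I"] ne_integrable prim_const_diff[of s t T ?I] st
    by (simp add: prim_mult right_diff_distrib)
  finally have "(\<integral>r. ?f r \<partial>M) = 0" by simp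
  then have "AE r in M. ?f r = 0" using integral_nonneg_eq_0_iff_AE[OF i] pos by auto
  then have "AE r in M. \<not> (s < r \<and> r < t)" using pos by eventually_elim auto
  from AE_time_imp_ex[OF this st] show False by auto
qed

lemma ex_good_energy:
  obtains good c where "AE t in M. good t" "\<And>t. good t \<Longrightarrow> t \<in> {0<..<T} \<and> e t \<in> V \<and> q t = c + 2 * prim T \<beta> t"
    "\<And>s t r. good s \<Longrightarrow> good t \<Longrightarrow> good r \<Longrightarrow> ipH (e t - e s) (e r) = pairing (e r) t - pairing (e r) s"
proof -
  obtain good where g: "AE t in M. good t" "\<And>t. good t \<Longrightarrow> t \<in> {0<..<T} \<and> e t \<in> V"
    "\<And>s t r. good s \<Longrightarrow> good t \<Longrightarrow> good r \<Longrightarrow> ipH (e t - e s) (e r) = pairing (e r) t - pairing (e r) s"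
    by (rule ex_good) (rule that)
  obtain c where c: "AE t in M. q t = c + 2 * prim T \<beta> t" using energy_identity_AE by blast
  have "AE t in M. good t \<and> q t = c + 2 * prim T \<beta> t" using g(1) c by eventually_elim simp
  then show ?thesis using g(2,3) by (intro that[of "\<lambda>t. good t \<and> q t = c + 2 * prim T \<beta> t" c]) auto
qed

text \<open>Both \<open>e s\<close> and \<open>e t\<close> are compared with \<open>e r\<close>, where \<open>s < r < t\<close> is chosen such that
  \<open>(t - s) * ne r\<close> does not exceed the integral of \<open>ne\<close> over \<open>(s, t)\<close>.\<close>

lemma increment_bound:
  assumes good: "AE t in M. good t" "\<And>t. good t \<Longrightarrow> t \<in> {0<..<T} \<and> e t \<in> V \<and> q t = c + 2 * prim T \<beta> t"
    "\<And>s t r. good s \<Longrightarrow> good t \<Longrightarrow> good r \<Longrightarrow> ipH (e t - e s) (e r) = pairing (e r) t - pairing (e r) s"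
    and st: "good s" "good t"
  shows "(snorm ipH (e t - e s))\<^sup>2 \<le> 8 * \<bar>prim T dens t - prim T dens s\<bar>"
proof -
  have main: "(snorm ipH (e t - e s))\<^sup>2 \<le> 8 * (prim T dens t - prim T dens s)"
    if st: "good s" "good t" "s < t" for s t
  proof -
    let ?\<Delta> = "prim T dens t - prim T dens s"
    have I: "0 < s" "t < T" "e s \<in> H" "e t \<in> H" using good(2)[OF st(1)] good(2)[OF st(2)] VH_mem by auto
    obtain r where r: "s < r" "r < t" "good r" "(t - s) * ne r \<le> prim T ne t - prim T ne s"
      using ex_small_norm[OF good(1), of s t] I st(3) by auto
    have er: "e r \<in> V" "e r \<in> H" using good(2)[OF r(3)] VH_mem by auto
    have h2: "integrable M (\<lambda>t. dens t / 2)" using dens_integrable by simp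
    have hr: "integrable M (\<lambda>p. (snorm ipV (\<gamma> p))\<^sup>2 / 2 + ne r / 2)"
      using BV.BL_integrable[OF \<gamma>] by simp
    \<comment> \<open>The squared distance is an increment of \<open>q\<close> minus twice one of
      \<open>pairing (e r)\<close>, and each of these two parts is at most \<open>?\<Delta>\<close>.
      Going from \<open>e s\<close> over \<open>e r\<close> to \<open>e t\<close> takes twice the
      sum of two such squares, whence the constant 8.\<close>
    have half: "(snorm ipH (e \<tau> - e r))\<^sup>2 \<le> 2 * ?\<Delta>" if \<tau>: "good \<tau>" "\<tau> \<in> {s..t}" for \<tau>
    proof -
      have e\<tau>: "e \<tau> \<in> H" using good(2)[OF \<tau>(1)] VH_mem by auto
      have "(snorm ipH (e \<tau> - e r))\<^sup>2 = ipH (e \<tau> - e r) (e \<tau> - e r)" using e\<tau> er by (simp add: H.sn_sq)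
      also have "\<dots> = q \<tau> - q r - 2 * ipH (e \<tau> - e r) (e r)"
        using e\<tau> er H.ip_commute[of "e r" "e \<tau>"] by (simp add: q_def H.ip_simps)
      also have "\<dots> = 2 * (prim T \<beta> \<tau> - prim T \<beta> r) - 2 * (pairing (e r) \<tau> - pairing (e r) r)"
        using good(2)[OF \<tau>(1)] good(2)[OF r(3)] good(3)[OF r(3) \<tau>(1) r(3)] by simp
      finally have eq: "(snorm ipH (e \<tau> - e r))\<^sup>2 = 2 * (prim T \<beta> \<tau> - prim T \<beta> r) - 2 * (pairing (e r) \<tau> - pairing (e r) r)" .
      have "\<bar>prim T \<beta> \<tau> - prim T \<beta> r\<bar> \<le> prim T (\<lambda>t. dens t / 2) t - prim T (\<lambda>t. dens t / 2) s"
      proof (rule abs_prim_diff_le_between[OF \<beta>_integrable h2])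
        show "AE r in M. \<bar>\<beta> r\<bar> \<le> dens r / 2"
          using BV.BL_AE_mem[OF \<gamma>] BV.BL_AE_mem[OF e]
          by eventually_elim (use V.ip_le_ab in \<open>simp add: \<beta>_def dens_def\<close>)
      qed (use dens_nonneg r \<tau> in auto)
      also have "\<dots> = ?\<Delta> / 2" using prim_mult[of T "1/2" dens] by simp
      finally have 1: "\<bar>prim T \<beta> \<tau> - prim T \<beta> r\<bar> \<le> ?\<Delta> / 2" .
      have "\<bar>pairing (e r) \<tau> - pairing (e r) r\<bar>
          \<le> prim T (\<lambda>p. (snorm ipV (\<gamma> p))\<^sup>2 / 2 + ne r / 2) t - prim T (\<lambda>p. (snorm ipV (\<gamma> p))\<^sup>2 / 2 + ne r / 2) s"
        unfolding pairing_def
      proof (rule abs_prim_diff_le_between[OF pairing_integrable[OF er(1)] hr])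
        show "AE p in M. \<bar>ipV (\<gamma> p) (e r)\<bar> \<le> (snorm ipV (\<gamma> p))\<^sup>2 / 2 + ne r / 2"
          using BV.BL_AE_mem[OF \<gamma>] by eventually_elim (use V.ip_le_ab er in \<open>simp add: ne_def add_divide_distrib\<close>)
      qed (use ne_nonneg r \<tau> in auto)
      also have "\<dots> = (prim T (\<lambda>p. (snorm ipV (\<gamma> p))\<^sup>2) t - prim T (\<lambda>p. (snorm ipV (\<gamma> p))\<^sup>2) s) / 2 + (ne r / 2) * (t - s)"
      proof -
        have g2: "integrable M (\<lambda>p. (snorm ipV (\<gamma> p))\<^sup>2 / 2)" using BV.BL_integrable[OF \<gamma>] by simp
        have p: "prim T (\<lambda>p. (snorm ipV (\<gamma> p))\<^sup>2 / 2 + ne r / 2) x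
            = prim T (\<lambda>p. (snorm ipV (\<gamma> p))\<^sup>2) x / 2 + prim T (\<lambda>_. ne r / 2) x" for x
          using prim_add[OF g2, of "\<lambda>_. ne r / 2" x] prim_mult[of T "1/2" "\<lambda>p. (snorm ipV (\<gamma> p))\<^sup>2" x] by simp
        have "prim T (\<lambda>_. ne r / 2) t - prim T (\<lambda>_. ne r / 2) s = (ne r / 2) * (t - s)"
          using I st(3) by (intro prim_const_diff) auto
        then have c: "prim T (\<lambda>_. ne r / 2) t = prim T (\<lambda>_. ne r / 2) s + (ne r / 2) * (t - s)" by simp
        show ?thesis unfolding p[of t] p[of s] c by (simp add: diff_divide_distrib)
      qed
      also have "\<dots> \<le> ?\<Delta> / 2"
      proof -
        have "?\<Delta> = (prim T (\<lambda>p. (snorm ipV (\<gamma> p))\<^sup>2) t - prim T (\<lambda>p. (snorm ipV (\<gamma> p))\<^sup>2) s) + (prim T ne t - prim T ne s)"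
          using prim_add[OF BV.BL_integrable[OF \<gamma>] ne_integrable] by (simp add: dens_def[abs_def] ne_def[abs_def])
        moreover have "(ne r / 2) * (t - s) \<le> (prim T ne t - prim T ne s) / 2" using r(4) by (simp add: mult.commute)
        ultimately show ?thesis by (simp add: add_divide_distrib)
      qed
      finally have 2: "\<bar>pairing (e r) \<tau> - pairing (e r) r\<bar> \<le> ?\<Delta> / 2" .
      show ?thesis unfolding eq using abs_le_D1[OF 1] abs_le_D2[OF 2] by simp
    qed
    have "e t - e s = (e t - e r) + (e r - e s)" by simp
    then have "(snorm ipH (e t - e s))\<^sup>2 \<le> 2 * (snorm ipH (e t - e r))\<^sup>2 + 2 * (snorm ipH (e r - e s))\<^sup>2"
      using H.sn_add_sq_le[of "e t - e r" "e r - e s"] I er by simp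
    also have "snorm ipH (e r - e s) = snorm ipH (e s - e r)" using I er by (intro H.sn_minus_commute)
    finally show ?thesis using half[of t] half[of s] st by simp
  qed
  have ets: "e t \<in> H" "e s \<in> H" using good(2)[OF st(1)] good(2)[OF st(2)] VH_mem by auto
  consider "s < t" | "s = t" | "t < s" by linarith
  then show ?thesis
  proof cases
    case 1
    show ?thesis by (rule order_trans[OF main[OF st 1]]) (intro mult_left_mono abs_ge_self, simp)
  next
    case 3
    have "8 * (prim T dens s - prim T dens t) \<le> 8 * \<bar>prim T dens t - prim T dens s\<bar>"
      unfolding abs_minus_commute[of "prim T dens t"] by (intro mult_left_mono abs_ge_self) simp
    from order_trans[OF main[OF st(2,1) 3] this] show ?thesis by (simp add: H.sn_minus_commute[OF ets])
  qed simp
qed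

text \<open>The increment bound makes \<open>e\<close> uniformly continuous on the good times, which
  are dense in \<open>{0..T}\<close>. Completeness of \<open>H\<close> extends it to all times, in
  particular to the end points, where \<open>e\<close> itself carries no information, and the energy
  identity passes to the limit.\<close>

theorem continuous_representative:
  obtains E where "\<And>t. t \<in> {0..T} \<Longrightarrow> E t \<in> H"
    "\<And>t. t \<in> {0..T} \<Longrightarrow> ((\<lambda>s. snorm ipH (E s - E t)) \<longlongrightarrow> 0) (at t within {0..T})"
    "AE t in M. snorm ipH (E t - e t) = 0"
    "(snorm ipH (E T))\<^sup>2 - (snorm ipH (E 0))\<^sup>2 = 2 * (\<integral>t. ipV (\<gamma> t) (e t) \<partial>M)"
proof -
  obtain good c where good: "AE t in M. good t" "\<And>t. good t \<Longrightarrow> t \<in> {0<..<T} \<and> e t \<in> V \<and> q t = c + 2 * prim T \<beta> t"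
    "\<And>s t r. good s \<Longrightarrow> good t \<Longrightarrow> good r \<Longrightarrow> ipH (e t - e s) (e r) = pairing (e r) t - pairing (e r) s"
    by (rule ex_good_energy) (rule that)
  have inc: "(snorm ipH (e t - e s))\<^sup>2 \<le> 8 * \<bar>prim T dens t - prim T dens s\<bar>"
    if "good s" "good t" for s t
    by (rule increment_bound[OF good(1) _ _ that]) (use good(2,3) in blast)+
  have eH': "e t \<in> H" if "good t" for t using good(2)[OF that] VH_mem by auto
  have dense: "\<exists>X. (\<forall>n::nat. good (X n)) \<and> X \<longlonglongrightarrow> t" if t: "t \<in> {0..T}" for t
  proof -
    have "\<exists>x. good x \<and> \<bar>x - t\<bar> \<le> 1 / real (Suc n)" for n
    proof -
      define \<delta> where "\<delta> = 1 / real (Suc n)"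
      have "0 < \<delta>" by (simp add: \<delta>_def)
      then have "max 0 (t - \<delta>) < min T (t + \<delta>)" using t T by auto
      then obtain x where "max 0 (t - \<delta>) < x" "x < min T (t + \<delta>)" "good x"
        using AE_time_imp_ex[OF good(1), of "max 0 (t - \<delta>)" "min T (t + \<delta>)"] by auto
      then have "good x \<and> \<bar>x - t\<bar> \<le> \<delta>" by auto
      then show ?thesis unfolding \<delta>_def by blast
    qed
    then obtain X where X: "\<And>n. good (X n)" "\<And>n. \<bar>X n - t\<bar> \<le> 1 / real (Suc n)" by metis
    have "(\<lambda>n. X n - t) \<longlonglongrightarrow> 0"
      by (rule Lim_null_comparison[OF _ LIMSEQ_Suc[OF lim_1_over_n]]) (use X(2) in auto)
    then show ?thesis using X(1) by (intro exI[of _ X]) (auto simp: LIM_zero_iff)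
  qed
  have "\<exists>E\<in>H. \<exists>X. (\<forall>n::nat. good (X n)) \<and> X \<longlonglongrightarrow> t \<and> (\<lambda>n. snorm ipH (e (X n) - E)) \<longlonglongrightarrow> 0"
    if t: "t \<in> {0..T}" for t
  proof -
    obtain X where X: "\<And>n::nat. good (X n)" "X \<longlonglongrightarrow> t" using dense[OF t] by blast
    have "Cauchy (\<lambda>n. prim T dens (X n))" using tendsto_prim[OF dens_integrable X(2)] by (rule LIMSEQ_imp_Cauchy)
    have "\<forall>\<epsilon>>0. \<exists>N. \<forall>m\<ge>N. \<forall>n\<ge>N. snorm ipH (e (X m) - e (X n)) < \<epsilon>"
    proof (intro allI impI)
      fix \<epsilon> :: real assume \<epsilon>: "0 < \<epsilon>"
      then have "0 < \<epsilon>\<^sup>2 / 8" by simp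
      then obtain N where N: "\<And>m n. m \<ge> N \<Longrightarrow> n \<ge> N \<Longrightarrow> dist (prim T dens (X m)) (prim T dens (X n)) < \<epsilon>\<^sup>2 / 8"
        using \<open>Cauchy _\<close> unfolding Cauchy_def by meson
      have "snorm ipH (e (X m) - e (X n)) < \<epsilon>" if "m \<ge> N" "n \<ge> N" for m n
      proof -
        have "(snorm ipH (e (X m) - e (X n)))\<^sup>2 < \<epsilon>\<^sup>2"
          using inc[OF X(1)[of n] X(1)[of m]] N[OF that] by (simp add: dist_real_def)
        then show ?thesis using \<epsilon> by (simp add: power_less_imp_less_base)
      qed
      then show "\<exists>N. \<forall>m\<ge>N. \<forall>n\<ge>N. snorm ipH (e (X m) - e (X n)) < \<epsilon>" by blast
    qed
    moreover have "\<forall>n. e (X n) \<in> H" using eH' X(1) by blast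
    ultimately obtain E where "E \<in> H" "(\<lambda>n. snorm ipH (e (X n) - E)) \<longlonglongrightarrow> 0"
      using H.complete[of "\<lambda>n. e (X n)"] by blast
    then show ?thesis using X by blast
  qed
  then obtain E X where E: "\<And>t. t \<in> {0..T} \<Longrightarrow> E t \<in> H"
    "\<And>t n. t \<in> {0..T} \<Longrightarrow> good (X t n)" "\<And>t. t \<in> {0..T} \<Longrightarrow> X t \<longlonglongrightarrow> t"
    "\<And>t. t \<in> {0..T} \<Longrightarrow> (\<lambda>n::nat. snorm ipH (e (X t n) - E t)) \<longlonglongrightarrow> 0" by metis
  have eX: "e (X t n) \<in> H" if "t \<in> {0..T}" for t n using eH'[OF E(2)[OF that]] .
  \<comment> \<open>Stated for the limit \<open>x\<close> of an arbitrary sequence of good times: it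
    serves for \<open>x = E t\<close>, giving continuity, and with a constant sequence for
    \<open>x = e t\<close>, giving agreement with \<open>e\<close>.\<close>
  have bd: "(snorm ipH (E s - x))\<^sup>2 \<le> 8 * \<bar>prim T dens s - d\<bar>"
    if s: "s \<in> {0..T}" and x: "x \<in> H" and
      Y: "\<And>n. good (Y n)" "(\<lambda>n::nat. snorm ipH (e (Y n) - x)) \<longlonglongrightarrow> 0" "(\<lambda>n. prim T dens (Y n)) \<longlonglongrightarrow> d" for s x Y d
  proof (rule LIMSEQ_le)
    have Ex: "E s - x \<in> H" using E(1)[OF s] x by simp
    have YH: "e (Y n) \<in> H" for n by (rule eH'[OF Y(1)])
    have "(\<lambda>n. snorm ipH ((e (X s n) - e (Y n)) - (E s - x))) \<longlonglongrightarrow> 0"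
    proof (rule Lim_null_comparison)
      show "(\<lambda>n. snorm ipH (e (X s n) - E s) + snorm ipH (e (Y n) - x)) \<longlonglongrightarrow> 0"
        using tendsto_add[OF E(4)[OF s] Y(2)] by simp
      have "norm (snorm ipH ((e (X s n) - e (Y n)) - (E s - x))) \<le> snorm ipH (e (X s n) - E s) + snorm ipH (e (Y n) - x)" for n
      proof -
        have eq: "(e (X s n) - e (Y n)) - (E s - x) = (e (X s n) - E s) - (e (Y n) - x)" by simp
        have m: "e (X s n) - E s \<in> H" "e (Y n) - x \<in> H" using eX[OF s] E(1)[OF s] YH x by auto
        show ?thesis unfolding eq using H.sn_diff_le[OF m] H.sn_nonneg[OF H.S_diff[OF m]] by simp
      qed
      then show "\<forall>\<^sub>F n in sequentially. norm (snorm ipH ((e (X s n) - e (Y n)) - (E s - x)))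
          \<le> snorm ipH (e (X s n) - E s) + snorm ipH (e (Y n) - x)" by simp
    qed
    then show "(\<lambda>n. (snorm ipH (e (X s n) - e (Y n)))\<^sup>2) \<longlonglongrightarrow> (snorm ipH (E s - x))\<^sup>2"
      using eX[OF s] YH Ex by (intro tendsto_power H.tendsto_sn) auto
    show "(\<lambda>n. 8 * \<bar>prim T dens (X s n) - prim T dens (Y n)\<bar>) \<longlonglongrightarrow> 8 * \<bar>prim T dens s - d\<bar>"
      by (intro tendsto_intros tendsto_prim[OF dens_integrable E(3)[OF s]] Y(3))
    show "\<exists>N. \<forall>n\<ge>N. (snorm ipH (e (X s n) - e (Y n)))\<^sup>2 \<le> 8 * \<bar>prim T dens (X s n) - prim T dens (Y n)\<bar>"
      using inc[OF Y(1) E(2)[OF s]] by blast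
  qed
  have cont: "((\<lambda>s. snorm ipH (E s - E t)) \<longlongrightarrow> 0) (at t within {0..T})" if t: "t \<in> {0..T}" for t
  proof (rule Lim_null_comparison)
    have "(snorm ipH (E s - E t))\<^sup>2 \<le> 8 * \<bar>prim T dens s - prim T dens t\<bar>" if "s \<in> {0..T}" for s
      by (rule bd[OF that E(1)[OF t] E(2)[OF t] E(4)[OF t] tendsto_prim[OF dens_integrable E(3)[OF t]]])
    then have "norm (snorm ipH (E s - E t)) \<le> sqrt (8 * \<bar>prim T dens s - prim T dens t\<bar>)" if "s \<in> {0..T}" for s
      using that E(1)[OF that] E(1)[OF t] H.sn_nonneg[of "E s - E t"] by (auto intro!: real_le_rsqrt)
    then show "\<forall>\<^sub>F s in at t within {0..T}. norm (snorm ipH (E s - E t)) \<le> sqrt (8 * \<bar>prim T dens s - prim T dens t\<bar>)"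
      by (auto simp: eventually_at_filter)
    have "continuous_on UNIV (prim T dens)"
      by (simp add: continuous_on_sequentially comp_def tendsto_prim[OF dens_integrable])
    then have "(prim T dens \<longlongrightarrow> prim T dens t) (at t within {0..T})"
      by (auto simp: continuous_on_def intro: tendsto_within_subset)
    then have "((\<lambda>s. sqrt (8 * \<bar>prim T dens s - prim T dens t\<bar>)) \<longlongrightarrow> sqrt (8 * \<bar>prim T dens t - prim T dens t\<bar>)) (at t within {0..T})"
      by (intro tendsto_intros)
    then show "((\<lambda>s. sqrt (8 * \<bar>prim T dens s - prim T dens t\<bar>)) \<longlongrightarrow> 0) (at t within {0..T})" by simp
  qed
  have rep: "AE t in M. snorm ipH (E t - e t) = 0"
    using good(1)
  proof eventually_elim
    case (elim t)
    have t: "t \<in> {0..T}" using good(2)[OF elim] by auto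
    have "(snorm ipH (E t - e t))\<^sup>2 \<le> 8 * \<bar>prim T dens t - prim T dens t\<bar>"
      by (rule bd[OF t eH'[OF elim], of "\<lambda>_. t"]) (use elim in auto)
    then show ?case by simp
  qed
  have en: "(snorm ipH (E t))\<^sup>2 = c + 2 * prim T \<beta> t" if t: "t \<in> {0..T}" for t
  proof (rule LIMSEQ_unique)
    show "(\<lambda>n. (snorm ipH (e (X t n)))\<^sup>2) \<longlonglongrightarrow> (snorm ipH (E t))\<^sup>2"
      by (intro tendsto_power H.tendsto_sn[OF eX[OF t] E(1)[OF t] E(4)[OF t]])
    have "(snorm ipH (e (X t n)))\<^sup>2 = c + 2 * prim T \<beta> (X t n)" for n
      using good(2)[OF E(2)[OF t]] eX[OF t] by (simp add: H.sn_sq q_def)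
    moreover have "(\<lambda>n. c + 2 * prim T \<beta> (X t n)) \<longlonglongrightarrow> c + 2 * prim T \<beta> t"
      by (intro tendsto_intros tendsto_prim[OF \<beta>_integrable E(3)[OF t]])
    ultimately show "(\<lambda>n. (snorm ipH (e (X t n)))\<^sup>2) \<longlonglongrightarrow> c + 2 * prim T \<beta> t" by simp
  qed
  have "(snorm ipH (E T))\<^sup>2 - (snorm ipH (E 0))\<^sup>2 = 2 * (\<integral>t. ipV (\<gamma> t) (e t) \<partial>M)"
    using en[of T] en[of 0] T prim_T[of T \<beta>] prim_0[of T \<beta>] by (simp add: \<beta>_def)
  then show ?thesis using that E(1) cont rep by blast
qed

end

text \<open>Measurability is asked of \<open>g\<close> only; completeness gives it to
  \<open>f\<close>. This suits integrands such as dual norms or values of a chosen derivative, whose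
  measurability is known through a function equal to them almost everywhere.\<close>

lemma (in complete_measure) integral_cong_AE_complete:
  fixes f g :: "'a \<Rightarrow> real"
  assumes "g \<in> borel_measurable M" "AE x in M. f x = g x"
  shows "integral\<^sup>L M f = integral\<^sup>L M g"
proof (rule integral_cong_AE)
  show "f \<in> borel_measurable M"
    by (rule borel_measurable_AE_LIMSEQ[of "\<lambda>_. g"]) (use assms in auto)
qed (use assms in auto)

section \<open>The Stokes problem\<close>

locale stokes_domain = bounded_open \<Omega> for \<Omega> :: "(real^'d) set" +
  fixes T :: real
  assumes T: "0 < T"
begin

abbreviation "I \<equiv> time_interval T"

sublocale IC: complete_measure I by (rule complete_measure_lebesgue_on) simp
sublocale BV: bochner_space "V_space \<Omega>" "V_ip \<Omega>" I ..
sublocale BH: bochner_space "L2 M" "L2_ip M :: (real^'d \<Rightarrow> real^'d) \<Rightarrow> _" I ..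
sublocale BY: bochner_space "L2 M" "L2_ip M :: (real^'d \<Rightarrow> real^'d^'d) \<Rightarrow> _" I ..

text \<open>Riesz map from the dual of \<open>V\<close> to \<open>V\<close>, a choice since
  representatives are unique only up to seminorm zero. It reduces measurability of functional-valued
  maps to that of maps into \<open>V\<close>.\<close>

definition rz :: "((real^'d \<Rightarrow> real^'d) \<Rightarrow> real) \<Rightarrow> real^'d \<Rightarrow> real^'d" where
  "rz F = (SOME r. r \<in> V_space \<Omega> \<and> (\<forall>w\<in>V_space \<Omega>. F w = V_ip \<Omega> r w))"

lemma rz:
  assumes "F \<in> V_dual \<Omega>"
  shows "rz F \<in> V_space \<Omega>" "w \<in> V_space \<Omega> \<Longrightarrow> V_ip \<Omega> (rz F) w = F w"
proof -
  have "\<exists>r. r \<in> V_space \<Omega> \<and> (\<forall>w\<in>V_space \<Omega>. F w = V_ip \<Omega> r w)"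
    using riesz_dual_space[OF V.semi_hilbert_axioms] assms unfolding V_norm_eq_snorm by blast
  then have "rz F \<in> V_space \<Omega> \<and> (\<forall>w\<in>V_space \<Omega>. F w = V_ip \<Omega> (rz F) w)" unfolding rz_def by (rule someI_ex)
  then show "rz F \<in> V_space \<Omega>" "w \<in> V_space \<Omega> \<Longrightarrow> V_ip \<Omega> (rz F) w = F w" by auto
qed

lemma V_dual_norm_eq:
  assumes "r \<in> V_space \<Omega>" "\<And>w. w \<in> V_space \<Omega> \<Longrightarrow> F w = V_ip \<Omega> r w"
  shows "V_dual_norm \<Omega> F = V.sn r"
  unfolding V_norm_eq_snorm by (rule V.dual_norm_eq_sn[OF assms])

lemma V_dual_norm_rz: "F \<in> V_dual \<Omega> \<Longrightarrow> V_dual_norm \<Omega> F = V.sn (rz F)"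
  by (rule V_dual_norm_eq) (simp_all add: rz)

lemma V_ip_mem_dual: assumes "r \<in> V_space \<Omega>" shows "V_ip \<Omega> r \<in> V_dual \<Omega>"
proof -
  have "V_ip \<Omega> r (\<lambda>x. c *\<^sub>R v x) = c * V_ip \<Omega> r v" if "v \<in> V_space \<Omega>" for c v
    using V.ip_scale_right[OF that assms, of c] by (simp add: scaleR_fun_def)
  then show ?thesis
    using assms V.ip_le_sn[OF assms] by (auto simp: dual_space_def V_norm_eq_snorm V.ip_add_right)
qed

text \<open>The dual norm of a difference of functionals is the seminorm of the difference of their
  representatives, so the Riesz map is Lipschitz with constant 1.\<close>

lemma L2_V_dual_imp_rz:
  assumes g: "g \<in> L2_V_dual \<Omega> T" shows "(\<lambda>t. rz (g t)) \<in> BV.BL" "AE t in I. g t \<in> V_dual \<Omega>"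
proof -
  have gm: "bochner_measurable I (V_dual \<Omega>) (V_dual_norm \<Omega>) g"
    and gi: "integrable I (\<lambda>t. (V_dual_norm \<Omega> (g t))\<^sup>2)" using g by (auto simp: bochner_L2_def)
  show ae: "AE t in I. g t \<in> V_dual \<Omega>"
    using gm unfolding bochner_measurable_def by auto
  have BM: "BV.BM (\<lambda>t. rz (g t))"
  proof (rule bochner_measurable_lipschitz[OF gm, where C = 1])
    fix F G assume F: "F \<in> V_dual \<Omega>" and G: "G \<in> V_dual \<Omega>"
    have m: "rz F - rz G \<in> V_space \<Omega>" using rz(1)[OF F] rz(1)[OF G] by simp
    have "V_dual_norm \<Omega> (F - G) = V.sn (rz F - rz G)"
      by (rule V_dual_norm_eq[OF m]) (use rz[OF F] rz[OF G] in \<open>simp add: V.ip_diff_left\<close>)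
    then show "0 \<le> V.sn (rz F - rz G) \<and> V.sn (rz F - rz G) \<le> 1 * V_dual_norm \<Omega> (F - G)"
      using V.sn_nonneg[OF m] by simp
  qed (rule rz(1))
  have "integrable I (\<lambda>t. (V.sn (rz (g t)))\<^sup>2)"
  proof (rule integrable_cong_AE_imp[OF gi])
    show "(\<lambda>t. (V.sn (rz (g t)))\<^sup>2) \<in> borel_measurable I"
      by (intro borel_measurable_power BV.BM_sn_measurable BM)
    show "AE t in I. (V_dual_norm \<Omega> (g t))\<^sup>2 = (V.sn (rz (g t)))\<^sup>2"
      using ae by eventually_elim (simp add: V_dual_norm_rz)
  qed
  then show "(\<lambda>t. rz (g t)) \<in> BV.BL" using BM by (simp add: bochner_L2_def)
qed

text \<open>Converse of the Riesz transfer. It certifies a candidate time derivative, given by its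
  representative, as square integrable with values in the dual.\<close>

lemma V_ip_L2_V_dual:
  assumes \<gamma>: "\<gamma> \<in> BV.BL" shows "(\<lambda>t. V_ip \<Omega> (\<gamma> t)) \<in> L2_V_dual \<Omega> T"
proof -
  have "bochner_measurable I (V_dual \<Omega>) (V_dual_norm \<Omega>) (\<lambda>t. V_ip \<Omega> (\<gamma> t))"
  proof (rule bochner_measurable_lipschitz[OF BV.BL_BM[OF \<gamma>], where C = 1])
    fix x y assume x: "x \<in> V_space \<Omega>" and y: "y \<in> V_space \<Omega>"
    have "V_dual_norm \<Omega> (V_ip \<Omega> x - V_ip \<Omega> y) = V.sn (x - y)"
      by (rule V_dual_norm_eq) (use x y in \<open>auto simp: V.ip_diff_left\<close>)
    then show "0 \<le> V_dual_norm \<Omega> (V_ip \<Omega> x - V_ip \<Omega> y) \<and> V_dual_norm \<Omega> (V_ip \<Omega> x - V_ip \<Omega> y) \<le> 1 * V.sn (x - y)"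
      using V.sn_nonneg[OF V.S_diff[OF x y]] by simp
  qed (rule V_ip_mem_dual)
  moreover have "integrable I (\<lambda>t. (V_dual_norm \<Omega> (V_ip \<Omega> (\<gamma> t)))\<^sup>2)"
  proof (rule integrable_cong_AE_imp[OF BV.BL_integrable[OF \<gamma>]])
    have ae: "AE t in I. (V.sn (\<gamma> t))\<^sup>2 = (V_dual_norm \<Omega> (V_ip \<Omega> (\<gamma> t)))\<^sup>2"
      using BV.BL_AE_mem[OF \<gamma>] by eventually_elim (use V_dual_norm_eq in auto)
    then show "AE t in I. (V.sn (\<gamma> t))\<^sup>2 = (V_dual_norm \<Omega> (V_ip \<Omega> (\<gamma> t)))\<^sup>2" .
    show "(\<lambda>t. (V_dual_norm \<Omega> (V_ip \<Omega> (\<gamma> t)))\<^sup>2) \<in> borel_measurable I"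
      by (rule IC.borel_measurable_AE_LIMSEQ[of "\<lambda>_ t. (V.sn (\<gamma> t))\<^sup>2"])
        (use ae BV.BL_integrable[OF \<gamma>] in auto)
  qed
  ultimately show ?thesis by (simp add: bochner_L2_def)
qed

lemma W_I_D:
  assumes "u \<in> W_I \<Omega> T"
  shows "u \<in> BV.BL" "time_deriv \<Omega> T u \<in> L2_V_dual \<Omega> T" "has_time_deriv \<Omega> T u (time_deriv \<Omega> T u)"
proof -
  show "u \<in> BV.BL" using assms by (simp add: W_I_def V_norm_eq_snorm)
  have "\<exists>g. g \<in> L2_V_dual \<Omega> T \<and> has_time_deriv \<Omega> T u g" using assms by (auto simp: W_I_def)
  then have "time_deriv \<Omega> T u \<in> L2_V_dual \<Omega> T \<and> has_time_deriv \<Omega> T u (time_deriv \<Omega> T u)"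
    unfolding time_deriv_def by (rule someI_ex)
  then show "time_deriv \<Omega> T u \<in> L2_V_dual \<Omega> T" "has_time_deriv \<Omega> T u (time_deriv \<Omega> T u)" by auto
qed

definition rzd :: "(real \<Rightarrow> real^'d \<Rightarrow> real^'d) \<Rightarrow> real \<Rightarrow> real^'d \<Rightarrow> real^'d" where
  "rzd u t = rz (time_deriv \<Omega> T u t)"

lemma rzd_BL: "u \<in> W_I \<Omega> T \<Longrightarrow> rzd u \<in> BV.BL"
  unfolding rzd_def[abs_def] by (rule L2_V_dual_imp_rz(1)[OF W_I_D(2)])

lemma rzd_AE:
  assumes u: "u \<in> W_I \<Omega> T"
  shows "AE t in I. rzd u t \<in> V_space \<Omega> \<and> (\<forall>w\<in>V_space \<Omega>. V_ip \<Omega> (rzd u t) w = time_deriv \<Omega> T u t w)"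
  using L2_V_dual_imp_rz(2)[OF W_I_D(2)[OF u]] unfolding rzd_def by eventually_elim (simp add: rz)

lemma has_time_deriv_rzd:
  assumes g: "g \<in> L2_V_dual \<Omega> T" "has_time_deriv \<Omega> T u g"
    and \<phi>: "\<phi> \<in> test_functions {0<..<T}" and w: "w \<in> V_space \<Omega>"
  shows "(\<integral>t. deriv \<phi> t * L2_ip M (u t) w \<partial>I) = - (\<integral>t. \<phi> t * V_ip \<Omega> (rz (g t)) w \<partial>I)"
proof -
  have [measurable]: "(\<lambda>t. V_ip \<Omega> (rz (g t)) w) \<in> borel_measurable I"
    using BV.BL_ip_const_integrable[OF finite_measure_time_interval L2_V_dual_imp_rz(1)[OF g(1)] w] by simp
  have [measurable]: "\<phi> \<in> borel_measurable I"
    using test_function_real(2)[OF \<phi>] by (intro measurable_time_interval borel_measurable_continuous_onI)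
  have "(\<integral>t. \<phi> t * g t w \<partial>I) = (\<integral>t. \<phi> t * V_ip \<Omega> (rz (g t)) w \<partial>I)"
  proof (rule IC.integral_cong_AE_complete)
    show "AE t in I. \<phi> t * g t w = \<phi> t * V_ip \<Omega> (rz (g t)) w"
      using L2_V_dual_imp_rz(2)[OF g(1)] by eventually_elim (use w in \<open>simp add: rz\<close>)
  qed measurable
  then show ?thesis using g(2) \<phi> w by (simp add: has_time_deriv_def L2_ip_def)
qed

text \<open>Countably many test functions, the values of simple functions approximating the difference,
  decide whether two derivatives agree.\<close>

lemma BL_AE_zero:
  assumes \<gamma>: "\<gamma> \<in> BV.BL"
    and z: "\<And>\<phi> w. \<phi> \<in> test_functions {0<..<T} \<Longrightarrow> w \<in> V_space \<Omega> \<Longrightarrow> (\<integral>t. \<phi> t * V_ip \<Omega> (\<gamma> t) w \<partial>I) = 0"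
  shows "AE t in I. V.sn (\<gamma> t) = 0"
proof -
  obtain s where s: "\<And>n. simple_function I (s n)" "\<And>n t. t \<in> space I \<Longrightarrow> s n t \<in> V_space \<Omega>"
    "AE t in I. \<gamma> t \<in> V_space \<Omega>" "AE t in I. (\<lambda>n::nat. V.sn (s n t - \<gamma> t)) \<longlonglongrightarrow> 0"
    by (rule BV.BM_obtain[OF BV.BL_BM[OF \<gamma>]]) (rule that)
  define W0 where "W0 = (\<Union>n. s n ` space I)"
  have "countable (s n ` space I)" for n by (rule countable_finite[OF simple_functionD(1)[OF s(1)]])
  then have W0: "countable W0" "W0 \<subseteq> V_space \<Omega>"
    using s(2) by (auto simp: W0_def simp del: space_time_interval intro!: countable_UN)
  have "AE t in I. V_ip \<Omega> (\<gamma> t) w = 0" if "w \<in> V_space \<Omega>" for w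
    by (rule fundamental_lemma)
      (use BV.BL_ip_const_integrable[OF finite_measure_time_interval \<gamma> that] z that in \<open>auto simp: mult.commute\<close>)
  then have "AE t in I. \<forall>w\<in>W0. V_ip \<Omega> (\<gamma> t) w = 0"
    using W0 by (intro AE_ball_countable[THEN iffD2]) auto
  then show ?thesis using s(3,4) AE_space
  proof eventually_elim
    case (elim t)
    have mem: "s n t \<in> V_space \<Omega>" "V_ip \<Omega> (s n t) (\<gamma> t) = 0" for n
    proof -
      have "s n t \<in> W0" unfolding W0_def using elim(4) by blast
      then show "s n t \<in> V_space \<Omega>" "V_ip \<Omega> (s n t) (\<gamma> t) = 0"
        using elim(1,2) W0(2) V.ip_commute[of "s n t" "\<gamma> t"] by auto
    qed
    \<comment> \<open>The test vectors approximate \<open>\<gamma> t\<close> itself, so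
      orthogonality to all of them forces seminorm zero.\<close>
    have "(\<lambda>n. V_ip \<Omega> (s n t) (\<gamma> t)) \<longlonglongrightarrow> V_ip \<Omega> (\<gamma> t) (\<gamma> t)"
      by (rule V.tendsto_ip_left[OF mem(1) elim(2,3,2)])
    then have "V_ip \<Omega> (\<gamma> t) (\<gamma> t) = 0" by (simp add: mem(2) LIMSEQ_const_iff)
    then show ?case by (simp add: snorm_def)
  qed
qed

lemma test_mult_integrable:
  assumes "\<phi> \<in> test_functions {0<..<T}" "integrable I g"
  shows "integrable I (\<lambda>t. \<phi> t * g t)" "integrable I (\<lambda>t. deriv \<phi> t * g t)"
proof -
  obtain C where "\<And>t. \<bar>\<phi> t\<bar> \<le> C" "\<And>t. \<bar>deriv \<phi> t\<bar> \<le> C" using test_function_bounded[OF assms(1) T] by metis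
  then show "integrable I (\<lambda>t. \<phi> t * g t)" "integrable I (\<lambda>t. deriv \<phi> t * g t)"
    using integrable_continuous_times[OF assms(2)] test_function_real[OF assms(1)] by blast+
qed

lemma obtain_embed: obtains C where "0 < C" "\<And>v. v \<in> V_space \<Omega> \<Longrightarrow> H.sn v \<le> C * V.sn v"
  using poincare by blast

lemma V_BL_imp_H_BL: assumes "u \<in> BV.BL" shows "u \<in> BH.BL"
proof -
  obtain C where C: "\<And>v. v \<in> V_space \<Omega> \<Longrightarrow> H.sn v \<le> C * V.sn v" using obtain_embed by metis
  show ?thesis
    by (rule bochner_L2_lipschitz[OF BV.bochner_space_axioms BH.bochner_space_axioms assms, of "\<lambda>x. x" C])
      (use C V_D in auto)
qed

text \<open>\<open>time_deriv\<close> is a choice, so additivity has to come from uniqueness: the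
  difference of the two representatives satisfies the weak identity for \<open>v - u\<close>, and
  \<open>BL_AE_zero\<close> compares it with the chosen derivative. The resulting equality holds
  almost everywhere in time and after testing.\<close>

lemma W_I_diff:
  assumes v: "v \<in> W_I \<Omega> T" and u: "u \<in> W_I \<Omega> T"
  shows "v - u \<in> W_I \<Omega> T" "AE t in I. \<forall>w\<in>V_space \<Omega>. V_ip \<Omega> (rzd (v - u) t) w = V_ip \<Omega> (rzd v t) w - V_ip \<Omega> (rzd u t) w"
proof -
  note fin = finite_measure_time_interval
  define \<gamma> where "\<gamma> = rzd v - rzd u"
  have \<gamma>: "\<gamma> \<in> BV.BL" unfolding \<gamma>_def by (intro BV.BL_diff rzd_BL v u)
  have vu: "v - u \<in> BV.BL" by (intro BV.BL_diff W_I_D v u)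
  have main: "(\<integral>t. deriv \<phi> t * L2_ip M ((v - u) t) w \<partial>I) = - (\<integral>t. \<phi> t * V_ip \<Omega> (\<gamma> t) w \<partial>I)"
    if \<phi>: "\<phi> \<in> test_functions {0<..<T}" and w: "w \<in> V_space \<Omega>" for \<phi> w
  proof -
    note h = has_time_deriv_rzd[OF W_I_D(2,3)[OF v] \<phi> w] has_time_deriv_rzd[OF W_I_D(2,3)[OF u] \<phi> w]
    have iH: "integrable I (\<lambda>t. L2_ip M (z t) w)" if "z \<in> BV.BL" for z
      by (rule BH.BL_ip_const_integrable[OF fin V_BL_imp_H_BL[OF that] V_D(2)[OF w]])
    have iV: "integrable I (\<lambda>t. V_ip \<Omega> (z t) w)" if "z \<in> BV.BL" for z
      by (rule BV.BL_ip_const_integrable[OF fin that w])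
    have "(\<integral>t. deriv \<phi> t * L2_ip M ((v - u) t) w \<partial>I)
        = (\<integral>t. deriv \<phi> t * L2_ip M (v t) w - deriv \<phi> t * L2_ip M (u t) w \<partial>I)"
    proof (rule IC.integral_cong_AE_complete)
      show "AE t in I. deriv \<phi> t * L2_ip M ((v - u) t) w = deriv \<phi> t * L2_ip M (v t) w - deriv \<phi> t * L2_ip M (u t) w"
        using BV.BL_AE_mem[OF W_I_D(1)[OF v]] BV.BL_AE_mem[OF W_I_D(1)[OF u]]
        by eventually_elim (use w V_D in \<open>simp add: H.ip_diff_left right_diff_distrib\<close>)
      show "(\<lambda>t. deriv \<phi> t * L2_ip M (v t) w - deriv \<phi> t * L2_ip M (u t) w) \<in> borel_measurable I"
        by (intro borel_measurable_diff borel_measurable_integrable test_mult_integrable[OF \<phi>] iH W_I_D v u)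
    qed
    also have "\<dots> = (\<integral>t. deriv \<phi> t * L2_ip M (v t) w \<partial>I) - (\<integral>t. deriv \<phi> t * L2_ip M (u t) w \<partial>I)"
      by (intro Bochner_Integration.integral_diff test_mult_integrable[OF \<phi>] iH W_I_D v u)
    also have "\<dots> = - ((\<integral>t. \<phi> t * V_ip \<Omega> (rzd v t) w \<partial>I) - (\<integral>t. \<phi> t * V_ip \<Omega> (rzd u t) w \<partial>I))"
      using h by (simp add: rzd_def)
    also have "(\<integral>t. \<phi> t * V_ip \<Omega> (rzd v t) w \<partial>I) - (\<integral>t. \<phi> t * V_ip \<Omega> (rzd u t) w \<partial>I)
        = (\<integral>t. \<phi> t * V_ip \<Omega> (rzd v t) w - \<phi> t * V_ip \<Omega> (rzd u t) w \<partial>I)"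
      by (intro Bochner_Integration.integral_diff[symmetric] test_mult_integrable[OF \<phi>] iV rzd_BL v u)
    also have "\<dots> = (\<integral>t. \<phi> t * V_ip \<Omega> (\<gamma> t) w \<partial>I)"
    proof (rule IC.integral_cong_AE_complete)
      show "AE t in I. \<phi> t * V_ip \<Omega> (rzd v t) w - \<phi> t * V_ip \<Omega> (rzd u t) w = \<phi> t * V_ip \<Omega> (\<gamma> t) w"
        using BV.BL_AE_mem[OF rzd_BL[OF v]] BV.BL_AE_mem[OF rzd_BL[OF u]]
        by eventually_elim (use w in \<open>simp add: \<gamma>_def V.ip_diff_left right_diff_distrib\<close>)
      show "(\<lambda>t. \<phi> t * V_ip \<Omega> (\<gamma> t) w) \<in> borel_measurable I"
        by (intro borel_measurable_integrable test_mult_integrable[OF \<phi>] iV \<gamma>)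
    qed
    finally show ?thesis .
  qed
  have "has_time_deriv \<Omega> T (v - u) (\<lambda>t. V_ip \<Omega> (\<gamma> t))"
    unfolding has_time_deriv_def using main by (simp add: L2_ip_def)
  then show W: "v - u \<in> W_I \<Omega> T"
    using vu V_ip_L2_V_dual[OF \<gamma>] unfolding W_I_def V_norm_eq_snorm by blast
  define \<delta> where "\<delta> = rzd (v - u) - \<gamma>"
  have \<delta>: "\<delta> \<in> BV.BL" unfolding \<delta>_def by (intro BV.BL_diff rzd_BL W \<gamma>)
  have "AE t in I. V.sn (\<delta> t) = 0"
  proof (rule BL_AE_zero[OF \<delta>])
    fix \<phi> :: "real \<Rightarrow> real" and w assume \<phi>: "\<phi> \<in> test_functions {0<..<T}" and w: "w \<in> V_space \<Omega>"
    have iV: "integrable I (\<lambda>t. V_ip \<Omega> (z t) w)" if "z \<in> BV.BL" for z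
      by (rule BV.BL_ip_const_integrable[OF fin that w])
    have "(\<integral>t. \<phi> t * V_ip \<Omega> (\<delta> t) w \<partial>I) = (\<integral>t. \<phi> t * V_ip \<Omega> (rzd (v - u) t) w - \<phi> t * V_ip \<Omega> (\<gamma> t) w \<partial>I)"
    proof (rule IC.integral_cong_AE_complete)
      show "AE t in I. \<phi> t * V_ip \<Omega> (\<delta> t) w = \<phi> t * V_ip \<Omega> (rzd (v - u) t) w - \<phi> t * V_ip \<Omega> (\<gamma> t) w"
        using BV.BL_AE_mem[OF rzd_BL[OF W]] BV.BL_AE_mem[OF \<gamma>]
        by eventually_elim (use w in \<open>simp add: \<delta>_def V.ip_diff_left right_diff_distrib\<close>)
      show "(\<lambda>t. \<phi> t * V_ip \<Omega> (rzd (v - u) t) w - \<phi> t * V_ip \<Omega> (\<gamma> t) w) \<in> borel_measurable I"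
        by (intro borel_measurable_diff borel_measurable_integrable test_mult_integrable[OF \<phi>] iV \<gamma> rzd_BL W)
    qed
    also have "\<dots> = (\<integral>t. \<phi> t * V_ip \<Omega> (rzd (v - u) t) w \<partial>I) - (\<integral>t. \<phi> t * V_ip \<Omega> (\<gamma> t) w \<partial>I)"
      by (intro Bochner_Integration.integral_diff test_mult_integrable[OF \<phi>] iV rzd_BL W \<gamma>)
    also have "\<dots> = 0"
      using main[OF \<phi> w] has_time_deriv_rzd[OF W_I_D(2,3)[OF W] \<phi> w] by (simp add: rzd_def)
    finally show "(\<integral>t. \<phi> t * V_ip \<Omega> (\<delta> t) w \<partial>I) = 0" .
  qed
  then show "AE t in I. \<forall>w\<in>V_space \<Omega>. V_ip \<Omega> (rzd (v - u) t) w = V_ip \<Omega> (rzd v t) w - V_ip \<Omega> (rzd u t) w"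
    using BV.BL_AE_mem[OF rzd_BL[OF W]] BV.BL_AE_mem[OF rzd_BL[OF v]] BV.BL_AE_mem[OF rzd_BL[OF u]]
  proof eventually_elim
    case (elim t)
    have "\<delta> t \<in> V_space \<Omega>" using elim by (simp add: \<delta>_def \<gamma>_def)
    then have "V_ip \<Omega> (\<delta> t) w = 0" if "w \<in> V_space \<Omega>" for w
      using V.sn_zero_imp_ip_zero[OF _ that elim(1)] by simp
    then show ?case using elim by (simp add: \<delta>_def \<gamma>_def V.ip_diff_left)
  qed
qed

section \<open>Continuous representatives\<close>

lemma H_sn_zero_iff: "f \<in> L2 M \<Longrightarrow> H.sn f = 0 \<longleftrightarrow> (AE x in M. f x = 0)"
proof -
  assume f: "f \<in> L2 M"
  have "H.sn f = 0 \<longleftrightarrow> (\<integral>x. f x \<bullet> f x \<partial>M) = 0" by (simp add: snorm_def L2_ip_def)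
  also have "\<dots> \<longleftrightarrow> (AE x in M. f x \<bullet> f x = 0)"
    by (rule integral_nonneg_eq_0_iff_AE[OF L2_inner_integrable[OF f f]]) simp
  finally show ?thesis by simp
qed

text \<open>The Poincare constant serves as embedding constant, and seminorm zero in
  \<open>H\<close> is rewritten as equality almost everywhere to match
  \<open>is_continuous_rep\<close>.\<close>

lemma W_I_energy:
  assumes e: "e \<in> W_I \<Omega> T"
  obtains E where "is_continuous_rep \<Omega> T e E"
    "(H.sn (E T))\<^sup>2 - (H.sn (E 0))\<^sup>2 = 2 * (\<integral>t. V_ip \<Omega> (rzd e t) (e t) \<partial>I)"
proof -
  obtain C where C: "\<And>v. v \<in> V_space \<Omega> \<Longrightarrow> H.sn v \<le> C * V.sn v" using obtain_embed by metis
  interpret ev: evolution "V_space \<Omega>" "L2 M" "V_ip \<Omega>" "L2_ip M" C T e "rzd e"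
  proof
    show "(\<integral>t. deriv \<phi> t * L2_ip M (e t) w \<partial>I) = - (\<integral>t. \<phi> t * V_ip \<Omega> (rzd e t) w \<partial>I)"
      if "\<phi> \<in> test_functions {0<..<T}" "w \<in> V_space \<Omega>" for \<phi> w
      using has_time_deriv_rzd[OF W_I_D(2,3)[OF e] that] by (simp add: rzd_def)
  qed (use C T V_D W_I_D(1)[OF e] rzd_BL[OF e] in auto)
  obtain E where E: "\<And>t. t \<in> {0..T} \<Longrightarrow> E t \<in> L2 M"
    "\<And>t. t \<in> {0..T} \<Longrightarrow> ((\<lambda>s. H.sn (E s - E t)) \<longlongrightarrow> 0) (at t within {0..T})"
    "AE t in I. H.sn (E t - e t) = 0"
    "(H.sn (E T))\<^sup>2 - (H.sn (E 0))\<^sup>2 = 2 * (\<integral>t. V_ip \<Omega> (rzd e t) (e t) \<partial>I)"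
    by (rule ev.continuous_representative) (rule that)
  have "AE t in I. AE x in M. E t x = e t x"
    using E(3) BV.BL_AE_mem[OF W_I_D(1)[OF e]] AE_space
  proof eventually_elim
    case (elim t)
    have m: "E t - e t \<in> L2 M" using E(1)[of t] elim V_D by simp
    have "AE x in M. (E t - e t) x = 0" using elim(1) H_sn_zero_iff[OF m] by simp
    then show ?case by simp
  qed
  then have "is_continuous_rep \<Omega> T e E"
    unfolding is_continuous_rep_def L2_norm_eq_snorm using E(1,2) by blast
  then show ?thesis using that E(4) by blast
qed

text \<open>The two representatives agree at almost every time, hence at times arbitrarily close to
  \<open>t\<close>, also when \<open>t\<close> is an end point; continuity transfers the agreement.
  This makes the choice in \<open>time_value\<close> harmless.\<close>

lemma is_continuous_rep_unique:
  assumes U: "is_continuous_rep \<Omega> T u U" and U': "is_continuous_rep \<Omega> T u U'" and t: "t \<in> {0..T}"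
  shows "H.sn (U t - U' t) = 0"
proof (rule ccontr)
  assume n: "H.sn (U t - U' t) \<noteq> 0"
  have mem: "U s \<in> L2 M" "U' s \<in> L2 M" if "s \<in> {0..T}" for s
    using U U' that by (auto simp: is_continuous_rep_def)
  define \<delta> where "\<delta> = H.sn (U t - U' t)"
  have \<delta>: "0 < \<delta>" using n H.sn_nonneg[of "U t - U' t"] mem[OF t] by (simp add: \<delta>_def)
  have "((\<lambda>s. H.sn (U s - U t)) \<longlongrightarrow> 0) (at t within {0..T})" "((\<lambda>s. H.sn (U' s - U' t)) \<longlongrightarrow> 0) (at t within {0..T})"
    using U U' t by (auto simp: is_continuous_rep_def L2_norm_eq_snorm)
  then have "\<forall>\<^sub>F s in at t within {0..T}. H.sn (U s - U t) < \<delta> / 2 \<and> H.sn (U' s - U' t) < \<delta> / 2"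
    using \<delta> by (intro eventually_conj order_tendstoD(2)) auto
  then obtain d where d: "0 < d" "\<And>s. s \<in> {0..T} \<Longrightarrow> s \<noteq> t \<Longrightarrow> dist s t < d \<Longrightarrow> H.sn (U s - U t) < \<delta> / 2 \<and> H.sn (U' s - U' t) < \<delta> / 2"
    unfolding eventually_at by auto
  have ae: "AE s in I. (AE x in M. U s x = u s x) \<and> (AE x in M. U' s x = u s x) \<and> s \<noteq> t"
  proof -
    have "{t} \<in> null_sets (lebesgue :: real measure)" by simp
    from AE_not_in[OF this] have "AE s in lebesgue. s \<in> {0<..<T} \<longrightarrow> s \<noteq> t" by eventually_elim simp
    then have "AE s in I. s \<noteq> t" by (simp add: AE_restrict_space_iff)
    moreover have "AE s in I. AE x in M. U s x = u s x" "AE s in I. AE x in M. U' s x = u s x"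
      using U U' by (auto simp: is_continuous_rep_def)
    ultimately show ?thesis by eventually_elim simp
  qed
  have "max 0 (t - d) < min T (t + d)" using t T d(1) by auto
  then obtain s where s: "max 0 (t - d) < s" "s < min T (t + d)" "AE x in M. U s x = u s x" "AE x in M. U' s x = u s x" "s \<noteq> t"
    using AE_time_imp_ex[OF ae, of "max 0 (t - d)" "min T (t + d)"] by auto
  have sI: "s \<in> {0..T}" using s by auto
  have "dist s t < d" using s by (auto simp: dist_real_def)
  note b = d(2)[OF sI s(5) this]
  have "AE x in M. (U s - U' s) x = 0" using s(3,4) by eventually_elim simp
  then have z: "H.sn (U s - U' s) = 0" using H_sn_zero_iff mem[OF sI] by simp
  have "\<delta> \<le> H.sn (U t - U s) + H.sn (U s - U' t)"
    unfolding \<delta>_def using mem[OF sI] mem[OF t] by (intro H.sn_diff_triangle) auto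
  also have "H.sn (U s - U' t) \<le> H.sn (U s - U' s) + H.sn (U' s - U' t)"
    using mem[OF sI] mem[OF t] by (intro H.sn_diff_triangle) auto
  finally have "\<delta> \<le> H.sn (U t - U s) + (H.sn (U s - U' s) + H.sn (U' s - U' t))"
    by (simp only: add_left_mono)
  then have "\<delta> \<le> H.sn (U s - U t) + (0 + H.sn (U' s - U' t))"
    unfolding z H.sn_minus_commute[OF mem(1)[OF t] mem(1)[OF sI]] .
  then show False using b by (simp only: add_0) (metis add_strict_mono field_sum_of_halves not_le)
qed

lemma time_value_rep:
  assumes "e \<in> W_I \<Omega> T" shows "is_continuous_rep \<Omega> T e (time_value \<Omega> T e)"
  unfolding time_value_def using W_I_energy[OF assms] by (metis someI)

lemma is_continuous_rep_diff:
  assumes "is_continuous_rep \<Omega> T v V" "is_continuous_rep \<Omega> T u U"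
  shows "is_continuous_rep \<Omega> T (v - u) (\<lambda>t. V t - U t)"
proof -
  have mem: "V s \<in> L2 M" "U s \<in> L2 M" if "s \<in> {0..T}" for s
    using assms that by (auto simp: is_continuous_rep_def)
  have "((\<lambda>s. H.sn ((V s - U s) - (V t - U t))) \<longlongrightarrow> 0) (at t within {0..T})" if t: "t \<in> {0..T}" for t
  proof (rule Lim_null_comparison)
    have "((\<lambda>s. H.sn (V s - V t)) \<longlongrightarrow> 0) (at t within {0..T})" "((\<lambda>s. H.sn (U s - U t)) \<longlongrightarrow> 0) (at t within {0..T})"
      using assms t by (auto simp: is_continuous_rep_def L2_norm_eq_snorm)
    from tendsto_add[OF this] show "((\<lambda>s. H.sn (V s - V t) + H.sn (U s - U t)) \<longlongrightarrow> 0) (at t within {0..T})" by simp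
    have "norm (H.sn ((V s - U s) - (V t - U t))) \<le> H.sn (V s - V t) + H.sn (U s - U t)" if s: "s \<in> {0..T}" for s
    proof -
      have eq: "(V s - U s) - (V t - U t) = (V s - V t) - (U s - U t)" by simp
      have m: "V s - V t \<in> L2 M" "U s - U t \<in> L2 M" using mem[OF s] mem[OF t] by auto
      show ?thesis unfolding eq using H.sn_diff_le[OF m] H.sn_nonneg[OF H.S_diff[OF m]] by simp
    qed
    then show "\<forall>\<^sub>F s in at t within {0..T}. norm (H.sn ((V s - U s) - (V t - U t))) \<le> H.sn (V s - V t) + H.sn (U s - U t)"
      by (auto simp: eventually_at_filter)
  qed
  moreover have "AE t in I. AE x in M. (V t - U t) x = (v - u) t x"
  proof -
    have "AE t in I. AE x in M. V t x = v t x" "AE t in I. AE x in M. U t x = u t x"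
      using assms by (auto simp: is_continuous_rep_def)
    then show ?thesis
    proof eventually_elim
      case (elim t)
      then show ?case by eventually_elim simp
    qed
  qed
  ultimately show ?thesis using mem unfolding is_continuous_rep_def L2_norm_eq_snorm by simp
qed

end

section \<open>Dual norms on \<open>V\<^sub>\<sigma>\<close> and the infimum\<close>

context stokes_domain
begin

lemma grad_BL: assumes "u \<in> BV.BL" shows "(\<lambda>t. grad \<Omega> (u t)) \<in> BY.BL"
  by (rule bochner_L2_lipschitz[OF BV.bochner_space_axioms BY.bochner_space_axioms assms, where C = 1])
    (use V_D sn_V_diff in \<open>auto simp: snorm_def V_ip_def\<close>)

lemma dev_BL: assumes "y \<in> BY.BL" shows "(\<lambda>t. dev_field (y t)) \<in> BY.BL"
proof (rule bochner_L2_lipschitz[OF BY.bochner_space_axioms BY.bochner_space_axioms assms, where C = 1])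
  fix x y :: "real^'d \<Rightarrow> real^'d^'d" assume xy: "x \<in> L2 M" "y \<in> L2 M"
  show "Y.sn (dev_field x - dev_field y) \<le> 1 * Y.sn (x - y)"
    using L2_sn_dev_field_le[OF Y.S_diff[OF xy]] by (simp add: dev_field_linear)
qed (auto simp: L2_dev_field L2_sn_dev_field_le)

definition ps :: "(real^'d \<Rightarrow> real^'d) \<Rightarrow> real^'d \<Rightarrow> real^'d" where
  "ps r = proj (V_sigma \<Omega>) (V_ip \<Omega>) r"

lemma ps:
  assumes "r \<in> V_space \<Omega>"
  shows "ps r \<in> V_sigma \<Omega>" "ps r \<in> V_space \<Omega>" "w \<in> V_sigma \<Omega> \<Longrightarrow> V_ip \<Omega> (ps r) w = V_ip \<Omega> r w"
  using Vs.proj_mem[OF assms] Vs.proj_mem_S[OF assms] Vs.ip_proj[OF assms] by (auto simp: ps_def)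

lemma ps_BL: assumes "u \<in> BV.BL" shows "(\<lambda>t. ps (u t)) \<in> BV.BL"
proof (rule bochner_L2_lipschitz[OF BV.bochner_space_axioms BV.bochner_space_axioms assms, where C = 1])
  fix x assume x: "x \<in> V_space \<Omega>"
  have "ps x - 0 \<in> V_space \<Omega>" "ps x \<in> V_space \<Omega>" using ps(2)[OF x] by auto
  have "(V.sn (ps x))\<^sup>2 \<le> V.sn x * V.sn (ps x)"
    using ps[OF x] V.ip_le_sn[OF x ps(2)[OF x]] by (simp add: V.sn_sq)
  then show "V.sn (ps x) \<le> 1 * V.sn x"
    using V.sn_nonneg[OF x] V.sn_nonneg[OF ps(2)[OF x]]
    by (cases "V.sn (ps x) = 0") (auto simp: power2_eq_square)
qed (use ps Vs.sn_proj_diff_le in \<open>auto simp: ps_def\<close>)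

text \<open>The projection of a representative in \<open>V\<close> represents the restricted
  functional within \<open>V\<^sub>\<sigma>\<close>. Outside \<open>V\<^sub>\<sigma>\<close> the
  value of \<open>restrict\<close> is a default that never enters the supremum.\<close>

lemma V_sigma_dual_norm_eq:
  assumes r: "r \<in> V_space \<Omega>" and F: "\<And>w. w \<in> V_sigma \<Omega> \<Longrightarrow> F w = V_ip \<Omega> r w"
  shows "V_sigma_dual_norm \<Omega> (restrict F (V_sigma \<Omega>)) = V.sn (ps r)"
  unfolding V_norm_eq_snorm
  by (rule Vs.D.dual_norm_eq_sn) (use ps[OF r] F in auto)

lemma L2_V_sigma_dual_norm_sq:
  assumes \<rho>: "\<rho> \<in> BV.BL" and F: "AE t in I. \<forall>w\<in>V_sigma \<Omega>. F t w = V_ip \<Omega> (\<rho> t) w"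
  shows "(L2_V_sigma_dual_norm \<Omega> T (restrict_V_sigma \<Omega> F))\<^sup>2 = (\<integral>t. (V.sn (ps (\<rho> t)))\<^sup>2 \<partial>I)"
  unfolding bochner_space.bochner_L2_norm_sq[OF BV.bochner_space_axioms]
proof (rule IC.integral_cong_AE_complete)
  show "AE t in I. (V_sigma_dual_norm \<Omega> (restrict_V_sigma \<Omega> F t))\<^sup>2 = (V.sn (ps (\<rho> t)))\<^sup>2"
    using F BV.BL_AE_mem[OF \<rho>]
    by eventually_elim (use V_sigma_dual_norm_eq in \<open>auto simp: restrict_V_sigma_def\<close>)
  show "(\<lambda>t. (V.sn (ps (\<rho> t)))\<^sup>2) \<in> borel_measurable I"
    using BV.BL_integrable[OF ps_BL[OF \<rho>]] by simp
qed

text \<open>\<open>ps r\<close> and \<open>ps g + e\<close> agree as functionals on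
  \<open>V\<^sub>\<sigma>\<close>. Expanding the square gives the cross term of \<open>ps g\<close>
  with \<open>e\<close>, which equals that of \<open>g\<close> with \<open>e\<close> because
  \<open>e\<close> is in \<open>V\<^sub>\<sigma>\<close>. In the application \<open>r\<close>
  represents the residual and \<open>g\<close> the time derivative of the error
  \<open>e\<close>.\<close>

lemma sn_ps_sum_sq:
  assumes r: "r \<in> V_space \<Omega>" and g: "g \<in> V_space \<Omega>" and e: "e \<in> V_sigma \<Omega>"
    and eq: "\<And>w. w \<in> V_sigma \<Omega> \<Longrightarrow> V_ip \<Omega> r w = V_ip \<Omega> g w + V_ip \<Omega> e w"
  shows "(V.sn (ps r))\<^sup>2 = (V.sn (ps g))\<^sup>2 + 2 * V_ip \<Omega> g e + (V.sn e)\<^sup>2"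
proof -
  have eV: "e \<in> V_space \<Omega>" using V_sigma_D(1)[OF e] .
  note pr = ps[OF r] and pg = ps[OF g]
  have x: "V_ip \<Omega> (ps r) w = V_ip \<Omega> (ps g) w + V_ip \<Omega> e w" if "w \<in> V_sigma \<Omega>" for w
    using pr(3)[OF that] pg(3)[OF that] eq[OF that] by simp
  have c: "V_ip \<Omega> (ps r) (ps r) = V_ip \<Omega> (ps g) (ps r) + V_ip \<Omega> e (ps r)" by (rule x[OF pr(1)])
  have "V_ip \<Omega> (ps g) (ps r) = V_ip \<Omega> (ps g) (ps g) + V_ip \<Omega> e (ps g)"
    using x[OF pg(1)] V.ip_commute[OF pr(2) pg(2)] by simp
  moreover have "V_ip \<Omega> e (ps r) = V_ip \<Omega> (ps g) e + V_ip \<Omega> e e"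
    using x[OF e] V.ip_commute[OF pr(2) eV] by simp
  moreover have "V_ip \<Omega> e (ps g) = V_ip \<Omega> g e" "V_ip \<Omega> (ps g) e = V_ip \<Omega> g e"
    using pg(3)[OF e] V.ip_commute[OF pg(2) eV] by auto
  ultimately show ?thesis using c pr(2) pg(2) eV by (simp add: V.sn_sq)
qed

text \<open>Density of \<open>dev_K\<close> in its closure, applied to the finitely many values of a simple function,
  produces a measurable selection.\<close>

lemma dev_K_selection:
  assumes b: "b \<in> BY.BL" and tr: "AE t in I. AE x in M. trace (b t x) = 0"
    and orth: "AE t in I. \<forall>w\<in>V_sigma \<Omega>. L2_ip M (b t) (grad \<Omega> w) = 0" and \<epsilon>: "0 < \<epsilon>"
  obtains \<kappa> where "\<kappa> \<in> BY.BL" "\<And>t. t \<in> space I \<Longrightarrow> \<kappa> t \<in> K_space"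
    "(\<integral>t. (Y.sn (b t - dev_field (\<kappa> t)))\<^sup>2 \<partial>I) \<le> \<epsilon>"
proof -
  interpret I: finite_measure I by (rule finite_measure_time_interval)
  let ?C = "sclosure (L2 M) (L2_ip M) dev_K"
  have CS: "?C \<subseteq> L2 M" by (auto simp: sclosure_def)
  interpret C: semi_hilbert_sub "L2 M" ?C "L2_ip M"
    using Y.semi_hilbert_sclosure[OF subspace_dev_K dev_K_subset] CS
    by (intro semi_hilbert_sub.intro Y.semi_inner_axioms semi_hilbert_sub_axioms.intro)
  let ?P = "proj ?C (L2_ip M)"
  have "0 < \<epsilon> / 4" using \<epsilon> by simp
  obtain s where s: "simple_function I s" "\<And>t. t \<in> space I \<Longrightarrow> s t \<in> L2 M" "s \<in> BY.BL"
    "(\<integral>t. (Y.sn (b t - s t))\<^sup>2 \<partial>I) < \<epsilon> / 4"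
    by (rule BY.BL_approx[OF b \<open>0 < \<epsilon> / 4\<close>]) (rule that)
  \<comment> \<open>Gives \<open>2 * \<eta>\<^sup>2 * T = \<epsilon> / 2\<close>, the error from
    replacing projections by elements of \<open>dev_K\<close>; the simple function contributes at
    most \<open>2 * (\<epsilon> / 4)\<close>.\<close>
  define \<eta> where "\<eta> = sqrt (\<epsilon> / (4 * T))"
  have \<eta>: "0 < \<eta>" using \<epsilon> T by (simp add: \<eta>_def)
  \<comment> \<open>The values of \<open>s\<close> may lie outside the closure and are projected
    first. The selection depends on \<open>t\<close> only through \<open>s t\<close>, so it takes
    finitely many values.\<close>
  have "\<exists>k\<in>K_space. Y.sn (?P x - dev_field k) < \<eta>" if "x \<in> L2 M" for x
    using C.proj_mem[OF that] \<eta> by (auto simp: sclosure_def dev_K_def)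
  then obtain k where k: "\<And>x. x \<in> L2 M \<Longrightarrow> k x \<in> K_space" "\<And>x. x \<in> L2 M \<Longrightarrow> Y.sn (?P x - dev_field (k x)) < \<eta>" by metis
  define \<kappa> where "\<kappa> t = k (s t)" for t
  have \<kappa>K: "\<kappa> t \<in> K_space" if "t \<in> space I" for t using k(1) s(2)[OF that] by (simp add: \<kappa>_def)
  have \<kappa>Y: "\<kappa> t \<in> L2 M" if "t \<in> space I" for t using \<kappa>K[OF that] by (simp add: K_space_def)
  have \<kappa>s: "simple_function I \<kappa>" unfolding \<kappa>_def by (rule simple_function_compose1[OF s(1)])
  have "integrable I (\<lambda>t. (Y.sn (\<kappa> t))\<^sup>2)"
  proof -
    have sf: "simple_function I (\<lambda>t. (Y.sn (\<kappa> t))\<^sup>2)" by (rule simple_function_compose1[OF \<kappa>s])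
    have "finite ((\<lambda>t. (Y.sn (\<kappa> t))\<^sup>2) ` space I)" using simple_functionD(1)[OF sf] .
    then have B: "(Y.sn (\<kappa> t))\<^sup>2 \<le> Max ((\<lambda>t. (Y.sn (\<kappa> t))\<^sup>2) ` space I)" if "t \<in> space I" for t
      using that by (intro Max_ge) auto
    show ?thesis
    proof (rule I.integrable_const_bound)
      show "AE t in I. norm ((Y.sn (\<kappa> t))\<^sup>2) \<le> Max ((\<lambda>t. (Y.sn (\<kappa> t))\<^sup>2) ` space I)"
        by (rule AE_I2) (simp only: real_norm_def abs_power2 B)
    qed (rule borel_measurable_simple_function[OF sf])
  qed
  then have \<kappa>: "\<kappa> \<in> BY.BL" using BY.BM_simple[OF \<kappa>s \<kappa>Y] by (simp add: bochner_L2_def)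
  have bs: "b - s \<in> BY.BL" by (intro BY.BL_diff b s)
  have bk: "b - (\<lambda>t. dev_field (\<kappa> t)) \<in> BY.BL" by (intro BY.BL_diff b dev_BL \<kappa>)
  have "(\<integral>t. (Y.sn (b t - dev_field (\<kappa> t)))\<^sup>2 \<partial>I) \<le> (\<integral>t. 2 * (Y.sn (b t - s t))\<^sup>2 + 2 * \<eta>\<^sup>2 \<partial>I)"
  proof (rule integral_mono_AE)
    show "integrable I (\<lambda>t. (Y.sn (b t - dev_field (\<kappa> t)))\<^sup>2)" using BY.BL_integrable[OF bk] by simp
    show "integrable I (\<lambda>t. 2 * (Y.sn (b t - s t))\<^sup>2 + 2 * \<eta>\<^sup>2)" using BY.BL_integrable[OF bs] by simp
    show "AE t in I. (Y.sn (b t - dev_field (\<kappa> t)))\<^sup>2 \<le> 2 * (Y.sn (b t - s t))\<^sup>2 + 2 * \<eta>\<^sup>2"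
      using BY.BL_AE_mem[OF b] tr orth AE_space
    proof eventually_elim
      case (elim t)
      note m = elim(1) s(2)[OF elim(4)] \<kappa>Y[OF elim(4)]
      have bC: "b t \<in> ?C" using elim by (intro mem_sclosure_dev_K) auto
      have P: "?P (b t) \<in> L2 M" "?P (s t) \<in> L2 M" using C.proj_mem_S m by auto
      have dk: "dev_field (\<kappa> t) \<in> L2 M" using m by (simp add: L2_dev_field)
      \<comment> \<open>\<open>b t\<close> is in the closure and is fixed by the projection up to
        seminorm zero, so projecting \<open>s t\<close> does not increase the error.\<close>
      have "Y.sn (b t - ?P (s t)) \<le> Y.sn (b t - ?P (b t)) + Y.sn (?P (b t) - ?P (s t))"
        using m P by (intro Y.sn_diff_triangle) auto
      also have "\<dots> \<le> 0 + Y.sn (b t - s t)"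
        using C.sn_diff_proj_of_mem[OF bC] C.sn_proj_diff_le[OF m(1,2)] by simp
      finally have 1: "Y.sn (b t - ?P (s t)) \<le> Y.sn (b t - s t)" by simp
      have 2: "Y.sn (?P (s t) - dev_field (\<kappa> t)) \<le> \<eta>" using k(2)[OF m(2)] by (simp add: \<kappa>_def)
      have "(Y.sn (b t - dev_field (\<kappa> t)))\<^sup>2 = (Y.sn ((b t - ?P (s t)) + (?P (s t) - dev_field (\<kappa> t))))\<^sup>2" by simp
      also have "\<dots> \<le> 2 * (Y.sn (b t - ?P (s t)))\<^sup>2 + 2 * (Y.sn (?P (s t) - dev_field (\<kappa> t)))\<^sup>2"
        using m P dk by (intro Y.sn_add_sq_le) auto
      also have "\<dots> \<le> 2 * (Y.sn (b t - s t))\<^sup>2 + 2 * \<eta>\<^sup>2"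
        using 1 2 m P dk by (intro add_mono mult_left_mono power_mono Y.sn_nonneg) auto
      finally show ?case .
    qed
  qed
  also have "\<dots> = 2 * (\<integral>t. (Y.sn (b t - s t))\<^sup>2 \<partial>I) + 2 * \<eta>\<^sup>2 * T"
  proof -
    have "measure I (space I) = T" using T by (simp add: measure_restrict_space)
    then show ?thesis using BY.BL_integrable[OF bs] by simp
  qed
  also have "2 * \<eta>\<^sup>2 * T = \<epsilon> / 2" using \<epsilon> T by (simp add: \<eta>_def)
  finally have le: "(\<integral>t. (Y.sn (b t - dev_field (\<kappa> t)))\<^sup>2 \<partial>I)
      \<le> 2 * (\<integral>t. (Y.sn (b t - s t))\<^sup>2 \<partial>I) + \<epsilon> / 2" .
  have "(\<integral>t. (Y.sn (b t - dev_field (\<kappa> t)))\<^sup>2 \<partial>I) \<le> \<epsilon>"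
    by (rule order_trans[OF le]) (use s(4) in simp)
  then show ?thesis using that \<kappa> \<kappa>K by blast
qed

definition admissible :: "(real \<Rightarrow> (real^'d \<Rightarrow> real^'d) \<Rightarrow> real) \<Rightarrow> (real \<Rightarrow> real^'d \<Rightarrow> real^'d^'d) set" where
  "admissible F = {y \<in> bochner_L2 I (Y_space \<Omega>) (Y_norm \<Omega>). AE t in I. eq_in_V_dual \<Omega> (L_adj \<Omega> (y t)) (F t)}"

lemma Q_norm_dev_sq:
  "(Q_norm \<Omega> T (\<lambda>t x. dev (y t x) - grad \<Omega> (v t) x))\<^sup>2 = (\<integral>t. (Y.sn (dev_field (y t) - grad \<Omega> (v t)))\<^sup>2 \<partial>I)"
  unfolding Q_norm_def bochner_space.bochner_L2_norm_sq[OF BV.bochner_space_axioms] L2_norm_eq_snorm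
  by (simp add: dev_field_def fun_diff_def)

lemma admissible_lower_bound:
  assumes v: "v \<in> BV.BL" "AE t in I. v t \<in> V_sigma \<Omega>" and a: "a \<in> BV.BL"
    and F: "AE t in I. \<forall>w\<in>V_space \<Omega>. F t w = V_ip \<Omega> (a t) w"
    and y: "y \<in> admissible F"
  shows "(\<integral>t. (V.sn (ps ((v - a) t)))\<^sup>2 \<partial>I) \<le> (\<integral>t. (Y.sn (dev_field (y t) - grad \<Omega> (v t)))\<^sup>2 \<partial>I)"
proof (rule integral_mono_AE)
  have yB: "y \<in> BY.BL" and L: "AE t in I. eq_in_V_dual \<Omega> (L_adj \<Omega> (y t)) (F t)"
    using y by (auto simp: admissible_def L2_norm_eq_snorm)
  show "integrable I (\<lambda>t. (V.sn (ps ((v - a) t)))\<^sup>2)"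
    by (intro BV.BL_integrable ps_BL BV.BL_diff v a)
  have "(\<lambda>t. dev_field (y t)) - (\<lambda>t. grad \<Omega> (v t)) \<in> BY.BL" by (intro BY.BL_diff dev_BL grad_BL yB v)
  from BY.BL_integrable[OF this] show "integrable I (\<lambda>t. (Y.sn (dev_field (y t) - grad \<Omega> (v t)))\<^sup>2)" by simp
  show "AE t in I. (V.sn (ps ((v - a) t)))\<^sup>2 \<le> (Y.sn (dev_field (y t) - grad \<Omega> (v t)))\<^sup>2"
    using v(2) BV.BL_AE_mem[OF a] F BY.BL_AE_mem[OF yB] L
  proof eventually_elim
    case (elim t)
    have vV: "v t \<in> V_space \<Omega>" using V_sigma_D(1)[OF elim(1)] .
    have r: "v t - a t \<in> V_space \<Omega>" using vV elim by simp
    \<comment> \<open>The maximising test function: the residual tested with \<open>w\<close> gives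
      the squared seminorm of \<open>w\<close>. Its gradient is trace-free and sees only the
      deviator of \<open>y t\<close>.\<close>
    define w where "w = ps (v t - a t)"
    have w: "w \<in> V_sigma \<Omega>" "w \<in> V_space \<Omega>" using ps[OF r] by (auto simp: w_def)
    note gw = V_D(3)[OF w(2)] and gv = V_D(3)[OF vV]
    have dy: "dev_field (y t) \<in> L2 M" using elim(4) by (rule L2_dev_field)
    have "(V.sn w)\<^sup>2 = V_ip \<Omega> (v t - a t) w" using ps(3)[OF r w(1)] w(2) by (simp add: V.sn_sq w_def)
    also have "\<dots> = V_ip \<Omega> (v t) w - F t w" using vV elim(2,3) w(2) by (simp add: V.ip_diff_left)
    also have "F t w = L2_ip M (y t) (grad \<Omega> w)"
      using elim(5) w(2) by (simp add: eq_in_V_dual_def L_adj_def L2_ip_def)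
    also have "L2_ip M (y t) (grad \<Omega> w) = L2_ip M (dev_field (y t)) (grad \<Omega> w)"
      using L2_ip_AE_dev[OF V_sigma_D(2)[OF w(1)] elim(4) gw] by (simp add: L2_ip_dev_field)
    also have "V_ip \<Omega> (v t) w - \<dots> = L2_ip M (grad \<Omega> (v t) - dev_field (y t)) (grad \<Omega> w)"
      using gv gw dy by (simp add: V_ip_def Y.ip_diff_left)
    also have "\<dots> \<le> Y.sn (grad \<Omega> (v t) - dev_field (y t)) * V.sn w"
      using Y.ip_le_sn[OF Y.S_diff[OF gv dy] gw] by (simp add: snorm_def V_ip_def)
    finally have "V.sn w * V.sn w \<le> Y.sn (grad \<Omega> (v t) - dev_field (y t)) * V.sn w" by (simp add: power2_eq_square)
    then have "V.sn w \<le> Y.sn (grad \<Omega> (v t) - dev_field (y t))"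
      using V.sn_nonneg[OF w(2)] Y.sn_nonneg[OF Y.S_diff[OF gv dy]]
      by (cases "V.sn w = 0") (auto simp: mult_le_cancel_right)
    then have "(V.sn w)\<^sup>2 \<le> (Y.sn (grad \<Omega> (v t) - dev_field (y t)))\<^sup>2"
      using V.sn_nonneg[OF w(2)] by (rule power_mono)
    then show ?case unfolding Y.sn_minus_commute[OF gv dy] w_def by simp
  qed
qed

text \<open>The gradient of \<open>a\<close> satisfies the constraint, and fields of
  \<open>K_space\<close> may be added to it. Such a correction steers \<open>dev y\<close> minus the
  gradient of \<open>v\<close> arbitrarily close to minus the gradient of \<open>ps (v - a)\<close>,
  whose norm is the lower bound.\<close>

lemma admissible_approx:
  assumes v: "v \<in> BV.BL" "AE t in I. v t \<in> V_sigma \<Omega>" and a: "a \<in> BV.BL"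
    and F: "AE t in I. \<forall>w\<in>V_space \<Omega>. F t w = V_ip \<Omega> (a t) w" and \<epsilon>: "0 < \<epsilon>"
  obtains y where "y \<in> admissible F"
    "sqrt (\<integral>t. (Y.sn (dev_field (y t) - grad \<Omega> (v t)))\<^sup>2 \<partial>I) \<le> \<epsilon> + sqrt (\<integral>t. (V.sn (ps ((v - a) t)))\<^sup>2 \<partial>I)"
proof -
  define g1 where "g1 t = grad \<Omega> (v t)" for t
  define g2 where "g2 t = dev_field (grad \<Omega> (a t))" for t
  define g3 where "g3 t = grad \<Omega> (ps ((v - a) t))" for t
  have g: "g1 \<in> BY.BL" "g2 \<in> BY.BL" "g3 \<in> BY.BL"
    unfolding g1_def[abs_def] g2_def[abs_def] g3_def[abs_def]
    by (intro grad_BL dev_BL ps_BL BV.BL_diff v a)+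
  \<comment> \<open>What the deviator of the correction has to approximate. It is trace-free, and
    subtracting the projected part \<open>g3\<close> makes it orthogonal to the gradients of
    \<open>V\<^sub>\<sigma>\<close>.\<close>
  define b where "b = g1 - g2 - g3"
  have b: "b \<in> BY.BL" unfolding b_def by (intro BY.BL_diff g)
  have lt: "trace (A - B) = trace A - trace B" for A B :: "real^'d^'d" by (simp add: trace_def sum_subtractf)
  have tr: "AE t in I. AE x in M. trace (b t x) = 0"
    using v(2) BV.BL_AE_mem[OF a]
  proof eventually_elim
    case (elim t)
    have r: "v t - a t \<in> V_space \<Omega>" using V_sigma_D(1)[OF elim(1)] elim(2) by simp
    show ?case using V_sigma_D(2)[OF elim(1)] V_sigma_D(2)[OF ps(1)[OF r]]
      by eventually_elim (simp add: b_def g1_def g2_def g3_def lt dev_field_def trace_dev)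
  qed
  have orth: "AE t in I. \<forall>w\<in>V_sigma \<Omega>. L2_ip M (b t) (grad \<Omega> w) = 0"
    using v(2) BV.BL_AE_mem[OF a]
  proof eventually_elim
    case (elim t)
    have vV: "v t \<in> V_space \<Omega>" using V_sigma_D(1)[OF elim(1)] .
    have r: "v t - a t \<in> V_space \<Omega>" using vV elim(2) by simp
    show ?case
    proof
      fix w assume w: "w \<in> V_sigma \<Omega>"
      note wV = V_sigma_D(1)[OF w]
      have d: "L2_ip M (dev_field (grad \<Omega> (a t))) (grad \<Omega> w) = V_ip \<Omega> (a t) w"
        using L2_ip_AE_dev[OF V_sigma_D(2)[OF w] V_D(3)[OF elim(2)] V_D(3)[OF wV]]
        by (simp add: L2_ip_dev_field V_ip_def)
      have "L2_ip M (b t) (grad \<Omega> w) = V_ip \<Omega> (v t) w - V_ip \<Omega> (a t) w - V_ip \<Omega> (ps (v t - a t)) w"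
        using V_D(3)[OF wV] V_D(3)[OF vV] V_D(3)[OF elim(2)] V_D(3)[OF ps(2)[OF r]] d
        by (simp add: b_def g1_def g2_def g3_def Y.ip_diff_left L2_dev_field V_ip_def)
      also have "\<dots> = 0" using ps(3)[OF r w] vV elim(2) wV by (simp add: V.ip_diff_left)
      finally show "L2_ip M (b t) (grad \<Omega> w) = 0" .
    qed
  qed
  have "0 < \<epsilon>\<^sup>2" using \<epsilon> by simp
  obtain \<kappa> where \<kappa>: "\<kappa> \<in> BY.BL" "\<And>t. t \<in> space I \<Longrightarrow> \<kappa> t \<in> K_space"
    "(\<integral>t. (Y.sn (b t - dev_field (\<kappa> t)))\<^sup>2 \<partial>I) \<le> \<epsilon>\<^sup>2"
    by (rule dev_K_selection[OF b tr orth \<open>0 < \<epsilon>\<^sup>2\<close>]) (rule that)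
  define y where "y = (\<lambda>t. grad \<Omega> (a t)) + \<kappa>"
  have y: "y \<in> BY.BL" unfolding y_def by (intro BY.BL_add grad_BL a \<kappa>)
  have "AE t in I. eq_in_V_dual \<Omega> (L_adj \<Omega> (y t)) (F t)"
    using F BV.BL_AE_mem[OF a] AE_space
  proof eventually_elim
    case (elim t)
    have "L_adj \<Omega> (y t) w = F t w" if w: "w \<in> V_space \<Omega>" for w
    proof -
      have kY: "\<kappa> t \<in> L2 M" "L2_ip M (\<kappa> t) (grad \<Omega> w) = 0" using \<kappa>(2)[OF elim(3)] w by (auto simp: K_space_def)
      have "L_adj \<Omega> (y t) w = L2_ip M (grad \<Omega> (a t) + \<kappa> t) (grad \<Omega> w)" by (simp add: L_adj_def L2_ip_def y_def)
      also have "\<dots> = V_ip \<Omega> (a t) w" using kY V_D(3)[OF elim(2)] V_D(3)[OF w] by (simp add: Y.ip_add_left V_ip_def)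
      finally show ?thesis using elim(1) w by simp
    qed
    then show ?case by (simp add: eq_in_V_dual_def)
  qed
  then have yF: "y \<in> admissible F" using y by (simp add: admissible_def L2_norm_eq_snorm)
  interpret B: semi_inner BY.BL BY.bip by (rule BY.semi_inner_BL)
  have sn_eq: "snorm BY.bip h = sqrt (\<integral>t. (Y.sn (h t))\<^sup>2 \<partial>I)" if "h \<in> BY.BL" for h
    unfolding snorm_def[of BY.bip] BY.bip_self[OF that] ..
  define dk where "dk t = dev_field (\<kappa> t)" for t
  have dk: "dk \<in> BY.BL" unfolding dk_def by (rule dev_BL[OF \<kappa>(1)])
  have eq: "dev_field (y t) - grad \<Omega> (v t) = ((dk - b) - g3) t" for t
    by (simp add: y_def dk_def b_def g1_def g2_def g3_def dev_field_linear)
  have "sqrt (\<integral>t. (Y.sn (dev_field (y t) - grad \<Omega> (v t)))\<^sup>2 \<partial>I) = snorm BY.bip ((dk - b) - g3)"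
    unfolding eq using dk b g by (subst sn_eq) (auto intro!: BY.BL_diff)
  also have "\<dots> \<le> snorm BY.bip (dk - b) + snorm BY.bip g3"
    using dk b g by (intro B.sn_diff_le) (auto intro!: BY.BL_diff)
  also have "snorm BY.bip (dk - b) = snorm BY.bip (b - dk)" by (rule B.sn_minus_commute[OF dk b])
  also have "\<dots> \<le> \<epsilon>"
    using sn_eq[OF BY.BL_diff[OF b dk]] \<kappa>(3) \<epsilon> by (simp add: dk_def real_le_lsqrt)
  also have "snorm BY.bip g3 = sqrt (\<integral>t. (V.sn (ps ((v - a) t)))\<^sup>2 \<partial>I)"
    unfolding sn_eq[OF g(3)] by (simp add: g3_def snorm_def V_ip_def)
  finally have "sqrt (\<integral>t. (Y.sn (dev_field (y t) - grad \<Omega> (v t)))\<^sup>2 \<partial>I) \<le> \<epsilon> + sqrt (\<integral>t. (V.sn (ps ((v - a) t)))\<^sup>2 \<partial>I)"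
    by (simp only: add_right_mono)
  with yF show ?thesis using that by blast
qed

text \<open>The lower bound holds for every admissible field and is approached within any
  \<open>\<epsilon>\<close> at the level of norms; squares are taken afterwards, letting
  \<open>\<epsilon>\<close> run through \<open>1 / real (Suc n)\<close>.\<close>

lemma Inf_admissible:
  assumes v: "v \<in> BV.BL" "AE t in I. v t \<in> V_sigma \<Omega>" and a: "a \<in> BV.BL"
    and F: "AE t in I. \<forall>w\<in>V_space \<Omega>. F t w = V_ip \<Omega> (a t) w"
  shows "Inf {1/2 * (Q_norm \<Omega> T (\<lambda>t x. dev (y t x) - grad \<Omega> (v t) x))\<^sup>2 | y. y \<in> admissible F}
    = 1/2 * (\<integral>t. (V.sn (ps ((v - a) t)))\<^sup>2 \<partial>I)"
proof -
  let ?X = "\<integral>t. (V.sn (ps ((v - a) t)))\<^sup>2 \<partial>I"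
  let ?S = "{1/2 * (Q_norm \<Omega> T (\<lambda>t x. dev (y t x) - grad \<Omega> (v t) x))\<^sup>2 | y. y \<in> admissible F}"
  have X: "0 \<le> ?X" by simp
  have lb: "1/2 * ?X \<le> z" if "z \<in> ?S" for z
    using that admissible_lower_bound[OF v a F] unfolding Q_norm_dev_sq by auto
  have ap: "\<exists>z\<in>?S. z \<le> 1/2 * (\<epsilon> + sqrt ?X)\<^sup>2" if \<epsilon>: "0 < \<epsilon>" for \<epsilon>
  proof -
    obtain y where y: "y \<in> admissible F"
      "sqrt (\<integral>t. (Y.sn (dev_field (y t) - grad \<Omega> (v t)))\<^sup>2 \<partial>I) \<le> \<epsilon> + sqrt ?X"
      by (rule admissible_approx[OF v a F \<epsilon>]) (rule that)
    let ?q = "\<integral>t. (Y.sn (dev_field (y t) - grad \<Omega> (v t)))\<^sup>2 \<partial>I"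
    have "(sqrt ?q)\<^sup>2 \<le> (\<epsilon> + sqrt ?X)\<^sup>2" using y(2) by (intro power_mono) auto
    moreover have "(sqrt ?q)\<^sup>2 = ?q" by simp
    ultimately show ?thesis
      using y(1) by (intro bexI[of _ "1/2 * (Q_norm \<Omega> T (\<lambda>t x. dev (y t x) - grad \<Omega> (v t) x))\<^sup>2"])
        (auto simp: Q_norm_dev_sq)
  qed
  \<comment> \<open>\<open>Inf\<close> on the reals is meaningful for nonempty sets bounded below;
    the approximation also supplies the existence of an admissible field.\<close>
  have ne: "?S \<noteq> {}" using ap[of 1] by auto
  have bdd: "bdd_below ?S" unfolding bdd_below_def using lb by blast
  have "Inf ?S \<le> 1/2 * (1 / real (Suc n) + sqrt ?X)\<^sup>2" for n
  proof -
    obtain z where "z \<in> ?S" "z \<le> 1/2 * (1 / real (Suc n) + sqrt ?X)\<^sup>2" using ap[of "1 / real (Suc n)"] by auto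
    then show ?thesis using cInf_lower[OF _ bdd] by (meson order_trans)
  qed
  moreover have "(\<lambda>n. 1/2 * (1 / real (Suc n) + sqrt ?X)\<^sup>2) \<longlonglongrightarrow> 1/2 * (0 + sqrt ?X)\<^sup>2"
    by (intro tendsto_intros LIMSEQ_Suc[OF lim_1_over_n])
  ultimately have "Inf ?S \<le> 1/2 * (0 + sqrt ?X)\<^sup>2" by (intro LIMSEQ_le_const) auto
  then have "Inf ?S \<le> 1/2 * ?X" using X by simp
  moreover have "1/2 * ?X \<le> Inf ?S" by (rule cInf_greatest[OF ne lb])
  ultimately show ?thesis by simp
qed

end

theorem lemma5p3:
  fixes \<Omega> :: "(real^'d) set" and T :: real
    and f :: "real \<Rightarrow> (real^'d \<Rightarrow> real^'d) \<Rightarrow> real"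
    and u0 :: "real^'d \<Rightarrow> real^'d"
    and u v :: "real \<Rightarrow> real^'d \<Rightarrow> real^'d"
    and p :: "real \<Rightarrow> real^'d \<Rightarrow> real"
  assumes "bounded_lipschitz_domain \<Omega>" and "0 < T"
    and "f \<in> L2_V_dual \<Omega> T"
    and "u0 \<in> H_sigma \<Omega>"
    and "stokes_solution \<Omega> T f u0 u p"
    and "v \<in> W_I \<Omega> T"
    and "AE x in lebesgue_on \<Omega>. time_value \<Omega> T v 0 x = u0 x"
    and "v \<in> bochner_L2 (time_interval T) (V_sigma \<Omega>) (V_norm \<Omega>)"
  shows
    "let m = Inf {1/2 * (Q_norm \<Omega> T (\<lambda>t x. dev (y t x) - grad \<Omega> (v t) x))\<^sup>2 | y.
                    y \<in> bochner_L2 (time_interval T) (Y_space \<Omega>) (Y_norm \<Omega>) \<and>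
                    (AE t in time_interval T.
                       eq_in_V_dual \<Omega> (L_adj \<Omega> (y t)) (f t - time_deriv \<Omega> T v t))}
     in
       1/2 * (Q_norm \<Omega> T (\<lambda>t. grad \<Omega> ((v - u) t)))\<^sup>2
       + 1/2 * (L2_V_sigma_dual_norm \<Omega> T (restrict_V_sigma \<Omega> (time_deriv \<Omega> T (v - u))))\<^sup>2
       + 1/2 * (H_norm \<Omega> (time_value \<Omega> T (v - u) T))\<^sup>2 = m
     \<and> m = 1/2 * (L2_V_sigma_dual_norm \<Omega> T
              (restrict_V_sigma \<Omega> (\<lambda>t. time_deriv \<Omega> T v t + neg_laplace \<Omega> (v t) - f t)))\<^sup>2"
proof -
  interpret stokes_domain \<Omega> T
    using assms(1,2) by unfold_locales (auto simp: bounded_lipschitz_domain_def)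
  note v = assms(6) and f = assms(3)
  have u: "u \<in> W_I \<Omega> T" and u_init: "AE x in M. time_value \<Omega> T u 0 x = u0 x"
    and stokes: "AE t in I. eq_in_V_dual \<Omega> (time_deriv \<Omega> T u t + neg_laplace \<Omega> (u t) + grad_pressure \<Omega> (p t)) (f t)
      \<and> div_free \<Omega> (u t)"
    using assms(5) by (auto simp: stokes_solution_def)
  note W = W_I_diff[OF v u]
  have vB: "v \<in> BV.BL" and uB: "u \<in> BV.BL" and eB: "v - u \<in> BV.BL"
    using W_I_D(1) v u W(1) by auto
  have v\<sigma>: "AE t in I. v t \<in> V_sigma \<Omega>"
    using assms(8) by (auto simp: bochner_L2_def bochner_measurable_def)
  have u\<sigma>: "AE t in I. u t \<in> V_sigma \<Omega>"
    using stokes BV.BL_AE_mem[OF uB] by eventually_elim (simp add: V_sigma_def)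
  define rf where "rf t = rz (f t)" for t
  have rf: "rf \<in> BV.BL" unfolding rf_def[abs_def] by (rule L2_V_dual_imp_rz(1)[OF f])
  have rf_AE: "AE t in I. rf t \<in> V_space \<Omega> \<and> (\<forall>w\<in>V_space \<Omega>. V_ip \<Omega> (rf t) w = f t w)"
    using L2_V_dual_imp_rz(2)[OF f] unfolding rf_def by eventually_elim (simp add: rz)
  \<comment> \<open>\<open>a\<close> represents the right-hand side
    \<open>f - \<partial>\<^sub>tv\<close> of the constraint, and \<open>\<rho> = v - a\<close>
    below represents the residual \<open>\<partial>\<^sub>tv + (-\<Delta>)v - f\<close>.\<close>
  define a where "a = rf - rzd v"
  have a: "a \<in> BV.BL" unfolding a_def by (intro BV.BL_diff rf rzd_BL v)
  have F: "AE t in I. \<forall>w\<in>V_space \<Omega>. (f t - time_deriv \<Omega> T v t) w = V_ip \<Omega> (a t) w"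
    using rf_AE rzd_AE[OF v] by eventually_elim (simp add: a_def V.ip_diff_left)
  define \<rho> where "\<rho> = v - a"
  have \<rho>: "\<rho> \<in> BV.BL" unfolding \<rho>_def by (intro BV.BL_diff vB a)
  let ?X = "\<integral>t. (V.sn (ps (\<rho> t)))\<^sup>2 \<partial>I"
  have third: "(L2_V_sigma_dual_norm \<Omega> T (restrict_V_sigma \<Omega> (\<lambda>t. time_deriv \<Omega> T v t + neg_laplace \<Omega> (v t) - f t)))\<^sup>2 = ?X"
  proof (rule L2_V_sigma_dual_norm_sq[OF \<rho>])
    show "AE t in I. \<forall>w\<in>V_sigma \<Omega>. (time_deriv \<Omega> T v t + neg_laplace \<Omega> (v t) - f t) w = V_ip \<Omega> (\<rho> t) w"
      using rf_AE rzd_AE[OF v] BV.BL_AE_mem[OF vB]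
    proof eventually_elim
      case (elim t)
      have "V_ip \<Omega> (\<rho> t) w = V_ip \<Omega> (v t) w - (f t w - time_deriv \<Omega> T v t w)" if "w \<in> V_sigma \<Omega>" for w
        using elim V_sigma_D(1)[OF that] by (simp add: \<rho>_def a_def V.ip_diff_left)
      then show ?case by (simp add: neg_laplace_def V_ip_def L2_ip_def)
    qed
  qed
  have dual: "(L2_V_sigma_dual_norm \<Omega> T (restrict_V_sigma \<Omega> (time_deriv \<Omega> T (v - u))))\<^sup>2 = (\<integral>t. (V.sn (ps (rzd (v - u) t)))\<^sup>2 \<partial>I)"
  proof (rule L2_V_sigma_dual_norm_sq[OF rzd_BL[OF W(1)]])
    show "AE t in I. \<forall>w\<in>V_sigma \<Omega>. time_deriv \<Omega> T (v - u) t w = V_ip \<Omega> (rzd (v - u) t) w"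
      using rzd_AE[OF W(1)] by eventually_elim (use V_sigma_D(1) in auto)
  qed
  have Qn: "(Q_norm \<Omega> T (\<lambda>t. grad \<Omega> ((v - u) t)))\<^sup>2 = (\<integral>t. (V.sn ((v - u) t))\<^sup>2 \<partial>I)"
    unfolding Q_norm_def bochner_space.bochner_L2_norm_sq[OF BV.bochner_space_axioms] L2_norm_eq_snorm
    by (simp add: snorm_def V_ip_def)
  have energy: "(H_norm \<Omega> (time_value \<Omega> T (v - u) T))\<^sup>2 = 2 * (\<integral>t. V_ip \<Omega> (rzd (v - u) t) ((v - u) t) \<partial>I)"
  proof -
    obtain E where E: "is_continuous_rep \<Omega> T (v - u) E"
      "(H.sn (E T))\<^sup>2 - (H.sn (E 0))\<^sup>2 = 2 * (\<integral>t. V_ip \<Omega> (rzd (v - u) t) ((v - u) t) \<partial>I)"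
      by (rule W_I_energy[OF W(1)]) (rule that)
    \<comment> \<open>\<open>time_value\<close> of \<open>v - u\<close> is chosen independently of
      those of \<open>v\<close> and \<open>u\<close>. Three representatives are compared:
      \<open>E\<close> carries the energy identity, \<open>?D\<close> the vanishing initial value,
      and the chosen one appears in the claim.\<close>
    let ?D = "\<lambda>t. time_value \<Omega> T v t - time_value \<Omega> T u t"
    have D: "is_continuous_rep \<Omega> T (v - u) ?D"
      by (intro is_continuous_rep_diff time_value_rep v u)
    have mem: "U t \<in> L2 M" if "is_continuous_rep \<Omega> T (v - u) U" "t \<in> {0..T}" for U t
      using that by (auto simp: is_continuous_rep_def)
    have eq: "H.sn (U t) = H.sn (U' t)"
      if "is_continuous_rep \<Omega> T (v - u) U" "is_continuous_rep \<Omega> T (v - u) U'" "t \<in> {0..T}" for U U' t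
      using is_continuous_rep_unique[OF that] H.abs_sn_diff_le[OF mem[OF that(1,3)] mem[OF that(2,3)]] by simp
    have "AE x in M. ?D 0 x = 0" using assms(7) u_init by eventually_elim simp
    then have "H.sn (?D 0) = 0" using H_sn_zero_iff mem[OF D, of 0] assms(2) by simp
    then have "H.sn (E 0) = 0" using eq[OF E(1) D, of 0] assms(2) by simp
    moreover have "H.sn (E T) = H_norm \<Omega> (time_value \<Omega> T (v - u) T)"
      unfolding L2_norm_eq_snorm using eq[OF E(1) time_value_rep[OF W(1)], of T] assms(2) by simp
    ultimately show ?thesis using E(2) by simp
  qed
  have "?X = (\<integral>t. (V.sn (ps (rzd (v - u) t)))\<^sup>2 + 2 * V_ip \<Omega> (rzd (v - u) t) ((v - u) t) + (V.sn ((v - u) t))\<^sup>2 \<partial>I)"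
  proof (rule IC.integral_cong_AE_complete)
    show "(\<lambda>t. (V.sn (ps (rzd (v - u) t)))\<^sup>2 + 2 * V_ip \<Omega> (rzd (v - u) t) ((v - u) t) + (V.sn ((v - u) t))\<^sup>2) \<in> borel_measurable I"
      using BV.BL_integrable[OF ps_BL[OF rzd_BL[OF W(1)]]] BV.BL_ip_integrable[OF rzd_BL[OF W(1)] eB] BV.BL_integrable[OF eB]
      by (intro borel_measurable_add borel_measurable_times) auto
    show "AE t in I. (V.sn (ps (\<rho> t)))\<^sup>2 = (V.sn (ps (rzd (v - u) t)))\<^sup>2 + 2 * V_ip \<Omega> (rzd (v - u) t) ((v - u) t) + (V.sn ((v - u) t))\<^sup>2"
      using BV.BL_AE_mem[OF \<rho>] BV.BL_AE_mem[OF rzd_BL[OF W(1)]] v\<sigma> u\<sigma> W(2) rf_AE rzd_AE[OF v] rzd_AE[OF u] stokes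
    proof eventually_elim
      case (elim t)
      have e\<sigma>: "(v - u) t \<in> V_sigma \<Omega>" using Vs.D.S_diff[OF elim(3,4)] by simp
      note vV = V_sigma_D(1)[OF elim(3)] and uV = V_sigma_D(1)[OF elim(4)]
      show ?case
      proof (rule sn_ps_sum_sq[OF elim(1,2) e\<sigma>])
        fix w assume w: "w \<in> V_sigma \<Omega>"
        note wV = V_sigma_D(1)[OF w]
        have "grad_pressure \<Omega> (p t) w = 0"
        proof -
          have "(\<integral>x. p t x * divergence \<Omega> w x \<partial>M) = 0"
            by (rule integral_eq_zero_AE) (use V_sigma_D(2)[OF w] in \<open>auto simp: divergence_def elim!: eventually_mono\<close>)
          then show ?thesis by (simp add: grad_pressure_def)
        qed
        moreover have "time_deriv \<Omega> T u t w + neg_laplace \<Omega> (u t) w + grad_pressure \<Omega> (p t) w = f t w"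
          using elim(9) wV unfolding eq_in_V_dual_def by simp
        moreover have "neg_laplace \<Omega> (u t) w = V_ip \<Omega> (u t) w" by (simp add: neg_laplace_def V_ip_def L2_ip_def)
        ultimately have "f t w = V_ip \<Omega> (rzd u t) w + V_ip \<Omega> (u t) w" using elim(8) wV by simp
        moreover have "V_ip \<Omega> (\<rho> t) w = V_ip \<Omega> (v t) w - (f t w - V_ip \<Omega> (rzd v t) w)"
          using elim(6,7) vV wV by (simp add: \<rho>_def a_def V.ip_diff_left)
        moreover have "V_ip \<Omega> ((v - u) t) w = V_ip \<Omega> (v t) w - V_ip \<Omega> (u t) w"
          using vV uV wV by (simp add: V.ip_diff_left)
        ultimately show "V_ip \<Omega> (\<rho> t) w = V_ip \<Omega> (rzd (v - u) t) w + V_ip \<Omega> ((v - u) t) w"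
          using elim(5) wV by simp
      qed
    qed
  qed
  also have "\<dots> = (\<integral>t. (V.sn (ps (rzd (v - u) t)))\<^sup>2 \<partial>I)
      + 2 * (\<integral>t. V_ip \<Omega> (rzd (v - u) t) ((v - u) t) \<partial>I) + (\<integral>t. (V.sn ((v - u) t))\<^sup>2 \<partial>I)"
    using BV.BL_integrable[OF ps_BL[OF rzd_BL[OF W(1)]]] BV.BL_ip_integrable[OF rzd_BL[OF W(1)] eB] BV.BL_integrable[OF eB]
    by simp
  finally have first: "1/2 * (Q_norm \<Omega> T (\<lambda>t. grad \<Omega> ((v - u) t)))\<^sup>2
       + 1/2 * (L2_V_sigma_dual_norm \<Omega> T (restrict_V_sigma \<Omega> (time_deriv \<Omega> T (v - u))))\<^sup>2
       + 1/2 * (H_norm \<Omega> (time_value \<Omega> T (v - u) T))\<^sup>2 = 1/2 * ?X"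
    unfolding Qn dual energy by simp
  have "Inf {1/2 * (Q_norm \<Omega> T (\<lambda>t x. dev (y t x) - grad \<Omega> (v t) x))\<^sup>2 | y.
      y \<in> bochner_L2 I (Y_space \<Omega>) (Y_norm \<Omega>) \<and>
      (AE t in I. eq_in_V_dual \<Omega> (L_adj \<Omega> (y t)) (f t - time_deriv \<Omega> T v t))} = 1/2 * ?X"
    using Inf_admissible[OF vB v\<sigma> a, of "\<lambda>t. f t - time_deriv \<Omega> T v t", OF F]
    unfolding admissible_def mem_Collect_eq \<rho>_def .
  then show ?thesis unfolding Let_def using first third by simp
qed

end
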